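(* Let $T>0$ and let $\omega\subseteq\mathbb{T}^n$ be a non-empty open set. Fix an open set $\omega_0$ with $\overline{\omega_0}\subset\omega$ and $\eta_0\in C^4(\mathbb{T}^n;\mathbb{R}_+)$ such that $\eta_0>0$ in $\mathbb{T}^n$ and $|\nabla\eta_0|>0$ in $\mathbb{T}^n\setminus\omega_0$. Let $F\in L^2(\mathbb{T}^n\times(0,T);\mathbb{R}^2)$ and $q_T\in L^2(\mathbb{T}^n;\mathbb{R}^2)$, and let $q\in L^2(0,T;H^1(\mathbb{T}^n;\mathbb{R}^2))\cap C([0,T];L^2(\mathbb{T}^n;\mathbb{R}^2))$ be the weak solution of $$-\partial_tq-A^\top\Delta q=F\ \text{ in }\mathbb{T}^n\times(0,T),\qquad q(\cdot,T)=q_T\ \text{ in }\mathbb{T}^n.$$ Then there exist constants $\lambda_*\ge1$, $\sigma_*\ge1$ and $C_1>0$, depending only on $\alpha,\eta_0,\gamma$, such that for every $\lambda\ge\lambda_*$ and $s\ge\sigma_*\big(e^{2\lambda\|\eta_0\|_\infty}T+T^2\big)$, $$\int_{\mathbb{T}^n\times(0,T)}e^{-2s\varphi}\Big[(s\xi)^{-1}\big(|\partial_tq|^2+|\Delta q|^2\big)+s^3\lambda^4\xi^3|q|^2\Big]\le C_1\left(\int_{\mathbb{T}^n\times(0,T)}e^{-2s\varphi}|F|^2+\int_{\omega\times(0,T)}e^{-2s\varphi}s^3\lambda^4\xi^3|q|^2\right).$$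
   Context: $\alpha>0$ and $\gamma\in\mathbb{R}$, $\gamma\ne0$, are fixed constants; $I$ is the $2\times2$ identity, $J=\begin{pmatrix}0&-1\\1&0\end{pmatrix}$, $A:=\alpha I+\gamma J$. $n\in\mathbb{N}$, $\mathbb{T}^n=(\mathbb{R}/2\pi\mathbb{Z})^n$. The Carleman weights are $$\xi(x,t)=\frac{e^{\lambda\eta_0(x)}}{t(T-t)},\qquad\varphi(x,t)=\frac{e^{2\lambda\|\eta_0\|_\infty}-e^{\lambda\eta_0(x)}}{t(T-t)},\qquad(x,t)\in\mathbb{T}^n\times(0,T).$$
   Formalization: The constants may depend on ω (with ω₀) as well as on α, η₀, γ, and are uniform in T, F, q_T, q, λ, s; uniformity in ω for fixed η₀ fails: shrink ω to the finitely many critical points of η₀ with F = 0 and q constant. *)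

theory Defs
  imports "HOL-Analysis.Analysis"
begin

section \<open>The torus\<close>

text \<open>
  The torus \<open>(R / 2 pi Z)^n\<close> has \<open>n = CARD('n)\<close>. Functions on it are identified with functions
  on \<open>real ^ 'n\<close> that are \<open>2 pi\<close>-periodic in every coordinate, subsets with their periodic
  preimages in \<open>real ^ 'n\<close>. As the projection is a local homeomorphism and an open map, \<open>open\<close>
  and \<open>closure\<close> of periodic sets are those of the torus. Integration over the torus is integration
  over a fundamental cell. Elements of Lebesgue spaces are given by Borel measurable
  representatives.
\<close>

definition torus_periodic :: "(real ^ 'n \<Rightarrow> 'b) \<Rightarrow> bool" where
  "torus_periodic f \<longleftrightarrow> (\<forall>x i. f (x + axis i (2 * pi)) = f x)"

definition torus_set :: "(real ^ 'n) set \<Rightarrow> bool" where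
  "torus_set S \<longleftrightarrow> torus_periodic (\<lambda>x. x \<in> S)"

definition torus_cell :: "(real ^ 'n) set" where
  "torus_cell = {x. \<forall>i. 0 \<le> x $ i \<and> x $ i < 2 * pi}"

definition torus :: "(real ^ 'n) measure" where
  "torus = restrict_space lborel torus_cell"

text \<open>The measure space of the cylinder, torus times \<open>(0, T)\<close>.\<close>

definition cylinder :: "real \<Rightarrow> ((real ^ 'n) \<times> real) measure" where
  "cylinder T = restrict_space lborel (torus_cell \<times> {0<..<T})"


section \<open>Derivatives and smooth functions\<close>

definition dir_deriv ::
    "'a::real_normed_vector \<Rightarrow> ('a \<Rightarrow> 'b::real_normed_vector) \<Rightarrow> 'a \<Rightarrow> 'b" where
  "dir_deriv v f = (\<lambda>x. frechet_derivative f (at x) v)"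

primrec C_k :: "nat \<Rightarrow> ('a::real_normed_vector \<Rightarrow> 'b::real_normed_vector) \<Rightarrow> bool" where
  "C_k 0 f \<longleftrightarrow> continuous_on UNIV f"
| "C_k (Suc k) f \<longleftrightarrow> (\<forall>x. f differentiable (at x)) \<and> (\<forall>v. C_k k (dir_deriv v f))"

definition C_infinity :: "('a::real_normed_vector \<Rightarrow> 'b::real_normed_vector) \<Rightarrow> bool" where
  "C_infinity f \<longleftrightarrow> (\<forall>k. C_k k f)"

definition grad :: "(real ^ 'n \<Rightarrow> real) \<Rightarrow> real ^ 'n \<Rightarrow> real ^ 'n" where
  "grad f x = (\<chi> i. dir_deriv (axis i 1) f x)"

definition time_deriv ::
    "((real ^ 'n) \<times> real \<Rightarrow> 'b::real_normed_vector) \<Rightarrow> (real ^ 'n) \<times> real \<Rightarrow> 'b" where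
  "time_deriv f = dir_deriv (0, 1) f"

definition space_deriv ::
    "'n \<Rightarrow> ((real ^ 'n) \<times> real \<Rightarrow> 'b::real_normed_vector) \<Rightarrow> (real ^ 'n) \<times> real \<Rightarrow> 'b" where
  "space_deriv i f = dir_deriv (axis i 1, 0) f"

definition laplacian ::
    "((real ^ 'n) \<times> real \<Rightarrow> 'b::real_normed_vector) \<Rightarrow> (real ^ 'n) \<times> real \<Rightarrow> 'b" where
  "laplacian f p = (\<Sum>i\<in>UNIV. space_deriv i (space_deriv i f) p)"

text \<open>Smooth vector fields on torus times \<open>(0, T)\<close> with compact support.\<close>

definition test_field :: "real \<Rightarrow> ((real ^ 'n) \<times> real \<Rightarrow> real ^ 2) \<Rightarrow> bool" where
  "test_field T \<psi> \<longleftrightarrow> C_infinity \<psi> \<and> (\<forall>t. torus_periodic (\<lambda>x. \<psi> (x, t))) \<and>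
     (\<exists>a b. 0 < a \<and> b < T \<and> (\<forall>x t. t \<notin> {a..b} \<longrightarrow> \<psi> (x, t) = 0))"


section \<open>Function spaces\<close>

definition L2_torus :: "(real ^ 'n \<Rightarrow> real ^ 2) \<Rightarrow> bool" where
  "L2_torus u \<longleftrightarrow> torus_periodic u \<and> u \<in> borel_measurable torus \<and>
     integrable torus (\<lambda>x. (norm (u x))\<^sup>2)"

definition L2_cylinder :: "real \<Rightarrow> ((real ^ 'n) \<times> real \<Rightarrow> real ^ 2) \<Rightarrow> bool" where
  "L2_cylinder T f \<longleftrightarrow> (\<forall>t\<in>{0<..<T}. torus_periodic (\<lambda>x. f (x, t))) \<and>
     f \<in> borel_measurable (cylinder T) \<and> integrable (cylinder T) (\<lambda>p. (norm (f p))\<^sup>2)"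

definition L1_loc_cylinder :: "real \<Rightarrow> ((real ^ 'n) \<times> real \<Rightarrow> real ^ 2) \<Rightarrow> bool" where
  "L1_loc_cylinder T f \<longleftrightarrow> (\<forall>t\<in>{0<..<T}. torus_periodic (\<lambda>x. f (x, t))) \<and>
     f \<in> borel_measurable (cylinder T) \<and>
     (\<forall>a b. 0 < a \<and> b < T \<longrightarrow> set_integrable (cylinder T) (UNIV \<times> {a..b}) f)"

text \<open>Membership in \<open>C([0,T]; L^2)\<close>.\<close>

definition C_L2 :: "real \<Rightarrow> ((real ^ 'n) \<times> real \<Rightarrow> real ^ 2) \<Rightarrow> bool" where
  "C_L2 T q \<longleftrightarrow> (\<forall>t\<in>{0..T}. L2_torus (\<lambda>x. q (x, t))) \<and>
     (\<forall>t\<in>{0..T}. ((\<lambda>\<tau>. \<integral>x. (norm (q (x, \<tau>) - q (x, t)))\<^sup>2 \<partial>torus) \<longlongrightarrow> 0) (at t within {0..T}))"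

definition weak_pderiv :: "'n \<Rightarrow> (real ^ 'n \<Rightarrow> real ^ 2) \<Rightarrow> (real ^ 'n \<Rightarrow> real ^ 2) \<Rightarrow> bool" where
  "weak_pderiv i u g \<longleftrightarrow>
     (\<forall>\<psi> :: real ^ 'n \<Rightarrow> real. C_infinity \<psi> \<and> torus_periodic \<psi> \<longrightarrow>
        (\<integral>x. dir_deriv (axis i 1) \<psi> x *\<^sub>R u x \<partial>torus) = - (\<integral>x. \<psi> x *\<^sub>R g x \<partial>torus))"

text \<open>
  Membership of \<open>q\<close> in \<open>L^2(0,T; H^1)\<close>, where \<open>dq i\<close> is the weak \<open>i\<close>-th partial derivative of
  \<open>q(., t)\<close> for almost every \<open>t\<close>.
\<close>

definition L2_H1_with ::
    "real \<Rightarrow> ((real ^ 'n) \<times> real \<Rightarrow> real ^ 2) \<Rightarrow> ('n \<Rightarrow> (real ^ 'n) \<times> real \<Rightarrow> real ^ 2) \<Rightarrow> bool" where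
  "L2_H1_with T q dq \<longleftrightarrow> L2_cylinder T q \<and> (\<forall>i. L2_cylinder T (dq i)) \<and>
     (\<forall>i. AE t in lborel. t \<in> {0<..<T} \<longrightarrow>
        L2_torus (\<lambda>x. q (x, t)) \<and> L2_torus (\<lambda>x. dq i (x, t)) \<and>
        weak_pderiv i (\<lambda>x. q (x, t)) (\<lambda>x. dq i (x, t)))"

text \<open>
  \<open>\<partial>\<^sub>t q = qt\<close> and \<open>\<Delta> q = lq\<close> in the sense of distributions on torus times \<open>(0, T)\<close>, with
  locally integrable \<open>qt\<close> and \<open>lq\<close>; these are unique up to null sets.
\<close>

definition weak_time_deriv ::
    "real \<Rightarrow> ((real ^ 'n) \<times> real \<Rightarrow> real ^ 2) \<Rightarrow> ((real ^ 'n) \<times> real \<Rightarrow> real ^ 2) \<Rightarrow> bool" where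
  "weak_time_deriv T q qt \<longleftrightarrow> L1_loc_cylinder T qt \<and>
     (\<forall>\<psi>. test_field T \<psi> \<longrightarrow>
        (\<integral>p. q p \<bullet> time_deriv \<psi> p \<partial>cylinder T) = - (\<integral>p. qt p \<bullet> \<psi> p \<partial>cylinder T))"

definition weak_laplacian ::
    "real \<Rightarrow> ((real ^ 'n) \<times> real \<Rightarrow> real ^ 2) \<Rightarrow> ((real ^ 'n) \<times> real \<Rightarrow> real ^ 2) \<Rightarrow> bool" where
  "weak_laplacian T q lq \<longleftrightarrow> L1_loc_cylinder T lq \<and>
     (\<forall>\<psi>. test_field T \<psi> \<longrightarrow>
        (\<integral>p. q p \<bullet> laplacian \<psi> p \<partial>cylinder T) = (\<integral>p. lq p \<bullet> \<psi> p \<partial>cylinder T))"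


section \<open>The adjoint equation\<close>

definition J_mat :: "real ^ 2 ^ 2" where
  "J_mat = vector [vector [0, -1], vector [1, 0]]"

definition A_mat :: "real \<Rightarrow> real \<Rightarrow> real ^ 2 ^ 2" where
  "A_mat \<alpha> \<gamma> = \<alpha> *\<^sub>R mat 1 + \<gamma> *\<^sub>R J_mat"

text \<open>
  Weak solutions of \<open>- \<partial>\<^sub>t q - A\<^sup>T \<Delta> q = F\<close>, \<open>q(., T) = qT\<close>, in the class
  \<open>L^2(0,T; H^1) \<inter> C([0,T]; L^2)\<close>: the equation is tested with compactly supported smooth fields,
  integrating by parts once in time and once in space, and the terminal value is attained in \<open>L^2\<close>.
\<close>

definition weak_solution ::
    "real \<Rightarrow> real \<Rightarrow> real \<Rightarrow> ((real ^ 'n) \<times> real \<Rightarrow> real ^ 2) \<Rightarrow> (real ^ 'n \<Rightarrow> real ^ 2) \<Rightarrow>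
     ((real ^ 'n) \<times> real \<Rightarrow> real ^ 2) \<Rightarrow> bool" where
  "weak_solution \<alpha> \<gamma> T F qT q \<longleftrightarrow>
     C_L2 T q \<and> (AE x in torus. q (x, T) = qT x) \<and>
     (\<exists>dq. L2_H1_with T q dq \<and>
       (\<forall>\<psi>. test_field T \<psi> \<longrightarrow>
          (\<integral>p. q p \<bullet> time_deriv \<psi> p \<partial>cylinder T) +
          (\<integral>p. (\<Sum>i\<in>UNIV. (transpose (A_mat \<alpha> \<gamma>) *v dq i p) \<bullet> space_deriv i \<psi> p) \<partial>cylinder T) =
          (\<integral>p. F p \<bullet> \<psi> p \<partial>cylinder T)))"


section \<open>Carleman weights\<close>

definition sup_norm :: "(real ^ 'n \<Rightarrow> real) \<Rightarrow> real" where
  "sup_norm f = (SUP x. \<bar>f x\<bar>)"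

definition carleman_xi ::
    "(real ^ 'n \<Rightarrow> real) \<Rightarrow> real \<Rightarrow> real \<Rightarrow> (real ^ 'n) \<times> real \<Rightarrow> real" where
  "carleman_xi \<eta>\<^sub>0 l T = (\<lambda>(x, t). exp (l * \<eta>\<^sub>0 x) / (t * (T - t)))"

definition carleman_phi ::
    "(real ^ 'n \<Rightarrow> real) \<Rightarrow> real \<Rightarrow> real \<Rightarrow> (real ^ 'n) \<times> real \<Rightarrow> real" where
  "carleman_phi \<eta>\<^sub>0 l T =
     (\<lambda>(x, t). (exp (2 * l * sup_norm \<eta>\<^sub>0) - exp (l * \<eta>\<^sub>0 x)) / (t * (T - t)))"

end

theory Submission
 imports Defs "HOL-Library.Diagonal_Subsequence"
begin

text \<open>
  The inequality is first proved for functions of class \<open>C\<^sup>2\<close> on an arbitrary time interval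
  (\<open>smooth_carleman\<close>). Put \<open>w = exp (- s \<phi>) q\<close> and multiply the conjugated equation by the inverse of
  \<open>A\<^sup>T\<close>, which is again a combination of \<open>I\<close> and \<open>J\<close>. The result splits as \<open>P1 + P2\<close>, and
  \<open>2 P1 \<bullet> P2\<close> is, up to a divergence, a quadratic form in \<open>w\<close> and \<open>\<nabla> w\<close> (\<open>carleman_identity\<close>). Its main
  part is \<open>4 s\<^sup>3 \<lambda>\<^sup>4 \<xi>\<^sup>3 \<bar>\<nabla> \<eta>\<bar>\<^sup>4 \<bar>w\<bar>\<^sup>2\<close>. The gradient part has no sign, but is of lower order in
  \<open>\<lambda>\<close>, and the energy estimate, that is the equation tested with \<open>s \<lambda>\<^sup>2 \<xi> w\<close>, controls it. Since
  \<open>\<nabla> \<eta>\<close> does not vanish off \<open>\<omega>\<^sub>0\<close>, a suitable combination of both bounds the weighted square of \<open>w\<close>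
 by the data and the observation on \<open>\<omega>\<^sub>0\<close> (\<open>carleman_absorption\<close>); the time derivative and the
 Laplacian follow from \<open>P2\<close> and the equation. Everything happens at one point (\<open>carleman_terms\<close>); integration
 enters once, to remove the divergence (\<open>nn_integral_cyl_mono_divergence\<close>), whose
 component in time vanishes at both ends because of the weight.

 A weak solution is mollified in space and time. A kernel is a test field as long as it is supported in the
 time interval, so that the mollified solutions solve the equation with mollified data away from the ends
 (\<open>mollified_equation\<close>), and they converge in the mean (\<open>mollify_L2\<close>). On compact time
 intervals the weights are harmless, and the inequality for differences of mollified solutions shows that
 their time derivatives and Laplacians are Cauchy (\<open>derivatives_cauchy\<close>). The limits are the
 distributional derivatives of \<open>q\<close> (\<open>weak_derivatives_limit\<close>). Finally, the inequality for the mollified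
 solutions on slightly shorter intervals passes to the limit by Fatou's lemma, where the
 weights of the shorter interval are dominated by those of the full one (\<open>shrunken_weights_le\<close>,
 \<open>carleman_limit\<close>).
\<close>

section \<open>Directional derivatives\<close>

notation scaleR (infixr "*R" 75)

abbreviation nsq :: "'a::real_normed_vector => real" where "nsq v \<equiv> (norm v)\<^sup>2"

abbreviation "sqdist M f g \<equiv> (\<integral>\<^sup>+z. ennreal (nsq (f z - g z)) \<partial>M)"

text \<open>
  Fluxes are differentiated in single directions only. With the value of the derivative explicit, the
  product rules apply to long expressions without proofs of differentiability.
\<close>

definition has_partial ::
  "('a::real_normed_vector => 'b::real_normed_vector) => 'b => 'a => 'a => bool" where
 "has_partial f d v p \<longleftrightarrow> ((\<lambda>h. f (p + h *R v)) has_vector_derivative d) (at 0)"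

lemma has_partial_const [simp]: "has_partial (\<lambda>x. c) 0 v p"
 by (simp add: has_partial_def)

lemma has_partial_add:
 "has_partial f d v p ==> has_partial g e v p ==> has_partial (\<lambda>x. f x + g x) (d + e) v p"
 by (simp add: has_partial_def has_vector_derivative_add)

lemma has_partial_diff:
 "has_partial f d v p ==> has_partial g e v p ==> has_partial (\<lambda>x. f x - g x) (d - e) v p"
 by (simp add: has_partial_def has_vector_derivative_diff)

lemma has_partial_sum:
 "(\<And>i. i \<in> I ==> has_partial (f i) (d i) v p) ==> has_partial (\<lambda>x. \<Sum>i\<in>I. f i x) (\<Sum>i\<in>I. d i) v p"
 unfolding has_partial_def by (rule has_vector_derivative_sum)

lemma has_partial_linear:
 "bounded_linear L ==> has_partial f d v p ==> has_partial (\<lambda>x. L (f x)) (L d) v p"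
 unfolding has_partial_def by (rule bounded_linear.has_vector_derivative)

lemma has_partial_bilinear:
 assumes "bounded_bilinear B" "has_partial f d v p" "has_partial g e v p"
 shows "has_partial (\<lambda>x. B (f x) (g x)) (B (f p) e + B d (g p)) v p"
 using bounded_bilinear.has_vector_derivative[OF assms(1) assms(2)[unfolded has_partial_def]
   assms(3)[unfolded has_partial_def]]
 by (simp add: has_partial_def)

lemmas has_partial_scaleR = has_partial_bilinear[OF bounded_bilinear_scaleR]
lemmas has_partial_inner = has_partial_bilinear[OF bounded_bilinear_inner]
lemmas has_partial_mult = has_partial_bilinear[OF bounded_bilinear_mult]

lemma has_partial_chain:
 fixes f :: "'a::real_normed_vector => real"
 assumes "(g has_real_derivative e) (at (f p))" "has_partial f d v p"
 shows "has_partial (\<lambda>x. g (f x)) (e * d) v p"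
proof -
 have "((\<lambda>h. f (p + h *R v)) has_real_derivative d) (at 0)"
  using assms(2) by (simp add: has_partial_def has_real_derivative_iff_has_vector_derivative)
 then have "((\<lambda>h. g (f (p + h *R v))) has_real_derivative e * d) (at 0)"
  using DERIV_chain2[of g e "\<lambda>h. f (p + h *R v)" 0 d UNIV] assms(1) by simp
 then show ?thesis
  by (simp add: has_partial_def has_real_derivative_iff_has_vector_derivative)
qed

text \<open>The definition at the origin of the line gives the derivative at all of its points.\<close>

lemma has_partial_along_line:
 assumes "has_partial f d v (p + \<tau> *R v)"
 shows "((\<lambda>h. f (p + h *R v)) has_vector_derivative d) (at \<tau> within S)"
proof -
 have "((\<lambda>h. f (p + \<tau> *R v + h *R v)) has_vector_derivative d) (at (\<tau> - \<tau>))"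
  using assms by (simp add: has_partial_def)
 then have "((\<lambda>h. f (p + \<tau> *R v + h *R v)) \<circ> (\<lambda>h. h - \<tau>) has_vector_derivative 1 *R d) (at \<tau>)"
  by (intro vector_diff_chain_at) (auto intro!: derivative_eq_intros)
 moreover have "(\<lambda>h. f (p + \<tau> *R v + h *R v)) \<circ> (\<lambda>h. h - \<tau>) = (\<lambda>h. f (p + h *R v))"
  by (auto simp: fun_eq_iff algebra_simps)
 ultimately show ?thesis by (auto intro: has_vector_derivative_at_within)
qed

lemma has_partial_dir_deriv:
 assumes "f differentiable (at p)"
 shows "has_partial f (dir_deriv v f p) v p"
proof -
 let ?D = "frechet_derivative f (at p)"
 have D: "(f has_derivative ?D) (at p)" using assms by (simp add: frechet_derivative_works)
 then have "(f has_derivative ?D) (at (p + 0 *R v))" by simp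
 then have "((\<lambda>h. f (p + h *R v)) has_derivative (\<lambda>h. ?D (h *R v))) (at 0)"
  by (rule has_derivative_compose[of "\<lambda>h. p + h *R v", rotated])
   (auto intro!: derivative_eq_intros)
 moreover have "?D (h *R v) = h *R dir_deriv v f p" for h
  using D by (simp add: dir_deriv_def has_derivative_linear linear_scale)
 ultimately show ?thesis by (simp add: has_partial_def has_vector_derivative_def)
qed

lemma has_derivative_imp_dir_deriv: "(f has_derivative f') (at p) ==> dir_deriv v f p = f' v"
 unfolding dir_deriv_def by (metis frechet_derivative_at)

section \<open>Functions of class C^k\<close>

lemma C_k_continuous: "C_k k f ==> continuous_on UNIV f"
 by (cases k) (auto simp: continuous_on_eq_continuous_within differentiable_imp_continuous_within)

lemma C_k_pred: "C_k (Suc k) f ==> C_k k f"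
proof (induction k arbitrary: f)
 case 0 then show ?case using C_k_continuous[OF 0] by simp
next
 case (Suc k) then show ?case by (metis C_k.simps(2))
qed

lemma C_k_mono: "C_k k f ==> j <= k ==> C_k j f"
proof (induction k)
 case (Suc k)
 then show ?case using C_k_pred[of k f] by (cases "j = Suc k") auto
qed simp

lemma C_k_dir_deriv: "C_k (Suc k) f ==> C_k k (dir_deriv v f)" by simp

lemma C_k_differentiable: "C_k k f ==> 0 < k ==> f differentiable (at x)"
 by (cases k) auto

lemma C_k_SucI:
 assumes "\<And>x. (f has_derivative f' x) (at x)" "\<And>v. C_k k (\<lambda>x. f' x v)"
 shows "C_k (Suc k) f"
proof -
 have "dir_deriv v f = (\<lambda>x. f' x v)" for v
  using has_derivative_imp_dir_deriv[OF assms(1)] by (auto simp: fun_eq_iff)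
 then show ?thesis using assms by (auto simp: differentiable_def)
qed

lemma C_k_has_derivative: "C_k (Suc k) f ==> (f has_derivative (\<lambda>v. dir_deriv v f x)) (at x)"
 by (simp add: dir_deriv_def[abs_def] frechet_derivative_works[symmetric])

lemma C_k_const: "C_k k (\<lambda>x. c)"
proof (induction k arbitrary: c)
 case (Suc k)
 show ?case by (rule C_k_SucI[where f' = "\<lambda>x v. 0"]) (auto intro: Suc)
qed simp

lemma C_k_add: "C_k k f ==> C_k k g ==> C_k k (\<lambda>x. f x + g x)"
proof (induction k arbitrary: f g)
 case (Suc k)
 show ?case
  by (rule C_k_SucI[OF has_derivative_add[OF C_k_has_derivative[OF Suc.prems(1)]
      C_k_has_derivative[OF Suc.prems(2)]]])
   (auto intro!: Suc.IH C_k_dir_deriv Suc.prems)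
qed (auto intro: continuous_intros)

lemma C_k_linear: "bounded_linear L ==> C_k k f ==> C_k k (\<lambda>x. L (f x))"
proof (induction k arbitrary: f)
 case 0 then show ?case
  by (auto intro: bounded_linear.continuous_on)
next
 case (Suc k)
 show ?case
  by (rule C_k_SucI[OF bounded_linear.has_derivative[OF Suc.prems(1) C_k_has_derivative[OF Suc.prems(2)]]])
   (auto intro!: Suc.IH C_k_dir_deriv Suc.prems)
qed

lemma C_k_bilinear:
 assumes "bounded_bilinear B"
 shows "C_k k f ==> C_k k g ==> C_k k (\<lambda>x. B (f x) (g x))"
proof (induction k arbitrary: f g)
 case 0 then show ?case by (auto intro: bounded_bilinear.continuous_on[OF assms])
next
 case (Suc k)
 show ?case
  by (rule C_k_SucI[OF bounded_bilinear.FDERIV[OF assms C_k_has_derivative[OF Suc.prems(1)]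
      C_k_has_derivative[OF Suc.prems(2)]]])
   (auto intro!: Suc.IH C_k_dir_deriv Suc.prems C_k_add C_k_pred[OF Suc.prems(1)] C_k_pred[OF Suc.prems(2)])
qed

lemmas C_k_mult = C_k_bilinear[OF bounded_bilinear_mult]
lemmas C_k_scaleR = C_k_bilinear[OF bounded_bilinear_scaleR]
lemmas C_k_inner = C_k_bilinear[OF bounded_bilinear_inner]

lemma C_k_sum: "(\<And>i. i \<in> I ==> C_k k (f i)) ==> C_k k (\<lambda>x. \<Sum>i\<in>I. f i x)"
 by (induction I rule: infinite_finite_induct) (auto intro: C_k_const C_k_add)

lemma C_k_affine:
 assumes "bounded_linear L"
 shows "C_k k f ==> C_k k (\<lambda>x. f (c + L x))"
proof (induction k arbitrary: f)
 case 0 then show ?case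
  by (auto intro!: continuous_on_compose2[of UNIV f UNIV "\<lambda>x. c + L x"]
    continuous_on_add continuous_on_const linear_continuous_on[OF assms])
next
 case (Suc k)
 have *: "((\<lambda>x. f (c + L x)) has_derivative (\<lambda>v. dir_deriv (L v) f (c + L x))) (at x)" for x
  by (rule has_derivative_compose[OF _ C_k_has_derivative[OF Suc.prems]])
   (auto intro!: derivative_eq_intros bounded_linear.has_derivative[OF assms])
 show ?case by (rule C_k_SucI[OF *]) (auto intro!: Suc.IH C_k_dir_deriv[OF Suc.prems])
qed

lemma dir_deriv_inner:
 assumes "f differentiable (at p)"
 shows "dir_deriv v (\<lambda>x. f x \<bullet> c) p = dir_deriv v f p \<bullet> c"
proof -
 have "((\<lambda>x. f x \<bullet> c) has_derivative (\<lambda>v. frechet_derivative f (at p) v \<bullet> c)) (at p)"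
  using assms by (intro has_derivative_inner_left) (simp add: frechet_derivative_works)
 then show ?thesis by (subst has_derivative_imp_dir_deriv) (auto simp: dir_deriv_def)
qed

lemma dir_deriv_linear: "f differentiable (at p) ==> linear (\<lambda>v. dir_deriv v f p)"
 unfolding dir_deriv_def by (simp add: linear_frechet_derivative)

text \<open>
  Second derivatives commute, since a second difference quotient is by the mean value theorem
  a value of either mixed derivative nearby.
\<close>

lemma second_difference:
 fixes f :: "'a::real_normed_vector => real"
 assumes "C_k 2 f" "h > 0"
 obtains \<tau> \<theta> where "0 < \<tau>" "\<tau> < h" "0 < \<theta>" "\<theta> < h"
  "f (p + h *R u + h *R v) - f (p + h *R u) - f (p + h *R v) + f p
   = h^2 * dir_deriv v (dir_deriv u f) (p + \<tau> *R u + \<theta> *R v)"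
proof -
 have C: "C_k (Suc 1) f" "C_k 1 (dir_deriv u f)"
  using assms by (auto simp: numeral_2_eq_2)
 define \<phi> where "\<phi> \<tau> = f (p + h *R v + \<tau> *R u) - f (p + \<tau> *R u)" for \<tau>
 have fd: "((\<lambda>\<tau>. f (q + \<tau> *R u)) has_real_derivative dir_deriv u f (q + \<tau> *R u)) (at \<tau>)" for q \<tau>
  unfolding has_real_derivative_iff_has_vector_derivative
  by (intro has_partial_along_line has_partial_dir_deriv C_k_differentiable[OF C(1)]) simp
 have "\<exists>\<tau>>0. \<tau> < h \<and> \<phi> h - \<phi> 0
   = (h - 0) * (dir_deriv u f (p + h *R v + \<tau> *R u) - dir_deriv u f (p + \<tau> *R u))"
  unfolding \<phi>_def using assms(2) by (intro MVT2) (auto intro!: DERIV_diff fd)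
 then obtain \<tau> where \<tau>: "0 < \<tau>" "\<tau> < h" "\<phi> h - \<phi> 0
   = h * (dir_deriv u f (p + h *R v + \<tau> *R u) - dir_deriv u f (p + \<tau> *R u))" by auto
 have gd: "((\<lambda>\<theta>. dir_deriv u f (p + \<tau> *R u + \<theta> *R v)) has_real_derivative
   dir_deriv v (dir_deriv u f) (p + \<tau> *R u + \<theta> *R v)) (at \<theta>)" for \<theta>
  unfolding has_real_derivative_iff_has_vector_derivative
  by (intro has_partial_along_line has_partial_dir_deriv C_k_differentiable[OF C(2)]) simp
 have "\<exists>\<theta>>0. \<theta> < h \<and> dir_deriv u f (p + \<tau> *R u + h *R v) - dir_deriv u f (p + \<tau> *R u + 0 *R v)
   = (h - 0) * dir_deriv v (dir_deriv u f) (p + \<tau> *R u + \<theta> *R v)"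
  using assms(2) by (intro MVT2) (auto intro!: gd)
 then obtain \<theta> where \<theta>: "0 < \<theta>" "\<theta> < h" "dir_deriv u f (p + \<tau> *R u + h *R v) - dir_deriv u f (p + \<tau> *R u)
   = h * dir_deriv v (dir_deriv u f) (p + \<tau> *R u + \<theta> *R v)" by auto
 have eq: "p + h *R v + \<tau> *R u = p + \<tau> *R u + h *R v"
  "p + h *R u + h *R v = p + h *R v + h *R u" by (auto simp: algebra_simps)
 have "f (p + h *R u + h *R v) - f (p + h *R u) - f (p + h *R v) + f p = \<phi> h - \<phi> 0"
  unfolding eq(2) by (simp add: \<phi>_def)
 also have "... = h^2 * dir_deriv v (dir_deriv u f) (p + \<tau> *R u + \<theta> *R v)"
  using \<tau>(3) \<theta>(3) unfolding eq(1) by (simp add: power2_eq_square)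
 finally show thesis by (rule that[OF \<tau>(1,2) \<theta>(1,2)])
qed

lemma dir_deriv_commute_real:
 fixes f :: "'a::real_normed_vector => real"
 assumes "C_k 2 f"
 shows "dir_deriv v (dir_deriv u f) p = dir_deriv u (dir_deriv v f) p"
proof (rule ccontr)
 let ?A = "dir_deriv v (dir_deriv u f)" and ?B = "dir_deriv u (dir_deriv v f)"
 assume "?A p \<noteq> ?B p"
 define e where "e = \<bar>?A p - ?B p\<bar> / 2"
 have e: "e > 0" using \<open>?A p \<noteq> ?B p\<close> by (simp add: e_def)
 have "continuous_on UNIV ?A" "continuous_on UNIV ?B"
  using assms by (auto simp: numeral_2_eq_2)
 then have "isCont ?A p" "isCont ?B p" by (auto simp: continuous_on_eq_continuous_at)
 then obtain d1 d2 where d: "d1 > 0" "d2 > 0"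
  "\<And>x. dist x p < d1 ==> dist (?A x) (?A p) < e" "\<And>x. dist x p < d2 ==> dist (?B x) (?B p) < e"
  unfolding continuous_at_eps_delta using e by metis
 define h where "h = min d1 d2 / (norm u + norm v + 1)"
 have h: "h > 0" using d by (auto simp: h_def intro!: divide_pos_pos add_nonneg_pos)
 have near: "dist (p + \<tau> *R x + \<theta> *R y) p < min d1 d2"
  if "0 < \<tau>" "\<tau> < h" "0 < \<theta>" "\<theta> < h" "norm x + norm y = norm u + norm v" for \<tau> \<theta> x y
 proof -
  have "dist (p + \<tau> *R x + \<theta> *R y) p <= norm (\<tau> *R x) + norm (\<theta> *R y)"
   by (simp add: dist_norm) (metis norm_scaleR norm_triangle_ineq)
  also have "... <= h * norm x + h * norm y"
   using that by (intro add_mono) (auto intro!: mult_right_mono)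
  also have "... = h * (norm u + norm v)" using that by (simp flip: distrib_left)
  also have "... < h * (norm u + norm v + 1)" using h by simp
  also have "... = min d1 d2"
   using add_nonneg_pos[of "norm u + norm v" 1] by (simp add: h_def)
  finally show ?thesis .
 qed
 obtain \<tau> \<theta> where 1: "0 < \<tau>" "\<tau> < h" "0 < \<theta>" "\<theta> < h"
  "f (p + h *R u + h *R v) - f (p + h *R u) - f (p + h *R v) + f p = h^2 * ?A (p + \<tau> *R u + \<theta> *R v)"
  using second_difference[OF assms h] by blast
 obtain \<tau>' \<theta>' where 2: "0 < \<tau>'" "\<tau>' < h" "0 < \<theta>'" "\<theta>' < h"
  "f (p + h *R v + h *R u) - f (p + h *R v) - f (p + h *R u) + f p = h^2 * ?B (p + \<tau>' *R v + \<theta>' *R u)"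
  using second_difference[OF assms h] by blast
 have "f (p + h *R u + h *R v) = f (p + h *R v + h *R u)" by (simp add: algebra_simps)
 then have "h^2 * ?A (p + \<tau> *R u + \<theta> *R v) = h^2 * ?B (p + \<tau>' *R v + \<theta>' *R u)"
  using 1(5) 2(5) by linarith
 then have "?A (p + \<tau> *R u + \<theta> *R v) = ?B (p + \<tau>' *R v + \<theta>' *R u)" using h by simp
 moreover have "dist (?A (p + \<tau> *R u + \<theta> *R v)) (?A p) < e" using near[OF 1(1-4)] d by simp
 moreover have "dist (?B (p + \<tau>' *R v + \<theta>' *R u)) (?B p) < e" using near[OF 2(1-4), of v u] d by simp
 ultimately show False by (auto simp: e_def dist_real_def abs_if split: if_splits)
qed

lemma dir_deriv_commute:
 fixes f :: "'a::real_normed_vector => 'b::euclidean_space"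
 assumes "C_k 2 f"
 shows "dir_deriv v (dir_deriv u f) p = dir_deriv u (dir_deriv v f) p"
proof (rule euclidean_eqI)
 fix c :: 'b
 have 1: "C_k (Suc 1) f" "\<And>u. C_k (Suc 0) (dir_deriv u f)" using assms by (auto simp: numeral_2_eq_2)
 have d: "dir_deriv u (\<lambda>x. f x \<bullet> c) = (\<lambda>x. dir_deriv u f x \<bullet> c)" for u
  using C_k_differentiable[OF 1(1)] by (auto simp: dir_deriv_inner)
 have dd: "dir_deriv v (dir_deriv u (\<lambda>x. f x \<bullet> c)) p = dir_deriv v (dir_deriv u f) p \<bullet> c" for u v
  unfolding d using C_k_differentiable[OF 1(2)] by (simp add: dir_deriv_inner)
 show "dir_deriv v (dir_deriv u f) p \<bullet> c = dir_deriv u (dir_deriv v f) p \<bullet> c"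
  unfolding dd[symmetric] by (intro dir_deriv_commute_real C_k_inner[OF assms C_k_const])
qed

section \<open>The commutator identity\<close>

abbreviation "flux_space_deriv p r J w wt lt L B Wb G wi b bt Li wti wij H i \<equiv>
 - 2 * (wij i \<bullet> Wb + wi i \<bullet> (\<Sum>j\<in>UNIV. H j *R wi j + b j *R wij j)) + (H i * G + b i * (\<Sum>j\<in>UNIV. 2 * (wij j \<bullet> wi j)))
 - (Li * (wi i \<bullet> w) + L * (wij i \<bullet> w + wi i \<bullet> wi i)) + p * (wij i \<bullet> wt + wi i \<bullet> wti)
 - r * (bt * (wi i \<bullet> J w) + lt * (wij i \<bullet> J w + wi i \<bullet> J (wi i)))
 - ((\<Sum>j\<in>UNIV. 2 * (b j * H j)) * (b i * (w \<bullet> w)) + B * (H i * (w \<bullet> w) + b i * (2 * (wi i \<bullet> w))))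
 + r * (H i * (J w \<bullet> wt) + b i * (J (wi i) \<bullet> wt + J w \<bullet> wti))
 + p * (bt * (b i * (w \<bullet> w)) + lt * (H i * (w \<bullet> w) + b i * (2 * (wi i \<bullet> w))))"

abbreviation "flux_time_deriv p r J w wt lt ltt B Wb b bt wi wti \<equiv> - p * (\<Sum>i\<in>UNIV. wi i \<bullet> wti i)
 + p / 2 * ((\<Sum>i\<in>UNIV. 2 * (b i * bt i)) * (w \<bullet> w) + B * (2 * (wt \<bullet> w)))
 - r * (J wt \<bullet> Wb + J w \<bullet> (\<Sum>i\<in>UNIV. bt i *R wi i + b i *R wti i))
 - (r^2 + p^2) / 2 * (ltt * (w \<bullet> w) + lt * (2 * (wt \<bullet> w)))"

text \<open>
  The commutator computation at one point. The letters stand for values: \<open>wi\<close>, \<open>wij\<close>, \<open>wt\<close> and \<open>wti\<close> for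
  derivatives of the conjugated function \<open>w\<close>, \<open>b\<close>, \<open>H\<close> and \<open>L\<close> for gradient, Hessian and Laplacian of the
  exponent of the weight, \<open>lt\<close> for its time derivative, and \<open>B\<close> for the square of the gradient. Multiplied by
  the inverse of the matrix, the conjugated operator splits into the two factors on the left; their product
  is a quadratic form plus a divergence, with \<open>dX\<close> and \<open>dY\<close> its components in space and time. Stated for
  numbers, the integration by parts becomes an algebraic identity.
\<close>

lemma carleman_identity:
 fixes w wt :: "'b::real_inner" and wi wti :: "'n::finite => 'b" and wij :: "'n => 'n => 'b"
  and b bt Li :: "'n => real" and H :: "'n => 'n => real" and lt ltt p r :: real and J :: "'b => 'b"
 assumes wij: "\<And>i j. wij i j = wij j i" and H: "\<And>i j. H i j = H j i"
  and J: "linear J" and skew: "\<And>x y. J x \<bullet> y = - (x \<bullet> J y)"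
  and iso: "\<And>x y. J x \<bullet> J y = x \<bullet> y"
  and L: "L = (\<Sum>i\<in>UNIV. H i i)" and B: "B = (\<Sum>i\<in>UNIV. b i * b i)"
  and Wb: "Wb = (\<Sum>j\<in>UNIV. b j *R wi j)" and lap: "lap = (\<Sum>i\<in>UNIV. wij i i)"
  and G: "G = (\<Sum>j\<in>UNIV. wi j \<bullet> wi j)"
  and dX: "\<And>i. dX i = flux_space_deriv p r J w wt lt L B Wb G wi b (bt i) (Li i) (wti i) (wij i) (H i) i"
  and dY: "dY = flux_time_deriv p r J w wt lt ltt B Wb b bt wi wti"
 shows "(lap + B *R w + r *R J wt - (p * lt) *R w) \<bullet> (- 2 *R Wb - L *R w + p *R wt - (r * lt) *R J w)
  = 2 * (\<Sum>i\<in>UNIV. \<Sum>j\<in>UNIV. H i j * (wi i \<bullet> wi j))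
   + 2 * (\<Sum>i\<in>UNIV. \<Sum>j\<in>UNIV. H i j * (b i * b j)) * (w \<bullet> w)
   + (\<Sum>i\<in>UNIV. Li i * (wi i \<bullet> w)) + 2 * r * (\<Sum>i\<in>UNIV. bt i * (wi i \<bullet> J w))
   - 2 * p * (\<Sum>i\<in>UNIV. b i * bt i) * (w \<bullet> w) + (p^2 + r^2) / 2 * ltt * (w \<bullet> w)
   + (\<Sum>i\<in>UNIV. dX i) + dY"
proof -
 have J0: "J x \<bullet> x = 0" "x \<bullet> J x = 0" for x using skew[of x x] by (auto simp: inner_commute)
 have Jsum: "J Wb = (\<Sum>j\<in>UNIV. b j *R J (wi j))"
  unfolding Wb using J by (simp add: linear_sum linear_scale)
 have swap: "(\<Sum>i\<in>UNIV. \<Sum>j\<in>UNIV. b i * (2 * (wij i j \<bullet> wi j))) = (\<Sum>i\<in>UNIV. \<Sum>j\<in>UNIV. b j * (2 * (wi i \<bullet> wij i j)))"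
  by (subst sum.swap) (simp add: wij[of _ _] inner_commute)
 define Wc where "Wc = (\<Sum>i\<in>UNIV. b i *R wti i)"
 have T1: "(\<Sum>i\<in>UNIV. - 2 * (wij i i \<bullet> Wb + wi i \<bullet> (\<Sum>j\<in>UNIV. H i j *R wi j + b j *R wij i j))
    + (H i i * G + b i * (\<Sum>j\<in>UNIV. 2 * (wij i j \<bullet> wi j))))
   = - 2 * (lap \<bullet> Wb) - 2 * (\<Sum>i\<in>UNIV. \<Sum>j\<in>UNIV. H i j * (wi i \<bullet> wi j)) + L * G"
  using swap unfolding lap L
  by (simp add: sum.distrib sum_subtractf sum_negf inner_sum_left inner_sum_right inner_add_right
    sum_distrib_left sum_distrib_right algebra_simps)
 have T2: "(\<Sum>i\<in>UNIV. Li i * (wi i \<bullet> w) + L * (wij i i \<bullet> w + wi i \<bullet> wi i))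
   = (\<Sum>i\<in>UNIV. Li i * (wi i \<bullet> w)) + L * (lap \<bullet> w) + L * G"
  unfolding lap G by (simp add: sum.distrib inner_sum_left sum_distrib_left distrib_left)
 have T3: "(\<Sum>i\<in>UNIV. p * (wij i i \<bullet> wt + wi i \<bullet> wti i)) = p * (lap \<bullet> wt) + p * (\<Sum>i\<in>UNIV. wi i \<bullet> wti i)"
  unfolding lap by (simp add: sum.distrib inner_sum_left sum_distrib_left distrib_left)
 have T4: "(\<Sum>i\<in>UNIV. r * (bt i * (wi i \<bullet> J w) + lt * (wij i i \<bullet> J w + wi i \<bullet> J (wi i))))
   = r * (\<Sum>i\<in>UNIV. bt i * (wi i \<bullet> J w)) + r * (lt * (lap \<bullet> J w))"
  unfolding lap by (simp add: J0 sum.distrib inner_sum_left sum_distrib_left distrib_left)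
 have T5: "(\<Sum>i\<in>UNIV. (\<Sum>j\<in>UNIV. 2 * (b j * H i j)) * (b i * (w \<bullet> w)) + B * (H i i * (w \<bullet> w) + b i * (2 * (wi i \<bullet> w))))
   = 2 * (\<Sum>i\<in>UNIV. \<Sum>j\<in>UNIV. H i j * (b i * b j)) * (w \<bullet> w) + B * L * (w \<bullet> w) + 2 * B * (Wb \<bullet> w)"
  unfolding L Wb
  by (simp add: sum.distrib inner_sum_left sum_distrib_left sum_distrib_right algebra_simps)
 have T6: "(\<Sum>i\<in>UNIV. r * (H i i * (J w \<bullet> wt) + b i * (J (wi i) \<bullet> wt + J w \<bullet> wti i)))
   = r * (L * (J w \<bullet> wt) + J Wb \<bullet> wt + J w \<bullet> Wc)"
  unfolding L Jsum Wc_def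
  by (simp add: sum.distrib inner_sum_left inner_sum_right sum_distrib_left sum_distrib_right algebra_simps)
 have T7: "(\<Sum>i\<in>UNIV. p * (bt i * (b i * (w \<bullet> w)) + lt * (H i i * (w \<bullet> w) + b i * (2 * (wi i \<bullet> w)))))
   = p * ((\<Sum>i\<in>UNIV. b i * bt i) * (w \<bullet> w) + lt * L * (w \<bullet> w) + 2 * lt * (Wb \<bullet> w))"
  unfolding L Wb
  by (simp add: sum.distrib inner_sum_left sum_distrib_left sum_distrib_right algebra_simps)
 have T8: "J w \<bullet> (\<Sum>i\<in>UNIV. bt i *R wi i + b i *R wti i) = (\<Sum>i\<in>UNIV. bt i * (wi i \<bullet> J w)) + J w \<bullet> Wc"
  unfolding Wc_def by (simp add: sum.distrib inner_sum_right inner_add_right inner_commute)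
 have T9: "(\<Sum>i\<in>UNIV. 2 * (b i * bt i)) = 2 * (\<Sum>i\<in>UNIV. b i * bt i)"
  by (simp add: sum_distrib_left)
 have K: "J wt \<bullet> w = - (J w \<bullet> wt)" "J Wb \<bullet> wt = - (J wt \<bullet> Wb)" "lap \<bullet> J w = J w \<bullet> lap"
  "Wb \<bullet> w = w \<bullet> Wb" "wt \<bullet> w = w \<bullet> wt" "J wt \<bullet> J w = w \<bullet> wt"
  using skew[of wt w] skew[of Wb wt] iso[of wt w] by (simp_all add: inner_commute)
 have "(\<Sum>i\<in>UNIV. dX i) = (- 2 * (lap \<bullet> Wb) - 2 * (\<Sum>i\<in>UNIV. \<Sum>j\<in>UNIV. H i j * (wi i \<bullet> wi j)) + L * G)
  - ((\<Sum>i\<in>UNIV. Li i * (wi i \<bullet> w)) + L * (lap \<bullet> w) + L * G)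
  + (p * (lap \<bullet> wt) + p * (\<Sum>i\<in>UNIV. wi i \<bullet> wti i))
  - (r * (\<Sum>i\<in>UNIV. bt i * (wi i \<bullet> J w)) + r * (lt * (lap \<bullet> J w)))
  - (2 * (\<Sum>i\<in>UNIV. \<Sum>j\<in>UNIV. H i j * (b i * b j)) * (w \<bullet> w) + B * L * (w \<bullet> w) + 2 * B * (Wb \<bullet> w))
  + r * (L * (J w \<bullet> wt) + J Wb \<bullet> wt + J w \<bullet> Wc)
  + p * ((\<Sum>i\<in>UNIV. b i * bt i) * (w \<bullet> w) + lt * L * (w \<bullet> w) + 2 * lt * (Wb \<bullet> w))"
  unfolding T1[symmetric] T2[symmetric] T3[symmetric] T4[symmetric] T5[symmetric] T6[symmetric] T7[symmetric]
   dX sum.distrib sum_subtractf ..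
 then show ?thesis
  unfolding dY T8 T9
  by (simp add: inner_add_left inner_add_right inner_diff_left inner_diff_right J0 K
    power2_eq_square inner_commute[of wt "J w"] inner_commute[of w "J w"])
   (simp add: field_simps)
qed

section \<open>Integration over the torus\<close>

lemma torus_cell_sets [measurable]: "torus_cell \<in> sets borel"
proof -
 have "torus_cell = (\<Inter>i\<in>UNIV. {x::real^'n. 0 <= x $ i} \<inter> {x. x $ i < 2 * pi})"
  by (auto simp: torus_cell_def)
 also have "... \<in> sets borel" by (intro sets.finite_INT) (auto intro!: sets.Int)
 finally show ?thesis .
qed

lemma torus_cell_subset: "torus_cell \<subseteq> cbox 0 (\<chi> i. 2 * pi)"
 by (auto simp: torus_cell_def mem_box_cart less_imp_le)

lemma emeasure_torus_cell_finite: "emeasure lborel torus_cell < \<infinity>"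
 by (rule le_less_trans[OF emeasure_mono[OF torus_cell_subset]]) (auto simp: emeasure_lborel_cbox_eq)

lemma finite_measure_restrict:
 "A \<in> sets M ==> emeasure M A < \<infinity> ==> finite_measure (restrict_space M A)"
 using sets.sets_into_space[of A M]
 by (intro finite_measureI) (simp add: emeasure_restrict_space space_restrict_space Int_absorb2)

lemma finite_measure_torus: "finite_measure torus"
 unfolding torus_def using emeasure_torus_cell_finite by (intro finite_measure_restrict) auto

interpretation torus: finite_measure torus by (rule finite_measure_torus)

lemma space_torus [simp]: "space torus = torus_cell"
 by (simp add: torus_def space_restrict_space)

lemma borel_measurable_torusI: "f \<in> borel_measurable borel ==> f \<in> borel_measurable torus"
 unfolding torus_def by (rule measurable_restrict_space1) simp

lemma nn_integral_torus: "(\<integral>\<^sup>+x. f x \<partial>torus) = (\<integral>\<^sup>+x. f x * indicator torus_cell x \<partial>lborel)"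
 unfolding torus_def by (subst nn_integral_restrict_space) auto

lemma periodic_int_shift:
 assumes "torus_periodic f"
 shows "f (x + axis i (2 * pi * of_int k)) = f x"
proof -
 have P: "f (x + axis i (2 * pi)) = f x" for x using assms by (simp add: torus_periodic_def)
 have N: "f (x + axis i (2 * pi * of_nat m)) = f x" for m x
 proof (induction m)
  case (Suc m)
  have "x + axis i (2 * pi * of_nat (Suc m)) = (x + axis i (2 * pi * of_nat m)) + axis i (2 * pi)"
   by (simp add: vec_eq_iff axis_def algebra_simps)
  then show ?case using P Suc by metis
 qed (simp add: axis_def zero_vec_def[symmetric])
 show ?thesis
 proof (cases "k >= 0")
  case True
  then show ?thesis using N[of x "nat k"] by simp
 next
  case False
  have "(x + axis i (2 * pi * of_int k)) + axis i (2 * pi * of_nat (nat (- k))) = x"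
   using False by (simp add: vec_eq_iff axis_def)
  then show ?thesis using N[of "x + axis i (2 * pi * of_int k)" "nat (- k)"] by metis
 qed
qed

lemma torus_periodic_shift: "torus_periodic f ==> torus_periodic (\<lambda>x. f (x + v))"
 unfolding torus_periodic_def
proof (intro allI)
 fix x i assume per: "\<forall>x i. f (x + axis i (2 * pi)) = f x"
 have "f (x + axis i (2 * pi) + v) = f ((x + v) + axis i (2 * pi))" by (simp add: add_ac)
 also have "... = f (x + v)" using per by blast
 finally show "f (x + axis i (2 * pi) + v) = f (x + v)" .
qed

lemma lborel_nn_shift:
 fixes f :: "'a::euclidean_space => ennreal"
 assumes "f \<in> borel_measurable borel"
 shows "(\<integral>\<^sup>+x. f (x + v) \<partial>lborel) = (\<integral>\<^sup>+x. f x \<partial>lborel)"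
proof -
 have "(\<integral>\<^sup>+x. f x \<partial>lborel) = (\<integral>\<^sup>+x. f x \<partial>distr lborel borel ((+) v))" by (simp add: lborel_distr_plus)
 also have "... = (\<integral>\<^sup>+x. f (v + x) \<partial>lborel)" using assms by (subst nn_integral_distr) auto
 finally show ?thesis by (simp add: add.commute)
qed

text \<open>
  The shift moves a slab of the cell across a face; periodicity moves it back to the opposite face.
\<close>

lemma nn_integral_torus_shift_axis:
 fixes f :: "real ^ 'n => ennreal"
 assumes f [measurable]: "f \<in> borel_measurable borel" and per: "torus_periodic f" and h: "0 <= h" "h <= 2 * pi"
 shows "(\<integral>\<^sup>+x. f (x + axis i h) \<partial>torus) = (\<integral>\<^sup>+x. f x \<partial>torus)"
proof -
 let ?C = "torus_cell :: (real ^ 'n) set"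
 let ?A = "{x. x \<in> ?C \<and> h <= x $ i}" and ?B = "{x. x \<in> ?C \<and> x $ i < h}"
 have [measurable]: "?A \<in> sets borel" "?B \<in> sets borel"
 proof -
  have "?A = ?C \<inter> {x. h <= x $ i}" "?B = ?C \<inter> {x. x $ i < h}" by auto
  then show "?A \<in> sets borel" "?B \<in> sets borel" by (auto intro!: sets.Int)
 qed
 have ind: "indicator ?C (y - axis i h) = (indicator ?A y + indicator ?B (y - axis i (2 * pi)) :: ennreal)" for y
 proof -
  have c: "y - axis i h \<in> ?C \<longleftrightarrow> (\<forall>j. j \<noteq> i \<longrightarrow> 0 <= y $ j \<and> y $ j < 2 * pi) \<and> h <= y $ i \<and> y $ i < 2 * pi + h"
   unfolding torus_cell_def by (auto simp: axis_def algebra_simps split: if_splits)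
  have a: "y \<in> ?A \<longleftrightarrow> (\<forall>j. j \<noteq> i \<longrightarrow> 0 <= y $ j \<and> y $ j < 2 * pi) \<and> h <= y $ i \<and> y $ i < 2 * pi"
   using h unfolding torus_cell_def by (auto; metis order_trans)
  have b: "y - axis i (2 * pi) \<in> ?B \<longleftrightarrow> (\<forall>j. j \<noteq> i \<longrightarrow> 0 <= y $ j \<and> y $ j < 2 * pi) \<and> 2 * pi <= y $ i \<and> y $ i < 2 * pi + h"
   using h unfolding torus_cell_def by (auto simp: axis_def algebra_simps split: if_splits)
  show ?thesis using a b c h by (auto simp: indicator_def)
 qed
 have per2: "f (y - axis i (2 * pi)) = f y" for y
  using per[unfolded torus_periodic_def, rule_format, of "y - axis i (2 * pi)" i] by simp
 have "(\<integral>\<^sup>+x. f (x + axis i h) \<partial>torus) = (\<integral>\<^sup>+x. f (x + axis i h) * indicator ?C ((x + axis i h) - axis i h) \<partial>lborel)"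
  unfolding nn_integral_torus by simp
 also have "... = (\<integral>\<^sup>+y. f y * indicator ?C (y - axis i h) \<partial>lborel)"
  by (rule lborel_nn_shift[of "\<lambda>y. f y * indicator ?C (y - axis i h)"]) measurable
 also have "... = (\<integral>\<^sup>+y. f y * indicator ?A y + f (y - axis i (2 * pi)) * indicator ?B (y - axis i (2 * pi)) \<partial>lborel)"
  unfolding ind per2 by (simp add: distrib_left)
 also have "... = (\<integral>\<^sup>+y. f y * indicator ?A y \<partial>lborel) + (\<integral>\<^sup>+y. f (y - axis i (2 * pi)) * indicator ?B (y - axis i (2 * pi)) \<partial>lborel)"
  by (rule nn_integral_add) measurable
 also have "(\<integral>\<^sup>+y. f (y - axis i (2 * pi)) * indicator ?B (y - axis i (2 * pi)) \<partial>lborel) = (\<integral>\<^sup>+y. f y * indicator ?B y \<partial>lborel)"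
  using lborel_nn_shift[of "\<lambda>y. f y * indicator ?B y" "- axis i (2 * pi)"] by simp
 also have "(\<integral>\<^sup>+y. f y * indicator ?A y \<partial>lborel) + (\<integral>\<^sup>+y. f y * indicator ?B y \<partial>lborel)
   = (\<integral>\<^sup>+y. f y * indicator ?A y + f y * indicator ?B y \<partial>lborel)"
  by (rule nn_integral_add[symmetric]) measurable
 also have "... = (\<integral>\<^sup>+x. f x \<partial>torus)"
  unfolding nn_integral_torus by (rule nn_integral_cong) (auto simp: indicator_def)
 finally show ?thesis .
qed

text \<open>Translations are compositions of translations along the axes by less than one period.\<close>

lemma nn_integral_torus_shift:
 fixes f :: "real ^ 'n => ennreal"
 assumes "f \<in> borel_measurable borel" "torus_periodic f"
 shows "(\<integral>\<^sup>+x. f (x + v) \<partial>torus) = (\<integral>\<^sup>+x. f x \<partial>torus)"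
proof -
 define P where "P v \<longleftrightarrow> (\<forall>f :: real ^ 'n => ennreal. f \<in> borel_measurable borel \<longrightarrow> torus_periodic f \<longrightarrow>
   (\<integral>\<^sup>+x. f (x + v) \<partial>torus) = (\<integral>\<^sup>+x. f x \<partial>torus))" for v
 have axis: "P (axis i h)" for i h
  unfolding P_def
 proof (intro allI impI)
  fix f :: "real ^ 'n => ennreal" assume f: "f \<in> borel_measurable borel" "torus_periodic f"
  define k where "k = \<lfloor>h / (2 * pi)\<rfloor>"
  define h' where "h' = h - 2 * pi * of_int k"
  have h': "0 <= h'" "h' <= 2 * pi"
   unfolding h'_def k_def using floor_divide_lower[of "2 * pi" h] floor_divide_upper[of "2 * pi" h]
   by (auto simp: algebra_simps)
  have "f (x + axis i h) = f (x + axis i h')" for x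
  proof -
   have "x + axis i h = (x + axis i h') + axis i (2 * pi * of_int k)"
    by (simp add: h'_def vec_eq_iff axis_def)
   then have "f (x + axis i h) = f ((x + axis i h') + axis i (2 * pi * of_int k))" by (simp only:)
   also have "... = f (x + axis i h')" by (rule periodic_int_shift[OF f(2)])
   finally show ?thesis .
  qed
  then show "(\<integral>\<^sup>+x. f (x + axis i h) \<partial>torus) = (\<integral>\<^sup>+x. f x \<partial>torus)"
   using nn_integral_torus_shift_axis[OF f h'] by simp
 qed
 have add: "P (u + v)" if "P u" "P v" for u v
  unfolding P_def
 proof (intro allI impI)
  fix f :: "real ^ 'n => ennreal" assume f: "f \<in> borel_measurable borel" "torus_periodic f"
  have "(\<integral>\<^sup>+x. f (x + u + v) \<partial>torus) = (\<integral>\<^sup>+x. f (x + v) \<partial>torus)"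
   using that(1)[unfolded P_def, rule_format, of "\<lambda>x. f (x + v)"] f torus_periodic_shift[OF f(2)] by simp
  also have "... = (\<integral>\<^sup>+x. f x \<partial>torus)" using that(2) f by (simp add: P_def)
  finally show "(\<integral>\<^sup>+x. f (x + (u + v)) \<partial>torus) = (\<integral>\<^sup>+x. f x \<partial>torus)" by (simp add: add.assoc)
 qed
 have "P (\<Sum>i\<in>I. axis i (v $ i))" if "finite I" for I
  using that
 proof (induction I)
  case empty show ?case by (simp add: P_def)
 next
  case (insert i I) then show ?case using add[OF axis] by simp
 qed
 moreover have "(\<Sum>i\<in>UNIV. axis i (v $ i)) = v"
  by (simp add: vec_eq_iff axis_def)
 ultimately have "P v" by (metis finite)
 then show ?thesis using assms by (simp add: P_def)
qed

lemma bounded_periodic_image: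
 fixes f :: "real ^ 'n => 'b::real_normed_vector"
 assumes "continuous_on UNIV f"
 obtains K where "K > 0" "\<And>x. x \<in> torus_cell ==> norm (f x) <= K"
proof -
 have "compact (f ` cbox 0 (\<chi> i. 2 * pi))"
  by (intro compact_continuous_image continuous_on_subset[OF assms]) auto
 then obtain K where "K > 0" "\<forall>y\<in>f ` cbox 0 (\<chi> i. 2 * pi). norm y <= K"
  using compact_imp_bounded bounded_pos by metis
 then show thesis using torus_cell_subset by (intro that) auto
qed

text \<open>Every point is congruent to one of the cell.\<close>

lemma torus_representative:
 fixes x :: "real ^ 'n"
 obtains y where "y \<in> torus_cell" "\<And>f :: real ^ 'n => 'b. torus_periodic f ==> f x = f y"
proof -
 define k where "k i = \<lfloor>x $ i / (2 * pi)\<rfloor>" for i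
 define y where "y = (\<chi> i. x $ i - 2 * pi * of_int (k i))"
 have "y \<in> torus_cell"
  unfolding torus_cell_def y_def k_def
  using floor_divide_lower[of "2 * pi"] floor_divide_upper[of "2 * pi"] by (auto simp: algebra_simps)
 moreover have "f x = f y" if "torus_periodic f" for f :: "real ^ 'n => 'b"
 proof -
  have "f (y + (\<Sum>i\<in>I. axis i (2 * pi * of_int (k i)))) = f y" if "finite I" for I
   using that
  proof (induction I)
   case (insert i I)
   have "f (y + (\<Sum>i\<in>insert i I. axis i (2 * pi * of_int (k i))))
    = f ((y + (\<Sum>i\<in>I. axis i (2 * pi * of_int (k i)))) + axis i (2 * pi * of_int (k i)))"
    using insert by (simp add: add_ac)
   then show ?case using periodic_int_shift[OF \<open>torus_periodic f\<close>] insert by simp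
  qed simp
  moreover have "y + (\<Sum>i\<in>UNIV. axis i (2 * pi * of_int (k i))) = x"
   by (simp add: vec_eq_iff y_def axis_def)
  ultimately show ?thesis by (metis finite)
 qed
 ultimately show thesis using that by blast
qed

lemma continuous_periodic_bounded:
 fixes f :: "real ^ 'n => 'b::real_normed_vector"
 assumes "continuous_on UNIV f" "torus_periodic f"
 obtains K where "K > 0" "\<And>x. norm (f x) <= K"
proof -
 obtain K where K: "K > 0" "\<And>x. x \<in> torus_cell ==> norm (f x) <= K"
  using bounded_periodic_image[OF assms(1)] by blast
 have "norm (f x) <= K" for x
  using torus_representative[of x] K(2) assms(2) by metis
 then show thesis using K that by blast
qed

lemma integral_torus_shift:
 fixes f :: "real ^ 'n => real"
 assumes "continuous_on UNIV f" "torus_periodic f"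
 shows "(\<integral>x. f (x + v) \<partial>torus) = (\<integral>x. f x \<partial>torus)"
proof -
 obtain K where K: "K > 0" "\<And>x. norm (f x) <= K" using continuous_periodic_bounded[OF assms] by blast
 have f [measurable]: "f \<in> borel_measurable borel" using assms(1) by (rule borel_measurable_continuous_onI)
 have I: "integrable torus (\<lambda>x. f (x + v))" for v
  using K by (intro torus.integrable_const_bound[of _ K] borel_measurable_torusI) auto
 have E: "(\<integral>x. f (x + v) + K \<partial>torus) = enn2real (\<integral>\<^sup>+x. ennreal (f (x + v) + K) \<partial>torus)" for v
 proof (rule integral_eq_nn_integral)
  show "(\<lambda>x. f (x + v) + K) \<in> borel_measurable torus" by (intro borel_measurable_torusI) measurable
  show "AE x in torus. 0 <= f (x + v) + K" using K(2) by (intro AE_I2) (metis abs_le_iff add.commute add.inverse_inverse le_add_same_cancel1 neg_le_iff_le real_norm_def diff_ge_0_iff_ge diff_minus_eq_add)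
 qed
 moreover have "(\<integral>\<^sup>+x. ennreal (f (x + v) + K) \<partial>torus) = (\<integral>\<^sup>+x. ennreal (f x + K) \<partial>torus)"
  by (rule nn_integral_torus_shift) (use assms(2) in \<open>auto simp: torus_periodic_def\<close>)
 ultimately have "(\<integral>x. f (x + v) + K \<partial>torus) = (\<integral>x. f x + K \<partial>torus)"
  using E[of 0] by simp
 then show ?thesis using I[of v] I[of 0] by simp
qed

text \<open>
  The integral equals its average over the translates in one direction through a full period. Exchanging the
  two integrals leaves the increment of \<open>f\<close> over a period.
\<close>

lemma integral_torus_partial:
 fixes f g :: "real ^ 'n => real" and i :: 'n
 assumes f: "torus_periodic f" "\<And>x. has_partial f (g x) (axis i 1) x"
  and g: "continuous_on UNIV g" "torus_periodic g"
 shows "(\<integral>x. g x \<partial>torus) = 0"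
proof -
 let ?I = "restrict_space lborel {0..2 * pi}"
 interpret I: finite_measure ?I by (intro finite_measure_restrict) auto
 interpret P: pair_sigma_finite "torus :: (real ^ 'n) measure" ?I ..
 interpret PF: finite_measure "(torus :: (real ^ 'n) measure) \<Otimes>\<^sub>M ?I" by (rule finite_measure_pair_measure) unfold_locales
 obtain K where K: "K > 0" "\<And>x. norm (g x) <= K" using continuous_periodic_bounded[OF g] by blast
 have gm [measurable]: "g \<in> borel_measurable borel" using g(1) by (rule borel_measurable_continuous_onI)
 have gt: "continuous_on S (\<lambda>\<tau>. g (x + \<tau> *R axis i 1))" for S and x :: "real ^ 'n"
  by (intro continuous_on_compose2[OF g(1)] continuous_intros) auto
 have inner: "(\<integral>\<tau>. g (x + \<tau> *R axis i 1) \<partial>?I) = 0" for x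
 proof -
  have "((\<lambda>\<tau>. f (x + \<tau> *R axis i 1)) has_vector_derivative g (x + \<tau> *R axis i 1)) (at \<tau> within {0..2*pi})" for \<tau>
   by (intro has_partial_along_line f)
  then have "(\<integral>\<tau>. indicator {0..2 * pi} \<tau> *R g (x + \<tau> *R axis i 1) \<partial>lborel)
   = f (x + (2 * pi) *R axis i 1) - f (x + 0 *R axis i 1)"
   by (intro integral_FTC_atLeastAtMost gt) auto
  also have "(2 * pi) *R axis i 1 = (axis i (2 * pi) :: real ^ 'n)" by (simp add: vec_eq_iff axis_def)
  finally show ?thesis using f(1) by (simp add: integral_restrict_space torus_periodic_def)
 qed
 have meas: "(\<lambda>(x, \<tau>). g (x + \<tau> *R axis i 1)) \<in> borel_measurable (torus \<Otimes>\<^sub>M ?I)"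
 proof -
  have [measurable]: "(\<lambda>x. x) \<in> borel_measurable torus" "(\<lambda>x. x) \<in> borel_measurable ?I"
   by (auto intro: borel_measurable_torusI measurable_restrict_space1)
  show ?thesis by measurable
 qed
 have int: "integrable (torus \<Otimes>\<^sub>M ?I) (\<lambda>(x, \<tau>). g (x + \<tau> *R axis i 1))"
  using K by (intro PF.integrable_const_bound[of _ K] meas) auto
 have "0 = (\<integral>x. (\<integral>\<tau>. g (x + \<tau> *R axis i 1) \<partial>?I) \<partial>torus)" by (simp add: inner)
 also have "... = (\<integral>\<tau>. (\<integral>x. g (x + \<tau> *R axis i 1) \<partial>torus) \<partial>?I)" by (rule P.Fubini_integral[OF int, symmetric])
 also have "... = (\<integral>\<tau>. (\<integral>x. g x \<partial>torus) \<partial>?I)" by (simp add: integral_torus_shift[OF g])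
 also have "... = 2 * pi * (\<integral>x. g x \<partial>torus)" by (simp add: measure_restrict_space)
 finally show ?thesis by simp
qed

section \<open>Energy identity and absorption\<close>

text \<open>
  The commutator gives no gradient term of a sign. One is obtained by testing the equation with a multiple
  of \<open>w\<close>, as in the energy estimate of the heat equation; the skew part of the matrix drops out.
\<close>

lemma energy_identity:
 fixes w wt :: "'b::real_inner" and wi :: "'n::finite => 'b" and wii :: "'n => 'b"
  and \<kappa>i :: "'n => real" and J :: "'b => 'b"
 assumes J: "linear J" and skew: "\<And>x y. J x \<bullet> y = - (x \<bullet> J y)"
  and c: "\<And>x. c x = \<alpha> *R x - \<gamma> *R J x"
  and lap: "lap = (\<Sum>i\<in>UNIV. wii i)"
  and g: "g = wt - lt *R w + c (lap - 2 *R Wb + (B - L) *R w)"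
  and dX: "\<And>i. dX i = \<kappa>i i * (w \<bullet> c (wi i)) + \<kappa> * (wi i \<bullet> c (wi i) + w \<bullet> c (wii i))"
  and dY: "dY = (\<kappa>t * (w \<bullet> w) + \<kappa> * (2 * (wt \<bullet> w))) / 2"
 shows "\<kappa> * (w \<bullet> g) = (\<Sum>i\<in>UNIV. dX i) + dY - \<kappa>t / 2 * (w \<bullet> w) - \<kappa> * lt * (w \<bullet> w)
  - w \<bullet> c (\<Sum>i\<in>UNIV. \<kappa>i i *R wi i) - \<alpha> * \<kappa> * (\<Sum>i\<in>UNIV. wi i \<bullet> wi i)
  - 2 * \<kappa> * (w \<bullet> c Wb) + \<alpha> * \<kappa> * (B - L) * (w \<bullet> w)"
proof -
 have J0: "J x \<bullet> x = 0" "x \<bullet> J x = 0" for x using skew[of x x] by (auto simp: inner_commute)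
 have lin: "linear c" unfolding c[abs_def]
  using J by (auto simp: linear_iff algebra_simps)
 have cc: "x \<bullet> c x = \<alpha> * (x \<bullet> x)" for x by (simp add: c inner_diff_right J0)
 have clap: "w \<bullet> c lap = (\<Sum>i\<in>UNIV. w \<bullet> c (wii i))"
  unfolding lap by (simp add: linear_sum[OF lin] inner_sum_right)
 have S: "(\<Sum>i\<in>UNIV. dX i) = w \<bullet> c (\<Sum>i\<in>UNIV. \<kappa>i i *R wi i) + \<kappa> * (\<alpha> * (\<Sum>i\<in>UNIV. wi i \<bullet> wi i) + w \<bullet> c lap)"
  unfolding dX clap by (simp add: cc linear_sum[OF lin] linear_scale[OF lin] inner_sum_right sum.distrib
    sum_distrib_left distrib_left)
 have wg: "w \<bullet> g = w \<bullet> wt - lt * (w \<bullet> w) + w \<bullet> c lap - 2 * (w \<bullet> c Wb) + (B - L) * (\<alpha> * (w \<bullet> w))"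
  unfolding g by (simp add: linear_add[OF lin] linear_diff[OF lin] linear_scale[OF lin]
    inner_add_right inner_diff_right cc)
 show ?thesis unfolding S dY wg by (simp add: field_simps inner_commute[of wt w])
qed

text \<open>Young's inequality in the form in which products of the weighted norms are absorbed.\<close>

lemma weighted_young:
 fixes a b u v :: real
 assumes "0 <= a" "0 <= b" "k^2 <= 4 * a * b" "0 <= u" "0 <= v"
 shows "k * (u * v) <= a * u^2 + b * v^2"
proof -
 have "\<bar>k\<bar> <= 2 * (sqrt a * sqrt b)"
  using assms(3) real_sqrt_le_mono[OF assms(3)] by (simp add: real_sqrt_mult)
 then have "k * (u * v) <= 2 * (sqrt a * sqrt b) * (u * v)"
  using assms by (intro mult_right_mono) auto
 also have "... <= (sqrt a * u)\<^sup>2 + (sqrt b * v)\<^sup>2"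
  using sum_squares_bound[of "sqrt a * u" "sqrt b * v"] by (simp add: mult_ac)
 also have "... = a * u^2 + b * v^2" using assms by (simp add: power_mult_distrib)
 finally show ?thesis .
qed

text \<open>
  Every product in the energy identity is split by Young's inequality into at most a quarter of the gradient
  term and a multiple of the weighted square of \<open>w\<close>.
\<close>

lemma energy_estimate:
 fixes m g \<alpha> \<rho> N \<sigma> lam x :: real
 assumes pos: "\<alpha> > 0" "\<rho> >= 0" "N >= 1" "\<sigma> >= 1" "lam >= 1" "x >= 4 * \<sigma>" "m >= 0" "g >= 0" "f >= 0"
  and id: "lam^2 * x * wg = D - kt / 2 * m^2 - lam\<^sup>2 * x * lt * m^2 - wk - \<alpha> * (lam^2 * x) * g^2
    - 2 * (lam^2 * x) * wb + \<alpha> * (lam^2 * x) * (B - L) * m^2"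
  and b: "\<bar>wg\<bar> <= m * f" "\<bar>kt\<bar> <= lam^2 * x^2 / \<sigma>" "\<bar>lt\<bar> <= x^2 / \<sigma>" "\<bar>wk\<bar> <= m * (\<rho> * (N * lam ^ 3 * x * g))"
   "\<bar>wb\<bar> <= m * (\<rho> * (N * lam * x * g))" "\<bar>B\<bar> <= N * lam^2 * x^2" "\<bar>L\<bar> <= N * lam^2 * x"
 shows "\<alpha> / 2 * (lam^2 * x * g^2) <= f^2 + (3 + 5 * (\<rho> * N)\<^sup>2 / \<alpha> + 2 * \<alpha> * N) * (lam ^ 4 * x ^ 3 * m^2) + D"
proof -
 have x: "x >= 1" using pos by linarith
 have xp: "x ^ i <= x ^ 3" if "i <= 3" for i using x that by (simp add: power_increasing)
 have lp: "lam ^ i <= lam ^ 4" if "i <= 4" for i using pos that by (simp add: power_increasing)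
 define W where "W = lam ^ 4 * x ^ 3 * m^2"
 have le: "lam ^ i * x ^ j * m^2 <= W" if "i <= 4" "j <= 3" for i j
  unfolding W_def using xp[OF that(2)] lp[OF that(1)] pos x by (intro mult_right_mono mult_mono) auto
 have W0: "W >= 0" unfolding W_def using x pos by auto
 have 1: "\<bar>lam\<^sup>2 * x * wg\<bar> <= f^2 + W"
 proof -
  have "\<bar>lam\<^sup>2 * x * wg\<bar> = lam^2 * x * \<bar>wg\<bar>" using x by (simp add: abs_mult)
  also have "... <= lam^2 * x * (m * f)" using b(1) x by (intro mult_left_mono) auto
  also have "... <= (lam ^ 4 * x^2) * m^2 + 1 * f^2"
   using pos by (intro weighted_young) (auto simp: power_mult_distrib simp flip: power_mult)
  finally show ?thesis using le[of 4 2] by simp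
 qed
 have 2: "\<bar>kt / 2 * m^2\<bar> <= W"
 proof -
  have "\<bar>kt / 2 * m^2\<bar> = \<bar>kt\<bar> / 2 * m^2" by (simp add: abs_mult)
  also have "... <= (lam^2 * x^2) * m^2"
  proof (rule mult_right_mono)
   have "lam^2 * x^2 / \<sigma> <= lam^2 * x^2 / 1" using pos by (intro divide_left_mono) auto
   then show "\<bar>kt\<bar> / 2 <= lam^2 * x^2" using b(2) by simp
  qed simp
  finally show ?thesis using le[of 2 2] by simp
 qed
 have 3: "\<bar>lam\<^sup>2 * x * lt * m^2\<bar> <= W"
 proof -
  have "x^2 / \<sigma> <= x^2 / 1" using pos by (intro divide_left_mono) auto
  then have "\<bar>lt\<bar> <= x^2" using b(3) by simp
  then have "lam^2 * x * \<bar>lt\<bar> * m^2 <= lam^2 * x * x^2 * m^2" using x by (intro mult_right_mono mult_left_mono) auto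
  moreover have "\<bar>lam\<^sup>2 * x * lt * m^2\<bar> = lam^2 * x * \<bar>lt\<bar> * m^2" using x by (simp add: abs_mult)
  moreover have "lam^2 * x * x^2 * m^2 = lam^2 * x ^ 3 * m^2" by (simp add: power3_eq_cube power2_eq_square)
  ultimately show ?thesis using le[of 2 3] by linarith
 qed
 have 4: "\<bar>wk\<bar> <= \<alpha> / 4 * (lam^2 * x * g^2) + (\<rho> * N)\<^sup>2 / \<alpha> * W"
 proof -
  have "\<bar>wk\<bar> <= \<rho> * N * lam ^ 3 * x * (m * g)" using b(4) by (simp add: mult_ac)
  also have "... <= ((\<rho> * N)\<^sup>2 / \<alpha> * (lam ^ 4 * x)) * m^2 + (\<alpha> / 4 * (lam^2 * x)) * g^2"
   using pos x by (intro weighted_young) (auto simp: field_simps power2_eq_square power3_eq_cube power4_eq_xxxx)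
  also have "(\<rho> * N)\<^sup>2 / \<alpha> * (lam ^ 4 * x) * m^2 <= (\<rho> * N)\<^sup>2 / \<alpha> * W"
   using mult_left_mono[OF le[of 4 1], of "(\<rho> * N)\<^sup>2 / \<alpha>"] pos by (simp add: mult_ac)
  finally show ?thesis by (simp add: mult_ac)
 qed
 have 5: "\<bar>2 * (lam^2 * x) * wb\<bar> <= \<alpha> / 4 * (lam^2 * x * g^2) + 4 * (\<rho> * N)\<^sup>2 / \<alpha> * W"
 proof -
  have "\<bar>2 * (lam^2 * x) * wb\<bar> = 2 * (lam^2 * x) * \<bar>wb\<bar>" using x by (simp add: abs_mult)
  also have "... <= 2 * (lam^2 * x) * (m * (\<rho> * (N * lam * x * g)))" using b(5) x by (intro mult_left_mono) auto
  also have "... = 2 * \<rho> * N * lam ^ 3 * x^2 * (m * g)" by (simp add: power2_eq_square power3_eq_cube mult_ac)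
  also have "... <= (4 * (\<rho> * N)\<^sup>2 / \<alpha> * (lam ^ 4 * x ^ 3)) * m^2 + (\<alpha> / 4 * (lam^2 * x)) * g^2"
   using pos x by (intro weighted_young) (auto simp: field_simps power2_eq_square power3_eq_cube power4_eq_xxxx)
  finally show ?thesis by (simp add: W_def mult_ac)
 qed
 have 6: "\<alpha> * (lam^2 * x) * (B - L) * m^2 <= 2 * \<alpha> * N * W"
 proof -
  have "B - L <= N * lam^2 * x^2 + N * lam^2 * x" using b(6,7) by linarith
  also have "... <= 2 * N * lam^2 * x^2"
  proof -
   have "N * lam^2 * x <= N * lam^2 * x^2" using pos x by (intro mult_left_mono) (auto simp: power2_eq_square)
   then show ?thesis by simp
  qed
  finally have "\<alpha> * (lam^2 * x) * (B - L) * m^2 <= \<alpha> * (lam^2 * x) * (2 * N * lam^2 * x^2) * m^2"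
   using pos x by (intro mult_right_mono mult_left_mono) auto
  then show ?thesis by (simp add: W_def power2_eq_square power3_eq_cube power4_eq_xxxx mult_ac)
 qed
 have "\<alpha> * (lam^2 * x) * g^2 = D - kt / 2 * m^2 - lam\<^sup>2 * x * lt * m^2 - wk - lam\<^sup>2 * x * wg
    - 2 * (lam^2 * x) * wb + \<alpha> * (lam^2 * x) * (B - L) * m^2" using id by linarith
 also have "... <= D + W + W + (\<alpha> / 4 * (lam^2 * x * g^2) + (\<rho> * N)\<^sup>2 / \<alpha> * W) + (f^2 + W)
  + (\<alpha> / 4 * (lam^2 * x * g^2) + 4 * (\<rho> * N)\<^sup>2 / \<alpha> * W) + 2 * \<alpha> * N * W"
  using 1 2 3 4 5 6 by linarith
 also have "... = \<alpha> / 2 * (lam^2 * x * g^2) + f^2 + (3 + 5 * (\<rho> * N)\<^sup>2 / \<alpha> + 2 * \<alpha> * N) * W + D"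
  by (simp add: field_simps)
 finally show ?thesis by (simp add: W_def field_simps)
qed

text \<open>The remainder of the commutator identity is small against the weighted norms.\<close>

lemma commutator_estimate:
 fixes m g p r N \<sigma> lam x :: real
 assumes pos: "p >= 0" "N >= 1" "\<sigma> >= 1" "lam >= 1" "x >= 4 * \<sigma>" "m >= 0" "g >= 0"
  and h: "hg >= - N * lam * x * g^2" "hb >= lam ^ 4 * x ^ 3 * E^2 - N * lam ^ 3 * x ^ 3"
   "\<bar>wl\<bar> <= N * lam ^ 3 * x * (g * m)" "\<bar>wt\<bar> <= N * lam * x^2 / \<sigma> * (g * m)"
   "\<bar>bb\<bar> <= N * lam^2 * x ^ 3 / \<sigma>" "\<bar>ltt\<bar> <= N * x ^ 3 / \<sigma>"
 shows "2 * hg + 2 * hb * m^2 + wl + 2 * r * wt - 2 * p * bb * m^2 + (p^2 + r^2) / 2 * ltt * m^2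
  >= 2 * E^2 * (lam ^ 4 * x ^ 3 * m^2)
   - (3 + 2 * \<bar>r\<bar> + 2 * p + p^2 + r^2) * N * (1 / lam + 1 / \<sigma>) * (lam ^ 4 * x ^ 3 * m^2 + lam^2 * x * g^2)"
proof -
 have x: "x >= 1" "lam > 0" "\<sigma> > 0" using pos by linarith+
 have xs: "\<sigma>^2 <= x^2" using pos by (intro power_mono) auto
 define W where "W = lam ^ 4 * x ^ 3 * m^2"
 define G where "G = lam^2 * x * g^2"
 define k where "k = N * (1 / lam + 1 / \<sigma>)"
 define e where "e = k * (W + G)"
 have W0: "W >= 0" "G >= 0" unfolding W_def G_def using x pos by auto
 have k: "k >= 0" "N / lam <= k" "N / \<sigma> <= k" unfolding k_def using pos x by (auto simp: distrib_left)
 have eW: "N / lam * W <= k * W" "N / \<sigma> * W <= k * W" "N / lam * G <= k * G" "N / \<sigma> * G <= k * G"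
  using k W0 by (auto intro!: mult_right_mono simp del: times_divide_eq_left)
 have eq: "e = k * W + k * G" by (simp only: e_def distrib_left)
 have e0: "k * W >= 0" "k * G >= 0" using W0 k by auto
 have 1: "2 * hg + 2 * hb * m^2 >= 2 * E^2 * W - 2 * e"
 proof -
  have a: "hg >= - (N / lam * G)" using h(1) x by (simp add: G_def power2_eq_square field_simps)
  define u v where "u = N / lam * W" and "v = N / lam * G"
  have "hb * m^2 >= (lam ^ 4 * x ^ 3 * E^2 - N * lam ^ 3 * x ^ 3) * m^2" using h(2) by (intro mult_right_mono) auto
  also have "(lam ^ 4 * x ^ 3 * E^2 - N * lam ^ 3 * x ^ 3) * m^2 = E^2 * W - N / lam * W"
   using x by (simp add: W_def field_simps power4_eq_xxxx power3_eq_cube)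
  finally have "hb * m^2 >= E^2 * W - N / lam * W" .
  then have "2 * (E^2 * W) - 2 * (k * W + k * G) <= 2 * hg + 2 * (hb * m^2)"
   using a eW(1,3) unfolding u_def[symmetric] v_def[symmetric] by argo
  then show ?thesis by (simp add: eq mult_ac)
 qed
 have 2: "\<bar>wl\<bar> <= e"
 proof -
  have "\<bar>wl\<bar> <= N * (lam ^ 3 * x * (g * m))" using h(3) by (simp add: mult_ac)
  also have "lam ^ 3 * x * (g * m) <= (lam^2 * x / \<sigma>) * g^2 + (lam ^ 4 * x * \<sigma>) * m^2"
   using pos x by (intro weighted_young) (auto simp: field_simps power2_eq_square power3_eq_cube power4_eq_xxxx)
  also have "(lam ^ 4 * x * \<sigma>) * m^2 <= W / \<sigma>"
  proof -
   have "lam ^ 4 * x * m^2 * \<sigma>^2 <= lam ^ 4 * x * m^2 * x^2" using xs x by (intro mult_left_mono) auto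
   then show ?thesis using x by (simp add: W_def field_simps power2_eq_square power3_eq_cube)
  qed
  finally have "\<bar>wl\<bar> <= N * (lam^2 * x / \<sigma> * g^2 + W / \<sigma>)" using pos by simp
  then have "\<bar>wl\<bar> <= N / \<sigma> * G + N / \<sigma> * W" by (simp add: G_def field_simps)
  then show ?thesis using eW eq by linarith
 qed
 have 3: "\<bar>wt\<bar> <= e"
 proof -
  have "lam * x^2 * (g * m) <= (lam^2 * x) * g^2 + (x ^ 3) * m^2"
   using pos x by (intro weighted_young) (auto simp: field_simps power2_eq_square power3_eq_cube)
  also have "x ^ 3 * m^2 <= W"
  proof -
   have "1 * (x ^ 3 * m^2) <= lam ^ 4 * (x ^ 3 * m^2)" using pos x by (intro mult_right_mono) auto
   then show ?thesis by (simp add: W_def mult_ac)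
  qed
  finally have "lam * x^2 * (g * m) <= G + W" by (simp add: G_def)
  then have "N / \<sigma> * (lam * x^2 * (g * m)) <= N / \<sigma> * (G + W)" using pos by (intro mult_left_mono) auto
  then have "\<bar>wt\<bar> <= N / \<sigma> * (G + W)" using h(4) by (simp add: mult_ac)
  then have "\<bar>wt\<bar> <= N / \<sigma> * G + N / \<sigma> * W" by (simp add: distrib_left)
  then show ?thesis using eW eq by linarith
 qed
 have 4: "\<bar>bb * m^2\<bar> <= e"
 proof -
  have "\<bar>bb * m^2\<bar> <= N * lam^2 * x ^ 3 / \<sigma> * m^2" using mult_right_mono[OF h(5), of "m^2"] by (simp add: abs_mult)
  also have "... = N / \<sigma> * (lam^2 * (x ^ 3 * m^2))" by simp
  also have "... <= N / \<sigma> * (lam ^ 4 * (x ^ 3 * m^2))"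
   using pos x power_increasing[of 2 4 lam] by (intro mult_left_mono mult_right_mono) auto
  finally have "\<bar>bb * m^2\<bar> <= N / \<sigma> * W" by (simp add: W_def mult_ac)
  then show ?thesis using eW e0 eq by linarith
 qed
 have 5: "\<bar>ltt * m^2\<bar> <= e"
 proof -
  have "\<bar>ltt * m^2\<bar> <= N * x ^ 3 / \<sigma> * m^2" using mult_right_mono[OF h(6), of "m^2"] by (simp add: abs_mult)
  also have "... = N / \<sigma> * (1 * (x ^ 3 * m^2))" by simp
  also have "... <= N / \<sigma> * (lam ^ 4 * (x ^ 3 * m^2))"
   using pos x power_increasing[of 0 4 lam] by (intro mult_left_mono mult_right_mono) auto
  finally have "\<bar>ltt * m^2\<bar> <= N / \<sigma> * W" by (simp add: W_def mult_ac)
  then show ?thesis using eW e0 eq by linarith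
 qed
 have e_nonneg: "e >= 0" using 2 by linarith
 have r: "2 * r * wt >= - (2 * \<bar>r\<bar> * e)"
 proof -
  have "\<bar>2 * r * wt\<bar> = 2 * \<bar>r\<bar> * \<bar>wt\<bar>" by (simp add: abs_mult)
  also have "... <= 2 * \<bar>r\<bar> * e" using 3 by (intro mult_left_mono) auto
  finally show ?thesis by linarith
 qed
 have pb: "2 * p * bb * m^2 <= 2 * p * e"
  using mult_left_mono[of "bb * m^2" e "2 * p"] 4 pos by (simp add: mult_ac)
 have l: "(p^2 + r^2) / 2 * ltt * m^2 >= - ((p^2 + r^2) * e)"
 proof -
  define a where "a = p^2 + r^2"
  have "a / 2 * (ltt * m^2) >= a / 2 * (- e)" using 5 by (intro mult_left_mono) (auto simp: a_def)
  moreover have "a * e >= 0" using e_nonneg by (simp add: a_def)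
  moreover have "a / 2 * ltt * m^2 = a / 2 * (ltt * m^2)" "a / 2 * (- e) = - (a * e) / 2" by simp_all
  ultimately show ?thesis unfolding a_def[symmetric] by linarith
 qed
 have "2 * hg + 2 * hb * m^2 + wl + 2 * r * wt - 2 * p * bb * m^2 + (p^2 + r^2) / 2 * ltt * m^2
  >= 2 * E^2 * W - 2 * e - e - 2 * \<bar>r\<bar> * e - 2 * p * e - (p^2 + r^2) * e"
  using 1 2 r pb l by linarith
 also have "2 * E^2 * W - 2 * e - e - 2 * \<bar>r\<bar> * e - 2 * p * e - (p^2 + r^2) * e
  = 2 * E^2 * W - (3 + 2 * \<bar>r\<bar> + 2 * p + p^2 + r^2) * e" by (simp add: algebra_simps)
 finally show ?thesis by (simp add: W_def G_def e_def k_def mult_ac)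
qed

text \<open>
  One of the two factors of the commutator contains \<open>p *R wt\<close>, the other terms of it being of lower order;
  hence its square controls the time derivative.
\<close>

lemma time_derivative_estimate:
 fixes P wt Wb w Jw v :: "'b::real_inner" and p r N lam x L lt g :: real
 assumes pos: "p > 0" "N >= 1" "lam >= 1" "x >= 1" "norm Jw = norm w"
  and P: "P = - 2 *R Wb - L *R w + p *R wt - (r * lt) *R Jw"
  and b: "\<bar>lt\<bar> <= x^2" "norm Wb <= N * lam * x * g" "\<bar>L\<bar> <= N * lam^2 * x"
 shows "nsq (wt - lt *R w) / x
  <= 4 / p^2 * (1 + 5 * N^2 + (\<bar>r\<bar> + p)\<^sup>2) * (nsq P + lam ^ 4 * x ^ 3 * nsq w + lam^2 * x * g^2)"
proof -
 define m where "m = norm w"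
 define W where "W = lam ^ 4 * x ^ 3 * m^2"
 define G where "G = lam^2 * x * g^2"
 have W0: "W >= 0" "G >= 0" unfolding W_def G_def using pos by auto
 have sq4: "(a + b + c + d)\<^sup>2 <= 4 * (a^2 + b^2 + c^2 + d^2)" for a b c d :: real
  using zero_le_power2[of "a - b"] zero_le_power2[of "a - c"] zero_le_power2[of "a - d"]
   zero_le_power2[of "b - c"] zero_le_power2[of "b - d"] zero_le_power2[of "c - d"]
  unfolding power2_eq_square by (simp add: algebra_simps)
 have "p *R (wt - lt *R w) = P + 2 *R Wb + L *R w + ((r * lt) *R Jw - (p * lt) *R w)"
  unfolding P by (simp add: algebra_simps)
 then have "p * norm (wt - lt *R w) = norm (P + 2 *R Wb + L *R w + ((r * lt) *R Jw - (p * lt) *R w))"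
  using pos by (metis abs_of_pos norm_scaleR)
 also have "... <= norm P + norm (2 *R Wb) + norm (L *R w) + (norm ((r * lt) *R Jw) + norm ((p * lt) *R w))"
  by (intro order_trans[OF norm_triangle_ineq] add_mono norm_triangle_ineq4 order_refl)
 also have "... = norm P + 2 * norm Wb + \<bar>L\<bar> * m + (\<bar>r\<bar> + p) * \<bar>lt\<bar> * m"
  using pos by (simp add: m_def abs_mult algebra_simps)
 also have "... <= norm P + 2 * (N * lam * x * g) + (N * lam^2 * x) * m + (\<bar>r\<bar> + p) * x^2 * m"
  using b pos by (intro add_mono mult_right_mono mult_left_mono) (auto simp: m_def)
 finally have "p * norm (wt - lt *R w) <= norm P + 2 * (N * lam * x * g) + (N * lam^2 * x) * m + (\<bar>r\<bar> + p) * x^2 * m" .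
 then have "(p * norm (wt - lt *R w))\<^sup>2 <= (norm P + 2 * (N * lam * x * g) + (N * lam^2 * x) * m + (\<bar>r\<bar> + p) * x^2 * m)\<^sup>2"
  using pos by (intro power_mono) auto
 also have "... <= 4 * (nsq P + (2 * (N * lam * x * g))\<^sup>2 + ((N * lam^2 * x) * m)\<^sup>2 + ((\<bar>r\<bar> + p) * x^2 * m)\<^sup>2)"
  by (rule sq4)
 also have "... <= x * (4 * (1 + 5 * N^2 + (\<bar>r\<bar> + p)\<^sup>2) * (nsq P + W + G))"
 proof -
  have 1: "nsq P <= x * nsq P" using pos mult_right_mono[of 1 x "nsq P"] by simp
  have 2: "(2 * (N * lam * x * g))\<^sup>2 = x * (4 * N^2 * G)"
   by (simp add: G_def power2_eq_square algebra_simps)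
  have 3: "((N * lam^2 * x) * m)\<^sup>2 <= x * (N^2 * W)"
  proof -
   have "((N * lam^2 * x) * m)\<^sup>2 = N^2 * lam ^ 4 * m^2 * x ^ 2"
    by (simp add: power2_eq_square power4_eq_xxxx algebra_simps)
   also have "... <= N^2 * lam ^ 4 * m^2 * x ^ 4" using pos by (intro mult_left_mono power_increasing) auto
   finally show ?thesis by (simp add: W_def power3_eq_cube power4_eq_xxxx algebra_simps)
  qed
  have 4: "((\<bar>r\<bar> + p) * x^2 * m)\<^sup>2 <= x * ((\<bar>r\<bar> + p)\<^sup>2 * W)"
  proof -
   have "((\<bar>r\<bar> + p) * x^2 * m)\<^sup>2 = (\<bar>r\<bar> + p)\<^sup>2 * x ^ 4 * m^2 * lam ^ 0"
    by (simp add: power2_eq_square power4_eq_xxxx algebra_simps)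
   also have "... <= (\<bar>r\<bar> + p)\<^sup>2 * x ^ 4 * m^2 * lam ^ 4" using pos by (intro mult_left_mono power_increasing) auto
   finally show ?thesis by (simp add: W_def power3_eq_cube power4_eq_xxxx mult_ac)
  qed
  define A where "A = 1 + 5 * N^2 + (\<bar>r\<bar> + p)\<^sup>2"
  have A: "1 <= A" "4 * N^2 <= A" "N^2 + (\<bar>r\<bar> + p)\<^sup>2 <= A"
   unfolding A_def using zero_le_power2[of N] zero_le_power2[of "\<bar>r\<bar> + p"] by linarith+
  have "nsq P + (2 * (N * lam * x * g))\<^sup>2 + ((N * lam^2 * x) * m)\<^sup>2 + ((\<bar>r\<bar> + p) * x^2 * m)\<^sup>2
   <= x * (1 * nsq P + 4 * N^2 * G + (N^2 + (\<bar>r\<bar> + p)\<^sup>2) * W)"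
  proof -
   have "x * (1 * nsq P + 4 * N^2 * G + (N^2 + (\<bar>r\<bar> + p)\<^sup>2) * W)
    = x * nsq P + x * (4 * N^2 * G) + x * (N^2 * W) + x * ((\<bar>r\<bar> + p)\<^sup>2 * W)"
    by (simp only: distrib_left distrib_right mult_1)
   then show ?thesis using 1 2 3 4 by linarith
  qed
  also have "... <= x * (A * nsq P + A * G + A * W)"
   using A pos W0 by (intro mult_left_mono add_mono mult_right_mono) auto
  finally show ?thesis unfolding A_def[symmetric] by (simp add: algebra_simps)
 qed
 finally have "p^2 * nsq (wt - lt *R w) <= x * (4 * (1 + 5 * N^2 + (\<bar>r\<bar> + p)\<^sup>2) * (nsq P + W + G))"
  by (simp add: power_mult_distrib)
 then have "nsq (wt - lt *R w) / x <= 4 * (1 + 5 * N^2 + (\<bar>r\<bar> + p)\<^sup>2) * (nsq P + W + G) / p^2"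
  using pos by (simp add: field_simps)
 then show ?thesis by (simp add: W_def G_def m_def)
qed

text \<open>
  The commutator bounds \<open>W\<close> up to a small multiple of \<open>G\<close>, the energy estimate bounds \<open>G\<close> by a large multiple
  of \<open>W\<close>. Adding the small multiple \<open>\<mu>\<close> of the latter keeps the sum coercive: where \<open>E \<ge> c0\<close> the term
  \<open>E\<^sup>2 * W\<close> dominates, elsewhere \<open>W\<close> is paid for by the observation. No gradient is observed, so
  that no cutoff function is involved.
\<close>

lemma carleman_absorption:
 fixes \<alpha> \<rho> c0 K C3 K2 :: real
 assumes "\<alpha> > 0" "c0 > 0" "K > 0" "C3 >= 0" "K2 >= 0" "\<rho> > 0"
 shows "\<exists>\<epsilon> C a b. \<epsilon> > 0 \<and> C > 0 \<and> (\<forall>Q W G F E D D' LH \<epsilon>' (ind::real).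
  Q >= 0 \<and> W >= 0 \<and> G >= 0 \<and> F >= 0 \<and> ind >= 0 \<and> (ind >= 1 \<or> E >= c0) \<and> 0 <= \<epsilon>' \<and> \<epsilon>' <= \<epsilon> \<and>
  Q + 2 * (2 * E^2 * W - C3 * \<epsilon>' * (W + G) + D) <= F / \<rho>^2 \<and>
  \<alpha> / 2 * G <= F + K * W + D' \<and> LH <= K2 * (Q + W + G + F) \<longrightarrow>
  LH + W <= C * (F + ind * W) + a * D + b * D')"
proof -
 define \<mu> where "\<mu> = c0^2 / K"
 define \<delta> where "\<delta> = min 1 (min (2 * c0^2) (\<mu> * \<alpha> / 4))"
 define \<epsilon> where "\<epsilon> = min (c0^2) (\<mu> * \<alpha> / 4) / (2 * (C3 + 1))"
 define k where "k = (K2 + 1) / \<delta>"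
 define C where "C = K2 + k * (1 / \<rho>^2 + \<mu> + 4 * c0^2)"
 have pos: "\<mu> > 0" "\<delta> > 0" "\<epsilon> > 0" "k > 0" using assms by (auto simp: \<mu>_def \<delta>_def \<epsilon>_def k_def)
 have "k * (1 / \<rho>^2 + \<mu> + 4 * c0^2) > 0" using assms pos by (intro mult_pos_pos add_pos_pos) auto
 then have C: "C > 0" unfolding C_def using assms by linarith
 show ?thesis
 proof (rule exI[of _ \<epsilon>], rule exI[of _ C], rule exI[of _ "- 2 * k"], rule exI[of _ "k * \<mu>"],
   intro conjI allI impI)
  fix Q W G F E D D' LH \<epsilon>' ind :: real
  assume A: "Q >= 0 \<and> W >= 0 \<and> G >= 0 \<and> F >= 0 \<and> ind >= 0 \<and> (ind >= 1 \<or> E >= c0) \<and> 0 <= \<epsilon>' \<and> \<epsilon>' <= \<epsilon> \<and>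
   Q + 2 * (2 * E^2 * W - C3 * \<epsilon>' * (W + G) + D) <= F / \<rho>^2 \<and>
   \<alpha> / 2 * G <= F + K * W + D' \<and> LH <= K2 * (Q + W + G + F)"
  have E: "4 * c0^2 * W <= 4 * E^2 * W + 4 * c0^2 * (ind * W)"
  proof (cases "E >= c0")
   case True
   then have "c0^2 * W <= E^2 * W" using assms A by (intro mult_right_mono power_mono) auto
   moreover have "0 <= c0^2 * (ind * W)" using A by simp
   ultimately show ?thesis by linarith
  next
   case False
   then have "c0^2 * (1 * W) <= c0^2 * (ind * W)" using A by (intro mult_left_mono mult_right_mono) auto
   moreover have "0 <= E^2 * W" using A by simp
   ultimately show ?thesis by simp
  qed
  have e: "2 * C3 * \<epsilon>' * (W + G) <= c0^2 * W + \<mu> * \<alpha> / 4 * G"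
  proof -
   have "2 * C3 * \<epsilon>' <= 2 * (C3 + 1) * \<epsilon>" using A assms pos by (intro mult_mono) auto
   also have "... = min (c0^2) (\<mu> * \<alpha> / 4)" using assms by (simp add: \<epsilon>_def)
   finally have l: "2 * C3 * \<epsilon>' <= c0^2" "2 * C3 * \<epsilon>' <= \<mu> * \<alpha> / 4" by auto
   have "2 * C3 * \<epsilon>' * (W + G) = 2 * C3 * \<epsilon>' * W + 2 * C3 * \<epsilon>' * G" by (simp add: distrib_left)
   also have "... <= c0^2 * W + \<mu> * \<alpha> / 4 * G" using l A by (intro add_mono mult_right_mono) auto
   finally show ?thesis .
  qed
  have "\<mu> * (\<alpha> / 2 * G) <= \<mu> * (F + K * W + D')" using A pos by (intro mult_left_mono) auto
  then have g: "\<mu> * \<alpha> / 2 * G <= \<mu> * F + c0^2 * W + \<mu> * D'" using assms by (simp add: \<mu>_def field_simps)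
  have "Q + 2 * c0^2 * W + \<mu> * \<alpha> / 4 * G <= F / \<rho>^2 + \<mu> * F + 4 * c0^2 * (ind * W) - 2 * D + \<mu> * D'"
   using E e g A by (simp add: algebra_simps)
  moreover have "\<delta> * (Q + W + G) <= 1 * Q + 2 * c0^2 * W + \<mu> * \<alpha> / 4 * G"
   unfolding distrib_left using A by (intro add_mono mult_right_mono) (auto simp: \<delta>_def)
  ultimately have "\<delta> * (Q + W + G) <= F / \<rho>^2 + \<mu> * F + 4 * c0^2 * (ind * W) - 2 * D + \<mu> * D'" by simp
  then have "(K2 + 1) / \<delta> * (\<delta> * (Q + W + G)) <= (K2 + 1) / \<delta> * (F / \<rho>^2 + \<mu> * F + 4 * c0^2 * (ind * W) - 2 * D + \<mu> * D')"
   using assms pos by (intro mult_left_mono) auto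
  then have 1: "(K2 + 1) * (Q + W + G) <= k * (F / \<rho>^2 + \<mu> * F + 4 * c0^2 * (ind * W) - 2 * D + \<mu> * D')"
   using pos by (simp add: k_def)
  have "LH + W <= K2 * F + (K2 + 1) * (Q + W + G)" using A assms by (simp add: algebra_simps)
  also have "... <= K2 * F + k * (F / \<rho>^2 + \<mu> * F + 4 * c0^2 * (ind * W) - 2 * D + \<mu> * D')" using 1 by simp
  also have "... = (K2 + k * (1 / \<rho>^2 + \<mu>)) * F + k * (4 * c0^2) * (ind * W) + - 2 * k * D + k * \<mu> * D'"
   by (simp add: algebra_simps)
  also have "... <= C * F + C * (ind * W) + - 2 * k * D + k * \<mu> * D'"
  proof -
   have "K2 + k * (1 / \<rho>^2 + \<mu>) <= C" "k * (4 * c0^2) <= C"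
    unfolding C_def distrib_left using assms pos by auto
   then have "(K2 + k * (1 / \<rho>^2 + \<mu>)) * F <= C * F" "k * (4 * c0^2) * (ind * W) <= C * (ind * W)"
    using A by (auto intro!: mult_right_mono simp del: mult.assoc)
   then show ?thesis by linarith
  qed
  finally show "LH + W <= C * (F + ind * W) + - 2 * k * D + k * \<mu> * D'" by (simp add: distrib_left)
 qed (use pos C in auto)
qed

section \<open>The pointwise Carleman inequality\<close>

lemma abs_sum_UNIV_le:
 fixes f :: "'n::finite => real"
 assumes "\<And>i. \<bar>f i\<bar> <= A"
 shows "\<bar>\<Sum>i\<in>UNIV. f i\<bar> <= real CARD('n) * A"
proof -
 have "(\<Sum>i\<in>UNIV. \<bar>f i\<bar>) <= real CARD('n) * A" using assms by (intro sum_bounded_above) auto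
 then show ?thesis using sum_abs[of f UNIV] by linarith
qed

lemma norm_sum_scaleR_le:
 fixes v :: "'n::finite => 'b::real_inner"
 assumes "\<And>i. \<bar>a i\<bar> <= A" "g = sqrt (\<Sum>i\<in>UNIV. v i \<bullet> v i)"
 shows "norm (\<Sum>i\<in>UNIV. a i *R v i) <= real CARD('n) * A * g"
proof -
 have vi: "norm (v i) <= g" for i
 proof -
  have "v i \<bullet> v i <= (\<Sum>i\<in>UNIV. v i \<bullet> v i)" by (intro member_le_sum) auto
  then show ?thesis unfolding assms norm_eq_sqrt_inner by (rule real_sqrt_le_mono)
 qed
 have "norm (\<Sum>i\<in>UNIV. a i *R v i) <= (\<Sum>i\<in>UNIV. norm (a i *R v i))" by (rule norm_sum)
 also have "... <= (\<Sum>i\<in>(UNIV::'n set). A * g)"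
  unfolding norm_scaleR
  using assms(1) vi order_trans[OF abs_ge_zero assms(1)] by (intro sum_mono mult_mono) auto
 finally show ?thesis by simp
qed

lemma abs_double_sum_inner_le:
 fixes v :: "'n::finite => 'b::real_inner"
 assumes "\<And>i j. \<bar>a i j\<bar> <= A" "g = sqrt (\<Sum>i\<in>UNIV. v i \<bullet> v i)"
 shows "\<bar>\<Sum>i\<in>UNIV. \<Sum>j\<in>UNIV. a i j * (v i \<bullet> v j)\<bar> <= (real CARD('n))\<^sup>2 * A * g^2"
proof -
 have A: "A >= 0" using order_trans[OF abs_ge_zero assms(1)] .
 have g0: "g >= 0" unfolding assms by (simp add: sum_nonneg)
 have "\<bar>\<Sum>j\<in>UNIV. a i j * (v i \<bullet> v j)\<bar> <= real CARD('n) * A * g^2" for i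
 proof -
  have vi: "norm (v i) <= g"
  proof -
   have "v i \<bullet> v i <= (\<Sum>i\<in>UNIV. v i \<bullet> v i)" by (intro member_le_sum) auto
   then show ?thesis unfolding assms norm_eq_sqrt_inner by (rule real_sqrt_le_mono)
  qed
  have "(\<Sum>j\<in>UNIV. a i j * (v i \<bullet> v j)) = v i \<bullet> (\<Sum>j\<in>UNIV. a i j *R v j)"
   by (simp add: inner_sum_right)
  also have "\<bar>...\<bar> <= norm (v i) * norm (\<Sum>j\<in>UNIV. a i j *R v j)" by (rule Cauchy_Schwarz_ineq2)
  also have "... <= g * (real CARD('n) * A * g)"
   using vi norm_sum_scaleR_le[of "a i" A g v] assms g0 by (intro mult_mono) auto
  finally show ?thesis by (simp add: power2_eq_square mult_ac)
 qed
 then have "\<bar>\<Sum>i\<in>UNIV. \<Sum>j\<in>UNIV. a i j * (v i \<bullet> v j)\<bar> <= (\<Sum>i\<in>(UNIV::'n set). real CARD('n) * A * g^2)"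
  by (rule order_trans[OF sum_abs sum_mono])
 then show ?thesis by (simp add: power2_eq_square mult_ac)
qed

text \<open>
  With \<open>x\<close> for \<open>s \<xi>\<close> and \<open>lam\<close> for the second parameter, all ingredients at one point: the lower bound
  from the commutator, the gradient bound from the energy identity, and the bound of the time derivative and the
  Laplacian by the equation. The errors are smaller than the main terms by a factor \<open>1 / lam\<close> or \<open>1 / \<sigma>\<close>.
  All derivatives of \<open>\<eta>\<close> enter through their common bound \<open>M\<close>.
\<close>

lemma carleman_terms:
 fixes w wt z gg :: "'b::real_inner" and wi wti :: "'n::finite => 'b" and wij :: "'n => 'n => 'b"
  and e dl :: "'n => real" and ee :: "'n => 'n => real" and J c :: "'b => 'b" and \<alpha> \<gamma> M \<sigma> lam x y lt ltt :: real
 assumes wij: "\<And>i j. wij i j = wij j i" and ee_sym: "\<And>i j. ee i j = ee j i"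
  and J: "linear J" and skew: "\<And>x y. J x \<bullet> y = - (x \<bullet> J y)" and iso: "\<And>x y. J x \<bullet> J y = x \<bullet> y"
  and JJ: "\<And>x. J (J x) = - x"
  and c: "\<And>x. c x = \<alpha> *R x - \<gamma> *R J x" and \<alpha>: "\<alpha> > 0"
  and \<rho>: "\<rho> = sqrt (\<alpha>^2 + \<gamma>^2)" and p: "p = \<alpha> / \<rho>^2" and r: "r = \<gamma> / \<rho>^2"
  and N: "N = 10 * (real CARD('n))\<^sup>2 * M ^ 3"
  and M: "M >= 1" "\<And>i. \<bar>e i\<bar> <= M" "\<And>i j. \<bar>ee i j\<bar> <= M" "\<And>i. \<bar>dl i\<bar> <= M"
  and par: "lam >= 1" "\<sigma> >= 1" "x >= 4 * \<sigma>"
  and b: "\<And>i. b i = lam * x * e i" and H: "\<And>i j. H i j = lam^2 * x * e i * e j + lam * x * ee i j"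
  and E: "E = (\<Sum>i\<in>UNIV. e i * e i)" and De: "De = (\<Sum>i\<in>UNIV. ee i i)"
  and Li: "\<And>i. Li i = lam ^ 3 * x * e i * E + 2 * lam^2 * x * (\<Sum>j\<in>UNIV. e j * ee i j)
    + lam^2 * x * e i * De + lam * x * dl i"
  and bt: "\<And>i. bt i = lam * y * e i" and y: "\<bar>y\<bar> <= x^2 / \<sigma>"
  and lt: "\<bar>lt\<bar> <= x^2 / \<sigma>" and ltt: "\<bar>ltt\<bar> <= 3 * x ^ 3 / \<sigma>"
  and L: "L = (\<Sum>i\<in>UNIV. H i i)" and B: "B = (\<Sum>i\<in>UNIV. b i * b i)"
  and Wb: "Wb = (\<Sum>j\<in>UNIV. b j *R wi j)" and lap: "lap = (\<Sum>i\<in>UNIV. wij i i)"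
  and G: "G = (\<Sum>j\<in>UNIV. wi j \<bullet> wi j)"
  and dX: "\<And>i. dX i = flux_space_deriv p r J w wt lt L B Wb G wi b (bt i) (Li i) (wti i) (wij i) (H i) i"
  and dY: "dY = flux_time_deriv p r J w wt lt ltt B Wb b bt wi wti"
  and \<kappa>i: "\<And>i. \<kappa>i i = lam ^ 3 * x * e i"
  and dX': "\<And>i. dX' i = \<kappa>i i * (w \<bullet> c (wi i)) + lam^2 * x * (wi i \<bullet> c (wi i) + w \<bullet> c (wij i i))"
  and dY': "dY' = (lam^2 * y * (w \<bullet> w) + lam^2 * x * (2 * (wt \<bullet> w))) / 2"
  and gg: "gg = wt - lt *R w + c (lap - 2 *R Wb + (B - L) *R w)"
  and z: "c z = gg - (wt - lt *R w)"
  and W: "W = lam ^ 4 * x ^ 3 * nsq w" and Q: "Q = nsq (- 2 *R Wb - L *R w + p *R wt - (r * lt) *R J w)"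
 shows "Q + 2 * (2 * E^2 * W - (3 + 2 * \<bar>r\<bar> + 2 * p + p^2 + r^2) * N * (1 / lam + 1 / \<sigma>) * (W + lam^2 * x * G)
    + ((\<Sum>i\<in>UNIV. dX i) + dY)) <= nsq gg / \<rho>^2" (is ?A)
  and "\<alpha> / 2 * (lam^2 * x * G) <= nsq gg + (3 + 5 * (\<rho> * N)\<^sup>2 / \<alpha> + 2 * \<alpha> * N) * W
    + ((\<Sum>i\<in>UNIV. dX' i) + dY')" (is ?B)
  and "inverse x * (nsq (wt - lt *R w) + nsq z)
    <= ((1 + 2 / \<rho>^2) * (4 / p^2 * (1 + 5 * N^2 + (\<bar>r\<bar> + p)\<^sup>2)) + 2 / \<rho>^2) * (Q + W + lam^2 * x * G + nsq gg)" (is ?C)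
proof -
 define n where "n = real CARD('n)"
 have n: "n >= 1" unfolding n_def by (simp add: Suc_leI)
 have x: "x >= 1" "x > 0" using par by linarith+
 have \<rho>2: "\<rho>^2 = \<alpha>^2 + \<gamma>^2" "\<rho> > 0" "\<rho>^2 > 0" using \<alpha> unfolding \<rho> by (auto simp: sum_power2_gt_zero_iff)
 have p0: "p > 0" unfolding p using \<alpha> \<rho>2 by auto
 have J0: "J x \<bullet> x = 0" "x \<bullet> J x = 0" for x using skew[of x x] by (auto simp: inner_commute)
 have normc: "nsq (c v) = \<rho>^2 * nsq v" for v
  unfolding c power2_norm_eq_inner \<rho>2
  by (simp add: inner_diff_left inner_diff_right J0 iso power2_eq_square algebra_simps)
 have normc1: "norm (c v) = \<rho> * norm v" for v
  using normc[of v] \<rho>2 by (metis abs_norm_cancel norm_ge_zero mult_nonneg_nonneg less_imp_le power_mult_distrib real_sqrt_abs real_sqrt_unique)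
 have Jc: "p *R c v + r *R J (c v) = v" for v
 proof -
  have "p *R c v + r *R J (c v) = ((\<alpha>^2 + \<gamma>^2) / \<rho>^2) *R v"
   unfolding c p r by (simp add: linear_diff[OF J] linear_scale[OF J] JJ algebra_simps add_divide_distrib power2_eq_square)
  then show ?thesis using \<rho>2(3) unfolding \<rho>2(1)[symmetric] by simp
 qed
 define m where "m = norm w"
 define g where "g = sqrt G"
 have mg: "m >= 0" "g >= 0" "g^2 = G" unfolding m_def g_def G by (auto simp: sum_nonneg)
 have geq: "g = sqrt (\<Sum>i\<in>UNIV. wi i \<bullet> wi i)" by (simp add: g_def G)
 have MM: "1 <= M^2" "M <= M ^ 3" "M^2 <= M ^ 3" "1 <= M ^ 3" "M <= M^2"
  using M(1) power_increasing[of 1 3 M] power_increasing[of 2 3 M] power_increasing[of 1 2 M] by auto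
 have le: "k * (n ^ i * M ^ j) <= N" if "i <= 2" "j <= 3" "k <= 10" "k >= 0" for k i j
 proof -
  have "n ^ i * M ^ j <= n^2 * M ^ 3" using n M that by (intro mult_mono power_increasing) auto
  then have "k * (n ^ i * M ^ j) <= 10 * (n^2 * M ^ 3)"
   using that n M(1) mult_mono[of k 10 "n ^ i * M ^ j" "n^2 * M ^ 3"] by simp
  then show ?thesis by (simp add: N n_def)
 qed
 have N1: "N >= 1" "N >= 3" using le[of 0 0 1] le[of 0 0 3] by auto
 have E0: "0 <= E" unfolding E by (intro sum_nonneg) auto
 have eM: "e i * e i <= M^2" for i
  using M(2)[of i] power_mono[of "\<bar>e i\<bar>" M 2] by (simp add: power2_eq_square)
 have EM: "E <= n * M^2"
  unfolding E n_def using sum_bounded_above[of UNIV "\<lambda>i. e i * e i" "M^2"] eM by simp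
 have DeM: "\<bar>De\<bar> <= n * M" unfolding De n_def using M(3) by (intro abs_sum_UNIV_le) auto
 have Leq: "L = lam^2 * x * E + lam * x * De"
  unfolding L H E De by (simp add: sum.distrib sum_distrib_left mult_ac)
 have Beq: "B = lam^2 * x^2 * E"
  unfolding B b E by (simp add: sum_distrib_left power2_eq_square mult_ac)
 have LM: "\<bar>L\<bar> <= N * lam^2 * x"
 proof -
  have "\<bar>L\<bar> <= lam^2 * x * E + lam * x * \<bar>De\<bar>"
   unfolding Leq using par x E0 by (intro order_trans[OF abs_triangle_ineq]) (auto simp: abs_mult)
  also have "... <= lam^2 * x * (n * M^2) + lam^2 * x * (n * M)"
   using par x E0 EM DeM n M by (intro add_mono mult_mono) (auto simp: power2_eq_square)
  also have "... = lam^2 * x * (n * M^2 + n * M)" by (simp add: distrib_left)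
  also have "... <= lam^2 * x * N"
  proof (rule mult_left_mono)
   have "n * M^2 >= 0" "n * M >= 0" using n M(1) by auto
   then show "n * M^2 + n * M <= N" using le[of 1 2 5] le[of 1 1 5] by simp
  qed (use x in auto)
  finally show ?thesis by (simp add: mult_ac)
 qed
 have BM: "\<bar>B\<bar> <= N * lam^2 * x^2"
 proof -
  have "E <= N" using EM le[of 1 2 1] by simp
  then show ?thesis unfolding Beq using E0 par x by (simp add: abs_mult mult_ac mult_left_mono)
 qed
 have be: "\<bar>lam * x * e i\<bar> <= lam * x * M" for i
  using M(2)[of i] par x by (simp add: abs_mult mult_left_mono)
 have WbM: "norm Wb <= N * lam * x * g"
 proof -
  have "norm Wb <= n * (lam * x * M) * g"
   unfolding Wb n_def b by (rule norm_sum_scaleR_le[OF be geq])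
  also have "... = (n * M) * (lam * x * g)" by simp
  also have "... <= N * (lam * x * g)" using le[of 1 1 1] par x mg by (intro mult_right_mono) auto
  finally show ?thesis by (simp add: mult_ac)
 qed
 have CS: "\<bar>v \<bullet> w\<bar> <= K * m" if "norm v <= K" for v K
 proof -
  have "\<bar>v \<bullet> w\<bar> <= norm v * norm w" by (rule Cauchy_Schwarz_ineq2)
  also have "... <= K * m" unfolding m_def using that by (intro mult_right_mono) auto
  finally show ?thesis .
 qed
 have normJ: "norm (J v) = norm v" for v by (simp add: norm_eq_sqrt_inner iso)
 have hW: "lam ^ 4 * x ^ 3 * m^2 = W" "lam^2 * x * g^2 = lam^2 * x * G" by (simp_all add: W m_def mg)
 have xx: "x^2 / \<sigma> <= x^2" using par(2) divide_left_mono[of 1 \<sigma> "x^2"] by simp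

 have ee_e: "\<bar>\<Sum>i\<in>UNIV. \<Sum>j\<in>UNIV. ee i j * (e i * e j)\<bar> <= n^2 * M ^ 3"
 proof -
  have "\<bar>ee i j * (e i * e j)\<bar> <= M ^ 3" for i j
  proof -
   have "\<bar>ee i j\<bar> * (\<bar>e i\<bar> * \<bar>e j\<bar>) <= M * (M * M)" using M by (intro mult_mono) auto
   then show ?thesis by (simp add: abs_mult power3_eq_cube)
  qed
  then have "\<bar>\<Sum>j\<in>UNIV. ee i j * (e i * e j)\<bar> <= n * M ^ 3" for i
   unfolding n_def by (rule abs_sum_UNIV_le)
  then have "\<bar>\<Sum>i\<in>UNIV. \<Sum>j\<in>UNIV. ee i j * (e i * e j)\<bar> <= n * (n * M ^ 3)"
   unfolding n_def by (rule abs_sum_UNIV_le)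
  then show ?thesis by (simp add: power2_eq_square mult_ac)
 qed

 have h1: "(\<Sum>i\<in>UNIV. \<Sum>j\<in>UNIV. H i j * (wi i \<bullet> wi j)) >= - N * lam * x * g^2"
 proof -
  let ?v = "\<Sum>i\<in>UNIV. e i *R wi i"
  let ?S = "\<Sum>i\<in>UNIV. \<Sum>j\<in>UNIV. ee i j * (wi i \<bullet> wi j)"
  have "?v \<bullet> ?v = (\<Sum>i\<in>UNIV. \<Sum>j\<in>UNIV. e i * e j * (wi i \<bullet> wi j))"
   by (subst inner_sum_left, subst inner_sum_right) (intro sum.cong refl, simp)
  then have "(\<Sum>i\<in>UNIV. \<Sum>j\<in>UNIV. H i j * (wi i \<bullet> wi j)) = lam^2 * x * (?v \<bullet> ?v) + lam * x * ?S"
   unfolding H by (simp add: sum.distrib sum_distrib_left algebra_simps)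
  moreover have "lam^2 * x * (?v \<bullet> ?v) >= 0" using x by simp
  moreover have "\<bar>?S\<bar> <= N * g^2"
  proof -
   have "\<bar>?S\<bar> <= n^2 * M * g^2" unfolding n_def by (rule abs_double_sum_inner_le[OF M(3) geq])
   also have "... <= N * g^2" using le[of 2 1 1] by (intro mult_right_mono) auto
   finally show ?thesis .
  qed
  then have "lam * x * (- (N * g^2)) <= lam * x * ?S" using par x by (intro mult_left_mono) auto
  moreover have "lam * x * (- (N * g^2)) = - N * lam * x * g^2" by simp
  ultimately show ?thesis by linarith
 qed
 have h2: "(\<Sum>i\<in>UNIV. \<Sum>j\<in>UNIV. H i j * (b i * b j)) >= lam ^ 4 * x ^ 3 * E^2 - N * lam ^ 3 * x ^ 3"
 proof -
  let ?S = "\<Sum>i\<in>UNIV. \<Sum>j\<in>UNIV. ee i j * (e i * e j)"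
  have "(\<Sum>i\<in>UNIV. \<Sum>j\<in>UNIV. H i j * (b i * b j)) = lam ^ 4 * x ^ 3 * E^2 + lam ^ 3 * x ^ 3 * ?S"
   unfolding H b E power2_eq_square[of "sum _ _"] sum_product
   by (simp add: sum.distrib sum_distrib_left power2_eq_square power3_eq_cube power4_eq_xxxx algebra_simps)
  moreover have "lam ^ 3 * x ^ 3 * (- N) <= lam ^ 3 * x ^ 3 * ?S"
   using ee_e le[of 2 3 1] par x by (intro mult_left_mono) auto
  moreover have "lam ^ 3 * x ^ 3 * (- N) = - N * lam ^ 3 * x ^ 3" by simp
  ultimately show ?thesis by linarith
 qed
 have LiM: "\<bar>Li i\<bar> <= lam ^ 3 * x * (5 * n * M ^ 3)" for i
 proof -
  have s: "\<bar>\<Sum>j\<in>UNIV. e j * ee i j\<bar> <= n * M^2"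
  proof -
   have "\<bar>e j * ee i j\<bar> <= M^2" for j
    unfolding abs_mult power2_eq_square using M by (intro mult_mono) auto
   then show ?thesis unfolding n_def by (rule abs_sum_UNIV_le)
  qed
  have pw: "lam ^ a * x <= lam ^ 3 * x" if "a <= 3" for a
   using power_increasing[OF that, of lam] par x by (intro mult_right_mono) auto
  have 1: "\<bar>lam ^ 3 * x * e i * E\<bar> <= lam ^ 3 * x * (n * M ^ 3)"
  proof -
   have "\<bar>lam ^ 3 * x * e i * E\<bar> = lam ^ 3 * x * (\<bar>e i\<bar> * E)" using par x E0 by (simp add: abs_mult)
   also have "... <= lam ^ 3 * x * (M * (n * M^2))" using par x E0 EM M(1) M(2)[of i] by (intro mult_left_mono mult_mono) auto
   finally show ?thesis by (simp add: power2_eq_square power3_eq_cube mult_ac)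
  qed
  have 2: "\<bar>2 * lam^2 * x * (\<Sum>j\<in>UNIV. e j * ee i j)\<bar> <= lam ^ 3 * x * (2 * (n * M ^ 3))"
  proof -
   have "\<bar>2 * lam^2 * x * (\<Sum>j\<in>UNIV. e j * ee i j)\<bar> = lam^2 * x * (2 * \<bar>\<Sum>j\<in>UNIV. e j * ee i j\<bar>)"
    using par x by (simp add: abs_mult)
   also have "... <= lam ^ 3 * x * (2 * (n * M^2))" using pw[of 2] s x par by (intro mult_mono) auto
   also have "... <= lam ^ 3 * x * (2 * (n * M ^ 3))" using MM n x par by (intro mult_left_mono) auto
   finally show ?thesis .
  qed
  have 3: "\<bar>lam\<^sup>2 * x * e i * De\<bar> <= lam ^ 3 * x * (n * M ^ 3)"
  proof -
   have "\<bar>lam\<^sup>2 * x * e i * De\<bar> = lam^2 * x * (\<bar>e i\<bar> * \<bar>De\<bar>)" using par x by (simp add: abs_mult)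
   also have "... <= lam ^ 3 * x * (M * (n * M))"
    using pw[of 2] DeM M(1) M(2)[of i] x par by (intro mult_mono) auto
   also have "... = lam ^ 3 * x * (n * M^2)" by (simp add: power2_eq_square)
   also have "... <= lam ^ 3 * x * (n * M ^ 3)" using MM n x par by (intro mult_left_mono) auto
   finally show ?thesis .
  qed
  have 4: "\<bar>lam * x * dl i\<bar> <= lam ^ 3 * x * (n * M ^ 3)"
  proof -
   have "\<bar>lam * x * dl i\<bar> = lam * x * \<bar>dl i\<bar>" using par x by (simp add: abs_mult)
   also have "... <= lam ^ 3 * x * (1 * M)"
    using pw[of 1] M(4)[of i] x par by (intro mult_mono) auto
   also have "... <= lam ^ 3 * x * (n * M ^ 3)" using MM M n x par by (intro mult_left_mono mult_mono) auto
   finally show ?thesis .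
  qed
  have "\<bar>Li i\<bar> <= lam ^ 3 * x * (n * M ^ 3) + lam ^ 3 * x * (2 * (n * M ^ 3)) + lam ^ 3 * x * (n * M ^ 3)
   + lam ^ 3 * x * (n * M ^ 3)" unfolding Li using 1 2 3 4 by linarith
  then show ?thesis by (simp add: algebra_simps)
 qed
 have h3: "\<bar>\<Sum>i\<in>UNIV. Li i * (wi i \<bullet> w)\<bar> <= N * lam ^ 3 * x * (g * m)"
 proof -
  have "norm (\<Sum>i\<in>UNIV. Li i *R wi i) <= n * (lam ^ 3 * x * (5 * n * M ^ 3)) * g"
   unfolding n_def by (rule norm_sum_scaleR_le[OF LiM[unfolded n_def] geq])
  also have "... = (5 * (n^2 * M ^ 3)) * (lam ^ 3 * x * g)" by (simp add: power2_eq_square)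
  also have "... <= N * (lam ^ 3 * x * g)" using le[of 2 3 5] x par mg by (intro mult_right_mono) auto
  finally have "\<bar>(\<Sum>i\<in>UNIV. Li i *R wi i) \<bullet> w\<bar> <= N * (lam ^ 3 * x * g) * m" by (rule CS)
  then show ?thesis by (simp add: inner_sum_left mult_ac)
 qed
 have btM: "\<bar>bt i\<bar> <= lam * (x^2 / \<sigma>) * M" for i
  unfolding bt abs_mult using par y M(1) M(2)[of i] by (intro mult_mono) auto
 have h4: "\<bar>\<Sum>i\<in>UNIV. bt i * (wi i \<bullet> J w)\<bar> <= N * lam * x^2 / \<sigma> * (g * m)"
 proof -
  have "norm (\<Sum>i\<in>UNIV. bt i *R wi i) <= n * (lam * (x^2 / \<sigma>) * M) * g"
   unfolding n_def by (rule norm_sum_scaleR_le[OF btM geq])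
  also have "... = (1 * (n ^ 1 * M ^ 1)) * (lam * (x^2 / \<sigma>) * g)" by simp
  also have "... <= N * (lam * (x^2 / \<sigma>) * g)" using le[of 1 1 1] x par mg by (intro mult_right_mono) auto
  finally have 1: "norm (\<Sum>i\<in>UNIV. bt i *R wi i) <= N * (lam * (x^2 / \<sigma>) * g)" .
  have "\<bar>(\<Sum>i\<in>UNIV. bt i *R wi i) \<bullet> J w\<bar> <= norm (\<Sum>i\<in>UNIV. bt i *R wi i) * norm (J w)"
   by (rule Cauchy_Schwarz_ineq2)
  also have "... <= N * (lam * (x^2 / \<sigma>) * g) * m"
   unfolding normJ m_def using 1 by (intro mult_right_mono) auto
  finally show ?thesis by (simp add: inner_sum_left mult_ac)
 qed
 have h5: "\<bar>\<Sum>i\<in>UNIV. b i * bt i\<bar> <= N * lam^2 * x ^ 3 / \<sigma>"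
 proof -
  have "(\<Sum>i\<in>UNIV. b i * bt i) = lam^2 * x * y * E"
   unfolding b bt E by (simp add: sum_distrib_left power2_eq_square mult_ac)
  also have "\<bar>...\<bar> = lam^2 * x * \<bar>y\<bar> * E" using x par E0 by (simp add: abs_mult)
  also have "... <= lam^2 * x * (x^2 / \<sigma>) * N"
   using EM E0 le[of 1 2 1] x par y by (intro mult_mono) auto
  finally show ?thesis by (simp add: power2_eq_square power3_eq_cube mult_ac)
 qed
 have h6: "\<bar>ltt\<bar> <= N * x ^ 3 / \<sigma>"
 proof -
  have "3 * x ^ 3 / \<sigma> <= N * x ^ 3 / \<sigma>" using N1 x par by (intro divide_right_mono mult_right_mono) auto
  then show ?thesis using ltt by linarith
 qed

 let ?P1 = "lap + B *R w + r *R J wt - (p * lt) *R w"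
 let ?P2 = "- 2 *R Wb - L *R w + p *R wt - (r * lt) *R J w"
 have Hs: "H i j = H j i" for i j unfolding H by (simp add: ee_sym[of i j])
 have id: "?P1 \<bullet> ?P2 = 2 * (\<Sum>i\<in>UNIV. \<Sum>j\<in>UNIV. H i j * (wi i \<bullet> wi j))
   + 2 * (\<Sum>i\<in>UNIV. \<Sum>j\<in>UNIV. H i j * (b i * b j)) * (w \<bullet> w)
   + (\<Sum>i\<in>UNIV. Li i * (wi i \<bullet> w)) + 2 * r * (\<Sum>i\<in>UNIV. bt i * (wi i \<bullet> J w))
   - 2 * p * (\<Sum>i\<in>UNIV. b i * bt i) * (w \<bullet> w) + (p^2 + r^2) / 2 * ltt * (w \<bullet> w)
   + (\<Sum>i\<in>UNIV. dX i) + dY"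
  by (rule carleman_identity[OF wij Hs J skew iso L B Wb lap G dX dY])
 have ww: "w \<bullet> w = m^2" by (simp add: m_def power2_norm_eq_inner)
 have com: "?P1 \<bullet> ?P2 >= 2 * E^2 * W - (3 + 2 * \<bar>r\<bar> + 2 * p + p^2 + r^2) * N * (1 / lam + 1 / \<sigma>) * (W + lam^2 * x * G)
   + ((\<Sum>i\<in>UNIV. dX i) + dY)"
  using commutator_estimate[OF less_imp_le[OF p0] N1(1) par(2,1,3) mg(1,2) h1 h2 h3 h4 h5 h6, of r]
  unfolding id ww hW by linarith
 have "?P1 + ?P2 = p *R gg + r *R J gg"
 proof -
  have "p *R gg + r *R J gg = p *R (wt - lt *R w) + r *R J (wt - lt *R w)
    + (lap - 2 *R Wb + (B - L) *R w)"
   using Jc[of "lap - 2 *R Wb + (B - L) *R w"] unfolding gg linear_add[OF J] scaleR_add_right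
   by (simp add: algebra_simps)
  then show ?thesis by (simp add: linear_diff[OF J] linear_scale[OF J] algebra_simps)
 qed
 moreover have "nsq (p *R gg + r *R J gg) = nsq gg / \<rho>^2"
 proof -
  have "nsq (p *R gg + r *R J gg) = (p^2 + r^2) * nsq gg"
   unfolding power2_norm_eq_inner
   by (simp add: inner_add_left inner_add_right J0 iso power2_eq_square algebra_simps)
  also have "p^2 + r^2 = (\<alpha>^2 + \<gamma>^2) / (\<rho>^2)\<^sup>2" unfolding p r by (simp add: power_divide add_divide_distrib)
  also have "... = 1 / \<rho>^2" unfolding \<rho>2(1)[symmetric] using \<rho>2 by (simp add: power2_eq_square)
  finally show ?thesis by simp
 qed
 moreover have "nsq (?P1 + ?P2) = nsq ?P1 + nsq ?P2 + 2 * (?P1 \<bullet> ?P2)"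
  unfolding power2_norm_eq_inner inner_add_left inner_add_right by (simp add: inner_commute)
 ultimately have fsq: "nsq gg / \<rho>^2 = nsq ?P1 + Q + 2 * (?P1 \<bullet> ?P2)" unfolding Q by simp
 have "Q + 2 * (2 * E^2 * W - (3 + 2 * \<bar>r\<bar> + 2 * p + p^2 + r^2) * N * (1 / lam + 1 / \<sigma>) * (W + lam^2 * x * G)
   + ((\<Sum>i\<in>UNIV. dX i) + dY)) <= Q + 2 * (?P1 \<bullet> ?P2)"
  using com by (intro add_left_mono mult_left_mono) simp_all
 also have "... <= nsq gg / \<rho>^2" unfolding fsq by simp
 finally show ?A .

 show ?B
 proof -
  define wk where "wk = w \<bullet> c (\<Sum>i\<in>UNIV. \<kappa>i i *R wi i)"
  have e1: "lam^2 * x * (w \<bullet> gg) = ((\<Sum>i\<in>UNIV. dX' i) + dY') - (lam^2 * y) / 2 * m^2 - lam\<^sup>2 * x * lt * m^2 - wk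
   - \<alpha> * (lam^2 * x) * g^2 - 2 * (lam^2 * x) * (w \<bullet> c Wb) + \<alpha> * (lam^2 * x) * (B - L) * m^2"
   using energy_identity[OF J skew c lap gg dX' dY'] unfolding wk_def ww mg(3) G .
  have e2: "\<bar>w \<bullet> gg\<bar> <= m * norm gg" unfolding m_def by (rule Cauchy_Schwarz_ineq2)
  have e3: "\<bar>lam\<^sup>2 * y\<bar> <= lam^2 * x^2 / \<sigma>" using y mult_left_mono[OF y, of "lam^2"] by (simp add: abs_mult)
  have "\<bar>\<kappa>i i\<bar> <= lam ^ 3 * x * M" for i
   unfolding \<kappa>i abs_mult using par x M(1) M(2)[of i] by (intro mult_mono) auto
  then have "norm (\<Sum>i\<in>UNIV. \<kappa>i i *R wi i) <= n * (lam ^ 3 * x * M) * g"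
   unfolding n_def by (rule norm_sum_scaleR_le[OF _ geq])
  also have "... = (1 * (n ^ 1 * M ^ 1)) * (lam ^ 3 * x * g)" by simp
  also have "... <= N * (lam ^ 3 * x * g)" using le[of 1 1 1] x par mg by (intro mult_right_mono) auto
  finally have k: "norm (\<Sum>i\<in>UNIV. \<kappa>i i *R wi i) <= N * lam ^ 3 * x * g" by (simp add: mult_ac)
  have c2: "\<bar>w \<bullet> c v\<bar> <= m * (\<rho> * K)" if "norm v <= K" for v K
  proof -
   have "\<bar>w \<bullet> c v\<bar> <= m * norm (c v)" unfolding m_def by (rule Cauchy_Schwarz_ineq2)
   also have "... <= m * (\<rho> * K)" unfolding normc1 using that mg \<rho>2 by (intro mult_left_mono) auto
   finally show ?thesis .
  qed
  show ?B
   using energy_estimate[OF \<alpha> less_imp_le[OF \<rho>2(2)] N1(1) par(2,1,3) mg(1,2) norm_ge_zero e1 e2 e3 lt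
    c2[OF k, folded wk_def] c2[OF WbM] BM LM] unfolding hW .
 qed

 show ?C
 proof -
  define K where "K = 4 / p^2 * (1 + 5 * N^2 + (\<bar>r\<bar> + p)\<^sup>2)"
  have K0: "K >= 0" unfolding K_def by (intro mult_nonneg_nonneg add_nonneg_nonneg) auto
  define V where "V = nsq (wt - lt *R w) / x"
  define S where "S = Q + W + lam^2 * x * G"
  have S0: "S >= 0" unfolding S_def Q W mg(3)[symmetric] using x by simp
  have ltx: "\<bar>lt\<bar> <= x^2" using lt xx by linarith
  have V: "V <= K * S"
   using time_derivative_estimate[OF p0 N1(1) par(1) x(1) normJ[of w] refl ltx WbM LM, of wt r]
   unfolding V_def K_def S_def m_def[symmetric] hW Q by simp
  have "\<rho>^2 * nsq z = nsq (gg - (wt - lt *R w))" unfolding normc[symmetric] z ..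
  also have "... <= 2 * nsq gg + 2 * nsq (wt - lt *R w)"
  proof -
   have "nsq (gg - (wt - lt *R w)) <= (norm gg + norm (wt - lt *R w))\<^sup>2"
    by (intro power_mono norm_triangle_ineq4) auto
   also have "... <= 2 * nsq gg + 2 * nsq (wt - lt *R w)"
    using sum_squares_bound[of "norm gg" "norm (wt - lt *R w)"] by (simp add: power2_sum)
   finally show ?thesis .
  qed
  finally have "\<rho>^2 * (nsq z / x) <= 2 * (nsq gg / x) + 2 * V"
   using x unfolding V_def by (simp add: field_simps)
  moreover have "nsq gg / x <= nsq gg" using x divide_left_mono[of 1 x "nsq gg"] by simp
  ultimately have "\<rho>^2 * (nsq z / x) <= 2 * nsq gg + 2 * V" by linarith
  note lez = this
  have zz: "nsq z / x <= 2 / \<rho>^2 * nsq gg + 2 / \<rho>^2 * V"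
  proof -
   have "\<rho>^2 * (nsq z / x) / \<rho>^2 <= (2 * nsq gg + 2 * V) / \<rho>^2"
    using lez by (rule divide_right_mono) simp
   then show ?thesis using \<rho>2(2) by (simp add: add_divide_distrib)
  qed
  have "inverse x * (nsq (wt - lt *R w) + nsq z) = V + nsq z / x"
   unfolding V_def by (simp add: field_simps add_divide_distrib)
  also have "... <= (1 + 2 / \<rho>^2) * V + 2 / \<rho>^2 * nsq gg" using zz by (simp add: distrib_right)
  also have "... <= (1 + 2 / \<rho>^2) * (K * S) + 2 / \<rho>^2 * nsq gg"
   using V by (intro add_mono mult_left_mono) auto
  also have "... <= ((1 + 2 / \<rho>^2) * K + 2 / \<rho>^2) * S + ((1 + 2 / \<rho>^2) * K + 2 / \<rho>^2) * nsq gg"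
  proof (intro add_mono mult_right_mono)
   have "(1 + 2 / \<rho>^2) * (K * S) = (1 + 2 / \<rho>^2) * K * S + 0 * S" by simp
   also have "... <= (1 + 2 / \<rho>^2) * K * S + 2 / \<rho>^2 * S" using S0 K0 by (intro add_mono mult_right_mono) auto
   finally show "(1 + 2 / \<rho>^2) * (K * S) <= ((1 + 2 / \<rho>^2) * K + 2 / \<rho>^2) * S" by (simp only: distrib_right)
   show "2 / \<rho>^2 <= (1 + 2 / \<rho>^2) * K + 2 / \<rho>^2" using K0 by simp
  qed auto
  finally show ?thesis unfolding K_def[symmetric] S_def by (simp add: distrib_left)
 qed
qed

section \<open>The divergence theorem on the cylinder\<close>

definition cyl :: "real set => ((real ^ 'n) \<times> real) measure" where
 "cyl I = restrict_space lborel (torus_cell \<times> I)"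

lemma cylinder_eq_cyl: "cylinder T = cyl {0<..<T}"
 by (simp add: cylinder_def cyl_def)

lemma cell_times_sets [measurable]:
 "I \<in> sets borel ==> torus_cell \<times> I \<in> sets (borel :: ((real ^ 'n) \<times> real) measure)"
 unfolding borel_prod[symmetric] by (rule pair_measureI[OF torus_cell_sets])

lemma space_cyl [simp]: "space (cyl I) = torus_cell \<times> I"
 by (simp add: cyl_def space_restrict_space)

lemma borel_measurable_cylI: "f \<in> borel_measurable borel ==> f \<in> borel_measurable (cyl I)"
 unfolding cyl_def by (rule measurable_restrict_space1) simp

lemma borel_measurable_cyl_subset:
 assumes "f \<in> borel_measurable (cyl I)" "K \<subseteq> I" "K \<in> sets borel" "I \<in> sets borel"
 shows "f \<in> borel_measurable (cyl K)"
proof -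
 have E: "cyl K = restrict_space (cyl I) (torus_cell \<times> K)"
  unfolding cyl_def using assms by (subst restrict_restrict_space) (auto intro!: arg_cong[of _ _ "restrict_space lborel"])
 show ?thesis unfolding E using assms(1) by (rule measurable_restrict_space1)
qed

lemma finite_measure_cyl:
 assumes "I \<in> sets borel" "bounded I"
 shows "finite_measure (cyl I :: ((real ^ 'n) \<times> real) measure)"
proof -
 obtain c where c: "I \<subseteq> {- c..c}"
  using assms(2) unfolding bounded_iff by (auto simp: subset_iff abs_le_iff) (metis minus_le_iff)
 have "torus_cell \<times> I \<subseteq> cbox (0 :: real ^ 'n, - c) ((\<chi> i. 2 * pi), c)"
  using torus_cell_subset c by (force simp: cbox_Pair_eq)
 then have "emeasure lborel ((torus_cell :: (real ^ 'n) set) \<times> I) <= emeasure lborel (cbox (0 :: real ^ 'n, - c) ((\<chi> i. 2 * pi), c))"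
  by (intro emeasure_mono) auto
 also have "... < \<infinity>" by (auto simp: emeasure_lborel_cbox_eq)
 finally show ?thesis unfolding cyl_def using assms(1) by (intro finite_measure_restrict) auto
qed

lemma nn_integral_cyl:
 fixes f :: "(real ^ 'n) \<times> real => ennreal"
 assumes [measurable]: "I \<in> sets borel" "f \<in> borel_measurable borel"
 shows "(\<integral>\<^sup>+p. f p \<partial>cyl I) = (\<integral>\<^sup>+t. (\<integral>\<^sup>+x. f (x, t) \<partial>torus) * indicator I t \<partial>lborel)"
proof -
 have [measurable]: "f \<in> borel_measurable (lborel \<Otimes>\<^sub>M lborel)"
  by (simp add: lborel_prod)
 have "(\<integral>\<^sup>+p. f p \<partial>cyl I) = (\<integral>\<^sup>+p. f p * indicator (torus_cell \<times> I) p \<partial>(lborel \<Otimes>\<^sub>M lborel))"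
  unfolding cyl_def by (subst nn_integral_restrict_space) (auto simp: lborel_prod)
 also have "... = (\<integral>\<^sup>+p. f p * (indicator torus_cell (fst p) * indicator I (snd p)) \<partial>(lborel \<Otimes>\<^sub>M lborel))"
  by (rule nn_integral_cong) (auto simp: indicator_def)
 also have "... = (\<integral>\<^sup>+t. (\<integral>\<^sup>+x. f (x, t) * (indicator torus_cell x * indicator I t) \<partial>lborel) \<partial>lborel)"
  by (subst lborel_pair.nn_integral_snd[symmetric]) auto
 also have "... = (\<integral>\<^sup>+t. (\<integral>\<^sup>+x. f (x, t) \<partial>torus) * indicator I t \<partial>lborel)"
 proof (rule nn_integral_cong)
  fix t :: real
  have "(\<integral>\<^sup>+x. f (x, t) * (indicator torus_cell x * indicator I t) \<partial>lborel)
   = (\<integral>\<^sup>+x. (f (x, t) * indicator torus_cell x) * indicator I t \<partial>lborel)" by (simp add: mult.assoc)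
  also have "... = (\<integral>\<^sup>+x. f (x, t) \<partial>torus) * indicator I t"
   unfolding nn_integral_torus by (rule nn_integral_multc) measurable
  finally show "(\<integral>\<^sup>+x. f (x, t) * (indicator torus_cell x * indicator I t) \<partial>lborel)
   = (\<integral>\<^sup>+x. f (x, t) \<partial>torus) * indicator I t" .
 qed
 finally show ?thesis .
qed

lemma integral_cyl:
 fixes f :: "(real ^ 'n) \<times> real => 'b::{banach, second_countable_topology}"
 assumes I [measurable]: "I \<in> sets borel" and f: "integrable (cyl I) f"
 shows "(\<integral>p. f p \<partial>cyl I) = (\<integral>t. indicator I t *R (\<integral>x. f (x, t) \<partial>torus) \<partial>lborel)"
  and "(\<integral>p. f p \<partial>cyl I) = (\<integral>x. (\<integral>t. indicator I t *R f (x, t) \<partial>lborel) \<partial>torus)"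
  and "integrable lborel (\<lambda>t. indicator I t *R (\<integral>x. f (x, t) \<partial>torus))"
proof -
 let ?f = "\<lambda>p. indicator torus_cell (fst p) *R indicator I (snd p) *R f p"
 have ind: "indicator (torus_cell \<times> I) p *R f p = ?f p" for p
  by (cases p) (auto simp: indicator_def)
 have int: "integrable (lborel \<Otimes>\<^sub>M lborel) ?f"
  using f unfolding cyl_def by (subst (asm) integrable_restrict_space) (auto simp: lborel_prod ind set_integrable_def)
 have eq: "(\<integral>p. f p \<partial>cyl I) = (\<integral>p. ?f p \<partial>(lborel \<Otimes>\<^sub>M lborel))"
  unfolding cyl_def by (subst integral_restrict_space) (auto simp: lborel_prod ind)
 have tor: "(\<integral>x. indicator torus_cell x *R g x \<partial>lborel) = (\<integral>x. g x \<partial>torus)" for g :: "real ^ 'n => 'b"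
  unfolding torus_def by (subst integral_restrict_space) auto
 have sec: "(\<integral>x. ?f (x, t) \<partial>lborel) = indicator I t *R (\<integral>x. f (x, t) \<partial>torus)" for t
  unfolding tor[symmetric] by (simp add: mult.commute flip: integral_scaleR_right)
 have "(\<integral>p. ?f p \<partial>(lborel \<Otimes>\<^sub>M lborel)) = (\<integral>t. (\<integral>x. ?f (x, t) \<partial>lborel) \<partial>lborel)"
  using int by (subst lborel_pair.integral_snd) (auto simp: case_prod_beta')
 also have "... = (\<integral>t. indicator I t *R (\<integral>x. f (x, t) \<partial>torus) \<partial>lborel)" unfolding sec ..
 finally show "(\<integral>p. f p \<partial>cyl I) = (\<integral>t. indicator I t *R (\<integral>x. f (x, t) \<partial>torus) \<partial>lborel)" using eq by simp
 have "integrable lborel (\<lambda>t. \<integral>x. ?f (x, t) \<partial>lborel)"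
  using lborel_pair.integrable_snd[of "\<lambda>x t. ?f (x, t)"] int by (simp add: case_prod_beta')
 then show "integrable lborel (\<lambda>t. indicator I t *R (\<integral>x. f (x, t) \<partial>torus))" unfolding sec .
 have "(\<integral>p. ?f p \<partial>(lborel \<Otimes>\<^sub>M lborel)) = (\<integral>x. (\<integral>t. ?f (x, t) \<partial>lborel) \<partial>lborel)"
  using lborel_pair.integral_fst'[OF int] by simp
 also have "... = (\<integral>x. (\<integral>t. indicator I t *R f (x, t) \<partial>lborel) \<partial>torus)"
  unfolding tor[symmetric]
  by (rule Bochner_Integration.integral_cong[OF refl]) (simp flip: integral_scaleR_right)
 finally show "(\<integral>p. f p \<partial>cyl I) = (\<integral>x. (\<integral>t. indicator I t *R f (x, t) \<partial>lborel) \<partial>torus)" using eq by simp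
qed

lemma integrable_cyl_continuous:
 fixes f :: "(real ^ 'n) \<times> real => 'b::{banach, second_countable_topology}"
 assumes "continuous_on (UNIV \<times> {c..d}) f"
 shows "integrable (cyl {c..d}) f"
proof -
 let ?K = "cbox (0 :: real ^ 'n) (\<chi> i. 2 * pi) \<times> {c..d}"
 have "integrable lborel (\<lambda>p. indicator ?K p *R f p)"
  by (intro borel_integrable_compact compact_Times continuous_on_subset[OF assms]) auto
 then have "set_integrable lborel (torus_cell \<times> {c..d}) f"
  using torus_cell_subset unfolding set_integrable_def[symmetric]
  by (elim set_integrable_subset) auto
 then show ?thesis unfolding cyl_def set_integrable_def by (subst integrable_restrict_space) auto
qed

text \<open>The divergence theorem on torus times a compact interval.\<close>

lemma integral_cyl_space_partial:
 fixes f g :: "(real ^ 'n) \<times> real => real" and i :: 'n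
 assumes per: "\<And>t. t \<in> {c..d} ==> torus_periodic (\<lambda>x. f (x, t))" "\<And>t. t \<in> {c..d} ==> torus_periodic (\<lambda>x. g (x, t))"
  and f: "\<And>x t. t \<in> {c..d} ==> has_partial f (g (x, t)) (axis i 1, 0) (x, t)"
  and g: "continuous_on (UNIV \<times> {c..d}) g"
 shows "(\<integral>p. g p \<partial>cyl {c..d}) = 0"
proof -
 have "(\<integral>x. g (x, t) \<partial>torus) = 0" if t: "t \<in> {c..d}" for t
 proof (rule integral_torus_partial[where f = "\<lambda>x. f (x, t)" and i = i])
  show "has_partial (\<lambda>x. f (x, t)) (g (x, t)) (axis i 1) x" for x
   using f[OF t, of x] by (simp add: has_partial_def)
  show "continuous_on UNIV (\<lambda>x. g (x, t))"
   by (rule continuous_on_compose2[OF g]) (use t in \<open>auto intro!: continuous_intros\<close>)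
 qed (use per t in auto)
 then have "(\<lambda>t. indicator {c..d} t *R (\<integral>x. g (x, t) \<partial>torus)) = (\<lambda>t. 0)"
  by (auto simp: indicator_def fun_eq_iff)
 then show ?thesis by (simp add: integral_cyl(1)[OF _ integrable_cyl_continuous[OF g]])
qed

lemma integral_cyl_time_partial:
 fixes f g :: "(real ^ 'n) \<times> real => real"
 assumes f: "\<And>x t. t \<in> {c..d} ==> has_partial f (g (x, t)) (0, 1) (x, t)" and cd: "c <= d"
  and g: "continuous_on (UNIV \<times> {c..d}) g"
 shows "(\<integral>p. g p \<partial>cyl {c..d}) = (\<integral>x. f (x, d) - f (x, c) \<partial>torus)"
proof -
 have "(\<integral>t. indicator {c..d} t *R g (x, t) \<partial>lborel) = f (x, d) - f (x, c)" for x
 proof (rule integral_FTC_atLeastAtMost[OF cd])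
  fix t assume "c <= t" "t <= d"
  then have "has_partial f (g (x, t)) (0, 1) ((x, 0) + t *R (0, 1))" using f[of t x] by simp
  from has_partial_along_line[OF this] show "((\<lambda>t. f (x, t)) has_vector_derivative g (x, t)) (at t within {c..d})"
   by simp
 next
  show "continuous_on {c..d} (\<lambda>t. g (x, t))"
   by (rule continuous_on_compose2[OF g]) (auto intro!: continuous_intros)
 qed
 then show ?thesis by (simp add: integral_cyl(2)[OF _ integrable_cyl_continuous[OF g]])
qed

text \<open>
  A pointwise inequality up to a divergence integrates to an inequality without it, if the time
  component of the divergence vanishes at both ends. The divergence may fail to be integrable up to
  the ends, so that one integrates over compact subintervals first.
\<close>

lemma nn_integral_cyl_mono_divergence:
 fixes f g D0 :: "(real ^ 'n) \<times> real => real" and X dX :: "'n => (real ^ 'n) \<times> real => real"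
  and Y dY :: "(real ^ 'n) \<times> real => real" and \<beta> :: "real => real"
 assumes ab: "a < b"
  and f: "f \<in> borel_measurable (cyl {a<..<b})" "\<And>x t. t \<in> {a<..<b} ==> 0 <= f (x, t)"
  and g: "g \<in> borel_measurable (cyl {a<..<b})" "\<And>x t. t \<in> {a<..<b} ==> 0 <= g (x, t)"
  and per: "\<And>i t. t \<in> {a<..<b} ==> torus_periodic (\<lambda>x. X i (x, t))"
   "\<And>i t. t \<in> {a<..<b} ==> torus_periodic (\<lambda>x. dX i (x, t))"
  and X: "\<And>i x t. t \<in> {a<..<b} ==> has_partial (X i) (dX i (x, t)) (axis i 1, 0) (x, t)"
   "\<And>i. continuous_on (UNIV \<times> {a<..<b}) (dX i)"
  and Y: "\<And>x t. t \<in> {a<..<b} ==> has_partial Y (dY (x, t)) (0, 1) (x, t)"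
   "continuous_on (UNIV \<times> {a<..<b}) dY"
  and \<beta>: "\<And>x t. x \<in> torus_cell ==> t \<in> {a<..<b} ==> \<bar>Y (x, t)\<bar> <= \<beta> t"
   "(\<beta> \<longlongrightarrow> 0) (at_right a)" "(\<beta> \<longlongrightarrow> 0) (at_left b)"
  and le: "\<And>x t. t \<in> {a<..<b} ==> f (x, t) <= g (x, t) + (\<Sum>i\<in>UNIV. dX i (x, t)) + dY (x, t)"
 shows "(\<integral>\<^sup>+p. ennreal (f p) \<partial>cyl {a<..<b}) <= (\<integral>\<^sup>+p. ennreal (g p) \<partial>cyl {a<..<b})"
proof -
 define D where "D p = (\<Sum>i\<in>UNIV. dX i p) + dY p" for p
 define m where "m = measure (torus :: (real ^ 'n) measure) torus_cell"
 have compact: "(\<integral>\<^sup>+p. ennreal (f p) \<partial>cyl {c..d}) <= (\<integral>\<^sup>+p. ennreal (g p) \<partial>cyl {a<..<b}) + ennreal (m * (\<beta> c + \<beta> d))"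
  if cd: "a < c" "c <= d" "d < b" for c d
 proof -
  have sub: "{c..d} \<subseteq> {a<..<b}" using cd by auto
  have fm: "f \<in> borel_measurable (cyl {c..d})" "g \<in> borel_measurable (cyl {c..d})"
   using borel_measurable_cyl_subset[OF f(1) sub] borel_measurable_cyl_subset[OF g(1) sub] by auto
  have cX: "continuous_on (UNIV \<times> {c..d}) (dX i)" for i
   by (rule continuous_on_subset[OF X(2)]) (use sub in auto)
  have cY: "continuous_on (UNIV \<times> {c..d}) dY"
   by (rule continuous_on_subset[OF Y(2)]) (use sub in auto)
  have iX: "integrable (cyl {c..d}) (dX i)" and iY: "integrable (cyl {c..d}) dY" for i
   by (rule integrable_cyl_continuous[OF cX], rule integrable_cyl_continuous[OF cY])
  have iD: "integrable (cyl {c..d}) D" unfolding D_def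
   by (intro Bochner_Integration.integrable_add Bochner_Integration.integrable_sum iX iY)
  have z: "(\<integral>p. dX i p \<partial>cyl {c..d}) = 0" for i
   by (rule integral_cyl_space_partial[where f = "X i", OF per X(1) cX]) (use sub in auto)
  have "(\<integral>p. D p \<partial>cyl {c..d}) = (\<Sum>i\<in>UNIV. \<integral>p. dX i p \<partial>cyl {c..d}) + (\<integral>p. dY p \<partial>cyl {c..d})"
   unfolding D_def using iX iY by simp
  also have "(\<integral>p. dY p \<partial>cyl {c..d}) = (\<integral>x. Y (x, d) - Y (x, c) \<partial>torus)"
   by (rule integral_cyl_time_partial[OF Y(1) cd(2) cY]) (use sub in auto)
  finally have D: "(\<integral>p. D p \<partial>cyl {c..d}) = (\<integral>x. Y (x, d) - Y (x, c) \<partial>torus)" by (simp add: z)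
  have \<beta>0: "\<beta> c >= 0" "\<beta> d >= 0"
  proof -
   have "(0 :: real ^ 'n) \<in> torus_cell" by (simp add: torus_cell_def)
   then show "\<beta> c >= 0" "\<beta> d >= 0" using \<beta>(1)[of 0 c] \<beta>(1)[of 0 d] cd by fastforce+
  qed
  have DB: "(\<integral>p. D p \<partial>cyl {c..d}) <= m * (\<beta> c + \<beta> d)"
  proof -
   have "(\<integral>x. Y (x, d) - Y (x, c) \<partial>torus) <= (\<integral>x. \<beta> c + \<beta> d \<partial>(torus :: (real ^ 'n) measure))"
   proof (rule integral_mono_AE')
    show "AE x in torus. Y (x, d) - Y (x, c) <= \<beta> c + \<beta> d"
    proof (rule AE_I2)
     fix x :: "real ^ 'n" assume "x \<in> space torus"
     then show "Y (x, d) - Y (x, c) <= \<beta> c + \<beta> d" using \<beta>(1)[of x c] \<beta>(1)[of x d] cd by fastforce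
    qed
    show "AE x in torus. 0 <= \<beta> c + \<beta> d" using \<beta>0 by simp
   qed simp
   also have "... = m * (\<beta> c + \<beta> d)" by (simp add: m_def)
   finally show ?thesis using D by simp
  qed
  have sp: "p \<in> space (cyl {c..d}) ==> snd p \<in> {a<..<b}" for p using sub by (auto simp: subset_iff)
  define Dp Dm where "Dp p = max 0 (D p)" and "Dm p = max 0 (- D p)" for p
  have iDp: "integrable (cyl {c..d}) Dp" "integrable (cyl {c..d}) Dm" unfolding Dp_def Dm_def using iD by auto
  have Dm: "Dp p - Dm p = D p" for p by (auto simp: Dp_def Dm_def)
  have "(\<integral>\<^sup>+p. ennreal (f p) \<partial>cyl {c..d}) + (\<integral>\<^sup>+p. ennreal (Dm p) \<partial>cyl {c..d})
   = (\<integral>\<^sup>+p. ennreal (f p) + ennreal (Dm p) \<partial>cyl {c..d})"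
   using fm iDp by (intro nn_integral_add[symmetric]) auto
  also have "... <= (\<integral>\<^sup>+p. ennreal (g p) + ennreal (Dp p) \<partial>cyl {c..d})"
  proof (rule nn_integral_mono)
   fix p assume "p \<in> space (cyl {c..d} :: ((real ^ 'n) \<times> real) measure)"
   then obtain x t where p: "p = (x, t)" "t \<in> {a<..<b}" using sp[of p] by (cases p) auto
   have "f p + Dm p <= g p + Dp p" using le[OF p(2), of x] unfolding p D_def Dm_def Dp_def by auto
   then show "ennreal (f p) + ennreal (Dm p) <= ennreal (g p) + ennreal (Dp p)"
    using f(2)[OF p(2), of x] g(2)[OF p(2), of x] unfolding p by (simp add: Dm_def Dp_def flip: ennreal_plus)
  qed
  also have "... = (\<integral>\<^sup>+p. ennreal (g p) \<partial>cyl {c..d}) + (\<integral>\<^sup>+p. ennreal (Dp p) \<partial>cyl {c..d})"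
   using fm iDp by (intro nn_integral_add) auto
  also have "(\<integral>\<^sup>+p. ennreal (Dp p) \<partial>cyl {c..d}) = ennreal (\<integral>p. Dp p \<partial>cyl {c..d})"
   by (rule nn_integral_eq_integral[OF iDp(1)]) (simp add: Dp_def)
  also have "(\<integral>p. Dp p \<partial>cyl {c..d}) = (\<integral>p. D p \<partial>cyl {c..d}) + (\<integral>p. Dm p \<partial>cyl {c..d})"
   using Bochner_Integration.integral_diff[OF iDp] by (simp add: Dm)
  also have "ennreal ... <= ennreal (m * (\<beta> c + \<beta> d) + (\<integral>p. Dm p \<partial>cyl {c..d}))"
   using DB by (intro ennreal_leI) simp
  also have "... = ennreal (m * (\<beta> c + \<beta> d)) + ennreal (\<integral>p. Dm p \<partial>cyl {c..d})"
   using \<beta>0 by (intro ennreal_plus) (auto simp: m_def Dm_def)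
  also have "ennreal (\<integral>p. Dm p \<partial>cyl {c..d}) = (\<integral>\<^sup>+p. ennreal (Dm p) \<partial>cyl {c..d})"
   by (rule nn_integral_eq_integral[OF iDp(2), symmetric]) (simp add: Dm_def)
  finally have le1: "(\<integral>\<^sup>+p. ennreal (f p) \<partial>cyl {c..d}) + (\<integral>\<^sup>+p. ennreal (Dm p) \<partial>cyl {c..d})
   <= (\<integral>\<^sup>+p. ennreal (g p) \<partial>cyl {c..d}) + (ennreal (m * (\<beta> c + \<beta> d)) + (\<integral>\<^sup>+p. ennreal (Dm p) \<partial>cyl {c..d}))"
   by (simp add: add_left_mono)
  have fin: "(\<integral>\<^sup>+p. ennreal (Dm p) \<partial>cyl {c..d}) < \<infinity>"
   by (subst nn_integral_eq_integral[OF iDp(2)]) (simp_all add: Dm_def)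
  have "(\<integral>\<^sup>+p. ennreal (f p) \<partial>cyl {c..d}) <= (\<integral>\<^sup>+p. ennreal (g p) \<partial>cyl {c..d}) + ennreal (m * (\<beta> c + \<beta> d))"
  proof -
   let ?M = "\<integral>\<^sup>+p. ennreal (Dm p) \<partial>cyl {c..d}"
   have "?M + (\<integral>\<^sup>+p. ennreal (f p) \<partial>cyl {c..d})
    <= ?M + ((\<integral>\<^sup>+p. ennreal (g p) \<partial>cyl {c..d}) + ennreal (m * (\<beta> c + \<beta> d)))"
    using le1 by (simp only: add_ac)
   then show ?thesis using fin by (auto simp: ennreal_add_left_cancel_le)
  qed
  also have "(\<integral>\<^sup>+p. ennreal (g p) \<partial>cyl {c..d}) <= (\<integral>\<^sup>+p. ennreal (g p) \<partial>cyl {a<..<b})"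
   unfolding cyl_def using sub
   by (subst (1 2) nn_integral_restrict_space) (auto intro!: nn_integral_mono simp: indicator_def)
  finally show ?thesis by (simp add: add_right_mono)
 qed
 define c d where "c n = a + (b - a) / (real n + 3)" and "d n = b - (b - a) / (real n + 3)" for n :: nat
 have small: "0 < (b - a) / (real n + 3)" "(b - a) / (real n + 3) <= (b - a) / 3" for n
 proof -
  show "0 < (b - a) / (real n + 3)" using ab by simp
  show "(b - a) / (real n + 3) <= (b - a) / 3" using ab by (intro divide_left_mono) simp_all
 qed
 have cd: "a < c n" "c n <= d n" "d n < b" for n
 proof -
  define e where "e = (b - a) / (real n + 3)"
  have "0 < e" "e <= (b - a) / 3" using small[of n] by (simp_all add: e_def)
  then show "a < c n" "c n <= d n" "d n < b" unfolding c_def d_def e_def[symmetric] using ab by auto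
 qed
 have lim: "(\<lambda>n. (b - a) / (real n + 3)) \<longlonglongrightarrow> 0" by real_asymp
 have cl: "filterlim c (at_right a) sequentially"
  unfolding filterlim_at using cd tendsto_add[OF tendsto_const[of a] lim]
  by (auto simp: c_def[abs_def] greaterThan_def intro!: always_eventually)
 have dl: "filterlim d (at_left b) sequentially"
  unfolding filterlim_at using cd tendsto_diff[OF tendsto_const[of b] lim]
  by (auto simp: d_def[abs_def] lessThan_def intro!: always_eventually)
 have bl: "(\<lambda>n. m * (\<beta> (c n) + \<beta> (d n))) \<longlonglongrightarrow> 0"
  using tendsto_mult[OF tendsto_const[of m] tendsto_add[OF filterlim_compose[OF \<beta>(2) cl] filterlim_compose[OF \<beta>(3) dl]]]
  by simp
 define F where "F p = ennreal (f p) * indicator (torus_cell \<times> {a<..<b}) p" for p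
 define Fn where "Fn n p = F p * indicator (torus_cell \<times> {c n..d n}) p" for n p
 have Fm: "F \<in> borel_measurable borel"
  using f(1) borel_measurable_restrict_space_iff_ennreal[of "torus_cell \<times> {a<..<b}" lborel "\<lambda>p. ennreal (f p)"]
  unfolding F_def cyl_def by simp
 have Fnm: "Fn n \<in> borel_measurable lborel" for n unfolding Fn_def using Fm by measurable
 have Fn: "(\<integral>\<^sup>+p. Fn n p \<partial>lborel) <= (\<integral>\<^sup>+p. ennreal (g p) \<partial>cyl {a<..<b}) + ennreal (m * (\<beta> (c n) + \<beta> (d n)))" for n
 proof -
  have "(\<integral>\<^sup>+p. Fn n p \<partial>lborel) = (\<integral>\<^sup>+p. ennreal (f p) \<partial>cyl {c n..d n})"
   unfolding cyl_def using cd[of n]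
   by (subst nn_integral_restrict_space) (auto intro!: nn_integral_cong simp: Fn_def F_def indicator_def)
  then show ?thesis using compact[OF cd] by simp
 qed
 have "(\<integral>\<^sup>+p. ennreal (f p) \<partial>cyl {a<..<b}) = (\<integral>\<^sup>+p. F p \<partial>lborel)"
  unfolding cyl_def by (subst nn_integral_restrict_space) (auto simp: F_def[abs_def])
 also have "... = (\<integral>\<^sup>+p. liminf (\<lambda>n. Fn n p) \<partial>lborel)"
 proof (rule nn_integral_cong)
  fix p :: "(real ^ 'n) \<times> real"
  have "\<forall>\<^sub>F n in sequentially. Fn n p = F p"
  proof (cases "snd p \<in> {a<..<b}")
   case True
   have "c \<longlonglongrightarrow> a" "d \<longlonglongrightarrow> b" using cl dl by (auto simp: filterlim_at)
   then have "\<forall>\<^sub>F n in sequentially. c n < snd p" "\<forall>\<^sub>F n in sequentially. snd p < d n"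
    using True by (auto simp: order_tendsto_iff)
   then show ?thesis
    by eventually_elim (cases p, auto simp: Fn_def F_def indicator_def)
  next
   case False
   then show ?thesis by (cases p) (auto simp: Fn_def F_def)
  qed
  then have "(\<lambda>n. Fn n p) \<longlonglongrightarrow> F p" by (rule tendsto_eventually)
  then show "F p = liminf (\<lambda>n. Fn n p)" by (simp add: lim_imp_Liminf)
 qed
 also have "... <= liminf (\<lambda>n. \<integral>\<^sup>+p. Fn n p \<partial>lborel)" by (rule nn_integral_liminf[OF Fnm])
 also have "... <= liminf (\<lambda>n. (\<integral>\<^sup>+p. ennreal (g p) \<partial>cyl {a<..<b}) + ennreal (m * (\<beta> (c n) + \<beta> (d n))))"
  using Fn by (intro Liminf_mono always_eventually) auto
 also have "... = (\<integral>\<^sup>+p. ennreal (g p) \<partial>cyl {a<..<b}) + ennreal 0"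
  by (intro lim_imp_Liminf tendsto_add tendsto_const tendsto_ennrealI bl) simp
 finally show ?thesis by simp
qed

section \<open>Fluxes of the commutator\<close>

lemma has_partial_value: "has_partial f d v p ==> d = e ==> has_partial f e v p"
 by simp

text \<open>
  The fluxes of the commutator identity, as functions of the point.
\<close>

definition flux_space ::
  "real => real => ('b => 'b) => ('a => 'b::real_inner) => ('n::finite => 'a => 'b) => ('a => 'b) => ('n => 'a => real) =>
  ('a => real) => ('a => real) => 'n => 'a => real" where
 "flux_space p r J w wi wt b L lt i = (\<lambda>z. - 2 * (wi i z \<bullet> (\<Sum>j\<in>UNIV. b j z *R wi j z))
  + b i z * (\<Sum>j\<in>UNIV. wi j z \<bullet> wi j z) - L z * (wi i z \<bullet> w z) + p * (wi i z \<bullet> wt z)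
  - r * (lt z * (wi i z \<bullet> J (w z))) - (\<Sum>j\<in>UNIV. b j z * b j z) * (b i z * (w z \<bullet> w z))
  + r * (b i z * (J (w z) \<bullet> wt z)) + p * (lt z * (b i z * (w z \<bullet> w z))))"

definition flux_time ::
  "real => real => ('b => 'b) => ('a => 'b::real_inner) => ('n::finite => 'a => 'b) => ('n => 'a => real) =>
  ('a => real) => 'a => real" where
 "flux_time p r J w wi b lt = (\<lambda>z. - (p / 2) * (\<Sum>i\<in>UNIV. wi i z \<bullet> wi i z)
  + p / 2 * ((\<Sum>i\<in>UNIV. b i z * b i z) * (w z \<bullet> w z))
  - r * (J (w z) \<bullet> (\<Sum>j\<in>UNIV. b j z *R wi j z)) - (r^2 + p^2) / 2 * (lt z * (w z \<bullet> w z)))"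

lemma has_partial_cmult: "has_partial f d v z ==> has_partial (\<lambda>x. (c::real) * f x) (c * d) v z"
 using has_partial_mult[OF has_partial_const] by force

lemma has_partial_flux_space:
 fixes w wt :: "'a::real_normed_vector => 'b::real_inner" and wi :: "'n::finite => 'a => 'b"
 assumes J: "bounded_linear J"
  and w: "has_partial w (wi i z) v z" "\<And>j. has_partial (wi j) (wij j) v z" "has_partial wt wti v z"
  and b: "\<And>j. has_partial (b j) (H j) v z" "has_partial L Li v z" "has_partial lt bt v z"
 shows "has_partial (flux_space p r J w wi wt b L lt i)
   (flux_space_deriv p r J (w z) (wt z) (lt z) (L z) (\<Sum>j\<in>UNIV. b j z * b j z) (\<Sum>j\<in>UNIV. b j z *R wi j z)
    (\<Sum>j\<in>UNIV. wi j z \<bullet> wi j z) (\<lambda>j. wi j z) (\<lambda>j. b j z) bt Li wti wij H i) v z"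
proof -
 note Jw = has_partial_linear[OF J w(1)]
 have Wb: "has_partial (\<lambda>z. \<Sum>j\<in>UNIV. b j z *R wi j z) (\<Sum>j\<in>UNIV. H j *R wi j z + b j z *R wij j) v z"
  by (rule has_partial_value[OF has_partial_sum[OF has_partial_scaleR[OF b(1) w(2)]]]) (simp add: add.commute)
 have G: "has_partial (\<lambda>z. \<Sum>j\<in>UNIV. wi j z \<bullet> wi j z) (\<Sum>j\<in>UNIV. 2 * (wij j \<bullet> wi j z)) v z"
  by (rule has_partial_value[OF has_partial_sum[OF has_partial_inner[OF w(2) w(2)]]]) (simp add: inner_commute)
 have B: "has_partial (\<lambda>z. \<Sum>j\<in>UNIV. b j z * b j z) (\<Sum>j\<in>UNIV. 2 * (b j z * H j)) v z"
  by (rule has_partial_value[OF has_partial_sum[OF has_partial_mult[OF b(1) b(1)]]]) (simp add: mult.commute)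
 have ww: "has_partial (\<lambda>z. w z \<bullet> w z) (2 * (wi i z \<bullet> w z)) v z"
  by (rule has_partial_value[OF has_partial_inner[OF w(1) w(1)]]) (simp add: inner_commute)
 note bww = has_partial_mult[OF b(1)[of i] ww]
 show ?thesis unfolding flux_space_def
  by (rule has_partial_value[OF has_partial_add[OF has_partial_add[OF has_partial_diff[OF has_partial_diff[OF
     has_partial_add[OF has_partial_diff[OF has_partial_add[OF
      has_partial_cmult[OF has_partial_inner[OF w(2)[of i] Wb], of "- 2"]
      has_partial_mult[OF b(1)[of i] G]]
      has_partial_mult[OF b(2) has_partial_inner[OF w(2)[of i] w(1)]]]
      has_partial_cmult[OF has_partial_inner[OF w(2)[of i] w(3)]]]
      has_partial_cmult[OF has_partial_mult[OF b(3) has_partial_inner[OF w(2)[of i] Jw]]]]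
      has_partial_mult[OF B bww]]
      has_partial_cmult[OF has_partial_mult[OF b(1)[of i] has_partial_inner[OF Jw w(3)]]]]
      has_partial_cmult[OF has_partial_mult[OF b(3) bww]]]])
   (simp add: algebra_simps)
qed

lemma has_partial_flux_time:
 fixes w wt :: "'a::real_normed_vector => 'b::real_inner" and wi :: "'n::finite => 'a => 'b"
 assumes J: "bounded_linear J"
  and w: "has_partial w (wt z) v z" "\<And>j. has_partial (wi j) (wti j) v z"
  and b: "\<And>j. has_partial (b j) (bt j) v z" "has_partial lt ltt v z"
 shows "has_partial (flux_time p r J w wi b lt)
   (flux_time_deriv p r J (w z) (wt z) (lt z) ltt (\<Sum>i\<in>UNIV. b i z * b i z) (\<Sum>j\<in>UNIV. b j z *R wi j z) (\<lambda>i. b i z) bt (\<lambda>i. wi i z) wti) v z"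
proof -
 note Jw = has_partial_linear[OF J w(1)]
 have Wb: "has_partial (\<lambda>z. \<Sum>j\<in>UNIV. b j z *R wi j z) (\<Sum>i\<in>UNIV. bt i *R wi i z + b i z *R wti i) v z"
  by (rule has_partial_value[OF has_partial_sum[OF has_partial_scaleR[OF b(1) w(2)]]]) (simp add: add.commute)
 have G: "has_partial (\<lambda>z. \<Sum>j\<in>UNIV. wi j z \<bullet> wi j z) (2 * (\<Sum>j\<in>UNIV. wi j z \<bullet> wti j)) v z"
  by (rule has_partial_value[OF has_partial_sum[OF has_partial_inner[OF w(2) w(2)]]])
   (simp add: inner_commute sum_distrib_left)
 have B: "has_partial (\<lambda>z. \<Sum>j\<in>UNIV. b j z * b j z) (\<Sum>j\<in>UNIV. 2 * (b j z * bt j)) v z"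
  by (rule has_partial_value[OF has_partial_sum[OF has_partial_mult[OF b(1) b(1)]]]) (simp add: mult.commute)
 have ww: "has_partial (\<lambda>z. w z \<bullet> w z) (2 * (wt z \<bullet> w z)) v z"
  by (rule has_partial_value[OF has_partial_inner[OF w(1) w(1)]]) (simp add: inner_commute)
 show ?thesis unfolding flux_time_def
  by (rule has_partial_value[OF has_partial_diff[OF has_partial_diff[OF has_partial_add[OF
      has_partial_cmult[OF G] has_partial_cmult[OF has_partial_mult[OF B ww]]]
      has_partial_cmult[OF has_partial_inner[OF Jw Wb]]]
      has_partial_cmult[OF has_partial_mult[OF b(2) ww]]]])
   (simp add: algebra_simps)
qed

lemma torus_periodic_dir_deriv:
 fixes f :: "real ^ 'n => 'b::real_normed_vector"
 assumes "torus_periodic f" "\<And>x. f differentiable (at x)"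
 shows "torus_periodic (dir_deriv v f)"
 unfolding torus_periodic_def
proof (intro allI)
 fix x :: "real ^ 'n" and i :: 'n
 let ?u = "axis i (2 * pi) :: real ^ 'n"
 have D: "(f has_derivative frechet_derivative f (at (x + ?u))) (at (x + ?u))"
  using assms(2) by (simp add: frechet_derivative_works)
 have "((\<lambda>y. f (y + ?u)) has_derivative frechet_derivative f (at (x + ?u))) (at x)"
  by (rule has_derivative_compose[of "\<lambda>y. y + ?u" "\<lambda>h. h" x UNIV f, OF _ D]) (auto intro!: derivative_eq_intros)
 moreover have "(\<lambda>y. f (y + ?u)) = f" using assms(1) by (auto simp: torus_periodic_def)
 ultimately show "dir_deriv v f (x + ?u) = dir_deriv v f x"
  using has_derivative_imp_dir_deriv[of f "frechet_derivative f (at (x + ?u))" x v] by (simp add: dir_deriv_def)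
qed

lemma has_partial_unique: "has_partial f d v p ==> has_partial f e v p ==> d = e"
 unfolding has_partial_def by (rule vector_derivative_unique_at)

lemma torus_periodic_partial:
 fixes f :: "(real ^ 'n) \<times> real => 'b::real_normed_vector"
 assumes "\<And>t. torus_periodic (\<lambda>x. f (x, t))" "\<And>x. f differentiable (at x)"
 shows "torus_periodic (\<lambda>x. dir_deriv v f (x, t))"
 unfolding torus_periodic_def
proof (intro allI)
 fix x :: "real ^ 'n" and i :: 'n
 let ?u = "(axis i (2 * pi) :: real ^ 'n, 0 :: real)"
 have "has_partial f (dir_deriv v f ((x, t) + ?u)) v ((x, t) + ?u)" by (intro has_partial_dir_deriv assms)
 moreover have "f ((x, t) + ?u + h *R v) = f ((x, t) + h *R v)" for h
  using assms(1)[of "t + h * snd v", unfolded torus_periodic_def, rule_format, of "x + h *R fst v" i]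
  by (cases v) (simp add: algebra_simps)
 ultimately have "has_partial f (dir_deriv v f ((x, t) + ?u)) v (x, t)" by (simp add: has_partial_def)
 then show "dir_deriv v f (x + axis i (2 * pi), t) = dir_deriv v f (x, t)"
  using has_partial_unique[OF _ has_partial_dir_deriv[OF assms(2)]] by fastforce
qed

lemma has_partial_space:
 assumes "has_partial (\<lambda>x. f (x, snd z)) d u (fst z)"
 shows "has_partial f d (u, 0) z"
 using assms by (cases z) (simp add: has_partial_def)

lemma has_partial_time:
 fixes f :: "'a::real_normed_vector \<times> real => real"
 assumes "((\<lambda>t. f (fst z, t)) has_real_derivative d) (at (snd z))"
 shows "has_partial f d (0, 1) z"
proof -
 obtain x t where z: "z = (x, t)" by (cases z)
 have "((\<lambda>t. f (x, t)) has_real_derivative d) (at (t + 0))" using assms z by simp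
 then have "((\<lambda>h. f (x, t + h)) has_real_derivative d) (at 0)"
  using DERIV_shift[of "\<lambda>t. f (x, t)" d 0 t] by (simp add: add.commute)
 then show ?thesis by (simp add: has_partial_def z has_real_derivative_iff_has_vector_derivative)
qed

lemma has_partial_exp_scaleR:
 fixes f :: "'a::real_normed_vector => real"
 assumes "has_partial f d v z" "has_partial u e v z"
 shows "has_partial (\<lambda>z. exp (f z) *R u z) (exp (f z) *R (e + d *R u z)) v z"
 by (rule has_partial_value[OF has_partial_scaleR[OF has_partial_chain[OF DERIV_exp assms(1)] assms(2)]])
  (simp add: algebra_simps)

section \<open>The weight\<close>

locale carleman_weights =
 fixes \<eta> :: "real ^ 'n => real" and l s a b :: real
 assumes smooth: "C_k 4 \<eta>" and periodic: "torus_periodic \<eta>" and ab: "a < b"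
begin

text \<open>
  Derivatives of \<open>\<eta>\<close>: \<open>e\<close> gradient, \<open>ee\<close> Hessian, \<open>De\<close> Laplacian, \<open>dl\<close> its gradient, \<open>E\<close> the square of the gradient.
  In terms of the Carleman weights, \<open>X\<close> is \<open>s \<xi>\<close> and \<open>ell\<close> is \<open>- s \<phi>\<close>; of the latter, \<open>bb\<close> is the gradient, \<open>H\<close> the
  Hessian, \<open>L\<close> the Laplacian and \<open>Li\<close> its gradient; \<open>lt\<close>, \<open>ltt\<close> and \<open>bt\<close> are the time derivatives of \<open>ell\<close>, \<open>lt\<close>
 and \<open>bb\<close>, and \<open>yy\<close> that of \<open>X\<close>.
\<close>

definition "e i = dir_deriv (axis i 1) \<eta>" for i
definition "ee i j = dir_deriv (axis j 1) (e i)" for i j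
definition "De x = (\<Sum>i\<in>UNIV. ee i i x)" for x
definition "dl i = dir_deriv (axis i 1) De" for i
definition "E x = (\<Sum>i\<in>UNIV. e i x * e i x)" for x
definition "th t = (t - a) * (b - t)" for t
definition "M0 = exp (2 * l * sup_norm \<eta>)"
definition "X z = s * (exp (l * \<eta> (fst z)) / th (snd z))" for z
definition "ell z = - (s * ((M0 - exp (l * \<eta> (fst z))) / th (snd z)))" for z
definition "bb i z = l * X z * e i (fst z)" for i z
definition "H i j z = l^2 * X z * e i (fst z) * e j (fst z) + l * X z * ee i j (fst z)" for i j z
definition "L z = (\<Sum>i\<in>UNIV. H i i z)" for z
definition "Li i z = l ^ 3 * X z * e i (fst z) * E (fst z) + 2 * l^2 * X z * (\<Sum>j\<in>UNIV. e j (fst z) * ee i j (fst z))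
  + l^2 * X z * e i (fst z) * De (fst z) + l * X z * dl i (fst z)" for i z
definition "yy z = - X z * (a + b - 2 * snd z) / th (snd z)" for z
definition "lt z = s * (M0 - exp (l * \<eta> (fst z))) * (a + b - 2 * snd z) / (th (snd z))\<^sup>2" for z
definition "ltt z = s * (M0 - exp (l * \<eta> (fst z))) * (- 2 / (th (snd z))\<^sup>2 - 2 * (a + b - 2 * snd z)\<^sup>2 / (th (snd z)) ^ 3)" for z
definition "bt i z = l * yy z * e i (fst z)" for i z

lemma th_pos: "t \<in> {a<..<b} ==> th t > 0"
 by (simp add: th_def)

lemma C_k_e: "C_k 3 (e i)" and C_k_ee: "C_k 2 (ee i j)" and C_k_De: "C_k 2 De" and C_k_dl: "C_k 1 (dl i)"
proof -
 show e: "C_k 3 (e i)" for i unfolding e_def using smooth by (simp add: numeral_eq_Suc)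
 show ee: "C_k 2 (ee i j)" for i j unfolding ee_def using e[of i] by (simp add: numeral_eq_Suc)
 show De: "C_k 2 De" unfolding De_def[abs_def] by (intro C_k_sum ee)
 show "C_k 1 (dl i)" unfolding dl_def using De by (simp add: numeral_eq_Suc)
qed

lemma ee_sym: "ee i j x = ee j i x"
 unfolding ee_def e_def by (rule dir_deriv_commute) (rule C_k_mono[OF smooth], simp)

lemma periodic_coefficients:
 "torus_periodic (e i)" "torus_periodic (ee i j)" "torus_periodic De" "torus_periodic (dl i)"
proof -
 show e: "torus_periodic (e i)" for i unfolding e_def
  by (intro torus_periodic_dir_deriv periodic C_k_differentiable[OF smooth]) simp
 show ee: "torus_periodic (ee i j)" for i j unfolding ee_def
  by (intro torus_periodic_dir_deriv e C_k_differentiable[OF C_k_e]) simp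
 show De: "torus_periodic De"
  using ee unfolding De_def[abs_def] torus_periodic_def by simp
 show "torus_periodic (dl i)" unfolding dl_def
  by (intro torus_periodic_dir_deriv De C_k_differentiable[OF C_k_De]) simp
qed

lemma partial_eta: "has_partial \<eta> (e i x) (axis i 1) x"
 unfolding e_def by (intro has_partial_dir_deriv C_k_differentiable[OF smooth]) simp
lemma partial_e: "has_partial (e i) (ee i j x) (axis j 1) x"
 unfolding ee_def by (intro has_partial_dir_deriv C_k_differentiable[OF C_k_e]) simp
lemma partial_De: "has_partial De (dl i x) (axis i 1) x"
 unfolding dl_def by (intro has_partial_dir_deriv C_k_differentiable[OF C_k_De]) simp
lemma partial_E: "has_partial E (2 * (\<Sum>j\<in>UNIV. e j x * ee i j x)) (axis i 1) x"
 unfolding E_def[abs_def]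
 by (rule has_partial_value[OF has_partial_sum[OF has_partial_mult[OF partial_e partial_e]]])
  (simp add: sum_distrib_left ee_sym[of i] mult.commute)

lemma L_eq: "L z = l^2 * X z * E (fst z) + l * X z * De (fst z)"
 unfolding L_def H_def E_def De_def by (simp add: sum.distrib sum_distrib_left mult_ac)

lemma partial_exp_eta: "has_partial (\<lambda>x. exp (l * \<eta> x)) (exp (l * \<eta> x) * (l * e i x)) (axis i 1) x"
 by (rule has_partial_chain[OF DERIV_exp has_partial_cmult[OF partial_eta]])

lemma partial_X: "has_partial X (l * X z * e i (fst z)) (axis i 1, 0) z"
proof (rule has_partial_space)
 have "has_partial (\<lambda>x. s / th (snd z) * exp (l * \<eta> x)) (s / th (snd z) * (exp (l * \<eta> (fst z)) * (l * e i (fst z))))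
   (axis i 1) (fst z)" by (rule has_partial_cmult[OF partial_exp_eta])
 then show "has_partial (\<lambda>x. X (x, snd z)) (l * X z * e i (fst z)) (axis i 1) (fst z)"
  by (simp add: X_def mult_ac)
qed

lemma partial_fst: "has_partial g d u (fst z) ==> has_partial (\<lambda>z. g (fst z)) d (u, 0) z"
 by (rule has_partial_space) simp

lemma partial_bb: "has_partial (bb i) (H i j z) (axis j 1, 0) z"
 unfolding bb_def[abs_def]
 by (rule has_partial_value[OF has_partial_mult[OF has_partial_cmult[OF partial_X] partial_fst[OF partial_e]]])
  (simp add: H_def power2_eq_square)

lemma partial_ell: "has_partial ell (bb i z) (axis i 1, 0) z"
proof (rule has_partial_space)
 have "has_partial (\<lambda>x. s / th (snd z) * (exp (l * \<eta> x) - M0)) (s / th (snd z) * (exp (l * \<eta> (fst z)) * (l * e i (fst z)) - 0))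
   (axis i 1) (fst z)" by (intro has_partial_cmult has_partial_diff partial_exp_eta has_partial_const)
 moreover have "(\<lambda>x. s / th (snd z) * (exp (l * \<eta> x) - M0)) = (\<lambda>x. ell (x, snd z))"
  by (simp add: ell_def fun_eq_iff diff_divide_distrib right_diff_distrib)
 ultimately show "has_partial (\<lambda>x. ell (x, snd z)) (bb i z) (axis i 1) (fst z)"
  by (simp add: bb_def X_def mult_ac)
qed

lemma partial_lt: "has_partial lt (bt i z) (axis i 1, 0) z"
proof (rule has_partial_space)
 let ?c = "- s * (a + b - 2 * snd z) / (th (snd z))\<^sup>2"
 have "has_partial (\<lambda>x. ?c * (exp (l * \<eta> x) - M0)) (?c * (exp (l * \<eta> (fst z)) * (l * e i (fst z)) - 0))
   (axis i 1) (fst z)" by (intro has_partial_cmult has_partial_diff partial_exp_eta has_partial_const)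
 moreover have "(\<lambda>x. ?c * (exp (l * \<eta> x) - M0)) = (\<lambda>x. lt (x, snd z))"
 proof
  fix x
  have "?c * (exp (l * \<eta> x) - M0) = s * (a + b - 2 * snd z) * (M0 - exp (l * \<eta> x)) / (th (snd z))\<^sup>2"
   by (simp add: algebra_simps)
  then show "?c * (exp (l * \<eta> x) - M0) = lt (x, snd z)" by (simp add: lt_def mult_ac)
 qed
 moreover have "?c * (exp (l * \<eta> (fst z)) * (l * e i (fst z)) - 0) = bt i z"
  by (simp add: bt_def yy_def X_def power2_eq_square mult_ac)
 ultimately show "has_partial (\<lambda>x. lt (x, snd z)) (bt i z) (axis i 1) (fst z)" by simp
qed

lemma partial_L: "has_partial L (Li i z) (axis i 1, 0) z"
 unfolding L_eq[abs_def]
 by (rule has_partial_value[OF has_partial_add[OF has_partial_mult[OF has_partial_cmult[OF partial_X] partial_fst[OF partial_E]]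
    has_partial_mult[OF has_partial_cmult[OF partial_X] partial_fst[OF partial_De]]]])
  (simp add: Li_def algebra_simps power2_eq_square power3_eq_cube)

lemma deriv_inverse_th:
 assumes "t \<in> {a<..<b}"
 shows "((\<lambda>t. 1 / th t) has_real_derivative - (a + b - 2 * t) / (th t)\<^sup>2) (at t)"
 using th_pos[OF assms] unfolding th_def
 by (auto intro!: derivative_eq_intros simp: power2_eq_square field_simps)

lemma time_partial_X:
 assumes t: "snd z \<in> {a<..<b}"
 shows "has_partial X (yy z) (0, 1) z"
proof (rule has_partial_time)
 have "((\<lambda>t. s * exp (l * \<eta> (fst z)) * (1 / th t)) has_real_derivative
   s * exp (l * \<eta> (fst z)) * (- (a + b - 2 * snd z) / (th (snd z))\<^sup>2)) (at (snd z))"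
  by (intro DERIV_cmult deriv_inverse_th t)
 moreover have "s * A * (- B / C^2) = - (s * (A / C)) * B / C" for A B C :: real by (simp add: power2_eq_square)
 then have "s * exp (l * \<eta> (fst z)) * (- (a + b - 2 * snd z) / (th (snd z))\<^sup>2) = yy z"
  unfolding yy_def X_def .
 moreover have "(\<lambda>t. s * exp (l * \<eta> (fst z)) * (1 / th t)) = (\<lambda>t. X (fst z, t))"
  by (simp add: X_def fun_eq_iff)
 ultimately show "((\<lambda>t. X (fst z, t)) has_real_derivative yy z) (at (snd z))" by simp
qed

lemma time_partial_bb: "snd z \<in> {a<..<b} ==> has_partial (bb i) (bt i z) (0, 1) z"
 unfolding bb_def[abs_def]
 by (rule has_partial_value[OF has_partial_mult[OF has_partial_cmult[OF time_partial_X]]])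
  (auto simp: bt_def has_partial_def)

lemma time_partial_ell:
 assumes t: "snd z \<in> {a<..<b}"
 shows "has_partial ell (lt z) (0, 1) z"
proof (rule has_partial_time)
 have "((\<lambda>t. (- s * (M0 - exp (l * \<eta> (fst z)))) * (1 / th t)) has_real_derivative
   (- s * (M0 - exp (l * \<eta> (fst z)))) * (- (a + b - 2 * snd z) / (th (snd z))\<^sup>2)) (at (snd z))"
  by (intro DERIV_cmult deriv_inverse_th t)
 moreover have "(- s * A) * (- B / C) = s * A * B / C" for A B C :: real by simp
 then have "(- s * (M0 - exp (l * \<eta> (fst z)))) * (- (a + b - 2 * snd z) / (th (snd z))\<^sup>2) = lt z"
  unfolding lt_def .
 moreover have "(\<lambda>t. (- s * (M0 - exp (l * \<eta> (fst z)))) * (1 / th t)) = (\<lambda>t. ell (fst z, t))"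
  by (simp add: ell_def fun_eq_iff)
 ultimately show "((\<lambda>t. ell (fst z, t)) has_real_derivative lt z) (at (snd z))" by simp
qed

lemma time_partial_lt:
 assumes t: "snd z \<in> {a<..<b}"
 shows "has_partial lt (ltt z) (0, 1) z"
proof (rule has_partial_time)
 have th: "th (snd z) \<noteq> 0" using th_pos[OF t] by simp
 have "((\<lambda>t. (a + b - 2 * t) * (1 / th t) * (1 / th t)) has_real_derivative
   (- 2 / (th (snd z))\<^sup>2 - 2 * (a + b - 2 * snd z)\<^sup>2 / (th (snd z)) ^ 3)) (at (snd z))"
  by (rule derivative_eq_intros deriv_inverse_th t refl)+
   (use th in \<open>simp add: field_simps power2_eq_square power3_eq_cube\<close>)
 then have "((\<lambda>t. s * (M0 - exp (l * \<eta> (fst z))) * ((a + b - 2 * t) * (1 / th t) * (1 / th t))) has_real_derivative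
   s * (M0 - exp (l * \<eta> (fst z))) * (- 2 / (th (snd z))\<^sup>2 - 2 * (a + b - 2 * snd z)\<^sup>2 / (th (snd z)) ^ 3)) (at (snd z))"
  by (rule DERIV_cmult)
 moreover have "(\<lambda>t. s * (M0 - exp (l * \<eta> (fst z))) * ((a + b - 2 * t) * (1 / th t) * (1 / th t))) = (\<lambda>t. lt (fst z, t))"
  by (simp add: lt_def fun_eq_iff power2_eq_square)
 ultimately show "((\<lambda>t. lt (fst z, t)) has_real_derivative ltt z) (at (snd z))" by (simp add: ltt_def)
qed

lemma continuous_weights:
 defines "S \<equiv> UNIV \<times> {a<..<b}"
 shows "continuous_on S X" "continuous_on S ell" "continuous_on S yy" "continuous_on S lt" "continuous_on S ltt"
  "continuous_on S (bb i)" "continuous_on S (H i j)" "continuous_on S L" "continuous_on S (Li i)" "continuous_on S (bt i)"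
proof -
 have c [continuous_intros]: "continuous_on S (\<lambda>z. g (fst z))" if "C_k k g" for g :: "real ^ 'n => real" and k
  by (rule continuous_on_compose2[OF C_k_continuous[OF that]]) (auto intro!: continuous_intros)
 note C = c[OF smooth] c[OF C_k_e] c[OF C_k_ee] c[OF C_k_De] c[OF C_k_dl]
 have nz: "\<forall>z\<in>S. th (snd z) \<noteq> 0" using th_pos unfolding S_def by fastforce
 have th: "continuous_on S (\<lambda>z. th (snd z))" unfolding th_def by (intro continuous_intros)
 have E: "continuous_on S (\<lambda>z. E (fst z))" unfolding E_def by (intro continuous_intros C)
 show X: "continuous_on S X" unfolding X_def[abs_def] using nz by (intro continuous_intros C th)
 show "continuous_on S ell" unfolding ell_def[abs_def] using nz by (intro continuous_intros C th)
 show y: "continuous_on S yy" unfolding yy_def[abs_def] using nz by (intro continuous_intros X th)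
 show "continuous_on S lt" unfolding lt_def[abs_def] using nz by (intro continuous_intros C th) auto
 show "continuous_on S ltt" unfolding ltt_def[abs_def] using nz by (intro continuous_intros C th) auto
 show "continuous_on S (bb i)" for i unfolding bb_def[abs_def] by (intro continuous_intros X C)
 show H: "continuous_on S (H i j)" for i j unfolding H_def[abs_def] by (intro continuous_intros X C)
 show "continuous_on S L" unfolding L_def[abs_def] by (intro continuous_intros H)
 show "continuous_on S (Li i)" unfolding Li_def[abs_def]
  by (intro continuous_on_add continuous_on_mult continuous_on_sum continuous_on_const X C E)
 show "continuous_on S (bt i)" unfolding bt_def[abs_def] by (intro continuous_intros y C)
qed

lemma weights_shift:
 fixes k :: 'n
 defines "u \<equiv> (axis k (2 * pi), 0)"
 shows "X (z + u) = X z" "ell (z + u) = ell z" "lt (z + u) = lt z" "bb i (z + u) = bb i z"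
  "H i j (z + u) = H i j z" "L (z + u) = L z" "Li i (z + u) = Li i z" "yy (z + u) = yy z" "bt i (z + u) = bt i z"
proof -
 note P = periodic[unfolded torus_periodic_def, rule_format] periodic_coefficients[unfolded torus_periodic_def, rule_format]
 have E: "E (x + axis k (2 * pi)) = E x" for x by (simp add: E_def P)
 show "X (z + u) = X z" "ell (z + u) = ell z" "lt (z + u) = lt z" "bb i (z + u) = bb i z"
  "H i j (z + u) = H i j z" "L (z + u) = L z" "Li i (z + u) = Li i z" "yy (z + u) = yy z" "bt i (z + u) = bt i z"
  by (simp_all add: u_def X_def ell_def lt_def bb_def H_def L_def Li_def yy_def bt_def P E)
qed

end

section \<open>The conjugated solution\<close>

locale carleman_solution = carleman_weights \<eta> l s a b
 for \<eta> :: "real ^ 'n => real" and l s a b :: real +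
 fixes q :: "(real ^ 'n) \<times> real => 'b::euclidean_space" and J :: "'b => 'b" and \<alpha> \<gamma> :: real
 assumes q_smooth: "C_k 2 q" and q_periodic: "\<And>t. torus_periodic (\<lambda>x. q (x, t))"
  and J_linear: "linear J" and J_skew: "\<And>x y. J x \<bullet> y = - (x \<bullet> J y)" and J_iso: "\<And>x y. J x \<bullet> J y = x \<bullet> y"
  and JJ: "\<And>x. J (J x) = - x" and \<alpha>: "\<alpha> > 0"
begin

text \<open>
  The derivatives of \<open>w = exp ell *R q\<close> are named by their indices as those of \<open>q\<close>; \<open>pp\<close> and \<open>rr\<close> are the
  coordinates of the inverse of \<open>cc\<close> with respect to the identity and \<open>J\<close>.
\<close>

definition "cc v = \<alpha> *R v - \<gamma> *R J v" for v :: 'b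
definition "\<rho> = sqrt (\<alpha>^2 + \<gamma>^2)"
definition "pp = \<alpha> / \<rho>^2"
definition "rr = \<gamma> / \<rho>^2"
definition "qi i = space_deriv i q" for i
definition "qt = time_deriv q"
definition "qij i j = space_deriv j (qi i)" for i j
definition "qti i = time_deriv (qi i)" for i
definition "w z = exp (ell z) *R q z" for z
definition "wi i z = exp (ell z) *R (qi i z + bb i z *R q z)" for i z
definition "wt z = exp (ell z) *R (qt z + lt z *R q z)" for z
definition "wij i j z = exp (ell z) *R (qij i j z + bb j z *R qi i z + bb i z *R qi j z + (H i j z + bb i z * bb j z) *R q z)" for i j z
definition "wti i z = exp (ell z) *R (qti i z + lt z *R qi i z + bb i z *R qt z + (bt i z + lt z * bb i z) *R q z)" for i z

lemma J_bounded: "bounded_linear J"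
 using J_linear by (rule linear_conv_bounded_linear[THEN iffD1])

lemma cc_bounded: "bounded_linear cc"
 unfolding cc_def[abs_def] by (intro bounded_linear_sub bounded_linear_scaleR_right[THEN bounded_linear_compose] J_bounded bounded_linear_ident)

lemma C_k_q: "C_k 1 (qi i)" "C_k 1 qt" "C_k 0 (qij i j)" "C_k 0 (qti i)"
 using q_smooth unfolding qi_def qt_def qij_def qti_def space_deriv_def time_deriv_def by (simp_all add: numeral_eq_Suc)

lemma partial_q: "has_partial q (qi i z) (axis i 1, 0) z" "has_partial q (qt z) (0, 1) z"
 "has_partial (qi i) (qij i j z) (axis j 1, 0) z" "has_partial (qi i) (qti i z) (0, 1) z"
proof -
 show "has_partial q (qi i z) (axis i 1, 0) z" "has_partial q (qt z) (0, 1) z"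
  unfolding qi_def qt_def space_deriv_def time_deriv_def
  by (intro has_partial_dir_deriv C_k_differentiable[OF q_smooth]; simp)+
 show "has_partial (qi i) (qij i j z) (axis j 1, 0) z" "has_partial (qi i) (qti i z) (0, 1) z"
  unfolding qij_def qti_def space_deriv_def time_deriv_def
  by (intro has_partial_dir_deriv C_k_differentiable[OF C_k_q(1)]; simp)+
qed

lemma q_commute: "qij i j z = qij j i z" "qti i = space_deriv i qt"
 unfolding qij_def qti_def qi_def qt_def space_deriv_def time_deriv_def
 by (intro dir_deriv_commute q_smooth, intro ext dir_deriv_commute q_smooth)

lemma partial_qt: "has_partial qt (qti i z) (axis i 1, 0) z"
 unfolding q_commute(2) space_deriv_def by (intro has_partial_dir_deriv C_k_differentiable[OF C_k_q(2)]) simp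

lemma wij_sym: "wij i j z = wij j i z"
 unfolding wij_def H_def by (simp add: q_commute(1)[of i j] ee_sym[of i j] add_ac mult_ac)

lemma partial_w: "has_partial w (wi i z) (axis i 1, 0) z"
 unfolding w_def[abs_def] wi_def by (rule has_partial_exp_scaleR[OF partial_ell partial_q(1)])

lemma partial_wi: "has_partial (wi i) (wij i j z) (axis j 1, 0) z"
 unfolding wi_def[abs_def] wij_def
 by (rule has_partial_value[OF has_partial_exp_scaleR[OF partial_ell
    has_partial_add[OF partial_q(3) has_partial_scaleR[OF partial_bb partial_q(1)]]]])
  (simp add: algebra_simps)

lemma partial_wt: "has_partial wt (wti i z) (axis i 1, 0) z"
 unfolding wt_def[abs_def] wti_def
 by (rule has_partial_value[OF has_partial_exp_scaleR[OF partial_ell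
    has_partial_add[OF partial_qt has_partial_scaleR[OF partial_lt partial_q(1)]]]])
  (simp add: algebra_simps)

lemma time_partial_w: "snd z \<in> {a<..<b} ==> has_partial w (wt z) (0, 1) z"
 unfolding w_def[abs_def] wt_def by (rule has_partial_exp_scaleR[OF time_partial_ell partial_q(2)])

lemma time_partial_wi: "snd z \<in> {a<..<b} ==> has_partial (wi i) (wti i z) (0, 1) z"
 unfolding wi_def[abs_def] wti_def
 by (rule has_partial_value[OF has_partial_exp_scaleR[OF time_partial_ell
    has_partial_add[OF partial_q(4) has_partial_scaleR[OF time_partial_bb partial_q(2)]]]])
  (simp_all add: algebra_simps)

lemma w_continuous:
 defines "S \<equiv> UNIV \<times> {a<..<b}"
 shows "continuous_on S w" "continuous_on S (wi i)" "continuous_on S wt" "continuous_on S (wij i j)" "continuous_on S (wti i)"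
proof -
 have c: "continuous_on S f" if "C_k k f" for f :: "(real ^ 'n) \<times> real => 'b" and k
  by (rule continuous_on_subset[OF C_k_continuous[OF that]]) simp
 note C = c[OF q_smooth] c[OF C_k_q(1)] c[OF C_k_q(2)] c[OF C_k_q(3)] c[OF C_k_q(4)]
 note W = continuous_weights[folded S_def]
 show "continuous_on S w" "continuous_on S (wi i)" "continuous_on S wt" "continuous_on S (wij i j)" "continuous_on S (wti i)"
  unfolding w_def[abs_def] wi_def[abs_def] wt_def[abs_def] wij_def[abs_def] wti_def[abs_def]
  by (intro continuous_on_scaleR continuous_on_exp continuous_on_add continuous_on_mult C W)+
qed

lemma w_shift:
 fixes k :: 'n
 defines "u \<equiv> (axis k (2 * pi), 0)"
 shows "w (z + u) = w z" "wi i (z + u) = wi i z" "wt (z + u) = wt z" "wij i j (z + u) = wij i j z" "wti i (z + u) = wti i z"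
proof -
 have D: "q differentiable (at z)" "qi i differentiable (at z)" for z i
  using C_k_differentiable[OF q_smooth] C_k_differentiable[OF C_k_q(1)] by auto
 have qi: "torus_periodic (\<lambda>x. qi i (x, t))" for i t
  unfolding qi_def space_deriv_def by (intro torus_periodic_partial q_periodic D)
 have P: "q (z + u) = q z" "qi i (z + u) = qi i z" "qt (z + u) = qt z" "qij i j (z + u) = qij i j z" "qti i (z + u) = qti i z" for i j
  using q_periodic[of "snd z"] qi[of i "snd z"]
   torus_periodic_partial[OF q_periodic D(1), of "(0, 1)" "snd z"]
   torus_periodic_partial[OF qi D(2), of "(axis j 1, 0)" i "snd z"]
   torus_periodic_partial[OF qi D(2), of "(0, 1)" i "snd z"]
  unfolding u_def torus_periodic_def qt_def qij_def qti_def space_deriv_def time_deriv_def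
  by (cases z; simp)+
 show "w (z + u) = w z" "wi i (z + u) = wi i z" "wt (z + u) = wt z" "wij i j (z + u) = wij i j z" "wti i (z + u) = wti i z"
  unfolding w_def wi_def wt_def wij_def wti_def
  by (simp_all add: P weights_shift[where k = k, folded u_def])
qed

definition "flux1 i = flux_space pp rr J w wi wt bb L lt i" for i
definition "flux2 i z = l^2 * X z * (w z \<bullet> cc (wi i z))" for i z
definition "ftime1 = flux_time pp rr J w wi bb lt"
definition "ftime2 z = (l^2 * X z) * (w z \<bullet> w z) / 2" for z

definition "dflux1 i z = flux_space_deriv pp rr J (w z) (wt z) (lt z) (L z) (\<Sum>j\<in>UNIV. bb j z * bb j z) (\<Sum>j\<in>UNIV. bb j z *R wi j z)
  (\<Sum>j\<in>UNIV. wi j z \<bullet> wi j z) (\<lambda>j. wi j z) (\<lambda>j. bb j z) (bt i z) (Li i z) (wti i z) (\<lambda>j. wij i j z) (\<lambda>j. H i j z) i" for i z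

definition "dftime1 z = flux_time_deriv pp rr J (w z) (wt z) (lt z) (ltt z) (\<Sum>i\<in>UNIV. bb i z * bb i z) (\<Sum>j\<in>UNIV. bb j z *R wi j z)
  (\<lambda>i. bb i z) (\<lambda>i. bt i z) (\<lambda>i. wi i z) (\<lambda>i. wti i z)" for z

definition "dflux2 i z = l ^ 3 * X z * e i (fst z) * (w z \<bullet> cc (wi i z)) + l^2 * X z * (wi i z \<bullet> cc (wi i z) + w z \<bullet> cc (wij i i z))" for i z
definition "dftime2 z = (l^2 * yy z * (w z \<bullet> w z) + l^2 * X z * (2 * (wt z \<bullet> w z))) / 2" for z

lemma H_sym: "H i j z = H j i z"
 by (simp add: H_def ee_sym[of i j])

lemma partial_flux1: "has_partial (flux1 i) (dflux1 i z) (axis i 1, 0) z"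
proof -
 have 1: "has_partial (wi j) (wij i j z) (axis i 1, 0) z" for j
  unfolding wij_sym[of i j] by (rule partial_wi)
 have 2: "has_partial (bb j) (H i j z) (axis i 1, 0) z" for j
  unfolding H_sym[of i j] by (rule partial_bb)
 show ?thesis unfolding flux1_def dflux1_def
  by (rule has_partial_flux_space[where wij = "\<lambda>j. wij i j z" and H = "\<lambda>j. H i j z" and wti = "wti i z"
     and Li = "Li i z" and bt = "bt i z", OF J_bounded partial_w 1 partial_wt 2 partial_L partial_lt])
qed

lemma partial_ftime1: "snd z \<in> {a<..<b} ==> has_partial ftime1 (dftime1 z) (0, 1) z"
 unfolding ftime1_def dftime1_def
 by (rule has_partial_flux_time[OF J_bounded time_partial_w time_partial_wi time_partial_bb time_partial_lt])

lemma partial_flux2: "has_partial (flux2 i) (dflux2 i z) (axis i 1, 0) z"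
 unfolding flux2_def[abs_def] dflux2_def
 by (rule has_partial_value[OF has_partial_mult[OF has_partial_cmult[OF partial_X]
    has_partial_inner[OF partial_w has_partial_linear[OF cc_bounded partial_wi]]]])
  (simp add: power2_eq_square power3_eq_cube algebra_simps)

lemma partial_ftime2: "snd z \<in> {a<..<b} ==> has_partial ftime2 (dftime2 z) (0, 1) z"
 unfolding ftime2_def[abs_def] dftime2_def
 by (rule has_partial_value[OF has_partial_linear[OF bounded_linear_divide has_partial_mult[OF has_partial_cmult[OF time_partial_X]
    has_partial_inner[OF time_partial_w time_partial_w]]]])
  (simp_all add: inner_commute algebra_simps)

lemma flux_continuous:
 defines "S \<equiv> UNIV \<times> {a<..<b}"
 shows "continuous_on S (dflux1 i)" "continuous_on S dftime1" "continuous_on S (dflux2 i)" "continuous_on S dftime2"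
proof -
 note W = continuous_weights[folded S_def] w_continuous[folded S_def]
 have J: "continuous_on S (\<lambda>z. J (f z))" "continuous_on S (\<lambda>z. cc (f z))" if "continuous_on S f" for f
  using that by (auto intro: bounded_linear.continuous_on J_bounded cc_bounded)
 have e: "continuous_on S (\<lambda>z. e i (fst z))"
  by (rule continuous_on_compose2[OF C_k_continuous[OF C_k_e]]) (auto intro!: continuous_intros)
 note R = continuous_on_add continuous_on_diff continuous_on_mult continuous_on_sum continuous_on_const continuous_on_inner
  continuous_on_scaleR continuous_on_divide continuous_on_minus
 show "continuous_on S (dflux1 i)" unfolding dflux1_def[abs_def] by (intro R W J)
 show "continuous_on S dftime1" unfolding dftime1_def[abs_def] by (intro R W J) auto
 show "continuous_on S (dflux2 i)" unfolding dflux2_def[abs_def] by (intro R W J e)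
 show "continuous_on S dftime2" unfolding dftime2_def[abs_def] by (intro R W J) auto
qed

lemma flux_shift:
 fixes k :: 'n
 defines "u \<equiv> (axis k (2 * pi), 0)"
 shows "flux1 i (z + u) = flux1 i z" "flux2 i (z + u) = flux2 i z" "dflux1 i (z + u) = dflux1 i z" "dflux2 i (z + u) = dflux2 i z"
proof -
 have e: "e i (fst (z + u)) = e i (fst z)"
  using periodic_coefficients(1)[unfolded torus_periodic_def] by (simp add: u_def)
 show "flux1 i (z + u) = flux1 i z" "flux2 i (z + u) = flux2 i z" "dflux1 i (z + u) = dflux1 i z" "dflux2 i (z + u) = dflux2 i z"
  unfolding flux1_def flux_space_def flux2_def dflux1_def dflux2_def e
  by (simp_all add: w_shift[where k = k, folded u_def] weights_shift[where k = k, folded u_def])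
qed

end

section \<open>Size of the weights\<close>

lemma le_sup_norm:
 fixes f :: "real ^ 'n => real"
 assumes "continuous_on UNIV f" "torus_periodic f"
 shows "f x <= sup_norm f"
proof -
 obtain K where "\<And>x. norm (f x) <= K" using continuous_periodic_bounded[OF assms] by metis
 then have "bdd_above (range (\<lambda>x. \<bar>f x\<bar>))" by (auto simp: bdd_above_def)
 then have "\<bar>f x\<bar> <= (SUP x. \<bar>f x\<bar>)" by (intro cSUP_upper) auto
 then show ?thesis by (simp add: sup_norm_def)
qed

context carleman_weights
begin

context
 fixes \<sigma> :: real
 assumes l: "l >= 1" and eta_pos: "\<And>x. \<eta> x > 0" and \<sigma>: "\<sigma> >= 1"
  and s: "s >= \<sigma> * (exp (2 * l * sup_norm \<eta>) * (b - a) + (b - a)\<^sup>2)"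
begin

lemma eta_le_sup: "\<eta> x <= sup_norm \<eta>"
 by (rule le_sup_norm[OF C_k_continuous[OF smooth] periodic])

lemma sup_pos: "sup_norm \<eta> > 0"
 using eta_le_sup[of 0] eta_pos[of 0] by linarith

lemma exp_eta_bounds: "1 <= exp (l * \<eta> x)" "exp (l * \<eta> x) <= exp (l * sup_norm \<eta>)" "exp (l * sup_norm \<eta>) < M0" "M0 >= 1"
proof -
 have "0 <= l * \<eta> x" using l eta_pos[of x] by simp
 then show "1 <= exp (l * \<eta> x)" by simp
 have "l * \<eta> x <= l * sup_norm \<eta>" using l eta_le_sup by (intro mult_left_mono) auto
 then show "exp (l * \<eta> x) <= exp (l * sup_norm \<eta>)" by simp
 have "0 < l * sup_norm \<eta>" using l sup_pos by simp
 then show "exp (l * sup_norm \<eta>) < M0" "M0 >= 1" by (auto simp: M0_def)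
qed

lemma s_bounds: "s > 0" "M0 * (b - a) <= s / \<sigma>" "(b - a)\<^sup>2 <= s / \<sigma>" "b - a <= s / \<sigma>" "s / \<sigma> <= s"
proof -
 have m: "0 < M0 * (b - a)" "0 < (b - a)\<^sup>2" using exp_eta_bounds(4) ab by auto
 have "M0 * (b - a) + (b - a)\<^sup>2 <= s / \<sigma>" using s \<sigma> by (simp add: M0_def field_simps)
 then show 1: "M0 * (b - a) <= s / \<sigma>" "(b - a)\<^sup>2 <= s / \<sigma>" using m by linarith+
 have "1 * (b - a) <= M0 * (b - a)" using exp_eta_bounds(4) ab by (intro mult_right_mono) auto
 then show "b - a <= s / \<sigma>" using 1 by simp
 have "s / \<sigma> > 0" using 1 m by linarith
 then show s0: "s > 0" using \<sigma> by (simp add: zero_less_divide_iff)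
 show "s / \<sigma> <= s" using s0 \<sigma> divide_left_mono[of 1 \<sigma> s] by simp
qed

text \<open>
  Time derivatives of the weights produce the factors \<open>M0 * (b - a)\<close> and \<open>(b - a)\<^sup>2\<close>, which the lower
  bound on \<open>s\<close> replaces by \<open>s / \<sigma>\<close>.
\<close>

lemma weight_bounds:
 assumes t: "snd z \<in> {a<..<b}"
 shows "X z >= 4 * \<sigma>" "\<bar>yy z\<bar> <= (X z)\<^sup>2 / \<sigma>" "\<bar>lt z\<bar> <= (X z)\<^sup>2 / \<sigma>" "\<bar>ltt z\<bar> <= 3 * (X z) ^ 3 / \<sigma>"
proof -
 define T where "T = 1 / th (snd z)"
 define A where "A = exp (l * \<eta> (fst z))"
 define d where "d = a + b - 2 * snd z"
 have th: "th (snd z) > 0" by (rule th_pos[OF t])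
 have T: "T > 0" using th by (simp add: T_def)
 have "A <= M0" unfolding A_def by (rule order_trans[OF exp_eta_bounds(2) less_imp_le[OF exp_eta_bounds(3)]])
 then have A: "1 <= A" "A <= M0" "0 <= M0 - A" "M0 - A <= M0"
  using exp_eta_bounds(1)[of "fst z"] unfolding A_def[symmetric] by simp_all
 have d: "\<bar>d\<bar> <= b - a" using t by (auto simp: d_def abs_le_iff)
 have "4 * th (snd z) = (b - a)\<^sup>2 - d\<^sup>2" by (simp add: th_def d_def power2_eq_square algebra_simps)
 then have th4: "4 * th (snd z) <= (b - a)\<^sup>2" by simp
 have X: "X z = s * A * T" by (simp add: X_def A_def T_def)
 have XsT: "s * T <= X z" unfolding X using A T s_bounds(1) by simp
 have XT0: "0 < s * T" using T s_bounds by simp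
 have "4 * \<sigma> = 4 * th (snd z) * T * \<sigma>" using th by (simp add: T_def)
 also have "... <= (s / \<sigma>) * T * \<sigma>" using th4 s_bounds(3) T \<sigma> by (intro mult_right_mono) auto
 also have "... = s * T" using \<sigma> by simp
 finally show "X z >= 4 * \<sigma>" using XsT by simp
 have sT: "s * T / \<sigma> <= X z / \<sigma>" using XsT \<sigma> by (intro divide_right_mono) auto
 have "\<bar>yy z\<bar> = X z * (\<bar>d\<bar> * T)"
  using XsT XT0 th unfolding yy_def d_def[symmetric] by (simp add: abs_mult T_def)
 also have "... <= X z * (s / \<sigma> * T)" using d s_bounds(4) T XsT XT0 by (intro mult_left_mono mult_right_mono) auto
 also have "... <= X z * (X z / \<sigma>)" using sT XsT XT0 by (intro mult_left_mono) auto
 finally show "\<bar>yy z\<bar> <= (X z)\<^sup>2 / \<sigma>" by (simp add: power2_eq_square)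
 have "\<bar>lt z\<bar> = s * ((M0 - A) * \<bar>d\<bar>) * T^2"
  unfolding lt_def d_def[symmetric] A_def[symmetric] using A s_bounds by (simp add: abs_mult T_def power_divide)
 also have "... <= s * (M0 * (b - a)) * T^2" using A d s_bounds ab by (intro mult_right_mono mult_left_mono mult_mono) auto
 also have "... <= s * (s / \<sigma>) * T^2" using s_bounds by (intro mult_right_mono mult_left_mono) auto
 also have "... = (s * T)\<^sup>2 / \<sigma>" by (simp add: power2_eq_square)
 also have "... <= (X z)\<^sup>2 / \<sigma>" using XsT XT0 \<sigma> by (intro divide_right_mono power_mono) auto
 finally show "\<bar>lt z\<bar> <= (X z)\<^sup>2 / \<sigma>" .
 have "\<bar>ltt z\<bar> = s * (M0 - A) * (2 * T^2 + 2 * d^2 * T ^ 3)"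
 proof -
  have "ltt z = - (s * (M0 - A) * (2 * T^2 + 2 * d^2 * T ^ 3))"
   unfolding ltt_def d_def[symmetric] A_def[symmetric] by (simp add: T_def power_divide algebra_simps)
  moreover have "0 <= s * (M0 - A) * (2 * T^2 + 2 * d^2 * T ^ 3)" using A s_bounds T by simp
  ultimately show ?thesis by simp
 qed
 also have "... <= s * M0 * ((b - a)\<^sup>2 * T ^ 3 / 2 + 2 * (b - a)\<^sup>2 * T ^ 3)"
 proof (intro mult_mono add_mono)
  have "2 * T^2 = 4 * th (snd z) * (T ^ 3 / 2)" using th by (simp add: T_def power2_eq_square power3_eq_cube)
  also have "... <= (b - a)\<^sup>2 * (T ^ 3 / 2)" using th4 T by (intro mult_right_mono) auto
  finally show "2 * T^2 <= (b - a)\<^sup>2 * T ^ 3 / 2" by simp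
  show "d^2 <= (b - a)\<^sup>2" using d by (metis abs_ge_zero power2_abs power_mono)
 qed (use A s_bounds T in auto)
 also have "... = 5 / 2 * s * (M0 * (b - a) * (b - a)) * T ^ 3"
 proof -
  have "s * M0 * (D^2 * T ^ 3 / 2 + 2 * D^2 * T ^ 3) = 5 / 2 * s * (M0 * D * D) * T ^ 3" for D
   by (simp add: power2_eq_square field_simps)
  then show ?thesis .
 qed
 also have "... <= 5 / 2 * s * (s / \<sigma> * s) * T ^ 3"
  using s_bounds A T ab \<sigma> by (intro mult_right_mono mult_left_mono mult_mono) auto
 also have "... = 5 / 2 * ((s * T) ^ 3 / \<sigma>)" by (simp add: power3_eq_cube)
 also have "... <= 3 * ((X z) ^ 3 / \<sigma>)"
  using XsT XT0 \<sigma> by (intro mult_mono divide_right_mono power_mono) auto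
 finally show "\<bar>ltt z\<bar> <= 3 * (X z) ^ 3 / \<sigma>" by simp
qed

end
end

context carleman_solution
begin

text \<open>
  The equation conjugated with the exponential: each derivative gains the derivative of the exponent.
\<close>

lemma conjugated_equation:
 "exp (ell z) *R (qt z + cc (laplacian q z)) = wt z - lt z *R w z
  + cc ((\<Sum>i\<in>UNIV. wij i i z) - 2 *R (\<Sum>j\<in>UNIV. bb j z *R wi j z) + ((\<Sum>i\<in>UNIV. bb i z * bb i z) - L z) *R w z)"
proof -
 have lin: "linear cc" using cc_bounded by (rule bounded_linear.linear)
 have lap: "laplacian q z = (\<Sum>i\<in>UNIV. qij i i z)" by (simp add: laplacian_def qij_def qi_def)
 let ?S = "\<Sum>i\<in>UNIV. bb i z *R qi i z" and ?B = "\<Sum>i\<in>UNIV. bb i z * bb i z"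
 have 1: "(\<Sum>i\<in>UNIV. wij i i z) = exp (ell z) *R (laplacian q z + 2 *R ?S + (L z + ?B) *R q z)"
 proof -
  have "wij i i z = exp (ell z) *R (qij i i z + 2 *R (bb i z *R qi i z) + (H i i z + bb i z * bb i z) *R q z)" for i
   unfolding wij_def scaleR_2 by (simp only: add.assoc)
  then show ?thesis unfolding lap L_def
   by (simp add: scaleR_sum_right scaleR_sum_left sum.distrib scaleR_add_left scaleR_add_right)
 qed
 have 2: "(\<Sum>j\<in>UNIV. bb j z *R wi j z) = exp (ell z) *R (?S + ?B *R q z)"
 proof -
  have "bb j z *R wi j z = exp (ell z) *R (bb j z *R qi j z + (bb j z * bb j z) *R q z)" for j
   by (simp add: wi_def algebra_simps)
  then show ?thesis by (simp add: scaleR_sum_right[symmetric] sum.distrib scaleR_left.sum)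
 qed
 have "(\<Sum>i\<in>UNIV. wij i i z) - 2 *R (\<Sum>j\<in>UNIV. bb j z *R wi j z) + (?B - L z) *R w z = exp (ell z) *R laplacian q z"
 proof -
  have "(L z + ?B) *R q z - (2 * ?B) *R q z + (?B - L z) *R q z = 0"
   by (simp flip: scaleR_left_diff_distrib scaleR_left_distrib)
  then have "laplacian q z + 2 *R ?S + (L z + ?B) *R q z - 2 *R (?S + ?B *R q z) + (?B - L z) *R q z = laplacian q z"
   by (simp add: scaleR_add_right algebra_simps)
  moreover have "exp (ell z) *R u - 2 *R (exp (ell z) *R v) + (?B - L z) *R (exp (ell z) *R x)
    = exp (ell z) *R (u - 2 *R v + (?B - L z) *R x)" for u v x :: 'b
   by (simp add: scaleR_add_right scaleR_diff_right mult.commute)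
  ultimately show ?thesis unfolding 1 2 w_def by simp
 qed
 then show ?thesis
  by (simp add: wt_def w_def linear_scale[OF lin] algebra_simps)
qed

lemma pointwise_terms:
 fixes \<sigma> M :: real
 assumes l: "l >= 1" and eta_pos: "\<And>x. \<eta> x > 0" and \<sigma>: "\<sigma> >= 1"
  and s: "s >= \<sigma> * (exp (2 * l * sup_norm \<eta>) * (b - a) + (b - a)\<^sup>2)"
  and M: "M >= 1" "\<And>i x. \<bar>e i x\<bar> <= M" "\<And>i j x. \<bar>ee i j x\<bar> <= M" "\<And>i x. \<bar>dl i x\<bar> <= M"
  and t: "snd z \<in> {a<..<b}"
 defines "N \<equiv> 10 * (real CARD('n))\<^sup>2 * M ^ 3"
  and "W \<equiv> l ^ 4 * (X z) ^ 3 * nsq (w z)" and "G \<equiv> l\<^sup>2 * X z * (\<Sum>j\<in>UNIV. wi j z \<bullet> wi j z)"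
  and "F \<equiv> nsq (exp (ell z) *R (qt z + cc (laplacian q z)))"
  and "Q \<equiv> nsq (- 2 *R (\<Sum>j\<in>UNIV. bb j z *R wi j z) - L z *R w z + pp *R wt z - (rr * lt z) *R J (w z))"
 shows "Q + 2 * (2 * (E (fst z))\<^sup>2 * W - (3 + 2 * \<bar>rr\<bar> + 2 * pp + pp^2 + rr^2) * N * (1 / l + 1 / \<sigma>) * (W + G)
    + ((\<Sum>i\<in>UNIV. dflux1 i z) + dftime1 z)) <= F / \<rho>^2"
  and "\<alpha> / 2 * G <= F + (3 + 5 * (\<rho> * N)\<^sup>2 / \<alpha> + 2 * \<alpha> * N) * W + ((\<Sum>i\<in>UNIV. dflux2 i z) + dftime2 z)"
  and "inverse (X z) * (nsq (exp (ell z) *R qt z) + nsq (exp (ell z) *R laplacian q z))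
    <= ((1 + 2 / \<rho>^2) * (4 / pp^2 * (1 + 5 * N^2 + (\<bar>rr\<bar> + pp)\<^sup>2)) + 2 / \<rho>^2) * (Q + W + G + F)"
proof -
 have lin: "linear cc" using cc_bounded by (rule bounded_linear.linear)
 have v: "wt z - lt z *R w z = exp (ell z) *R qt z" by (simp add: wt_def w_def algebra_simps)
 have zz: "cc (exp (ell z) *R laplacian q z) = exp (ell z) *R (qt z + cc (laplacian q z)) - (wt z - lt z *R w z)"
  unfolding v by (simp add: linear_scale[OF lin] algebra_simps)
 note wb = weight_bounds[OF l eta_pos \<sigma> s t]
 note T = carleman_terms[where w = "w z" and wt = "wt z" and wi = "\<lambda>i. wi i z" and wti = "\<lambda>i. wti i z"
   and wij = "\<lambda>i j. wij i j z" and e = "\<lambda>i. e i (fst z)" and ee = "\<lambda>i j. ee i j (fst z)" and dl = "\<lambda>i. dl i (fst z)"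
   and J = J and c = cc and x = "X z" and y = "yy z" and lt = "lt z" and ltt = "ltt z" and lam = l and \<sigma> = \<sigma>
   and \<alpha> = \<alpha> and \<gamma> = \<gamma> and \<rho> = \<rho> and p = pp and r = rr and N = N and M = M
   and b = "\<lambda>i. bb i z" and H = "\<lambda>i j. H i j z" and E = "E (fst z)" and De = "De (fst z)" and Li = "\<lambda>i. Li i z"
   and bt = "\<lambda>i. bt i z" and L = "L z" and B = "\<Sum>i\<in>UNIV. bb i z * bb i z" and Wb = "\<Sum>j\<in>UNIV. bb j z *R wi j z"
   and lap = "\<Sum>i\<in>UNIV. wij i i z" and G = "\<Sum>j\<in>UNIV. wi j z \<bullet> wi j z" and dX = "\<lambda>i. dflux1 i z" and dY = "dftime1 z"
   and \<kappa>i = "\<lambda>i. l ^ 3 * X z * e i (fst z)" and dX' = "\<lambda>i. dflux2 i z" and dY' = "dftime2 z"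
   and gg = "exp (ell z) *R (qt z + cc (laplacian q z))" and z = "exp (ell z) *R laplacian q z" and W = W and Q = Q,
   OF wij_sym ee_sym J_linear J_skew J_iso JJ cc_def \<alpha> \<rho>_def pp_def rr_def N_def[THEN meta_eq_to_obj_eq] M l \<sigma> wb(1)
    bb_def H_def E_def De_def Li_def bt_def wb(2-4) L_def refl refl refl refl dflux1_def dftime1_def refl dflux2_def
    dftime2_def conjugated_equation zz W_def[THEN meta_eq_to_obj_eq] Q_def[THEN meta_eq_to_obj_eq]]
 show "Q + 2 * (2 * (E (fst z))\<^sup>2 * W - (3 + 2 * \<bar>rr\<bar> + 2 * pp + pp^2 + rr^2) * N * (1 / l + 1 / \<sigma>) * (W + G)
    + ((\<Sum>i\<in>UNIV. dflux1 i z) + dftime1 z)) <= F / \<rho>^2"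
  using T(1) unfolding F_def G_def .
 show "\<alpha> / 2 * G <= F + (3 + 5 * (\<rho> * N)\<^sup>2 / \<alpha> + 2 * \<alpha> * N) * W + ((\<Sum>i\<in>UNIV. dflux2 i z) + dftime2 z)"
  using T(2) unfolding F_def G_def .
 show "inverse (X z) * (nsq (exp (ell z) *R qt z) + nsq (exp (ell z) *R laplacian q z))
    <= ((1 + 2 / \<rho>^2) * (4 / pp^2 * (1 + 5 * N^2 + (\<bar>rr\<bar> + pp)\<^sup>2)) + 2 / \<rho>^2) * (Q + W + G + F)"
  using T(3) unfolding v F_def G_def .
qed

text \<open>The exponential weight beats every power of the singular coefficients at both ends.\<close>

lemma time_flux_vanishes:
 assumes l: "l >= 1" and eta_pos: "\<And>x. \<eta> x > 0" and s0: "s > 0"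
  and M: "M >= 1" "\<And>i x. \<bar>e i x\<bar> <= M"
 shows "\<exists>\<beta>. (\<forall>z. fst z \<in> torus_cell \<longrightarrow> snd z \<in> {a<..<b} \<longrightarrow> \<bar>k1 * ftime1 z + k2 * ftime2 z\<bar> <= \<beta> (snd z))
  \<and> (\<beta> \<longlongrightarrow> 0) (at_right a) \<and> (\<beta> \<longlongrightarrow> 0) (at_left b)"
proof -
 have sup: "\<eta> x <= sup_norm \<eta>" for x by (rule le_sup_norm[OF C_k_continuous[OF smooth] periodic])
 have sup0: "sup_norm \<eta> > 0" using sup[of 0] eta_pos[of 0] by linarith
 define m0 where "m0 = M0 - exp (l * sup_norm \<eta>)"
 have m0: "m0 > 0" unfolding m0_def M0_def using l sup0 by simp
 have exps: "exp (l * \<eta> x) <= M0 - m0" for x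
  unfolding m0_def using sup[of x] l by (simp add: mult_left_mono)
 have M0pos: "M0 > 0" by (simp add: M0_def)
 \<comment> \<open>\<open>q\<close> and its first derivatives are bounded up to the ends of the time interval.\<close>
 have "\<exists>Q. \<forall>z. fst z \<in> torus_cell \<longrightarrow> snd z \<in> {a<..<b} \<longrightarrow> norm (f z) <= Q"
  if "C_k k f" for f :: "(real ^ 'n) \<times> real => 'b" and k
 proof -
  let ?K = "cbox (0 :: real ^ 'n) (\<chi> i. 2 * pi) \<times> {a..b}"
  have "compact (f ` ?K)"
   by (intro compact_continuous_image compact_Times continuous_on_subset[OF C_k_continuous[OF that]]) auto
  then obtain Q where "\<forall>y\<in>f ` ?K. norm y <= Q" using compact_imp_bounded bounded_iff by metis
  then show ?thesis using torus_cell_subset by (intro exI[of _ Q]) (auto simp: subset_iff less_imp_le)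
 qed
 from this[OF q_smooth] this[OF C_k_q(1)] obtain Q0 Qi
  where Q0: "\<And>z. fst z \<in> torus_cell ==> snd z \<in> {a<..<b} ==> norm (q z) <= Q0"
  and Qi: "\<And>i z. fst z \<in> torus_cell ==> snd z \<in> {a<..<b} ==> norm (qi i z) <= Qi i" by metis
 define Q where "Q = 1 + \<bar>Q0\<bar> + (\<Sum>i\<in>UNIV. \<bar>Qi i\<bar>)"
 have Q1: "Q >= 1" by (simp add: Q_def sum_nonneg)
 have Q: "norm (q z) <= Q" "norm (qi i z) <= Q" if "fst z \<in> torus_cell" "snd z \<in> {a<..<b}" for z i
 proof -
  have "\<bar>Qi i\<bar> <= (\<Sum>i\<in>UNIV. \<bar>Qi i\<bar>)" by (intro member_le_sum) auto
  then show "norm (qi i z) <= Q" using Qi[OF that, of i] by (simp add: Q_def)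
  have "0 <= (\<Sum>i\<in>UNIV. \<bar>Qi i\<bar>)" by (intro sum_nonneg) auto
  then show "norm (q z) <= Q" using Q0[OF that] unfolding Q_def by linarith
 qed
 define c1 where "c1 = 1 + l * s * M0 * M + s * M0 * (b - a) + l^2 * s * M0"
 have c1: "c1 >= 1" "l * s * M0 * M <= c1" "s * M0 * (b - a) <= c1" "l^2 * s * M0 <= c1"
  and c1': "1 + l * s * M0 * M <= c1"
 proof -
  have "l * s * M0 * M >= 0" "s * M0 * (b - a) >= 0" "l^2 * s * M0 >= 0" using l s0 M0pos M(1) ab by auto
  then show "c1 >= 1" "l * s * M0 * M <= c1" "s * M0 * (b - a) <= c1" "l^2 * s * M0 <= c1" "1 + l * s * M0 * M <= c1"
   unfolding c1_def by linarith+
 qed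
 define A where "A T = Q * c1 * (1 + T)\<^sup>2" for T :: real
 define n where "n = real CARD('n)"
 define k where "k = \<bar>k1\<bar> * (pp / 2 * n + pp / 2 * n + \<bar>rr\<bar> * n + (rr^2 + pp^2) / 2) + \<bar>k2\<bar>"
 define B where "B T = k * ((A T) ^ 4 * exp (- 2 * (s * m0 * T)))" for T
 define \<beta> where "\<beta> t = B (1 / th t)" for t
 have pp0: "pp >= 0" using \<alpha> by (simp add: pp_def)
 have "\<bar>k1 * ftime1 z + k2 * ftime2 z\<bar> <= \<beta> (snd z)" if z: "fst z \<in> torus_cell" "snd z \<in> {a<..<b}" for z
 proof -
  define T where "T = 1 / th (snd z)"
  have T: "T > 0" using th_pos[OF z(2)] by (simp add: T_def)
  have one: "1 <= (1 + T)\<^sup>2" "T <= (1 + T)\<^sup>2" "T^2 <= (1 + T)\<^sup>2"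
   using T by (auto simp: power2_eq_square algebra_simps)
  have AQ: "u * v <= A T" if "0 <= u" "u <= c1" "v <= (1 + T)\<^sup>2" "0 <= v" for u v
  proof -
   have "u * v <= c1 * (1 + T)\<^sup>2" using that c1 by (intro mult_mono) auto
   also have "... <= Q * (c1 * (1 + T)\<^sup>2)" using Q1 c1 mult_right_mono[of 1 Q "c1 * (1 + T)\<^sup>2"] by simp
   finally show ?thesis by (simp add: A_def mult_ac)
  qed
  have A1: "A T >= 1" using AQ[of 1 1] c1 one by simp
  have X0: "0 < X z" "X z <= s * M0 * T"
  proof -
   show "0 < X z" using s0 th_pos[OF z(2)] by (simp add: X_def)
   have "exp (l * \<eta> (fst z)) <= M0" using exps[of "fst z"] m0 by linarith
   then show "X z <= s * M0 * T" unfolding X_def T_def using s0 th_pos[OF z(2)] by (simp add: divide_right_mono)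
  qed
  have bbT: "\<bar>bb i z\<bar> <= l * s * M0 * M * T" for i
  proof -
   have "\<bar>bb i z\<bar> = l * X z * \<bar>e i (fst z)\<bar>" using l X0 by (simp add: bb_def abs_mult)
   also have "... <= l * (s * M0 * T) * M" using l X0 M M0pos s0 T by (intro mult_mono) auto
   finally show ?thesis by (simp add: mult_ac)
  qed
  have bbA: "\<bar>bb i z\<bar> <= A T" for i
   by (rule order_trans[OF bbT AQ]) (use c1 one T l s0 M0pos M in auto)
  have XA: "l^2 * X z <= A T"
  proof -
   have "l^2 * X z <= l^2 * (s * M0 * T)" using X0 by (intro mult_left_mono) auto
   also have "... = l^2 * s * M0 * T" by simp
   also have "... <= A T" by (rule AQ) (use c1 one T s0 M0pos in auto)
   finally show ?thesis .
  qed
  have ltA: "\<bar>lt z\<bar> <= A T"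
  proof -
   have d: "\<bar>a + b - 2 * snd z\<bar> <= b - a" using z by (auto simp: abs_le_iff)
   have m: "0 <= M0 - exp (l * \<eta> (fst z))" "M0 - exp (l * \<eta> (fst z)) <= M0" using exps[of "fst z"] m0 by auto
   have "\<bar>lt z\<bar> = s * (M0 - exp (l * \<eta> (fst z))) * \<bar>a + b - 2 * snd z\<bar> * T^2"
    unfolding lt_def T_def using m s0 by (simp add: abs_mult power_divide)
   also have "... <= s * M0 * (b - a) * T^2" using d m s0 M0pos ab by (intro mult_mono) auto
   also have "... <= A T" by (rule AQ) (use c1 one s0 M0pos ab in auto)
   finally show ?thesis .
  qed
  define x where "x = exp (ell z)"
  have x: "0 < x" "x <= exp (- (s * m0 * T))"
  proof -
   have "s * m0 * T <= s * ((M0 - exp (l * \<eta> (fst z))) / th (snd z))"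
   proof -
    have "m0 / th (snd z) <= (M0 - exp (l * \<eta> (fst z))) / th (snd z)"
     using exps[of "fst z"] th_pos[OF z(2)] by (intro divide_right_mono) auto
    then have "s * (m0 / th (snd z)) <= s * ((M0 - exp (l * \<eta> (fst z))) / th (snd z))"
     using s0 by (intro mult_left_mono) auto
    then show ?thesis unfolding T_def by (simp only: times_divide_eq_right mult_1_right)
   qed
   then show "x <= exp (- (s * m0 * T))" unfolding x_def ell_def by simp
  qed (simp add: x_def)
  have wA: "norm (w z) <= x * A T"
  proof -
   have "Q * 1 <= Q * (c1 * (1 + T)\<^sup>2)"
    using Q1 c1 one mult_mono[of 1 c1 1 "(1 + T)\<^sup>2"] by (intro mult_left_mono) auto
   then have "norm (q z) <= A T" using Q(1)[OF z] by (simp add: A_def mult_ac)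
   then show ?thesis using x by (simp add: w_def x_def)
  qed
  have wiA: "norm (wi i z) <= x * A T" for i
  proof -
   have "norm (qi i z + bb i z *R q z) <= Q + (l * s * M0 * M * T) * Q"
    using Q[OF z] bbT[of i] Q1 T l s0 M0pos M by (intro order_trans[OF norm_triangle_ineq] add_mono) (auto intro!: mult_mono)
   also have "... <= Q * (1 + T)\<^sup>2 + (l * s * M0 * M * (1 + T)\<^sup>2) * Q"
    using Q1 one l s0 M0pos M by (intro add_mono mult_right_mono mult_left_mono) auto
   also have "... = (1 + l * s * M0 * M) * (Q * (1 + T)\<^sup>2)" by (simp add: algebra_simps)
   also have "... <= c1 * (Q * (1 + T)\<^sup>2)" using c1' Q1 by (intro mult_right_mono) auto
   finally show ?thesis using x by (simp add: wi_def x_def A_def mult_ac)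
  qed
  have ww: "\<bar>u \<bullet> v\<bar> <= x^2 * (A T)\<^sup>2" if "norm u <= x * A T" "norm v <= x * A T" for u v :: 'b
  proof -
   have "\<bar>u \<bullet> v\<bar> <= norm u * norm v" by (rule Cauchy_Schwarz_ineq2)
   also have "... <= (x * A T) * (x * A T)" using that x A1 by (intro mult_mono) auto
   finally show ?thesis by (simp add: power2_eq_square mult_ac)
  qed
  define R where "R = x^2 * (A T) ^ 4"
  have pw: "x^2 * (A T)\<^sup>2 <= R" "x^2 * (A T) ^ 3 <= R"
   unfolding R_def using A1 by (auto intro!: mult_left_mono power_increasing)
  have J: "norm (J v) = norm v" for v by (simp add: norm_eq_sqrt_inner J_iso)
  have f1: "\<bar>\<Sum>i\<in>UNIV. wi i z \<bullet> wi i z\<bar> <= n * R"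
   unfolding n_def by (intro abs_sum_UNIV_le order_trans[OF ww pw(1)] wiA)
  have f2: "\<bar>(\<Sum>i\<in>UNIV. bb i z * bb i z) * (w z \<bullet> w z)\<bar> <= n * R"
  proof -
   have "\<bar>\<Sum>i\<in>UNIV. bb i z * bb i z\<bar> <= n * (A T)\<^sup>2"
    unfolding n_def
   proof (rule abs_sum_UNIV_le)
    show "\<bar>bb i z * bb i z\<bar> <= (A T)\<^sup>2" for i
     unfolding abs_mult power2_eq_square using A1 by (intro mult_mono bbA) auto
   qed
   then have "\<bar>(\<Sum>i\<in>UNIV. bb i z * bb i z) * (w z \<bullet> w z)\<bar> <= n * (A T)\<^sup>2 * (x^2 * (A T)\<^sup>2)"
    unfolding abs_mult using ww[OF wA wA] by (intro mult_mono) (auto simp: n_def)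
   then show ?thesis by (simp add: R_def power2_eq_square power4_eq_xxxx mult_ac)
  qed
  have f3: "\<bar>J (w z) \<bullet> (\<Sum>j\<in>UNIV. bb j z *R wi j z)\<bar> <= n * R"
  proof -
   have "\<bar>bb j z * (J (w z) \<bullet> wi j z)\<bar> <= R" for j
   proof -
    have "\<bar>bb j z * (J (w z) \<bullet> wi j z)\<bar> <= A T * (x^2 * (A T)\<^sup>2)"
     unfolding abs_mult using bbA ww[of "J (w z)" "wi j z"] wA wiA J A1 by (intro mult_mono) auto
    then show ?thesis using pw(2) by (simp add: power2_eq_square power3_eq_cube mult_ac)
   qed
   then show ?thesis unfolding n_def inner_sum_right inner_scaleR_right by (intro abs_sum_UNIV_le)
  qed
  have f4: "\<bar>lt z * (w z \<bullet> w z)\<bar> <= R"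
  proof -
   have "\<bar>lt z * (w z \<bullet> w z)\<bar> <= A T * (x^2 * (A T)\<^sup>2)"
    unfolding abs_mult using ltA ww[OF wA wA] A1 by (intro mult_mono) auto
   then show ?thesis using pw(2) by (simp add: power2_eq_square power3_eq_cube mult_ac)
  qed
  have "\<bar>ftime1 z\<bar> <= (pp / 2 * n + pp / 2 * n + \<bar>rr\<bar> * n + (rr^2 + pp^2) / 2) * R"
  proof -
   have "\<bar>ftime1 z\<bar> <= \<bar>pp / 2 * (\<Sum>i\<in>UNIV. wi i z \<bullet> wi i z)\<bar> + \<bar>pp / 2 * ((\<Sum>i\<in>UNIV. bb i z * bb i z) * (w z \<bullet> w z))\<bar>
    + \<bar>rr * (J (w z) \<bullet> (\<Sum>j\<in>UNIV. bb j z *R wi j z))\<bar> + \<bar>(rr^2 + pp^2) / 2 * (lt z * (w z \<bullet> w z))\<bar>"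
    unfolding ftime1_def flux_time_def minus_mult_left[symmetric] by linarith
   also have "... <= pp / 2 * (n * R) + pp / 2 * (n * R) + \<bar>rr\<bar> * (n * R) + (rr^2 + pp^2) / 2 * R"
    unfolding abs_mult[of "pp / 2"] abs_mult[of rr] abs_mult[of "(rr^2 + pp^2) / 2"]
    using f1 f2 f3 f4 pp0 by (intro add_mono) (auto intro!: mult_left_mono)
   finally show ?thesis by (simp add: algebra_simps)
  qed
  moreover have "\<bar>ftime2 z\<bar> <= R"
  proof -
   have "\<bar>ftime2 z\<bar> = (l^2 * X z) * \<bar>w z \<bullet> w z\<bar> / 2" using X0 by (simp add: ftime2_def abs_mult)
   also have "... <= A T * (x^2 * (A T)\<^sup>2) / 1" using XA ww[OF wA wA] A1 X0 by (intro frac_le mult_mono) auto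
   finally show ?thesis using pw(2) by (simp add: power2_eq_square power3_eq_cube mult_ac)
  qed
  ultimately have "\<bar>k1\<bar> * \<bar>ftime1 z\<bar> + \<bar>k2\<bar> * \<bar>ftime2 z\<bar>
    <= \<bar>k1\<bar> * ((pp / 2 * n + pp / 2 * n + \<bar>rr\<bar> * n + (rr^2 + pp^2) / 2) * R) + \<bar>k2\<bar> * R"
   by (intro add_mono mult_left_mono) simp_all
  also have "... = k * R" by (simp only: k_def distrib_right mult.assoc)
  finally have "\<bar>k1 * ftime1 z + k2 * ftime2 z\<bar> <= k * R"
   using abs_triangle_ineq[of "k1 * ftime1 z" "k2 * ftime2 z"] unfolding abs_mult by linarith
  also have "R <= (A T) ^ 4 * exp (- 2 * (s * m0 * T))"
  proof -
   have "x^2 <= (exp (- (s * m0 * T)))\<^sup>2" using x by (intro power_mono) auto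
   also have "... = exp (- 2 * (s * m0 * T))" by (simp add: power2_eq_square flip: exp_add)
   finally show ?thesis unfolding R_def
    using mult_right_mono[of "x^2" "exp (- 2 * (s * m0 * T))" "(A T) ^ 4"] by (simp add: mult.commute)
  qed
  finally show ?thesis using pp0 unfolding \<beta>_def B_def T_def[symmetric]
   by (simp add: k_def n_def mult_left_mono)
 qed
 moreover have "(\<beta> \<longlongrightarrow> 0) F" if "filterlim (\<lambda>t. 1 / th t) at_top F" for F
 proof -
  define c where "c = 2 * (s * m0)"
  have "c > 0" using s0 m0 by (simp add: c_def)
  then have "((\<lambda>T. (1 + T) ^ 8 * exp (- (c * T))) \<longlongrightarrow> 0) at_top" by real_asymp
  then have "((\<lambda>T. k * (Q * c1) ^ 4 * ((1 + T) ^ 8 * exp (- (c * T)))) \<longlongrightarrow> 0) at_top"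
   by (rule tendsto_mult_right_zero)
  moreover have "B = (\<lambda>T. k * (Q * c1) ^ 4 * ((1 + T) ^ 8 * exp (- (c * T))))"
   by (simp add: fun_eq_iff B_def A_def c_def power_mult_distrib mult_ac flip: power_mult)
  ultimately have "(B \<longlongrightarrow> 0) at_top" by simp
  then show ?thesis unfolding \<beta>_def[abs_def] by (rule filterlim_compose[OF _ that])
 qed
 moreover have "filterlim (\<lambda>t. 1 / th t) at_top (at_right a)"
  unfolding th_def using ab by real_asymp
 moreover have "filterlim (\<lambda>t. 1 / th t) at_top (at_left b)"
  unfolding th_def using ab by real_asymp
 ultimately show ?thesis by blast
qed

end

section \<open>The Carleman inequality for smooth functions\<close>

definition interval_xi :: "(real ^ 'n => real) => real => real => real => (real ^ 'n) \<times> real => real" where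
 "interval_xi \<eta> l a b z = exp (l * \<eta> (fst z)) / ((snd z - a) * (b - snd z))"

definition interval_phi :: "(real ^ 'n => real) => real => real => real => (real ^ 'n) \<times> real => real" where
 "interval_phi \<eta> l a b z = (exp (2 * l * sup_norm \<eta>) - exp (l * \<eta> (fst z))) / ((snd z - a) * (b - snd z))"

text \<open>
  The weights of an arbitrary time interval. The inequality is applied on interior intervals, where
  mollified solutions satisfy the equation, and compared to the weights of the full interval later.
\<close>

abbreviation "decay \<eta> l s a b z \<equiv> exp (- 2 * s * interval_phi \<eta> l a b z)"
abbreviation "cubic \<eta> l s a b z \<equiv> s ^ 3 * l ^ 4 * interval_xi \<eta> l a b z ^ 3"
abbreviation "recip \<eta> l s a b z \<equiv> inverse (s * interval_xi \<eta> l a b z)"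

abbreviation "carleman_left \<eta> l s a b q z \<equiv> decay \<eta> l s a b z *
 (recip \<eta> l s a b z * (nsq (time_deriv q z) + nsq (laplacian q z)) + cubic \<eta> l s a b z * nsq (q z))"

abbreviation "carleman_right \<eta> \<omega> l s a b F q z \<equiv> decay \<eta> l s a b z * nsq F
 + indicator \<omega> (fst z) * (decay \<eta> l s a b z * (cubic \<eta> l s a b z * nsq (q z)))"

abbreviation "heat_operator \<alpha> \<gamma> J q z \<equiv> time_deriv q z + (\<alpha> *R laplacian q z - \<gamma> *R J (laplacian q z))"

definition "carleman_estimate \<eta> \<omega> \<alpha> \<gamma> J C l s a b q \<longleftrightarrow> (\<integral>\<^sup>+z. ennreal (carleman_left \<eta> l s a b q z) \<partial>cyl {a<..<b})
 <= (\<integral>\<^sup>+z. ennreal (C * carleman_right \<eta> \<omega> l s a b (heat_operator \<alpha> \<gamma> J q z) q z) \<partial>cyl {a<..<b})"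

lemma measurable_cyl_continuous:
 fixes f :: "(real ^ 'n) \<times> real => 'b::topological_space"
 assumes "continuous_on (UNIV \<times> I) f"
 shows "f \<in> borel_measurable (cyl I)"
proof -
 have "f \<in> borel_measurable (restrict_space borel (UNIV \<times> I))"
  using assms by (rule borel_measurable_continuous_on_restrict)
 then have "f \<in> borel_measurable (restrict_space borel (torus_cell \<times> I))"
  by (rule measurable_restrict_mono) auto
 then show ?thesis unfolding cyl_def
  by (subst measurable_cong_sets[OF sets_restrict_space_cong[OF sets_lborel] refl])
qed

text \<open>Off \<open>\<omega>\<^sub>0\<close>, the gradient is bounded away from zero by compactness of the torus.\<close>

lemma gradient_lower_bound:
 fixes g :: "real ^ 'n => real"
 assumes g: "continuous_on UNIV g" "torus_periodic g" and S: "torus_set S" "open S"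
  and pos: "\<And>x. x \<notin> S ==> g x > 0"
 obtains c where "c > 0" "\<And>x. x \<notin> S ==> c <= g x"
proof -
 let ?K = "cbox (0 :: real ^ 'n) (\<chi> i. 2 * pi) - S"
 have K: "compact ?K" using S(2) by (intro compact_diff) auto
 have "\<exists>c>0. \<forall>x\<in>?K. c <= g x"
 proof (cases "?K = {}")
  case False
  then obtain y where "y \<in> ?K" "\<forall>x\<in>?K. g y <= g x"
   using continuous_attains_inf[OF K _ continuous_on_subset[OF g(1)]] by blast
  then show ?thesis using pos[of y] by blast
 qed (auto intro: exI[of _ 1])
 then obtain c where c: "c > 0" "\<And>x. x \<in> ?K ==> c <= g x" by blast
 have "c <= g x" if "x \<notin> S" for x
 proof -
  have "torus_periodic (\<lambda>x. (g x, x \<in> S))"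
   using g(2) S(1) unfolding torus_set_def torus_periodic_def by auto
  then obtain y where "y \<in> torus_cell" "(g x, x \<in> S) = (g y, y \<in> S)"
   using torus_representative[of x] by metis
  then show ?thesis using c(2)[of y] that torus_cell_subset by auto
 qed
 then show thesis using that c(1) by blast
qed

text \<open>
  The pointwise terms combine by the absorption lemma; the divergence integrates to zero. The
  constants are uniform in the time interval, which is needed when it is exhausted from inside.
\<close>

theorem smooth_carleman:
 fixes \<eta> :: "real ^ 'n => real" and \<omega>\<^sub>0 :: "(real ^ 'n) set" and J :: "'b::euclidean_space => 'b" and \<alpha> \<gamma> :: real
 assumes \<eta>: "C_k 4 \<eta>" "torus_periodic \<eta>" "\<And>x. \<eta> x > 0"
  and \<omega>\<^sub>0: "torus_set \<omega>\<^sub>0" "open \<omega>\<^sub>0" "\<And>x. x \<notin> \<omega>\<^sub>0 ==> norm (grad \<eta> x) > 0"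
  and \<alpha>: "\<alpha> > 0"
  and J: "linear J" "\<And>x y. J x \<bullet> y = - (x \<bullet> J y)" "\<And>x y. J x \<bullet> J y = x \<bullet> y" "\<And>x. J (J x) = - x"
 shows "\<exists>l0 s0 C. l0 >= 1 \<and> s0 >= 1 \<and> C > 0 \<and> (\<forall>(q :: (real ^ 'n) \<times> real => 'b) a b l s.
  a < b \<and> C_k 2 q \<and> (\<forall>t. torus_periodic (\<lambda>x. q (x, t))) \<and> l >= l0 \<and>
  s >= s0 * (exp (2 * l * sup_norm \<eta>) * (b - a) + (b - a)\<^sup>2) \<longrightarrow>
  carleman_estimate \<eta> \<omega>\<^sub>0 \<alpha> \<gamma> J C l s a b q)"
proof -
 interpret W: carleman_weights \<eta> 1 1 0 1 by unfold_locales (use \<eta> in auto)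
 have bound: "\<exists>K\<ge>1. \<forall>x. \<bar>f x\<bar> <= K" if h: "C_k k f" "torus_periodic f" for f :: "real ^ 'n => real" and k
 proof -
  obtain K where "K > 0" "\<And>x. norm (f x) <= K" using continuous_periodic_bounded[OF C_k_continuous[OF h(1)] h(2)] by blast
  then show ?thesis by (intro exI[of _ "1 + K"]) (auto intro: order_trans[of _ K])
 qed
 obtain K1 where K1: "\<And>i x. \<bar>W.e i x\<bar> <= K1 i" "\<And>i. K1 i >= 1"
  using bound[OF W.C_k_e W.periodic_coefficients(1)] by metis
 obtain K2 where K2: "\<And>i j x. \<bar>W.ee i j x\<bar> <= K2 i j" "\<And>i j. K2 i j >= 1"
  using bound[OF W.C_k_ee W.periodic_coefficients(2)] by metis
 obtain K3 where K3: "\<And>i x. \<bar>W.dl i x\<bar> <= K3 i" "\<And>i. K3 i >= 1"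
  using bound[OF W.C_k_dl W.periodic_coefficients(4)] by metis
 define M where "M = 1 + (\<Sum>i\<in>UNIV. K1 i) + (\<Sum>i\<in>UNIV. \<Sum>j\<in>UNIV. K2 i j) + (\<Sum>i\<in>UNIV. K3 i)"
 have nn: "0 <= K1 i" "0 <= K2 i j" "0 <= K3 i" for i j using K1(2)[of i] K2(2)[of i j] K3(2)[of i] by auto
 have sums: "0 <= (\<Sum>i\<in>UNIV. K1 i)" "0 <= (\<Sum>i\<in>UNIV. \<Sum>j\<in>UNIV. K2 i j)" "0 <= (\<Sum>i\<in>UNIV. K3 i)"
  using nn by (auto intro!: sum_nonneg)
 have M: "M >= 1" "\<bar>W.e i x\<bar> <= M" "\<bar>W.ee i j x\<bar> <= M" "\<bar>W.dl i x\<bar> <= M" for i j x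
 proof -
  have "K1 i <= (\<Sum>i\<in>UNIV. K1 i)" "K3 i <= (\<Sum>i\<in>UNIV. K3 i)" using nn by (auto intro!: member_le_sum)
  moreover have "K2 i j <= (\<Sum>j\<in>UNIV. K2 i j)" using nn by (auto intro!: member_le_sum)
  moreover have "(\<Sum>j\<in>UNIV. K2 i j) <= (\<Sum>i\<in>UNIV. \<Sum>j\<in>UNIV. K2 i j)"
   using nn by (intro member_le_sum) (auto intro!: sum_nonneg)
  ultimately show "M >= 1" "\<bar>W.e i x\<bar> <= M" "\<bar>W.ee i j x\<bar> <= M" "\<bar>W.dl i x\<bar> <= M"
   using K1(1)[of i x] K2(1)[of i j x] K3(1)[of i x] sums unfolding M_def by linarith+
 qed
 have Egrad: "W.E x = nsq (grad \<eta> x)" for x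
  by (simp add: W.E_def W.e_def grad_def norm_vec_def L2_set_def sum_nonneg power2_eq_square)
 have "continuous_on UNIV W.E" unfolding W.E_def[abs_def]
  by (intro continuous_on_sum continuous_on_mult C_k_continuous[OF W.C_k_e])
 moreover have "torus_periodic W.E"
  using W.periodic_coefficients(1) unfolding W.E_def[abs_def] torus_periodic_def by simp
 ultimately obtain c0 where c0: "c0 > 0" "\<And>x. x \<notin> \<omega>\<^sub>0 ==> c0 <= W.E x"
  by (rule gradient_lower_bound[OF _ _ \<omega>\<^sub>0(1,2)]) (use \<omega>\<^sub>0(3) Egrad in auto)
 define \<rho> p r N where "\<rho> = sqrt (\<alpha>^2 + \<gamma>^2)" and "p = \<alpha> / \<rho>^2" and "r = \<gamma> / \<rho>^2"
  and "N = 10 * (real CARD('n))\<^sup>2 * M ^ 3"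
 have \<rho>: "\<rho> > 0" unfolding \<rho>_def using \<alpha> by (simp add: sum_power2_gt_zero_iff)
 have p: "p > 0" unfolding p_def using \<alpha> \<rho> by simp
 have N: "N > 0" unfolding N_def using M(1) by simp
 define C3 K K4 where "C3 = (3 + 2 * \<bar>r\<bar> + 2 * p + p^2 + r^2) * N"
  and "K = 3 + 5 * (\<rho> * N)\<^sup>2 / \<alpha> + 2 * \<alpha> * N"
  and "K4 = (1 + 2 / \<rho>^2) * (4 / p^2 * (1 + 5 * N^2 + (\<bar>r\<bar> + p)\<^sup>2)) + 2 / \<rho>^2"
 have C3: "C3 >= 0" unfolding C3_def using p N by simp
 have K: "K > 0" unfolding K_def using \<alpha> N by (intro add_pos_pos add_pos_nonneg) auto
 have K4: "K4 >= 0" unfolding K4_def by (intro add_nonneg_nonneg mult_nonneg_nonneg) auto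
 obtain \<epsilon> C k1 k2 where \<epsilon>: "\<epsilon> > 0" "C > 0" and absorb: "\<And>Q W G F E D D' LH \<epsilon>' (ind::real).
  Q >= 0 \<and> W >= 0 \<and> G >= 0 \<and> F >= 0 \<and> ind >= 0 \<and> (ind >= 1 \<or> E >= c0) \<and> 0 <= \<epsilon>' \<and> \<epsilon>' <= \<epsilon> \<and>
  Q + 2 * (2 * E^2 * W - C3 * \<epsilon>' * (W + G) + D) <= F / \<rho>^2 \<and>
  \<alpha> / 2 * G <= F + K * W + D' \<and> LH <= K4 * (Q + W + G + F) ==>
  LH + W <= C * (F + ind * W) + k1 * D + k2 * D'"
  using carleman_absorption[OF \<alpha> c0(1) K C3 K4 \<rho>] by blast
 define l0 where "l0 = max 1 (2 / \<epsilon>)"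
 have l0: "l0 >= 1" "1 / x <= \<epsilon> / 2" if "x >= l0" for x
 proof -
  have "2 / \<epsilon> <= x" "x >= 1" using that by (auto simp: l0_def)
  then show "1 / x <= \<epsilon> / 2" using \<epsilon> by (simp add: field_simps)
 qed (simp add: l0_def)
 show ?thesis
 proof (rule exI[of _ l0], rule exI[of _ l0], rule exI[of _ C], intro conjI allI impI)
  show "l0 >= 1" "l0 >= 1" by (simp_all add: l0_def)
  fix q :: "(real ^ 'n) \<times> real => 'b" and a b l s :: real
  assume A: "a < b \<and> C_k 2 q \<and> (\<forall>t. torus_periodic (\<lambda>x. q (x, t))) \<and> l >= l0 \<and>
   s >= l0 * (exp (2 * l * sup_norm \<eta>) * (b - a) + (b - a)\<^sup>2)"
  then interpret S: carleman_solution \<eta> l s a b q J \<alpha> \<gamma>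
   by (intro carleman_solution.intro carleman_weights.intro carleman_solution_axioms.intro) (use \<eta> J \<alpha> in auto)
  have l: "l >= 1" and s: "s >= l0 * (exp (2 * l * sup_norm \<eta>) * (b - a) + (b - a)\<^sup>2)" and ll: "l >= l0"
   using A l0(1)[of l] by (auto simp: l0_def)
  have s0: "l0 >= 1" by (simp add: l0_def)
  have s_pos: "s > 0" by (rule S.s_bounds(1)[OF l \<eta>(3) s0 s])
  obtain \<beta> where \<beta>: "\<And>z. fst z \<in> torus_cell ==> snd z \<in> {a<..<b} ==> \<bar>k1 * S.ftime1 z + k2 * S.ftime2 z\<bar> <= \<beta> (snd z)"
   "(\<beta> \<longlongrightarrow> 0) (at_right a)" "(\<beta> \<longlongrightarrow> 0) (at_left b)"
   using S.time_flux_vanishes[OF l \<eta>(3) s_pos M(1,2)] by blast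
  have const_eqs: "S.\<rho> = \<rho>" "S.pp = p" "S.rr = r"
   by (simp_all add: S.\<rho>_def S.pp_def S.rr_def \<rho>_def p_def r_def)
  have X: "s * interval_xi \<eta> l a b z = S.X z" for z by (simp add: interval_xi_def S.X_def S.th_def)
  have ell: "decay \<eta> l s a b z = exp (2 * S.ell z)" for z
   by (simp add: interval_phi_def S.ell_def S.th_def S.M0_def)
  have sq: "nsq (exp (S.ell z) *R v) = exp (2 * S.ell z) * nsq v" for z and v :: 'b
  proof -
   have "exp (2 * S.ell z) = exp (S.ell z) * exp (S.ell z)" by (simp flip: exp_add)
   then show ?thesis by (simp add: power_mult_distrib power2_eq_square)
  qed
  have W: "cubic \<eta> l s a b z = l ^ 4 * (S.X z) ^ 3" for z
   by (simp add: X[symmetric] power_mult_distrib)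
  define f where "f z = exp (2 * S.ell z) * (inverse (S.X z) * (nsq (S.qt z) + nsq (laplacian q z))
    + l ^ 4 * (S.X z) ^ 3 * nsq (q z))" for z
  define g where "g z = C * (exp (2 * S.ell z) * nsq (S.qt z + S.cc (laplacian q z))
    + indicator \<omega>\<^sub>0 (fst z) * (exp (2 * S.ell z) * (l ^ 4 * (S.X z) ^ 3 * nsq (q z))))" for z
  have X0: "S.X z > 0" if "snd z \<in> {a<..<b}" for z
   using S.weight_bounds(1)[OF l \<eta>(3) s0 s that] s0 by linarith
  have lap: "continuous_on UNIV (laplacian q)"
  proof -
   have "laplacian q = (\<lambda>z. \<Sum>i\<in>UNIV. S.qij i i z)"
    by (simp add: fun_eq_iff laplacian_def S.qij_def S.qi_def)
   then show ?thesis using C_k_continuous[OF S.C_k_q(3)] by (simp add: continuous_on_sum)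
  qed
  note c = continuous_on_subset[OF lap] continuous_on_subset[OF C_k_continuous[OF S.C_k_q(2)]]
   continuous_on_subset[OF C_k_continuous[OF S.q_smooth]]
  have nz: "\<forall>z\<in>UNIV \<times> {a<..<b}. S.X z \<noteq> 0"
  proof
   fix z :: "(real ^ 'n) \<times> real" assume "z \<in> UNIV \<times> {a<..<b}"
   then show "S.X z \<noteq> 0" using X0[of z] by auto
  qed
  have cf: "continuous_on (UNIV \<times> {a<..<b}) f" unfolding f_def
   by (intro continuous_intros c S.continuous_weights) (use nz in auto)
  have cc: "continuous_on (UNIV \<times> {a<..<b}) (\<lambda>z. S.cc (laplacian q z))"
   by (rule bounded_linear.continuous_on[OF S.cc_bounded]) (intro c, simp)
  have gm: "g \<in> borel_measurable (cyl {a<..<b})"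
  proof -
   have 1: "(\<lambda>z. exp (2 * S.ell z) * nsq (S.qt z + S.cc (laplacian q z))) \<in> borel_measurable (cyl {a<..<b})"
    by (rule measurable_cyl_continuous) (intro continuous_intros c S.continuous_weights cc; simp)
   have 2: "(\<lambda>z. exp (2 * S.ell z) * (l ^ 4 * (S.X z) ^ 3 * nsq (q z))) \<in> borel_measurable (cyl {a<..<b})"
    by (rule measurable_cyl_continuous) (intro continuous_intros c S.continuous_weights; simp)
   have "(\<lambda>z. indicator \<omega>\<^sub>0 (fst z) :: real) \<in> borel_measurable (borel :: ((real ^ 'n) \<times> real) measure)"
    using \<omega>\<^sub>0(2) by (intro measurable_compose[OF borel_measurable_continuous_onI[OF continuous_on_fst[OF continuous_on_id]]] borel_measurable_indicator) auto
   then have 3: "(\<lambda>z. indicator \<omega>\<^sub>0 (fst z) :: real) \<in> borel_measurable (cyl {a<..<b})" by (rule borel_measurable_cylI)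
   show ?thesis unfolding g_def by (intro borel_measurable_times borel_measurable_add 1 2 3 borel_measurable_const)
  qed
  have shift: "torus_periodic (\<lambda>x. h (x, t))" if "\<And>z k. h (z + (axis k (2 * pi), 0)) = h z" for h :: "(real ^ 'n) \<times> real => real" and t
   using that[of "(_, t)"] unfolding torus_periodic_def by simp
  have "(\<integral>\<^sup>+z. ennreal (f z) \<partial>cyl {a<..<b}) <= (\<integral>\<^sup>+z. ennreal (g z) \<partial>cyl {a<..<b})"
  proof (rule nn_integral_cyl_mono_divergence[where X = "\<lambda>i z. k1 * S.flux1 i z + k2 * S.flux2 i z"
     and dX = "\<lambda>i z. k1 * S.dflux1 i z + k2 * S.dflux2 i z" and Y = "\<lambda>z. k1 * S.ftime1 z + k2 * S.ftime2 z"
     and dY = "\<lambda>z. k1 * S.dftime1 z + k2 * S.dftime2 z" and \<beta> = \<beta>])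
   show "a < b" by (rule S.ab)
   show "f \<in> borel_measurable (cyl {a<..<b})" by (rule measurable_cyl_continuous[OF cf])
   show "g \<in> borel_measurable (cyl {a<..<b})" by (rule gm)
   show "0 <= f (x, t)" "0 <= g (x, t)" if "t \<in> {a<..<b}" for x t
    using X0[of "(x, t)"] that \<epsilon>(2) unfolding f_def g_def by (auto intro!: mult_nonneg_nonneg add_nonneg_nonneg)
   show "torus_periodic (\<lambda>x. k1 * S.flux1 i (x, t) + k2 * S.flux2 i (x, t))"
    "torus_periodic (\<lambda>x. k1 * S.dflux1 i (x, t) + k2 * S.dflux2 i (x, t))" for i t
    by (rule shift, simp only: S.flux_shift)+
   show "has_partial (\<lambda>z. k1 * S.flux1 i z + k2 * S.flux2 i z) (k1 * S.dflux1 i (x, t) + k2 * S.dflux2 i (x, t)) (axis i 1, 0) (x, t)" for i x t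
    by (intro has_partial_add has_partial_cmult S.partial_flux1 S.partial_flux2)
   show "has_partial (\<lambda>z. k1 * S.ftime1 z + k2 * S.ftime2 z) (k1 * S.dftime1 (x, t) + k2 * S.dftime2 (x, t)) (0, 1) (x, t)"
    if "t \<in> {a<..<b}" for x t
    using that by (intro has_partial_add has_partial_cmult S.partial_ftime1 S.partial_ftime2) auto
   show "continuous_on (UNIV \<times> {a<..<b}) (\<lambda>z. k1 * S.dflux1 i z + k2 * S.dflux2 i z)" for i
    by (intro continuous_intros S.flux_continuous)
   show "continuous_on (UNIV \<times> {a<..<b}) (\<lambda>z. k1 * S.dftime1 z + k2 * S.dftime2 z)"
    by (intro continuous_intros S.flux_continuous)
   show "\<bar>k1 * S.ftime1 (x, t) + k2 * S.ftime2 (x, t)\<bar> <= \<beta> t" if "x \<in> torus_cell" "t \<in> {a<..<b}" for x t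
    using \<beta>(1)[of "(x, t)"] that by simp
   show "(\<beta> \<longlongrightarrow> 0) (at_right a)" "(\<beta> \<longlongrightarrow> 0) (at_left b)" by (rule \<beta>(2), rule \<beta>(3))
   fix x :: "real ^ 'n" and t assume t: "t \<in> {a<..<b}"
   let ?z = "(x, t)"
   have tz: "snd ?z \<in> {a<..<b}" using t by simp
   define Q where "Q = nsq (- 2 *R (\<Sum>j\<in>UNIV. S.bb j ?z *R S.wi j ?z) - S.L ?z *R S.w ?z + p *R S.wt ?z - (r * S.lt ?z) *R J (S.w ?z))"
   define Ww where "Ww = l ^ 4 * (S.X ?z) ^ 3 * nsq (S.w ?z)"
   define G where "G = l^2 * S.X ?z * (\<Sum>j\<in>UNIV. S.wi j ?z \<bullet> S.wi j ?z)"
   define F where "F = nsq (exp (S.ell ?z) *R (S.qt ?z + S.cc (laplacian q ?z)))"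
   note P = S.pointwise_terms[OF l \<eta>(3) s0 s M tz, unfolded const_eqs, folded N_def Q_def Ww_def G_def F_def C3_def K_def K4_def]
   have eps: "0 <= 1 / l + 1 / l0" "1 / l + 1 / l0 <= \<epsilon>"
    using l0(2)[of l] l0(2)[of l0] ll l s0 by auto
   have "inverse (S.X ?z) * (nsq (exp (S.ell ?z) *R S.qt ?z) + nsq (exp (S.ell ?z) *R laplacian q ?z)) + Ww
    <= C * (F + indicator \<omega>\<^sub>0 x * Ww) + k1 * ((\<Sum>i\<in>UNIV. S.dflux1 i ?z) + S.dftime1 ?z)
     + k2 * ((\<Sum>i\<in>UNIV. S.dflux2 i ?z) + S.dftime2 ?z)"
   proof (rule absorb[of Q Ww G F "indicator \<omega>\<^sub>0 x" "W.E x" "1 / l + 1 / l0"], intro conjI)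
    show "Q >= 0" "F >= 0" by (simp_all add: Q_def F_def)
    show "Ww >= 0" "G >= 0" using X0[OF tz] by (auto simp: Ww_def G_def intro!: mult_nonneg_nonneg sum_nonneg)
    show "(0::real) <= indicator \<omega>\<^sub>0 x" by simp
    show "(1::real) <= indicator \<omega>\<^sub>0 x \<or> c0 <= W.E x" using c0(2)[of x] by (auto simp: indicator_def)
    show "Q + 2 * (2 * (W.E x)\<^sup>2 * Ww - C3 * (1 / l + 1 / l0) * (Ww + G) + ((\<Sum>i\<in>UNIV. S.dflux1 i ?z) + S.dftime1 ?z)) <= F / \<rho>^2"
     using P(1) by (simp add: C3_def)
    show "0 <= 1 / l + 1 / l0" "1 / l + 1 / l0 <= \<epsilon>" by (rule eps)+
    show "\<alpha> / 2 * G <= F + K * Ww + ((\<Sum>i\<in>UNIV. S.dflux2 i ?z) + S.dftime2 ?z)"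
     using P(2) by (simp only: K_def)
    show "inverse (S.X ?z) * (nsq (exp (S.ell ?z) *R S.qt ?z) + nsq (exp (S.ell ?z) *R laplacian q ?z))
      <= K4 * (Q + Ww + G + F)" using P(3) by (simp only: K4_def)
   qed
   moreover have "f ?z = inverse (S.X ?z) * (nsq (exp (S.ell ?z) *R S.qt ?z) + nsq (exp (S.ell ?z) *R laplacian q ?z)) + Ww"
    unfolding f_def Ww_def sq S.w_def by (simp add: algebra_simps)
   moreover have "g ?z = C * (F + indicator \<omega>\<^sub>0 x * Ww)"
    unfolding g_def Ww_def F_def sq S.w_def by (simp add: mult_ac)
   moreover have "(\<Sum>i\<in>UNIV. k1 * S.dflux1 i ?z + k2 * S.dflux2 i ?z) + (k1 * S.dftime1 ?z + k2 * S.dftime2 ?z)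
    = k1 * ((\<Sum>i\<in>UNIV. S.dflux1 i ?z) + S.dftime1 ?z) + k2 * ((\<Sum>i\<in>UNIV. S.dflux2 i ?z) + S.dftime2 ?z)"
    by (simp add: sum.distrib sum_distrib_left distrib_left)
   ultimately show "f ?z <= g ?z + (\<Sum>i\<in>UNIV. k1 * S.dflux1 i ?z + k2 * S.dflux2 i ?z) + (k1 * S.dftime1 ?z + k2 * S.dftime2 ?z)"
    by linarith
  qed
  then show "carleman_estimate \<eta> \<omega>\<^sub>0 \<alpha> \<gamma> J C l s a b q"
   unfolding carleman_estimate_def X W ell f_def g_def S.qt_def S.cc_def .
 qed (rule \<epsilon>(2))
qed

section \<open>Mollifiers\<close>

text \<open>
  The family is closed under differentiation up to linear combinations, whence smoothness at the origin by induction.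
\<close>

definition flat :: "nat => real => real" where
 "flat j t = (if t > 0 then exp (- 1 / t) / t ^ j else 0)"

lemma flat_deriv: "(flat j has_real_derivative - real j * flat (Suc j) t + flat (j + 2) t) (at t)"
proof (cases "t = 0")
 case False
 show ?thesis
 proof (cases "t > 0")
  case True
  have "((\<lambda>t. exp (- 1 / t) / t ^ j) has_real_derivative - real j * flat (Suc j) t + flat (j + 2) t) (at t)"
  proof (cases j)
   case 0
   then show ?thesis using True
    by (auto intro!: derivative_eq_intros simp: flat_def field_simps power2_eq_square)
  next
   case (Suc n)
   have e: "((\<lambda>t. exp (- 1 / t)) has_real_derivative exp (- 1 / t) / t^2) (at t)"
    using True by (auto intro!: derivative_eq_intros simp: power2_eq_square)
   have "((\<lambda>t. t ^ Suc n) has_real_derivative real (Suc n) * t ^ n) (at t)"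
    using DERIV_pow[of "Suc n" t UNIV] by simp
   from DERIV_divide[OF e this] show ?thesis unfolding Suc
    by (rule DERIV_cong) (use True in \<open>auto simp: flat_def field_simps power2_eq_square\<close>)
  qed
  then show ?thesis
   by (rule DERIV_cong_ev[OF refl _ refl, THEN iffD1, rotated])
    (use True in \<open>auto simp: flat_def intro: eventually_mono[OF eventually_gt_at_top] eventually_nhds_in_open[of "{0<..}", THEN eventually_mono]\<close>)
 next
  case neg: False
  have "((\<lambda>t. 0) has_real_derivative 0) (at t)" by simp
  then have "(flat j has_real_derivative 0) (at t)"
  proof (rule has_field_derivative_transform_within_open[of _ _ _ "{..<0}"])
  qed (use neg False in \<open>auto simp: flat_def\<close>)
  then show ?thesis using neg by (simp add: flat_def)
 qed
next
 case True
 have r: "((\<lambda>h. exp (- 1 / h) / h ^ Suc j) \<longlongrightarrow> 0) (at_right (0 :: real))" by real_asymp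
 have "((\<lambda>h. flat j h / h) \<longlongrightarrow> 0) (at_right 0)"
  by (rule Lim_transform_eventually[OF r]) (auto simp: flat_def eventually_at_filter)
 moreover have "((\<lambda>h. flat j h / h) \<longlongrightarrow> 0) (at_left 0)"
  by (rule Lim_transform_eventually[OF tendsto_const]) (auto simp: flat_def eventually_at_filter)
 ultimately have "((\<lambda>h. flat j h / h) \<longlongrightarrow> 0) (at 0)" by (simp add: filterlim_split_at)
 then show ?thesis using True by (simp add: has_field_derivative_iff flat_def)
qed

lemma C_k_flat: "C_k k (flat j)"
proof (induction k arbitrary: j)
 case 0
 show ?case using flat_deriv DERIV_isCont by (simp add: continuous_on_eq_continuous_at) blast
next
 case (Suc k)
 show ?case
 proof (rule C_k_SucI)
  show "(flat j has_derivative (\<lambda>v. (- real j * flat (Suc j) x + flat (j + 2) x) * v)) (at x)" for x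
   using flat_deriv by (simp add: has_field_derivative_def)
  show "C_k k (\<lambda>x. (- real j * flat (Suc j) x + flat (j + 2) x) * v)" for v
   by (intro C_k_mult C_k_add C_k_const Suc)
 qed
qed

definition bump :: "real => real" where
 "bump t = flat 0 (1 + t) * flat 0 (1 - t)"

lemma bump_pos: "\<bar>t\<bar> < 1 ==> bump t > 0" and bump_nonneg: "bump t >= 0" and bump_zero: "\<bar>t\<bar> >= 1 ==> bump t = 0"
 and bump_even: "bump (- t) = bump t"
 by (auto simp: bump_def flat_def mult.commute)

lemma C_k_bump: "C_k k bump"
proof -
 have "C_k k (\<lambda>t. flat 0 (1 + t))" using C_k_affine[OF bounded_linear_ident C_k_flat] .
 moreover have "C_k k (\<lambda>t. flat 0 (1 + - t))" using C_k_affine[OF bounded_linear_minus[OF bounded_linear_ident] C_k_flat] .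
 ultimately have "C_k k (\<lambda>t. flat 0 (1 + t) * flat 0 (1 + - t))" by (rule C_k_mult)
 then show ?thesis by (simp add: bump_def[abs_def])
qed

lemma C_k_cos_sin: "C_k k (\<lambda>t::real. cos t) \<and> C_k k (\<lambda>t::real. sin t)"
proof (induction k)
 case 0 then show ?case by (auto intro: continuous_intros)
next
 case (Suc k)
 have "C_k k (\<lambda>x::real. - sin x * v)" "C_k k (\<lambda>x::real. cos x * v)" for v
  using C_k_mult[OF C_k_mult[OF C_k_const[of k "-1::real"] conjunct2[OF Suc]] C_k_const[of k v]]
   C_k_mult[OF conjunct1[OF Suc] C_k_const[of k v]] by simp_all
 moreover have "(cos has_derivative (\<lambda>v. - sin x * v)) (at x)" "(sin has_derivative (\<lambda>v. cos x * v)) (at x)" for x :: real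
  by (rule DERIV_cos[unfolded has_field_derivative_def], rule DERIV_sin[unfolded has_field_derivative_def])
 ultimately show ?case
  using C_k_SucI[of cos "\<lambda>x v. - sin x * v" k] C_k_SucI[of sin "\<lambda>x v. cos x * v" k] by blast
qed

lemma C_k_power: "C_k k f ==> C_k k (\<lambda>x. f x ^ m :: real)"
 by (induction m) (auto intro: C_k_const C_k_mult)

lemma C_k_prod: "finite I ==> (\<And>i. i \<in> I ==> C_k k (f i)) ==> C_k k (\<lambda>x. \<Prod>i\<in>I. f i x :: real)"
 by (induction I rule: finite_induct) (auto intro: C_k_const C_k_mult)

text \<open>
  A trigonometric polynomial with values in the unit interval that equals one only at the lattice
  points, so that its normalised powers are mollifiers that are periodic by themselves.
\<close>

definition peak :: "real ^ 'n => real" where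
 "peak x = (\<Prod>i\<in>UNIV. (1 + cos (x $ i)) / 2)"

lemma peak_bounds: "0 <= peak x" "peak x <= 1"
proof -
 have "0 <= (1 + cos y) / 2" "(1 + cos y) / 2 <= 1" for y :: real
  using cos_ge_minus_one[of y] cos_le_one[of y] by (auto simp del: cos_ge_minus_one cos_le_one)
 then show "0 <= peak x" "peak x <= 1" unfolding peak_def by (auto intro!: prod_nonneg prod_le_1)
qed

lemma peak_le: "peak x <= (1 + cos (x $ i)) / 2"
proof -
 have b: "0 <= (1 + cos y) / 2" "(1 + cos y) / 2 <= 1" for y :: real
  using cos_ge_minus_one[of y] cos_le_one[of y] by (auto simp del: cos_ge_minus_one cos_le_one)
 have "peak x = (1 + cos (x $ i)) / 2 * (\<Prod>j\<in>UNIV - {i}. (1 + cos (x $ j)) / 2)"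
  unfolding peak_def by (rule prod.remove) auto
 also have "... <= (1 + cos (x $ i)) / 2 * 1"
  using b by (intro mult_left_mono prod_le_1) auto
 finally show ?thesis by simp
qed

lemma C_k_peak: "C_k k peak"
proof -
 have "C_k k (\<lambda>x :: real ^ 'n. (1 + cos (x $ i)) / 2)" for i
 proof -
  have "C_k k (\<lambda>x :: real ^ 'n. cos (0 + x $ i))"
   by (rule C_k_affine[OF bounded_linear_vec_nth conjunct1[OF C_k_cos_sin]])
  from C_k_mult[OF C_k_const[of k "1/2"] C_k_add[OF C_k_const[of k 1] this]] show ?thesis by simp
 qed
 then show ?thesis unfolding peak_def[abs_def] by (intro C_k_prod) auto
qed

lemma peak_periodic: "torus_periodic (peak :: real ^ 'n => real)"
proof -
 have "cos ((x + axis j (2 * pi)) $ i) = cos (x $ i)" for x :: "real ^ 'n" and i j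
  by (simp add: axis_def)
 then show ?thesis unfolding torus_periodic_def peak_def by simp
qed

lemma peak_even: "peak (- x) = peak x"
 by (simp add: peak_def)

text \<open>This class is closed under differentiation, and reflected kernels are admissible test fields.\<close>

definition kernel :: "((real ^ 'n) \<times> real => real) => real => bool" where
 "kernel K r \<longleftrightarrow> C_infinity K \<and> (\<forall>t. torus_periodic (\<lambda>x. K (x, t))) \<and> (\<forall>x t. \<bar>t\<bar> > r \<longrightarrow> K (x, t) = 0)"

lemma C_infinity_dir_deriv: "C_infinity f ==> C_infinity (dir_deriv v f)"
 unfolding C_infinity_def using C_k_dir_deriv by blast

lemma C_infinity_has_derivative: "C_infinity f ==> (f has_derivative (\<lambda>v. dir_deriv v f x)) (at x)"
 unfolding C_infinity_def using C_k_has_derivative by blast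

lemma kernel_dir_deriv:
 fixes K :: "(real ^ 'n) \<times> real => real"
 assumes "kernel K r"
 shows "kernel (dir_deriv v K) r"
proof -
 have d: "K differentiable (at x)" for x
  using assms by (auto simp: kernel_def C_infinity_def intro: C_k_differentiable[of 1])
 have "dir_deriv v K (x, t) = 0" if "\<bar>t\<bar> > r" for x t
 proof -
  have "open {z :: (real ^ 'n) \<times> real. \<bar>snd z\<bar> > r}" by (intro open_Collect_less continuous_intros)
  then have "(K has_derivative (\<lambda>v. 0)) (at (x, t))"
   by (rule has_derivative_transform_within_open[of "\<lambda>z. 0", rotated]) (use assms that in \<open>auto simp: kernel_def\<close>)
  then show ?thesis by (rule has_derivative_imp_dir_deriv)
 qed
 moreover have "torus_periodic (\<lambda>x. dir_deriv v K (x, t))" for t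
  using assms d by (intro torus_periodic_partial) (auto simp: kernel_def)
 ultimately show ?thesis using assms C_infinity_dir_deriv unfolding kernel_def by blast
qed

lemma kernel_continuous: "kernel K r ==> continuous_on UNIV K"
 unfolding kernel_def C_infinity_def using C_k_continuous by blast

lemma kernel_bounded:
 fixes K :: "(real ^ 'n) \<times> real => real"
 assumes "kernel K r"
 obtains B where "B > 0" "\<And>z. \<bar>K z\<bar> <= B"
proof -
 let ?S = "cbox (0 :: real ^ 'n) (\<chi> i. 2 * pi) \<times> {- r..r}"
 have "compact (K ` ?S)"
  by (intro compact_continuous_image compact_Times continuous_on_subset[OF kernel_continuous[OF assms]]) auto
 then obtain B where B: "B > 0" "\<forall>y\<in>K ` ?S. norm y <= B" using compact_imp_bounded bounded_pos by metis
 have "\<bar>K (x, t)\<bar> <= B" for x t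
 proof (cases "\<bar>t\<bar> > r")
  case True then show ?thesis using assms B by (simp add: kernel_def)
 next
  case False
  have P: "torus_periodic (\<lambda>x. K (x, t))" using assms by (simp add: kernel_def)
  have "\<exists>y\<in>torus_cell. K (x, t) = K (y, t)"
  proof (rule torus_representative[of x])
   fix y assume "y \<in> torus_cell" "\<And>f :: real ^ 'n => real. torus_periodic f ==> f x = f y"
   then show ?thesis using P by blast
  qed
  then obtain y where y: "y \<in> torus_cell" "K (x, t) = K (y, t)" by blast
  moreover have "(y, t) \<in> ?S" using y(1) False torus_cell_subset by auto
  ultimately show ?thesis using B(2) y(2) by auto
 qed
 then show thesis using B(1) that by auto
qed

lemma dir_deriv_basis:
 fixes f :: "'a::euclidean_space => real"
 assumes "f differentiable (at p)"
 shows "dir_deriv v f p = (\<Sum>b\<in>Basis. (v \<bullet> b) * dir_deriv b f p)"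
proof -
 note lin = dir_deriv_linear[OF assms]
 have "dir_deriv v f p = dir_deriv (\<Sum>b\<in>Basis. (v \<bullet> b) *R b) f p" by (simp add: euclidean_representation)
 then show ?thesis
  using linear_sum[OF lin, of "\<lambda>b. (v \<bullet> b) *R b" Basis] linear_scale[OF lin] by simp
qed

lemma kernel_dir_deriv_bounded:
 fixes K :: "(real ^ 'n) \<times> real => real"
 assumes "kernel K r"
 obtains B where "B > 0" "\<And>v z. \<bar>dir_deriv v K z\<bar> <= B * norm v"
proof -
 have "\<exists>B>0. \<forall>z. \<bar>dir_deriv b K z\<bar> <= B" for b
  using kernel_bounded[OF kernel_dir_deriv[OF assms]] by metis
 then obtain B where B: "\<And>b. B b > 0" "\<And>b z. \<bar>dir_deriv b K z\<bar> <= B b" by metis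
 have "\<bar>dir_deriv v K z\<bar> <= (1 + (\<Sum>b\<in>Basis. B b)) * norm v" for v z
 proof -
  have d: "K differentiable (at z)"
   using assms by (auto simp: kernel_def C_infinity_def intro: C_k_differentiable[of 1])
  have "dir_deriv v K z = (\<Sum>b\<in>Basis. (v \<bullet> b) * dir_deriv b K z)" by (rule dir_deriv_basis[OF d])
  also have "\<bar>...\<bar> <= (\<Sum>b\<in>Basis. norm v * B b)"
  proof (rule order_trans[OF sum_abs sum_mono])
   fix b :: "(real ^ 'n) \<times> real" assume "b \<in> Basis"
   then show "\<bar>(v \<bullet> b) * dir_deriv b K z\<bar> <= norm v * B b"
    unfolding abs_mult by (intro mult_mono Basis_le_norm B(2)) auto
  qed
  also have "... <= (1 + (\<Sum>b\<in>Basis. B b)) * norm v" by (simp add: sum_distrib_left algebra_simps)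
  finally show ?thesis .
 qed
 moreover have "1 + (\<Sum>b\<in>Basis. B b) > 0" using B(1) by (intro add_pos_nonneg sum_nonneg) (auto intro: less_imp_le)
 ultimately show thesis using that by blast
qed

lemma kernel_mvt:
 fixes K :: "(real ^ 'n) \<times> real => real"
 assumes "kernel K r"
 obtains \<tau> where "0 < \<tau>" "\<tau> < 1" "K (z + h) - K z = dir_deriv h K (z + \<tau> *R h)"
proof -
 have d: "K differentiable (at z)" for z
  using assms by (auto simp: kernel_def C_infinity_def intro: C_k_differentiable[of 1])
 have "((\<lambda>\<tau>. K (z + \<tau> *R h)) has_real_derivative dir_deriv h K (z + \<tau> *R h)) (at \<tau>)" for \<tau>
  unfolding has_real_derivative_iff_has_vector_derivative
  by (intro has_partial_along_line has_partial_dir_deriv d)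
 then have "\<exists>\<tau>>0. \<tau> < 1 \<and> K (z + 1 *R h) - K (z + 0 *R h) = (1 - 0) * dir_deriv h K (z + \<tau> *R h)"
  by (intro MVT2) auto
 then show thesis using that by auto
qed

text \<open>
  A remainder that is uniform in the point justifies differentiation under the integral sign.
\<close>

lemma kernel_taylor:
 fixes K :: "(real ^ 'n) \<times> real => real"
 assumes "kernel K r"
 obtains B where "B > 0" "\<And>z h. \<bar>K (z + h) - K z - dir_deriv h K z\<bar> <= B * nsq h"
proof -
 have "\<exists>B>0. \<forall>v z. \<bar>dir_deriv v (dir_deriv b K) z\<bar> <= B * norm v" for b
  using kernel_dir_deriv_bounded[OF kernel_dir_deriv[OF assms]] by metis
 then obtain B where B: "\<And>b. B b > 0" "\<And>b v z. \<bar>dir_deriv v (dir_deriv b K) z\<bar> <= B b * norm v" by metis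
 have "\<bar>K (z + h) - K z - dir_deriv h K z\<bar> <= (1 + (\<Sum>b\<in>Basis. B b)) * nsq h" for z h
 proof -
  obtain \<tau> where \<tau>: "0 < \<tau>" "\<tau> < 1" "K (z + h) - K z = dir_deriv h K (z + \<tau> *R h)"
   using kernel_mvt[OF assms] by metis
  have d: "K differentiable (at z)" for z
   using assms by (auto simp: kernel_def C_infinity_def intro: C_k_differentiable[of 1])
  note lin = dir_deriv_basis[OF d, of h]
  have lip: "\<bar>dir_deriv b K (z + \<tau> *R h) - dir_deriv b K z\<bar> <= B b * norm h" for b
  proof -
   obtain \<theta> where "dir_deriv b K (z + \<tau> *R h) - dir_deriv b K z
     = dir_deriv (\<tau> *R h) (dir_deriv b K) (z + \<theta> *R (\<tau> *R h))"
    using kernel_mvt[OF kernel_dir_deriv[OF assms]] by metis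
   then have "\<bar>dir_deriv b K (z + \<tau> *R h) - dir_deriv b K z\<bar> <= B b * norm (\<tau> *R h)"
    using B(2) by presburger
   also have "... <= B b * norm h"
   proof (rule mult_left_mono)
    show "norm (\<tau> *R h) <= norm h" using \<tau> by (simp add: mult_left_le_one_le)
   qed (use B(1)[of b] in simp)
   finally show ?thesis .
  qed
  have "K (z + h) - K z - dir_deriv h K z = (\<Sum>b\<in>Basis. (h \<bullet> b) * (dir_deriv b K (z + \<tau> *R h) - dir_deriv b K z))"
   unfolding \<tau>(3) lin by (simp add: sum_subtractf right_diff_distrib)
  also have "\<bar>...\<bar> <= (\<Sum>b\<in>Basis. norm h * (B b * norm h))"
  proof (rule order_trans[OF sum_abs sum_mono])
   fix b :: "(real ^ 'n) \<times> real" assume "b \<in> Basis"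
   then show "\<bar>(h \<bullet> b) * (dir_deriv b K (z + \<tau> *R h) - dir_deriv b K z)\<bar> <= norm h * (B b * norm h)"
    unfolding abs_mult by (intro mult_mono Basis_le_norm lip) auto
  qed
  also have "... = (\<Sum>b\<in>Basis. B b) * nsq h"
   by (simp add: sum_distrib_left sum_distrib_right power2_eq_square mult_ac)
  also have "... <= (1 + (\<Sum>b\<in>Basis. B b)) * nsq h" by (intro mult_right_mono) auto
  finally show ?thesis .
 qed
 moreover have "1 + (\<Sum>b\<in>Basis. B b) > 0" using B(1) by (intro add_pos_nonneg sum_nonneg) (auto intro: less_imp_le)
 ultimately show thesis using that by blast
qed

section \<open>Convolution over the cylinder\<close>

definition conv :: "real => ((real ^ 'n) \<times> real => real) => ((real ^ 'n) \<times> real => 'b) => (real ^ 'n) \<times> real => 'b::euclidean_space" where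
 "conv T K u p = (\<integral>z. K (p - z) *R u z \<partial>cylinder T)"

lemma kernel_shift_measurable: "kernel K r ==> (\<lambda>z. K (p - z)) \<in> borel_measurable borel"
 by (intro borel_measurable_continuous_onI continuous_on_compose2[OF kernel_continuous]) (auto intro!: continuous_intros)

lemma conv_integrable:
 fixes K :: "(real ^ 'n) \<times> real => real" and u :: "(real ^ 'n) \<times> real => 'b::euclidean_space"
 assumes K: "kernel K r" and u: "integrable (cylinder T) u"
 shows "integrable (cylinder T) (\<lambda>z. K (p - z) *R u z)"
proof -
 obtain B where B: "B > 0" "\<And>z. \<bar>K z\<bar> <= B" using kernel_bounded[OF K] by blast
 show ?thesis
 proof (rule Bochner_Integration.integrable_bound[where f = "\<lambda>z. B * norm (u z)"])
  show "integrable (cylinder T) (\<lambda>z. B * norm (u z))" using u by simp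
  show "(\<lambda>z. K (p - z) *R u z) \<in> borel_measurable (cylinder T)"
   using borel_measurable_cylI[OF kernel_shift_measurable[OF K]] u
   unfolding cylinder_eq_cyl by (intro borel_measurable_scaleR) auto
  show "AE z in cylinder T. norm (K (p - z) *R u z) <= norm (B * norm (u z))"
  proof (rule AE_I2)
   fix z
   have "\<bar>K (p - z)\<bar> * norm (u z) <= B * norm (u z)" using B(2) by (intro mult_right_mono) (auto simp del: split_paired_All)
   then show "norm (K (p - z) *R u z) <= norm (B * norm (u z))" using B(1) by simp
  qed
 qed
qed

lemma conv_has_derivative:
 fixes K :: "(real ^ 'n) \<times> real => real"
 assumes K: "kernel K r" and u: "integrable (cylinder T) u"
 shows "(conv T K u has_derivative (\<lambda>v. conv T (dir_deriv v K) u p)) (at p)"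
proof -
 obtain B where B: "B > 0" "\<And>z h. \<bar>K (z + h) - K z - dir_deriv h K z\<bar> <= B * nsq h"
  using kernel_taylor[OF K] by blast
 obtain B' where B': "B' > 0" "\<And>v z. \<bar>dir_deriv v K z\<bar> <= B' * norm v" using kernel_dir_deriv_bounded[OF K] by blast
 define U where "U = (\<integral>z. norm (u z) \<partial>cylinder T)"
 have U: "U >= 0" unfolding U_def by simp
 have d: "K differentiable (at z)" for z
  using K by (auto simp: kernel_def C_infinity_def intro: C_k_differentiable[of 1])
 note I = conv_integrable[OF _ u]
 note Iv = I[OF kernel_dir_deriv[OF K]]
 have bl: "bounded_linear (\<lambda>v. conv T (dir_deriv v K) u p)"
 proof (rule bounded_linear_intro[of _ "B' * U"])
  show "conv T (dir_deriv (v + w) K) u p = conv T (dir_deriv v K) u p + conv T (dir_deriv w K) u p" for v w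
   unfolding conv_def using Iv linear_add[OF dir_deriv_linear[OF d]] by (simp add: scaleR_add_left)
  show "conv T (dir_deriv (c *R v) K) u p = c *R conv T (dir_deriv v K) u p" for c v
   unfolding conv_def using linear_scale[OF dir_deriv_linear[OF d]] by (simp flip: scaleR_scaleR)
  show "norm (conv T (dir_deriv v K) u p) <= norm v * (B' * U)" for v
  proof -
   have "norm (conv T (dir_deriv v K) u p) <= (\<integral>z. (B' * norm v) * norm (u z) \<partial>cylinder T)"
    unfolding conv_def
   proof (rule Bochner_Integration.integral_norm_bound_integral[OF Iv])
    show "norm (dir_deriv v K (p - z) *R u z) <= B' * norm v * norm (u z)" for z
     using B'(2)[of v "p - z"] by (auto intro!: mult_right_mono)
   qed (use u in auto)
   then show ?thesis by (simp add: U_def mult_ac)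
  qed
 qed
 have est: "norm (conv T K u (p + h) - conv T K u p - conv T (dir_deriv h K) u p) <= B * U * nsq h" for h
 proof -
  have "conv T K u (p + h) - conv T K u p - conv T (dir_deriv h K) u p
   = (\<integral>z. K (p + h - z) *R u z - K (p - z) *R u z - dir_deriv h K (p - z) *R u z \<partial>cylinder T)"
   unfolding conv_def using I[OF K] Iv by simp
  also have "norm ... <= (\<integral>z. (B * nsq h) * norm (u z) \<partial>cylinder T)"
  proof (rule Bochner_Integration.integral_norm_bound_integral)
   show "norm (K (p + h - z) *R u z - K (p - z) *R u z - dir_deriv h K (p - z) *R u z) <= B * nsq h * norm (u z)" for z
   proof -
    have "K (p + h - z) *R u z - K (p - z) *R u z - dir_deriv h K (p - z) *R u z
     = (K ((p - z) + h) - K (p - z) - dir_deriv h K (p - z)) *R u z"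
     by (simp add: algebra_simps)
    then show ?thesis using B(2)[of "p - z" h] by (auto intro!: mult_right_mono)
   qed
  qed (use u I[OF K] Iv in auto)
  finally show ?thesis by (simp add: U_def mult_ac)
 qed
 show ?thesis unfolding has_derivative_at
 proof (intro conjI bl)
  show "(\<lambda>h. norm (conv T K u (p + h) - conv T K u p - conv T (dir_deriv h K) u p) / norm h) \<midarrow>0\<rightarrow> 0"
  proof (rule Lim_null_comparison[of _ "\<lambda>h. B * U * norm h"])
   show "\<forall>\<^sub>F h in at 0. norm (norm (conv T K u (p + h) - conv T K u p - conv T (dir_deriv h K) u p) / norm h) <= B * U * norm h"
   proof (rule always_eventually, rule allI)
    fix h
    show "norm (norm (conv T K u (p + h) - conv T K u p - conv T (dir_deriv h K) u p) / norm h) <= B * U * norm h"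
     using est[of h] B U by (cases "h = 0") (auto simp: divide_simps power2_eq_square mult_ac)
   qed
   show "((\<lambda>h. B * U * norm h) \<longlongrightarrow> 0) (at 0)"
    using tendsto_mult_right_zero[OF tendsto_norm_zero[OF tendsto_ident_at[of 0 UNIV]], of "B * U"] by simp
  qed
 qed
qed

lemma conv_dir_deriv:
 fixes K :: "(real ^ 'n) \<times> real => real"
 assumes "kernel K r" "integrable (cylinder T) u"
 shows "dir_deriv v (conv T K u) = conv T (dir_deriv v K) u"
 using has_derivative_imp_dir_deriv[OF conv_has_derivative[OF assms]] by (auto simp: fun_eq_iff)

lemma C_k_conv:
 assumes "integrable (cylinder T) u"
 shows "kernel K r ==> C_k k (conv T K u)"
proof (induction k arbitrary: K)
 case 0
 then show ?case using has_derivative_continuous[OF conv_has_derivative[OF 0 assms]]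
  by (simp add: continuous_on_eq_continuous_at)
next
 case (Suc k)
 show ?case
  by (rule C_k_SucI[OF conv_has_derivative[OF Suc.prems assms]]) (rule Suc.IH[OF kernel_dir_deriv[OF Suc.prems]])
qed

lemma conv_periodic:
 fixes K :: "(real ^ 'n) \<times> real => real"
 assumes "kernel K r"
 shows "torus_periodic (\<lambda>x. conv T K u (x, t))"
 unfolding torus_periodic_def conv_def
proof (intro allI Bochner_Integration.integral_cong refl)
 fix x i z
 have "K ((x - fst z) + axis i (2 * pi), t - snd z) = K (x - fst z, t - snd z)"
  using assms unfolding kernel_def torus_periodic_def by blast
 then show "K ((x + axis i (2 * pi), t) - z) *R u z = K ((x, t) - z) *R u z"
  by (cases z) (simp add: algebra_simps)
qed

section \<open>The mollified equation\<close>

lemma integrable_cylinder_L2: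
 assumes f: "f \<in> borel_measurable (cylinder T)" "integrable (cylinder T) (\<lambda>z. nsq (f z))"
 shows "integrable (cylinder T) (f :: _ => 'b::euclidean_space)"
proof (rule Bochner_Integration.integrable_bound[where f = "\<lambda>z. 1 + nsq (f z)"])
 interpret finite_measure "cylinder T :: ((real ^ 'a) \<times> real) measure"
  unfolding cylinder_eq_cyl by (rule finite_measure_cyl) auto
 show "integrable (cylinder T) (\<lambda>z. 1 + nsq (f z))" using f(2) by simp
 have "norm (f z) <= 1 + nsq (f z)" for z
  using sum_squares_bound[of 1 "norm (f z)"] norm_ge_zero[of "f z"] unfolding power2_eq_square by linarith
 then show "AE z in cylinder T. norm (f z) <= norm (1 + nsq (f z))" by simp
qed (use f in auto)

lemma L2_cylinder_integrable: "L2_cylinder T f ==> integrable (cylinder T) f"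
 using integrable_cylinder_L2[of f T] unfolding L2_cylinder_def by blast

lemma C_infinity_affine: "bounded_linear L ==> C_infinity f ==> C_infinity (\<lambda>x. f (c + L x))"
 unfolding C_infinity_def using C_k_affine by blast

lemma C_infinity_scaleR_const: "C_infinity f ==> C_infinity (\<lambda>x. f x *R c)"
 unfolding C_infinity_def using C_k_scaleR[of _ f "\<lambda>x. c"] C_k_const[of _ c] by blast

lemma torus_periodic_reflect:
 assumes "torus_periodic f"
 shows "torus_periodic (\<lambda>x. f (y - x))"
 unfolding torus_periodic_def
proof (intro allI)
 fix x i
 have "f (y - (x + axis i (2 * pi)) + axis i (2 * pi)) = f (y - (x + axis i (2 * pi)))"
  using assms unfolding torus_periodic_def by blast
 then show "f (y - (x + axis i (2 * pi))) = f (y - x)" by (simp add: algebra_simps)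
qed

lemma dir_deriv_reflect:
 fixes K :: "'a::real_normed_vector => real" and c :: "'b::real_normed_vector"
 assumes "C_infinity K"
 shows "dir_deriv v (\<lambda>z. K (p - z) *R c) = (\<lambda>z. dir_deriv v K (p - z) *R (- c))"
proof
 fix z
 have "((\<lambda>z. K (p - z)) has_derivative (\<lambda>h. dir_deriv (0 - h) K (p - z))) (at z)"
  by (rule has_derivative_compose[of "\<lambda>z. p - z" "\<lambda>h. 0 - h" z UNIV K, OF _ C_infinity_has_derivative[OF assms]])
   (auto intro!: derivative_eq_intros)
 from has_derivative_scaleR_left[OF this, of c]
 have "dir_deriv v (\<lambda>z. K (p - z) *R c) z = dir_deriv (0 - v) K (p - z) *R c"
  by (rule has_derivative_imp_dir_deriv)
 moreover have "dir_deriv (- v) K (p - z) = - dir_deriv v K (p - z)"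
  using assms by (intro linear_neg dir_deriv_linear) (auto simp: C_infinity_def intro: C_k_differentiable[of 1])
 ultimately show "dir_deriv v (\<lambda>z. K (p - z) *R c) z = dir_deriv v K (p - z) *R (- c)" by simp
qed

text \<open>
  Reflected kernels are test fields as long as their support stays inside the time interval, which is why
  mollified equations hold away from both ends only.
\<close>

lemma test_field_kernel:
 fixes K :: "(real ^ 'n) \<times> real => real"
 assumes K: "kernel K r" and t: "r < snd p" "snd p < T - r"
 shows "test_field T (\<lambda>z. K (p - z) *R c)"
 unfolding test_field_def
proof (intro conjI allI exI impI)
 have "C_infinity (\<lambda>z. K (p + - z))"
  using K by (intro C_infinity_affine bounded_linear_minus bounded_linear_ident) (simp add: kernel_def)
 then show "C_infinity (\<lambda>z. K (p - z) *R c)" by (intro C_infinity_scaleR_const) simp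
 show "torus_periodic (\<lambda>x. K (p - (x, t)) *R c)" for t
  using torus_periodic_reflect[of "\<lambda>x. K (x, snd p - t)" "fst p"] K
  unfolding kernel_def torus_periodic_def by (cases p) simp
 show "0 < snd p - r" "snd p + r < T" using t by auto
 fix x s assume "s \<notin> {snd p - r..snd p + r}"
 then have "\<bar>snd p - s\<bar> > r" by (auto simp: abs_if)
 then show "K (p - (x, s)) *R c = 0" using K by (cases p) (auto simp: kernel_def)
qed

text \<open>
  The weak derivative passes from the solution to the kernel; this is an identity between
  slices at almost every time, integrated over time.
\<close>

lemma conv_weak_partial:
 fixes K :: "(real ^ 'n) \<times> real => real" and i :: 'n
 assumes K: "kernel K r" and q: "L2_H1_with T q dq"
 shows "conv T K (dq i) p = conv T (dir_deriv (axis i 1, 0) K) q p"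
proof -
 have qi: "integrable (cylinder T) q" "integrable (cylinder T) (dq i)"
  using q unfolding L2_H1_with_def by (auto intro: L2_cylinder_integrable)
 have ae: "AE t in lborel. t \<in> {0<..<T} \<longrightarrow> weak_pderiv i (\<lambda>x. q (x, t)) (\<lambda>x. dq i (x, t))"
  using q unfolding L2_H1_with_def by (auto elim: eventually_mono)
 let ?f = "\<lambda>z. K (p - z) *R dq i z" and ?g = "\<lambda>z. dir_deriv (axis i 1, 0) K (p - z) *R q z"
 have I: "integrable (cyl {0<..<T}) ?f" "integrable (cyl {0<..<T}) ?g"
  using conv_integrable[OF K qi(2)] conv_integrable[OF kernel_dir_deriv[OF K] qi(1)]
  unfolding cylinder_eq_cyl by auto
 have eq: "(\<integral>x. ?f (x, t) \<partial>torus) = (\<integral>x. ?g (x, t) \<partial>torus)"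
  if w: "weak_pderiv i (\<lambda>x. q (x, t)) (\<lambda>x. dq i (x, t))" for t
 proof -
  define \<psi> where "\<psi> x = K (p - (x, t))" for x
  have L: "bounded_linear (\<lambda>x :: real ^ 'n. (- x, 0 :: real))"
   by (intro bounded_linear_Pair bounded_linear_minus bounded_linear_ident bounded_linear_zero)
  have "\<psi> = (\<lambda>x. K ((p - (0, t)) + (- x, 0)))" by (cases p) (auto simp: \<psi>_def fun_eq_iff)
  then have smooth: "C_infinity \<psi>"
   using C_infinity_affine[OF L, of K "p - (0, t)"] K by (simp add: kernel_def)
  have per: "torus_periodic \<psi>"
   using torus_periodic_reflect[of "\<lambda>x. K (x, snd p - t)" "fst p"] K
   unfolding kernel_def torus_periodic_def \<psi>_def by (cases p) simp
  have d: "dir_deriv (axis i 1) \<psi> x = - dir_deriv (axis i 1, 0) K (p - (x, t))" for x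
  proof -
   have dK: "(\<lambda>z. K (p - z)) differentiable (at (x, t))"
    using C_infinity_affine[OF bounded_linear_minus[OF bounded_linear_ident], of K p] K
    by (auto simp: kernel_def C_infinity_def intro: C_k_differentiable[of 1])
   have "has_partial (\<lambda>z. K (p - z)) (dir_deriv (axis i 1, 0) (\<lambda>z. K (p - z)) (x, t)) (axis i 1, 0) (x, t)"
    by (rule has_partial_dir_deriv[OF dK])
   then have "has_partial \<psi> (dir_deriv (axis i 1, 0) (\<lambda>z. K (p - z)) (x, t)) (axis i 1) x"
    by (simp add: has_partial_def \<psi>_def)
   moreover have "has_partial \<psi> (dir_deriv (axis i 1) \<psi> x) (axis i 1) x"
    using smooth by (intro has_partial_dir_deriv) (auto simp: C_infinity_def intro: C_k_differentiable[of 1])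
   ultimately have "dir_deriv (axis i 1) \<psi> x = dir_deriv (axis i 1, 0) (\<lambda>z. K (p - z)) (x, t)"
    by (rule has_partial_unique[symmetric])
   then show ?thesis using dir_deriv_reflect[of K "(axis i 1, 0)" p "1::real"] K by (simp add: kernel_def fun_eq_iff)
  qed
  have "(\<integral>x. dir_deriv (axis i 1) \<psi> x *R q (x, t) \<partial>torus) = - (\<integral>x. \<psi> x *R dq i (x, t) \<partial>torus)"
   using w smooth per unfolding weak_pderiv_def by blast
  then show ?thesis unfolding d by (simp add: \<psi>_def)
 qed
 have "conv T K (dq i) p = (\<integral>t. indicator {0<..<T} t *R (\<integral>x. ?f (x, t) \<partial>torus) \<partial>lborel)"
  unfolding conv_def cylinder_eq_cyl by (rule integral_cyl(1)[OF _ I(1)]) simp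
 also have "... = (\<integral>t. indicator {0<..<T} t *R (\<integral>x. ?g (x, t) \<partial>torus) \<partial>lborel)"
 proof (rule integral_cong_AE)
  show "(\<lambda>t. indicator {0<..<T} t *R (\<integral>x. ?f (x, t) \<partial>torus)) \<in> borel_measurable lborel"
   using integral_cyl(3)[OF _ I(1)] by auto
  show "(\<lambda>t. indicator {0<..<T} t *R (\<integral>x. ?g (x, t) \<partial>torus)) \<in> borel_measurable lborel"
   using integral_cyl(3)[OF _ I(2)] by auto
  show "AE t in lborel. indicator {0<..<T} t *R (\<integral>x. ?f (x, t) \<partial>torus) = indicator {0<..<T} t *R (\<integral>x. ?g (x, t) \<partial>torus)"
   using ae by eventually_elim (use eq in \<open>auto simp: indicator_def\<close>)
 qed
 also have "... = conv T (dir_deriv (axis i 1, 0) K) q p"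
  unfolding conv_def cylinder_eq_cyl by (rule integral_cyl(1)[OF _ I(2), symmetric]) simp
 finally show ?thesis .
qed

definition rot :: "real ^ 2 => real ^ 2" where "rot v = J_mat *v v"

lemma rot_eq: "rot v $ 1 = - v $ 2" "rot v $ 2 = v $ 1"
 by (simp_all add: rot_def J_mat_def matrix_vector_mult_def UNIV_2 vector_2)

lemma rot_linear: "linear rot"
 unfolding rot_def[abs_def] by (rule matrix_vector_mul_linear)

lemma rot_skew: "rot x \<bullet> y = - (x \<bullet> rot y)" and rot_iso: "rot x \<bullet> rot y = x \<bullet> y" and rot_rot: "rot (rot x) = - x"
 by (simp_all add: inner_vec_def UNIV_2 rot_eq vec_eq_iff forall_2)

lemma adjoint_matrix: "transpose (A_mat \<alpha> \<gamma>) *v v = \<alpha> *R v - \<gamma> *R rot v"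
 by (simp add: vec_eq_iff forall_2 rot_eq A_mat_def J_mat_def transpose_def matrix_vector_mult_def UNIV_2 vector_2 mat_def algebra_simps)

lemma mollified_equation:
 assumes sol: "weak_solution \<alpha> \<gamma> T F qT q" and F: "L2_cylinder T F" and K: "kernel K r"
  and t: "r < snd p" "snd p < T - r"
 shows "time_deriv (conv T K q) p + (\<alpha> *R laplacian (conv T K q) p - \<gamma> *R rot (laplacian (conv T K q) p)) = - conv T K F p"
proof -
 obtain dq where dq: "L2_H1_with T q dq"
  and weak: "\<And>\<psi>. test_field T \<psi> ==> (\<integral>p. q p \<bullet> time_deriv \<psi> p \<partial>cylinder T) +
     (\<integral>p. (\<Sum>i\<in>UNIV. (transpose (A_mat \<alpha> \<gamma>) *v dq i p) \<bullet> space_deriv i \<psi> p) \<partial>cylinder T) =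
     (\<integral>p. F p \<bullet> \<psi> p \<partial>cylinder T)"
  using sol unfolding weak_solution_def by blast
 have int: "integrable (cylinder T) q" "integrable (cylinder T) (dq i)" "integrable (cylinder T) F" for i
  using dq F unfolding L2_H1_with_def by (auto intro: L2_cylinder_integrable)
 define A where "A v = \<alpha> *R v - \<gamma> *R rot v" for v
 have A: "bounded_linear A" unfolding A_def[abs_def]
  using rot_linear by (intro linear_conv_bounded_linear[THEN iffD1]) (auto simp: linear_iff algebra_simps)
 have Kinf: "C_infinity K" using K by (simp add: kernel_def)
 let ?D = "\<lambda>v. dir_deriv v K"
 note KD = kernel_dir_deriv[OF K]
 have moved: "conv T K' u p \<bullet> c = (\<integral>z. K' (p - z) * (u z \<bullet> c) \<partial>cylinder T)"
  if "kernel K' r" "integrable (cylinder T) u" for K' c and u :: "_ => real ^ 2"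
  unfolding conv_def using integral_inner_left[OF conv_integrable[OF that], symmetric] by simp
 have "(time_deriv (conv T K q) p + A (laplacian (conv T K q) p)) \<bullet> c = - conv T K F p \<bullet> c" for c
 proof -
  define \<psi> where "\<psi> z = K (p - z) *R c" for z
  have \<psi>t: "time_deriv \<psi> z = ?D (0, 1) (p - z) *R (- c)" and \<psi>i: "space_deriv i \<psi> z = ?D (axis i 1, 0) (p - z) *R (- c)" for z i
   unfolding time_deriv_def space_deriv_def \<psi>_def dir_deriv_reflect[OF Kinf] by simp_all
  have "test_field T \<psi>" unfolding \<psi>_def by (rule test_field_kernel[OF K t])
  from weak[OF this]
  have w: "(\<integral>z. q z \<bullet> (?D (0, 1) (p - z) *R (- c)) \<partial>cylinder T)
   + (\<integral>z. (\<Sum>i\<in>UNIV. A (dq i z) \<bullet> (?D (axis i 1, 0) (p - z) *R (- c))) \<partial>cylinder T) = (\<integral>z. F z \<bullet> (K (p - z) *R c) \<partial>cylinder T)"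
   unfolding \<psi>t \<psi>i \<psi>_def adjoint_matrix A_def .
  have 1: "(\<integral>z. q z \<bullet> (?D (0, 1) (p - z) *R (- c)) \<partial>cylinder T) = - (time_deriv (conv T K q) p \<bullet> c)"
   unfolding time_deriv_def conv_dir_deriv[OF K int(1)] moved[OF KD int(1)] by simp
  have 3: "(\<integral>z. F z \<bullet> (K (p - z) *R c) \<partial>cylinder T) = conv T K F p \<bullet> c"
   unfolding moved[OF K int(3)] by simp
  have Aint: "integrable (cylinder T) (\<lambda>z. A (dq i z))" for i
   by (rule integrable_bounded_linear[OF A int(2)])
  have Ai: "(\<integral>z. A (dq i z) \<bullet> (?D (axis i 1, 0) (p - z) *R (- c)) \<partial>cylinder T)
   = - (A (conv T (dir_deriv (axis i 1, 0) (?D (axis i 1, 0))) q p) \<bullet> c)" for i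
  proof -
   have "(\<integral>z. A (dq i z) \<bullet> (?D (axis i 1, 0) (p - z) *R (- c)) \<partial>cylinder T)
    = - (conv T (?D (axis i 1, 0)) (\<lambda>z. A (dq i z)) p \<bullet> c)"
    unfolding moved[OF KD Aint] by simp
   also have "conv T (?D (axis i 1, 0)) (\<lambda>z. A (dq i z)) p = A (conv T (?D (axis i 1, 0)) (dq i) p)"
   proof -
    have "?D (axis i 1, 0) (p - z) *R A (dq i z) = A (?D (axis i 1, 0) (p - z) *R dq i z)" for z
     using A by (simp add: linear_scale bounded_linear.linear)
    then show ?thesis unfolding conv_def
     using integral_bounded_linear[OF A conv_integrable[OF KD int(2)]] by simp
   qed
   also have "conv T (?D (axis i 1, 0)) (dq i) p = conv T (dir_deriv (axis i 1, 0) (?D (axis i 1, 0))) q p"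
    by (rule conv_weak_partial[OF KD dq])
   finally show ?thesis .
  qed
  have i2: "integrable (cylinder T) (\<lambda>z. A (dq i z) \<bullet> (?D (axis i 1, 0) (p - z) *R (- c)))" for i
  proof -
   have "integrable (cylinder T) (\<lambda>z. (?D (axis i 1, 0) (p - z) *R A (dq i z)) \<bullet> (- c))"
    by (intro integrable_inner_left conv_integrable[OF KD Aint])
   then show ?thesis by simp
  qed
  have "(\<integral>z. (\<Sum>i\<in>UNIV. A (dq i z) \<bullet> (?D (axis i 1, 0) (p - z) *R (- c))) \<partial>cylinder T)
   = (\<Sum>i\<in>UNIV. - (A (conv T (dir_deriv (axis i 1, 0) (?D (axis i 1, 0))) q p) \<bullet> c))"
   using i2 Ai by (subst Bochner_Integration.integral_sum) auto
  also have "... = - (A (laplacian (conv T K q) p) \<bullet> c)"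
   unfolding laplacian_def space_deriv_def conv_dir_deriv[OF K int(1)] conv_dir_deriv[OF KD int(1)]
   using A by (simp add: linear_sum bounded_linear.linear inner_sum_left sum_negf)
  finally show ?thesis using w 1 3 by (simp add: inner_add_left)
 qed
 then show ?thesis unfolding A_def by (metis inner_commute vector_eq_rdot)
qed

section \<open>Approximation in the mean\<close>

definition moll :: "nat => (real ^ 'n) \<times> real => real" where
 "moll m z = peak (fst z) ^ m / (\<integral>x. peak x ^ m \<partial>(torus :: (real ^ 'n) measure))
  * (bump (real m * snd z) / (\<integral>t. bump (real m * t) \<partial>lborel))"

lemma peak_measurable [measurable]: "peak \<in> borel_measurable borel"
 by (rule borel_measurable_continuous_onI[OF C_k_continuous[OF C_k_peak]])

lemma bump_measurable [measurable]: "bump \<in> borel_measurable borel"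
 by (rule borel_measurable_continuous_onI[OF C_k_continuous[OF C_k_bump]])

lemma peak_power_integrable: "integrable torus (\<lambda>x. peak x ^ m)"
proof (rule torus.integrable_const_bound[of _ 1])
 have "norm (peak x ^ m) <= 1" for x :: "real ^ 'a" using peak_bounds[of x] by (simp add: power_le_one)
 then show "AE x in torus. norm (peak (x :: real ^ 'a) ^ m) <= 1" by simp
qed (rule borel_measurable_torusI, measurable)

text \<open>The set is open and contains the origin, a corner of the cell, hence a small box inside the cell.\<close>

lemma peak_superlevel:
 assumes "\<delta> > 0"
 shows "measure torus ({x :: real ^ 'n. peak x > 1 - \<delta>} \<inter> torus_cell) > 0"
proof -
 let ?S = "{x :: real ^ 'n. peak x > 1 - \<delta>}"
 have oS: "open ?S" by (intro open_Collect_less continuous_intros C_k_continuous[OF C_k_peak])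
 have "peak (0 :: real ^ 'n) = 1" by (simp add: peak_def)
 then have "0 \<in> ?S" using assms by (simp del: zero_vec_def)
 then obtain e where e: "e > 0" "ball 0 e \<subseteq> ?S" using oS openE by blast
 define d where "d = min pi (e / (2 * (real CARD('n) + 1)))"
 have d: "d > 0" "d <= pi" unfolding d_def using e(1) by (auto intro!: divide_pos_pos)
 let ?B = "box (0 :: real ^ 'n) (\<chi> i. d)"
 have "?B \<subseteq> ?S \<inter> torus_cell"
 proof
  fix x assume "x \<in> ?B"
  then have x: "0 < x $ i \<and> x $ i < d" for i by (simp add: mem_box_cart)
  have "norm x <= (\<Sum>i\<in>UNIV. \<bar>x $ i\<bar>)" by (rule norm_le_l1_cart)
  also have "... <= real CARD('n) * d"
   using abs_sum_UNIV_le[of "\<lambda>i. \<bar>x $ i\<bar>" d] x by (auto simp: sum_nonneg less_imp_le)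
  also have "... <= real CARD('n) * (e / (2 * (real CARD('n) + 1)))" by (intro mult_left_mono) (auto simp: d_def)
  also have "... < e" using e(1) by (simp add: field_simps add_pos_nonneg)
  finally have "x \<in> ball 0 e" by simp
  moreover have "x \<in> torus_cell" using x d pi_gt_zero by (fastforce simp: torus_cell_def intro: less_imp_le order_less_le_trans)
  ultimately show "x \<in> ?S \<inter> torus_cell" using e by blast
 qed
 have m: "?S \<inter> torus_cell \<in> sets borel" using oS by auto
 have "0 < measure lborel ?B" using d by (subst measure_lborel_box_eq) (auto simp: Basis_vec_def inner_axis intro!: prod_pos)
 also have "... <= measure lborel (?S \<inter> torus_cell)"
 proof (rule measure_mono_fmeasurable[OF \<open>?B \<subseteq> _\<close>])
  show "?S \<inter> torus_cell \<in> fmeasurable lborel"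
   using m emeasure_torus_cell_finite by (intro fmeasurableI) (auto intro: le_less_trans[OF emeasure_mono[of "?S \<inter> torus_cell" torus_cell]])
 qed auto
 also have "... = measure torus (?S \<inter> torus_cell)"
  unfolding torus_def by (subst measure_restrict_space) auto
 finally show ?thesis .
qed

lemma peak_mass_lower:
 assumes "0 < \<delta>" "\<delta> <= 1"
 shows "(1 - \<delta>) ^ m * measure torus ({x :: real ^ 'n. peak x > 1 - \<delta>} \<inter> torus_cell) <= (\<integral>x. peak x ^ m \<partial>(torus :: (real ^ 'n) measure))"
proof -
 let ?S = "{x :: real ^ 'n. peak x > 1 - \<delta>} \<inter> torus_cell"
 have S: "?S \<in> sets torus"
 proof -
  have "{x :: real ^ 'n. peak x > 1 - \<delta>} \<in> sets lborel" by simp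
  then show ?thesis unfolding torus_def by (auto simp: sets_restrict_space)
 qed
 have "(1 - \<delta>) ^ m * measure torus ?S = (\<integral>x. (1 - \<delta>) ^ m * indicator ?S x \<partial>torus)"
  using S by simp
 also have "... <= (\<integral>x. peak x ^ m \<partial>(torus :: (real ^ 'n) measure))"
 proof (rule Bochner_Integration.integral_mono)
  show "integrable torus (\<lambda>x. (1 - \<delta>) ^ m * indicator ?S x)"
   using S by (intro integrable_mult_right integrable_real_indicator) (auto simp: torus.emeasure_finite less_top[symmetric])
  show "(1 - \<delta>) ^ m * indicator ?S x <= peak x ^ m" for x
   using assms peak_bounds(1)[of x] by (auto simp: indicator_def intro!: power_mono)
 qed (rule peak_power_integrable)
 finally show ?thesis .
qed

lemma peak_mass_pos: "(\<integral>x. peak x ^ m \<partial>(torus :: (real ^ 'n) measure)) > 0"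
proof -
 have "0 < (1 - 1/2 :: real) ^ m * measure torus ({x :: real ^ 'n. peak x > 1 - 1/2} \<inter> torus_cell)"
  using peak_superlevel[where 'n = 'n, of "1/2"] by (intro mult_pos_pos) simp_all
 then show ?thesis using peak_mass_lower[where 'n = 'n, of "1/2" m] by linarith
qed

lemma bump_scaled_integral:
 assumes m: "m > 0"
 shows "integrable lborel (\<lambda>t. bump (real m * t))" "(\<integral>t. bump (real m * t) \<partial>lborel) > 0"
proof -
 let ?f = "\<lambda>t. bump (real m * t)"
 have c: "continuous_on UNIV ?f"
  by (intro continuous_on_compose2[OF C_k_continuous[OF C_k_bump]] continuous_intros) auto
 have supp: "?f t = 0" if "t \<notin> {- 1 / real m..1 / real m}" for t
  using that m bump_zero[of "real m * t"] by (auto simp: abs_le_iff field_simps abs_if)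
 have "integrable lborel (\<lambda>t. indicator {- 1 / real m..1 / real m} t *R ?f t)"
  by (intro borel_integrable_compact continuous_on_subset[OF c]) auto
 moreover have "(\<lambda>t. indicator {- 1 / real m..1 / real m} t *R ?f t) = ?f"
  using supp by (auto simp: indicator_def fun_eq_iff)
 ultimately show I: "integrable lborel ?f" by (simp only:)
 have "(\<integral>t. ?f t \<partial>lborel) \<noteq> 0"
 proof
  assume "(\<integral>t. ?f t \<partial>lborel) = 0"
  then have "AE t in lborel. ?f t = 0" using integral_nonneg_eq_0_iff_AE[OF I] bump_nonneg by simp
  then have "AE t in lborel. t \<notin> {- (1 / real m)<..<1 / real m}"
  proof eventually_elim
   case (elim t)
   then show ?case using bump_pos[of "real m * t"] m by (auto simp: abs_less_iff field_simps)
  qed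
  then have "{- (1 / real m)<..<1 / real m} \<in> null_sets lborel" by (subst (asm) AE_iff_null_sets[symmetric]) auto
  then have "emeasure lborel {- (1 / real m)<..<1 / real m} = 0" by (rule null_setsD1)
  then show False using m by (simp add: )
 qed
 moreover have "(\<integral>t. ?f t \<partial>lborel) >= 0" using bump_nonneg by simp
 ultimately show "(\<integral>t. ?f t \<partial>lborel) > 0" by simp
qed

lemma kernel_moll:
 assumes "m > 0"
 shows "kernel (moll m :: (real ^ 'n) \<times> real => real) (1 / real m)"
 unfolding kernel_def
proof (intro conjI allI impI)
 have "C_k k (\<lambda>z :: (real ^ 'n) \<times> real. peak (0 + fst z) ^ m)" for k
  by (intro C_k_power C_k_affine bounded_linear_fst C_k_peak)
 moreover have "C_k k (\<lambda>z :: (real ^ 'n) \<times> real. bump (0 + real m * snd z))" for k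
  by (intro C_k_affine C_k_bump bounded_linear_const_mult bounded_linear_snd)
 ultimately have "C_k k (\<lambda>z :: (real ^ 'n) \<times> real. 1 / (\<integral>x. peak x ^ m \<partial>(torus :: (real ^ 'n) measure)) * peak (0 + fst z) ^ m
  * (1 / (\<integral>t. bump (real m * t) \<partial>lborel) * bump (0 + real m * snd z)))" for k
  by (intro C_k_mult C_k_const)
 then show "C_infinity (moll m :: (real ^ 'n) \<times> real => real)" by (simp add: C_infinity_def moll_def[abs_def])
 show "torus_periodic (\<lambda>x :: real ^ 'n. moll m (x, t))" for t
  unfolding torus_periodic_def moll_def by (simp add: peak_periodic[unfolded torus_periodic_def, rule_format])
 show "moll m (x, t) = 0" if "\<bar>t\<bar> > 1 / real m" for x :: "real ^ 'n" and t
  using that assms bump_zero[of "real m * t"] by (simp add: moll_def abs_mult field_simps)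
qed

lemma moll_nonneg: "moll m z >= 0"
 unfolding moll_def by (intro mult_nonneg_nonneg divide_nonneg_nonneg integral_nonneg) (simp_all add: peak_bounds bump_nonneg)

lemma moll_even: "moll m (- z) = moll m z"
 by (simp add: moll_def peak_even bump_even)

lemma moll_measurable [measurable]: "moll m \<in> borel_measurable borel"
proof (cases "m = 0")
 case True
 have "(\<lambda>z. peak (fst z) ^ m) \<in> borel_measurable borel" "(\<lambda>z :: ((real ^ 'n) \<times> real). bump (real m * snd z)) \<in> borel_measurable borel"
  by (intro borel_measurable_continuous_onI continuous_intros continuous_on_compose2[OF C_k_continuous[OF C_k_peak]]
    continuous_on_compose2[OF C_k_continuous[OF C_k_bump]]; simp)+
 then show ?thesis unfolding moll_def[abs_def] by (intro borel_measurable_times borel_measurable_divide) auto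
qed (intro borel_measurable_continuous_onI kernel_continuous[OF kernel_moll], simp)

lemma nn_integral_cyl_UNIV_shift:
 fixes f :: "(real ^ 'n) \<times> real => ennreal"
 assumes f: "f \<in> borel_measurable borel" "\<And>t. torus_periodic (\<lambda>x. f (x, t))"
 shows "(\<integral>\<^sup>+z. f (z + v) \<partial>cyl UNIV) = (\<integral>\<^sup>+z. f z \<partial>cyl UNIV)"
proof -
 have [measurable]: "f \<in> borel_measurable (borel \<Otimes>\<^sub>M borel)" using f(1) by (simp add: borel_prod)
 define g where "g t = (\<integral>\<^sup>+x. f (x, t) \<partial>torus)" for t
 have [measurable]: "(\<lambda>x. x) \<in> torus \<rightarrow>\<^sub>M borel" by (rule borel_measurable_torusI) simp
 interpret S: sigma_finite_measure "torus :: (real ^ 'n) measure" by unfold_locales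
 have g: "g \<in> borel_measurable borel" unfolding g_def by measurable
 have "(\<integral>\<^sup>+z. f (z + v) \<partial>cyl UNIV) = (\<integral>\<^sup>+t. (\<integral>\<^sup>+x. f (x + fst v, t + snd v) \<partial>torus) \<partial>lborel)"
 proof -
  have "(\<lambda>z. f (z + v)) \<in> borel_measurable borel" using f(1) by measurable
  from nn_integral_cyl[OF _ this, of UNIV] show ?thesis by (simp add: plus_prod_def)
 qed
 also have "... = (\<integral>\<^sup>+t. g (t + snd v) \<partial>lborel)"
  unfolding g_def by (intro nn_integral_cong nn_integral_torus_shift f(2)) measurable
 also have "... = (\<integral>\<^sup>+t. g t \<partial>lborel)" by (rule lborel_nn_shift[OF g])
 also have "... = (\<integral>\<^sup>+z. f z \<partial>cyl UNIV)" unfolding g_def using f(1) by (subst nn_integral_cyl) auto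
 finally show ?thesis .
qed

lemma moll_mass:
 assumes m: "m > 0"
 shows "(\<integral>\<^sup>+z. ennreal (moll m z) \<partial>(cyl UNIV :: ((real ^ 'n) \<times> real) measure)) = 1"
proof -
 let ?a = "\<integral>x. peak x ^ m \<partial>(torus :: (real ^ 'n) measure)" and ?b = "\<integral>t. bump (real m * t) \<partial>lborel"
 have a: "?a > 0" by (rule peak_mass_pos)
 note b = bump_scaled_integral[OF m]
 have 1: "(\<integral>\<^sup>+x. ennreal (peak x ^ m / ?a) \<partial>(torus :: (real ^ 'n) measure)) = 1"
  using a by (subst nn_integral_eq_integral) (simp_all add: peak_power_integrable peak_bounds)
 have 2: "(\<integral>\<^sup>+t. ennreal (bump (real m * t) / ?b) \<partial>lborel) = 1"
  using b bump_nonneg by (subst nn_integral_eq_integral) (auto intro!: divide_nonneg_nonneg)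
 have "(\<integral>\<^sup>+z. ennreal (moll m z) \<partial>(cyl UNIV :: ((real ^ 'n) \<times> real) measure)) = (\<integral>\<^sup>+t. (\<integral>\<^sup>+x. ennreal (moll m (x, t)) \<partial>(torus :: (real ^ 'n) measure)) \<partial>lborel)"
  by (subst nn_integral_cyl) auto
 also have "... = (\<integral>\<^sup>+t. (\<integral>\<^sup>+x. ennreal (peak x ^ m / ?a) * ennreal (bump (real m * t) / ?b) \<partial>(torus :: (real ^ 'n) measure)) \<partial>lborel)"
 proof -
  have "ennreal (moll m (x, t)) = ennreal (peak x ^ m / ?a) * ennreal (bump (real m * t) / ?b)" for x :: "real ^ 'n" and t
   unfolding moll_def fst_conv snd_conv using a b(2) by (intro ennreal_mult) (simp_all add: peak_bounds bump_nonneg)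
  then show ?thesis by simp
 qed
 also have "... = (\<integral>\<^sup>+t. (\<integral>\<^sup>+x. ennreal (peak x ^ m / ?a) \<partial>(torus :: (real ^ 'n) measure)) * ennreal (bump (real m * t) / ?b) \<partial>lborel)"
  by (intro nn_integral_cong nn_integral_multc borel_measurable_torusI) measurable
 also have "... = 1" using 1 2 by simp
 finally show ?thesis .
qed

lemma moll_mass_shift:
 fixes p :: "(real ^ 'n) \<times> real"
 assumes m: "m > 0"
 shows "(\<integral>\<^sup>+z. ennreal (moll m (z - p)) \<partial>cyl UNIV) = 1" "(\<integral>\<^sup>+z. ennreal (moll m (p - z)) \<partial>cyl UNIV) = 1"
proof -
 have per: "torus_periodic (\<lambda>x :: real ^ 'n. ennreal (moll m (x, t)))" for t
  using kernel_moll[OF m, where 'n = 'n] unfolding kernel_def torus_periodic_def by simp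
 show 1: "(\<integral>\<^sup>+z. ennreal (moll m (z - p)) \<partial>cyl UNIV) = 1"
  using nn_integral_cyl_UNIV_shift[of "\<lambda>z. ennreal (moll m z)" "- p"] per moll_mass[OF m] by simp
 have "moll m (p - z) = moll m (z - p)" for z using moll_even[of m "z - p"] by simp
 then show "(\<integral>\<^sup>+z. ennreal (moll m (p - z)) \<partial>cyl UNIV) = 1" using 1 by simp
qed

lemma nn_integral_cyl_mono_set:
 assumes "I \<subseteq> I'" "I \<in> sets borel" "I' \<in> sets borel"
 shows "(\<integral>\<^sup>+z. f z \<partial>cyl I) <= (\<integral>\<^sup>+z. f z \<partial>cyl I')"
 unfolding cyl_def using assms
 by (subst (1 2) nn_integral_restrict_space) (auto intro!: nn_integral_mono simp: indicator_def)

lemma moll_mass_cylinder: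
 fixes p :: "(real ^ 'n) \<times> real"
 assumes m: "m > 0"
 shows "(\<integral>\<^sup>+z. ennreal (moll m (z - p)) \<partial>cylinder T) <= 1" "(\<integral>\<^sup>+z. ennreal (moll m (p - z)) \<partial>cylinder T) <= 1"
 using nn_integral_cyl_mono_set[of "{0<..<T}" UNIV "\<lambda>z. ennreal (moll m (z - p))"] moll_mass_shift(1)[OF m, of p]
  nn_integral_cyl_mono_set[of "{0<..<T}" UNIV "\<lambda>z. ennreal (moll m (p - z))"] moll_mass_shift(2)[OF m, of p]
 by (simp_all add: cylinder_eq_cyl)

lemma finite_measure_cylinder: "finite_measure (cylinder T)"
 unfolding cylinder_eq_cyl by (rule finite_measure_cyl) auto

lemma measurable_ident_cylinder: "(\<lambda>z. z) \<in> cylinder T \<rightarrow>\<^sub>M borel"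
 unfolding cylinder_eq_cyl by (rule borel_measurable_cylI) simp

lemma kernel_mult_integrable:
 fixes K :: "(real ^ 'n) \<times> real => real" and f :: "(real ^ 'n) \<times> real => real"
 assumes "kernel K r" "integrable (cylinder T) f"
 shows "integrable (cylinder T) (\<lambda>z. K (p - z) * f z)"
 using conv_integrable[OF assms] by simp

lemma norm_conv_sq_le:
 fixes u :: "(real ^ 'n) \<times> real => 'b::euclidean_space"
 assumes m: "m > 0" and u: "u \<in> borel_measurable (cylinder T)" "integrable (cylinder T) (\<lambda>z. nsq (u z))"
 shows "ennreal (nsq (conv T (moll m) u p)) <= (\<integral>\<^sup>+z. ennreal (moll m (p - z) * nsq (u z)) \<partial>cylinder T)"
proof -
 interpret finite_measure "cylinder T :: ((real ^ 'n) \<times> real) measure" by (rule finite_measure_cylinder)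
 note K = kernel_moll[OF m, where 'n = 'n]
 have ui: "integrable (cylinder T) u" by (rule integrable_cylinder_L2[OF u])
 let ?K = "\<lambda>z. moll m (p - z)"
 define a where "a = (\<integral>z. ?K z * norm (u z) \<partial>cylinder T)"
 have I: "integrable (cylinder T) ?K" "integrable (cylinder T) (\<lambda>z. ?K z * norm (u z))" "integrable (cylinder T) (\<lambda>z. ?K z * nsq (u z))"
  using kernel_mult_integrable[OF K, of T "\<lambda>z. 1" p] kernel_mult_integrable[OF K integrable_norm[OF ui], of p]
   kernel_mult_integrable[OF K u(2), of p] by simp_all
 have "norm (conv T (moll m) u p) <= (\<integral>z. norm (?K z *R u z) \<partial>cylinder T)"
  unfolding conv_def by (rule integral_norm_bound)
 then have le: "norm (conv T (moll m) u p) <= a" by (simp add: a_def moll_nonneg)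
 have mass: "(\<integral>z. ?K z \<partial>cylinder T) <= 1"
 proof -
  have "ennreal (\<integral>z. ?K z \<partial>cylinder T) = (\<integral>\<^sup>+z. ennreal (?K z) \<partial>cylinder T)"
   by (rule nn_integral_eq_integral[symmetric, OF I(1)]) (simp add: moll_nonneg)
  then have "ennreal (\<integral>z. ?K z \<partial>cylinder T) <= ennreal 1" using moll_mass_cylinder(2)[OF m, where p = p and T = T] by simp
  then show ?thesis by (simp add: ennreal_le_iff)
 qed
 \<comment> \<open>Jensen's inequality: the variance of the norm under the kernel is nonnegative.\<close>
 have "0 <= (\<integral>z. ?K z * (norm (u z) - a)\<^sup>2 \<partial>cylinder T)"
  by (intro Bochner_Integration.integral_nonneg mult_nonneg_nonneg moll_nonneg) simp
 also have "... = (\<integral>z. ?K z * nsq (u z) - 2 * a * (?K z * norm (u z)) + a^2 * ?K z \<partial>cylinder T)"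
  by (rule Bochner_Integration.integral_cong) (auto simp: power2_diff algebra_simps)
 also have "... = (\<integral>z. ?K z * nsq (u z) \<partial>cylinder T) - 2 * a * a + a^2 * (\<integral>z. ?K z \<partial>cylinder T)"
  using I unfolding a_def by simp
 also have "... <= (\<integral>z. ?K z * nsq (u z) \<partial>cylinder T) - 2 * a * a + a^2 * 1"
  using mass by (intro add_left_mono mult_left_mono) auto
 finally have "a^2 <= (\<integral>z. ?K z * nsq (u z) \<partial>cylinder T)" by (simp add: power2_eq_square)
 moreover have "nsq (conv T (moll m) u p) <= a^2" using le by (intro power_mono) auto
 ultimately have "ennreal (nsq (conv T (moll m) u p)) <= ennreal (\<integral>z. ?K z * nsq (u z) \<partial>cylinder T)"
  by (intro ennreal_leI) linarith
 also have "... = (\<integral>\<^sup>+z. ennreal (?K z * nsq (u z)) \<partial>cylinder T)"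
  by (rule nn_integral_eq_integral[symmetric, OF I(3)]) (simp add: moll_nonneg)
 finally show ?thesis .
qed

text \<open>
  Young's inequality for kernels of mass one: Jensen's inequality at each point and an exchange of integrals.
\<close>

lemma conv_L2_bound:
 fixes u :: "(real ^ 'n) \<times> real => 'b::euclidean_space"
 assumes m: "m > 0" and u: "u \<in> borel_measurable (cylinder T)" "integrable (cylinder T) (\<lambda>z. nsq (u z))"
 shows "(\<integral>\<^sup>+p. ennreal (nsq (conv T (moll m) u p)) \<partial>cylinder T) <= (\<integral>\<^sup>+z. ennreal (nsq (u z)) \<partial>cylinder T)"
proof -
 let ?C = "cylinder T :: ((real ^ 'n) \<times> real) measure"
 interpret C: finite_measure ?C by (rule finite_measure_cylinder)
 interpret P: pair_sigma_finite ?C ?C ..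
 note [measurable] = measurable_ident_cylinder[of T] u(1)
 have "(\<integral>\<^sup>+p. ennreal (nsq (conv T (moll m) u p)) \<partial>?C)
  <= (\<integral>\<^sup>+p. (\<integral>\<^sup>+z. ennreal (moll m (p - z) * nsq (u z)) \<partial>?C) \<partial>?C)"
  by (intro nn_integral_mono norm_conv_sq_le[OF m u])
 also have "... = (\<integral>\<^sup>+z. (\<integral>\<^sup>+p. ennreal (moll m (p - z) * nsq (u z)) \<partial>?C) \<partial>?C)"
  using P.Fubini[of "\<lambda>(p, z). ennreal (moll m (p - z) * nsq (u z))"] by simp
 also have "... = (\<integral>\<^sup>+z. (\<integral>\<^sup>+p. ennreal (moll m (p - z)) \<partial>?C) * ennreal (nsq (u z)) \<partial>?C)"
  by (intro nn_integral_cong) (subst nn_integral_multc[symmetric], auto simp: ennreal_mult moll_nonneg)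
 also have "... <= (\<integral>\<^sup>+z. 1 * ennreal (nsq (u z)) \<partial>?C)"
  by (intro nn_integral_mono mult_right_mono moll_mass_cylinder(1)[OF m]) simp
 finally show ?thesis by simp
qed

text \<open>A function that vanishes near the boundary of the box has a continuous periodic extension.\<close>

definition box_supported :: "real => real => ((real ^ 'n) \<times> real => 'b::real_normed_vector) => bool" where
 "box_supported T d g \<longleftrightarrow> continuous_on UNIV g \<and>
  (\<forall>x t. g (x, t) \<noteq> 0 \<longrightarrow> (\<forall>i. d <= x $ i \<and> x $ i <= 2 * pi - d) \<and> d <= t \<and> t <= T - d)"

definition clip :: "real => real" where "clip s = max 0 (min 1 s)"

lemma clip: "0 <= clip s" "clip s <= 1" "s <= 0 ==> clip s = 0" "s >= 1 ==> clip s = 1" "continuous_on A clip"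
 by (auto simp: clip_def[abs_def] intro!: continuous_intros)

definition cutoff :: "real => nat => (real ^ 'n) \<times> real => real" where
 "cutoff T k z = (\<Prod>i\<in>UNIV. clip (real k * fst z $ i - 1) * clip (real k * (2 * pi - fst z $ i) - 1))
  * (clip (real k * snd z - 1) * clip (real k * (T - snd z) - 1))"

lemma cutoff_bounds: "0 <= cutoff T k z" "cutoff T k z <= 1"
proof -
 show "0 <= cutoff T k z" unfolding cutoff_def by (intro mult_nonneg_nonneg prod_nonneg) (auto simp: clip)
 have "(\<Prod>i\<in>UNIV. clip (real k * fst z $ i - 1) * clip (real k * (2 * pi - fst z $ i) - 1)) <= 1"
  by (intro prod_le_1 conjI mult_nonneg_nonneg mult_le_one) (auto simp: clip)
 then show "cutoff T k z <= 1" unfolding cutoff_def by (intro mult_le_one mult_nonneg_nonneg) (auto simp: clip)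
qed

lemma cutoff_continuous: "continuous_on UNIV (cutoff T k)"
 unfolding cutoff_def[abs_def]
 by (intro continuous_on_mult continuous_on_prod continuous_on_compose2[OF clip(5)[of UNIV]] continuous_intros) auto

lemma cutoff_support:
 assumes "k > 0" "cutoff T k (x, t) \<noteq> 0"
 shows "1 / real k <= x $ i \<and> x $ i <= 2 * pi - 1 / real k" "1 / real k <= t \<and> t <= T - 1 / real k"
proof -
 have nz: "clip (real k * x $ i - 1) \<noteq> 0" "clip (real k * (2 * pi - x $ i) - 1) \<noteq> 0"
  "clip (real k * t - 1) \<noteq> 0" "clip (real k * (T - t) - 1) \<noteq> 0" for i
  using assms(2) unfolding cutoff_def by auto
 have g: "real k * s - 1 > 0" if "clip (real k * s - 1) \<noteq> 0" for s using that clip(3)[of "real k * s - 1"] by force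
 have h: "s >= 1 / real k" if "clip (real k * s - 1) \<noteq> 0" for s using g[OF that] assms(1) by (simp add: field_simps)
 show "1 / real k <= x $ i \<and> x $ i <= 2 * pi - 1 / real k" using h[OF nz(1)[of i]] h[OF nz(2)[of i]] by auto
 show "1 / real k <= t \<and> t <= T - 1 / real k" using h[OF nz(3)] h[OF nz(4)] by auto
qed

lemma cutoff_limit:
 assumes "(x, t) \<in> box 0 ((\<chi> i. 2 * pi), T)"
 shows "(\<lambda>k. cutoff T k (x, t)) \<longlonglongrightarrow> 1"
proof -
 have x: "0 < x $ i" "x $ i < 2 * pi" for i
  using assms[unfolded mem_box, rule_format, of "(axis i 1, 0)"] by (auto simp: Basis_prod_def axis_in_Basis_iff inner_axis zero_prod_def)
 have t: "0 < t" "t < T"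
  using assms[unfolded mem_box, rule_format, of "(0, 1)"] by (auto simp: Basis_prod_def zero_prod_def)
 have c: "(\<lambda>k. clip (real k * s - 1)) \<longlonglongrightarrow> 1" if "s > 0" for s
 proof (rule tendsto_eventually)
  have "filterlim (\<lambda>k. real k * s - 1) at_top sequentially" using that by real_asymp
  then have "\<forall>\<^sub>F k in sequentially. real k * s - 1 >= 1" unfolding filterlim_at_top by blast
  then show "\<forall>\<^sub>F k in sequentially. clip (real k * s - 1) = 1" by eventually_elim (rule clip(4))
 qed
 have "(\<lambda>k. (\<Prod>i\<in>UNIV. clip (real k * x $ i - 1) * clip (real k * (2 * pi - x $ i) - 1))
  * (clip (real k * t - 1) * clip (real k * (T - t) - 1))) \<longlonglongrightarrow> (\<Prod>i\<in>(UNIV :: 'a set). 1 * 1) * (1 * 1)"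
  using x t by (intro tendsto_mult tendsto_prod c) auto
 then show ?thesis by (simp add: cutoff_def)
qed

lemma norm_add_sq_le: "nsq (a + b) <= 2 * nsq a + 2 * nsq b"
proof -
 have "nsq (a + b) <= (norm a + norm b)\<^sup>2" by (intro power_mono norm_triangle_ineq) simp
 also have "... <= 2 * nsq a + 2 * nsq b"
  using sum_squares_bound[of "norm a" "norm b"] by (simp add: power2_sum)
 finally show ?thesis .
qed

lemma AE_cylinder_box: "AE z in (cylinder T :: ((real ^ 'n) \<times> real) measure). z \<in> box 0 ((\<chi> i. 2 * pi), T)"
proof -
 have "cbox 0 ((\<chi> i. 2 * pi), T) - box (0 :: (real ^ 'n) \<times> real) ((\<chi> i. 2 * pi), T) \<in> null_sets lebesgue"
  using negligible_frontier_interval negligible_iff_null_sets by blast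
 then have "AE z in lebesgue. z \<notin> cbox 0 ((\<chi> i. 2 * pi), T) - box (0 :: (real ^ 'n) \<times> real) ((\<chi> i. 2 * pi), T)"
  by (rule AE_not_in)
 then have "AE z in lborel. z \<notin> cbox 0 ((\<chi> i. 2 * pi), T) - box (0 :: (real ^ 'n) \<times> real) ((\<chi> i. 2 * pi), T)"
  unfolding AE_completion_iff .
 then have "AE z in lborel. z \<in> torus_cell \<times> {0<..<T} \<longrightarrow> z \<in> box (0 :: (real ^ 'n) \<times> real) ((\<chi> i. 2 * pi), T)"
 proof eventually_elim
  case (elim z)
  show ?case
  proof
   assume "z \<in> torus_cell \<times> {0<..<T}"
   then have "z \<in> cbox 0 ((\<chi> i. 2 * pi), T)"
    using torus_cell_subset by (cases z) (auto simp: zero_prod_def cbox_Pair_eq subset_iff)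
   then show "z \<in> box 0 ((\<chi> i. 2 * pi), T)" using elim by blast
  qed
 qed
 then show ?thesis unfolding cylinder_def by (subst AE_restrict_space_iff) auto
qed

text \<open>
  A truncated function is almost everywhere a limit of continuous functions. Projection to the ball of the
  truncation makes them bounded, a cutoff makes them vanish near the boundary, and dominated convergence applies.
\<close>

lemma box_supported_dense:
 fixes u :: "(real ^ 'n) \<times> real => 'b::euclidean_space"
 assumes u: "u \<in> borel_measurable (cylinder T)" "integrable (cylinder T) (\<lambda>z. nsq (u z))" and e: "e > 0"
 obtains g d where "d > 0" "box_supported T d g" "integrable (cylinder T) (\<lambda>z. nsq (u z - g z))"
  "(\<integral>z. nsq (u z - g z) \<partial>cylinder T) < e"
proof -
 let ?C = "cylinder T :: ((real ^ 'n) \<times> real) measure"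
 interpret C: finite_measure ?C by (rule finite_measure_cylinder)
 note [measurable] = u(1)
 define uR where "uR R z = (if norm (u z) <= real R then u z else 0)" for R z
 have uR_m [measurable]: "uR R \<in> borel_measurable ?C" for R unfolding uR_def[abs_def] by measurable
 have sq: "nsq (u z - uR R z) <= nsq (u z)" for R z by (auto simp: uR_def)
 have "(\<lambda>R. \<integral>z. nsq (u z - uR R z) \<partial>?C) \<longlonglongrightarrow> (\<integral>z. 0 \<partial>?C)"
 proof (rule integral_dominated_convergence[where w = "\<lambda>z. nsq (u z)"])
  show "AE z in ?C. (\<lambda>R. nsq (u z - uR R z)) \<longlonglongrightarrow> 0"
  proof (rule AE_I2, rule tendsto_eventually)
   fix z
   have "\<forall>\<^sub>F R in sequentially. norm (u z) <= real R"
    using filterlim_real_sequentially by (simp add: filterlim_at_top)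
   then show "\<forall>\<^sub>F R in sequentially. nsq (u z - uR R z) = 0" by eventually_elim (simp add: uR_def)
  qed
 qed (use u(2) sq in auto)
 then have "\<forall>\<^sub>F R in sequentially. (\<integral>z. nsq (u z - uR R z) \<partial>?C) < e / 4"
  by (rule order_tendstoD(2)) (use e in simp)
 then obtain R where R: "(\<integral>z. nsq (u z - uR R z) \<partial>?C) < e / 4" by (auto simp: eventually_sequentially)
 have IR: "integrable ?C (\<lambda>z. nsq (u z - uR R z))"
  by (rule Bochner_Integration.integrable_bound[OF u(2)]) (use sq in auto)
 define U where "U z = indicator (torus_cell \<times> {0<..<T}) z *R uR R z" for z
 have "U \<in> borel_measurable lborel"
  using uR_m[of R] unfolding cylinder_def U_def by (subst (asm) borel_measurable_restrict_space_iff) auto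
 then have "U \<in> borel_measurable lebesgue" by (simp add: measurable_completion)
 then have "U measurable_on UNIV" by (rule lebesgue_measurable_imp_measurable_on) auto
 then obtain N h where N: "negligible N" and h: "\<And>k. continuous_on UNIV (h k)" "\<And>z. z \<notin> N ==> (\<lambda>k. h k z) \<longlonglongrightarrow> U z"
  unfolding measurable_on_def by auto
 let ?p = "closest_point (cball (0 :: 'b) (real R))"
 define g where "g k z = cutoff T (Suc k) z *R ?p (h k z)" for k z
 have pc: "continuous_on UNIV ?p" by (rule continuous_on_closest_point) auto
 have pn: "norm (?p y) <= real R" for y
  using closest_point_in_set[of "cball (0 :: 'b) (real R)" y] by simp
 have gc: "continuous_on UNIV (g k)" for k
  unfolding g_def by (intro continuous_on_scaleR cutoff_continuous continuous_on_compose2[OF pc h(1)]) auto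
 have gn: "norm (g k z) <= real R" for k z
 proof -
  have "cutoff T (Suc k) z * norm (?p (h k z)) <= 1 * real R"
   using cutoff_bounds[of T "Suc k" z] pn by (intro mult_mono) auto
  then show ?thesis using cutoff_bounds(1)[of T "Suc k" z] by (simp add: g_def)
 qed
 have gb: "box_supported T (1 / real (Suc k)) (g k)" for k
  unfolding box_supported_def
 proof (intro conjI gc allI impI)
  fix x t i assume "g k (x, t) \<noteq> 0"
  then have c: "cutoff T (Suc k) (x, t) \<noteq> 0" by (auto simp: g_def)
  show "1 / real (Suc k) <= x $ i" "x $ i <= 2 * pi - 1 / real (Suc k)" "1 / real (Suc k) <= t" "t <= T - 1 / real (Suc k)"
   using cutoff_support[OF _ c] by auto
 qed
 have AEN: "AE z in ?C. z \<notin> N"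
 proof -
  have "AE z in lebesgue. z \<notin> N" using N by (intro AE_not_in) (simp add: negligible_iff_null_sets)
  then have "AE z in lborel. z \<notin> N" unfolding AE_completion_iff .
  then show ?thesis unfolding cylinder_def by (subst AE_restrict_space_iff) (auto elim: eventually_mono)
 qed
 have uRn: "norm (uR R z) <= real R" for z by (simp add: uR_def)
 have lim: "AE z in ?C. (\<lambda>k. nsq (uR R z - g k z)) \<longlonglongrightarrow> 0"
  using AEN AE_cylinder_box AE_space
 proof eventually_elim
  case (elim z)
  have "U z = uR R z" using elim(3) by (simp add: U_def cylinder_def space_restrict_space indicator_def)
  then have 1: "(\<lambda>k. h k z) \<longlonglongrightarrow> uR R z" using h(2)[OF elim(1)] by simp
  have "isCont ?p (uR R z)" using pc by (simp add: continuous_on_eq_continuous_at)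
  from isCont_tendsto_compose[OF this 1] have "(\<lambda>k. ?p (h k z)) \<longlonglongrightarrow> uR R z"
   using closest_point_self[of "uR R z" "cball 0 (real R)"] uRn by simp
  moreover have "(\<lambda>k. cutoff T (Suc k) z) \<longlonglongrightarrow> 1"
   using LIMSEQ_Suc[OF cutoff_limit[of "fst z" "snd z" T]] elim(2) by simp
  ultimately have "(\<lambda>k. g k z) \<longlonglongrightarrow> 1 *R uR R z" unfolding g_def by (intro tendsto_scaleR)
  then have "(\<lambda>k. norm (uR R z - g k z)) \<longlonglongrightarrow> norm (uR R z - 1 *R uR R z)" by (intro tendsto_norm tendsto_diff tendsto_const)
  then have "(\<lambda>k. norm (uR R z - g k z)) \<longlonglongrightarrow> 0" by simp
  from tendsto_power[OF this, of 2] show ?case by simp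
 qed
 have gm [measurable]: "g k \<in> borel_measurable ?C" for k
  using borel_measurable_continuous_onI[OF gc] unfolding cylinder_eq_cyl by (rule borel_measurable_cylI)
 have bd: "nsq (uR R z - g k z) <= (2 * real R)\<^sup>2" for z k
  using norm_triangle_ineq4[of "uR R z" "g k z"] uRn[of z] gn[of k z] by (intro power_mono) auto
 have "(\<lambda>k. \<integral>z. nsq (uR R z - g k z) \<partial>?C) \<longlonglongrightarrow> (\<integral>z. 0 \<partial>?C)"
  by (rule integral_dominated_convergence[where w = "\<lambda>z. (2 * real R)\<^sup>2"]) (use lim bd in auto)
 then have "\<forall>\<^sub>F k in sequentially. (\<integral>z. nsq (uR R z - g k z) \<partial>?C) < e / 4"
  by (rule order_tendstoD(2)) (use e in simp)
 then obtain k where k: "(\<integral>z. nsq (uR R z - g k z) \<partial>?C) < e / 4" by (auto simp: eventually_sequentially)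
 have Ik: "integrable ?C (\<lambda>z. nsq (uR R z - g k z))"
  using bd by (intro C.integrable_const_bound[of _ "(2 * real R)\<^sup>2"]) auto
 have tri: "nsq (u z - g k z) <= 2 * nsq (u z - uR R z) + 2 * nsq (uR R z - g k z)" for z
  using norm_add_sq_le[of "u z - uR R z" "uR R z - g k z"] by simp
 have I2: "integrable ?C (\<lambda>z. 2 * nsq (u z - uR R z) + 2 * nsq (uR R z - g k z))" using IR Ik by simp
 have I3: "integrable ?C (\<lambda>z. nsq (u z - g k z))"
  by (rule Bochner_Integration.integrable_bound[OF I2]) (use tri in auto)
 have "(\<integral>z. nsq (u z - g k z) \<partial>?C) <= (\<integral>z. 2 * nsq (u z - uR R z) + 2 * nsq (uR R z - g k z) \<partial>?C)"
  by (rule Bochner_Integration.integral_mono[OF I3 I2 tri])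
 also have "... < e" using R k IR Ik by simp
 finally show thesis using that[OF _ gb I3] by simp
qed

lemma box_supported_bounded:
 fixes g :: "(real ^ 'n) \<times> real => 'b::euclidean_space"
 assumes "box_supported T d g" "d > 0"
 obtains G where "G > 0" "\<And>z. norm (g z) <= G"
proof -
 let ?S = "cbox (0 :: real ^ 'n) (\<chi> i. 2 * pi) \<times> {0..T}"
 have gc: "continuous_on UNIV g" using assms(1) unfolding box_supported_def by blast
 have "compact (g ` ?S)"
  by (intro compact_continuous_image compact_Times continuous_on_subset[OF gc]) auto
 then obtain G where G: "G > 0" "\<forall>y\<in>g ` ?S. norm y <= G" using compact_imp_bounded bounded_pos by metis
 have "norm (g (x, t)) <= G" for x t
 proof (cases "g (x, t) = 0")
  case False
  then have "(\<forall>i. d <= x $ i \<and> x $ i <= 2 * pi - d) \<and> d <= t \<and> t <= T - d"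
   using assms(1) unfolding box_supported_def by blast
  then have b: "d <= x $ i" "x $ i <= 2 * pi - d" "d <= t" "t <= T - d" for i by auto
  have "0 <= x $ i \<and> x $ i <= 2 * pi" for i using b(1,2)[of i] assms(2) by linarith
  moreover have "0 <= t" "t <= T" using b(3,4) assms(2) by auto
  ultimately have "(x, t) \<in> ?S" by (simp add: mem_box_cart)
  then show ?thesis using G(2) by blast
 qed (use G in simp)
 then show thesis using that[OF G(1)] by auto
qed

lemma cos_near_one:
 assumes h: "0 < \<eta>" "\<eta> < pi" "\<eta> < d" and y: "\<bar>y\<bar> <= 2 * pi - d" "cos y >= cos \<eta>"
 shows "\<bar>y\<bar> <= \<eta>"
proof (rule ccontr)
 assume "\<not> \<bar>y\<bar> <= \<eta>"
 then have g: "\<eta> < \<bar>y\<bar>" by simp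
 have "cos y < cos \<eta>"
 proof (cases "\<bar>y\<bar> <= pi")
  case True
  have "cos \<bar>y\<bar> < cos \<eta>" by (rule cos_monotone_0_pi) (use g h True in auto)
  then show ?thesis by simp
 next
  case False
  have "cos (2 * pi - \<bar>y\<bar>) < cos \<eta>" by (rule cos_monotone_0_pi) (use y h False in auto)
  moreover have "cos (2 * pi - \<bar>y\<bar>) = cos y" by (simp add: cos_diff)
  ultimately show ?thesis by simp
 qed
 then show False using y by simp
qed

text \<open>
  Where the kernel is not small, the two points are close on the torus. Close points of the cell
  are close in space too, unless both lie near its boundary, where the function vanishes.
\<close>

lemma kernel_near:
 fixes g :: "(real ^ 'n) \<times> real => 'b::euclidean_space"
 assumes g: "box_supported T d g" "d > 0" and e: "e > 0"
 obtains \<delta> m0 where "0 < \<delta>" "\<delta> < 1" "m0 > (0::nat)"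
  "\<And>m x y t s. m >= m0 ==> x \<in> torus_cell ==> y \<in> torus_cell ==> \<bar>t - s\<bar> <= 1 / real m ==> peak (x - y) >= 1 - \<delta>
   ==> norm (g (y, s) - g (x, t)) <= e"
proof -
 let ?S = "cbox (0 :: real ^ 'n) (\<chi> i. 2 * pi) \<times> {- 1..T + 1}"
 have gc: "continuous_on UNIV g" using g(1) unfolding box_supported_def by blast
 have "uniformly_continuous_on ?S g"
  by (intro compact_uniformly_continuous compact_Times continuous_on_subset[OF gc]) auto
 then obtain r where r: "r > 0" "\<And>z p. z \<in> ?S ==> p \<in> ?S ==> dist z p < r ==> dist (g z) (g p) < e"
  using e unfolding uniformly_continuous_on_def by metis
 define n where "n = real CARD('n)"
 define \<eta> where "\<eta> = min (pi / 2) (min (d / 2) (r / (2 * (n + 1))))"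
 have n: "n >= 0" by (simp add: n_def)
 have \<eta>: "0 < \<eta>" "\<eta> < pi" "\<eta> < d" "n * \<eta> < r / 2"
 proof -
  show p: "0 < \<eta>" unfolding \<eta>_def using g(2) r(1) n by (auto intro!: divide_pos_pos)
  have "\<eta> <= pi / 2" "\<eta> <= d / 2" "\<eta> <= r / (2 * (n + 1))" unfolding \<eta>_def by linarith+
  then show "\<eta> < pi" "\<eta> < d" using g(2) pi_gt_zero by linarith+
  have "n * \<eta> < (n + 1) * \<eta>" using p by simp
  also have "... <= (n + 1) * (r / (2 * (n + 1)))" using n \<open>\<eta> <= r / _\<close> by (intro mult_left_mono) auto
  also have "... = r / 2" using n by (simp add: field_simps)
  finally show "n * \<eta> < r / 2" .
 qed
 define \<delta> where "\<delta> = (1 - cos \<eta>) / 2"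
 have c: "cos \<eta> < 1" "-1 < cos \<eta>"
  using cos_monotone_0_pi[of 0 \<eta>] cos_monotone_0_pi[of \<eta> pi] \<eta> by auto
 have \<delta>: "0 < \<delta>" "\<delta> < 1" using c by (auto simp: \<delta>_def)
 obtain m0 where m0: "real m0 > max 1 (2 / r)" using reals_Archimedean2 by blast
 have m0': "m0 > 0" using m0 by (cases m0) auto
 have "norm (g (y, s) - g (x, t)) <= e"
  if m: "m >= m0" and x: "x \<in> torus_cell" "y \<in> torus_cell" and ts: "\<bar>t - s\<bar> <= 1 / real m" and pk: "peak (x - y) >= 1 - \<delta>"
  for m x y t s
 proof (cases "g (y, s) = 0 \<and> g (x, t) = 0")
  case True then show ?thesis using e by simp
 next
  case False
  have mr: "1 / real m < r / 2" "1 / real m <= 1"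
  proof -
   have "real m > 2 / r" "real m > 1" using m m0 by auto
   then show "1 / real m < r / 2" "1 / real m <= 1" using r(1) by (auto simp: field_simps)
  qed
  have sup: "(\<forall>i. d <= v $ i \<and> v $ i <= 2 * pi - d) \<and> d <= \<tau> \<and> \<tau> <= T - d" if "g (v, \<tau>) \<noteq> 0" for v \<tau>
   using g(1) that unfolding box_supported_def by blast
  have cell: "0 <= x $ i" "x $ i < 2 * pi" "0 <= y $ i" "y $ i < 2 * pi" for i using x by (auto simp: torus_cell_def)
  have di: "\<bar>x $ i - y $ i\<bar> <= \<eta>" for i
  proof (rule cos_near_one[OF \<eta>(1-3)])
   show "\<bar>x $ i - y $ i\<bar> <= 2 * pi - d"
   proof -
    have "(d <= x $ i \<and> x $ i <= 2 * pi - d) \<or> (d <= y $ i \<and> y $ i <= 2 * pi - d)"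
     using False sup[of y s] sup[of x t] by blast
    then show ?thesis using cell[of i] by (auto simp: abs_le_iff)
   qed
   have "1 - \<delta> <= (1 + cos ((x - y) $ i)) / 2" using pk peak_le[of "x - y" i] by linarith
   then show "cos \<eta> <= cos (x $ i - y $ i)" by (simp add: \<delta>_def field_simps)
  qed
  have "dist (y, s) (x, t) <= dist y x + dist s t" by (simp add: dist_Pair_Pair sqrt_sum_squares_le_sum)
  also have "dist y x <= (\<Sum>i\<in>UNIV. \<bar>(y - x) $ i\<bar>)" unfolding dist_norm by (rule norm_le_l1_cart)
  also have "... <= n * \<eta>"
   using abs_sum_UNIV_le[of "\<lambda>i. \<bar>(y - x) $ i\<bar>" \<eta>] di by (simp add: n_def abs_minus_commute sum_nonneg)
  finally have "dist (y, s) (x, t) <= n * \<eta> + \<bar>t - s\<bar>" by (simp add: dist_real_def abs_minus_commute)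
  then have dist: "dist (y, s) (x, t) < r" using \<eta>(4) ts mr by linarith
  have "- 1 <= t \<and> t <= T + 1 \<and> - 1 <= s \<and> s <= T + 1"
   using False sup[of y s] sup[of x t] ts mr(2) g(2) by (auto simp: abs_le_iff)
  then have "(y, s) \<in> ?S" "(x, t) \<in> ?S" using x torus_cell_subset by auto
  from r(2)[OF this dist] show ?thesis by (simp add: dist_norm)
 qed
 then show thesis using that \<delta> m0' by blast
qed

text \<open>
  The mass of the power is at least a multiple of \<open>(1 - \<delta> / 2) ^ m\<close>, which outweighs \<open>(1 - \<delta>) ^ m\<close>.
\<close>

lemma peak_concentrates:
 assumes \<delta>: "0 < \<delta>" "\<delta> < 1"
 shows "(\<lambda>m. (1 - \<delta>) ^ m / (\<integral>x. peak x ^ m \<partial>(torus :: (real ^ 'n) measure))) \<longlonglongrightarrow> 0"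
proof -
 define v where "v = measure torus ({x :: real ^ 'n. peak x > 1 - \<delta> / 2} \<inter> torus_cell)"
 have v: "v > 0" unfolding v_def using \<delta> by (intro peak_superlevel) simp
 let ?q = "(1 - \<delta>) / (1 - \<delta> / 2)"
 have q: "0 <= ?q" "?q < 1" using \<delta> by (auto simp: field_simps)
 have "(\<lambda>m. ?q ^ m / v) \<longlonglongrightarrow> 0 / v" by (intro tendsto_divide LIMSEQ_realpow_zero[OF q] tendsto_const) (use v in auto)
 then have l: "(\<lambda>m. ?q ^ m / v) \<longlonglongrightarrow> 0" by simp
 show ?thesis
 proof (rule tendsto_sandwich[OF _ _ tendsto_const l]; rule always_eventually; rule allI)
  fix m
  have Z: "0 < (\<integral>x. peak x ^ m \<partial>(torus :: (real ^ 'n) measure))" by (rule peak_mass_pos)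
  show "0 <= (1 - \<delta>) ^ m / (\<integral>x. peak x ^ m \<partial>(torus :: (real ^ 'n) measure))" using Z \<delta> by simp
  have "(1 - \<delta> / 2) ^ m * v <= (\<integral>x. peak x ^ m \<partial>(torus :: (real ^ 'n) measure))"
   unfolding v_def using \<delta> by (intro peak_mass_lower) auto
  then have "(1 - \<delta>) ^ m / (\<integral>x. peak x ^ m \<partial>(torus :: (real ^ 'n) measure)) <= (1 - \<delta>) ^ m / ((1 - \<delta> / 2) ^ m * v)"
   using \<delta> v Z by (intro divide_left_mono) auto
  also have "... = ?q ^ m / v" by (simp add: power_divide)
  finally show "(1 - \<delta>) ^ m / (\<integral>x. peak x ^ m \<partial>(torus :: (real ^ 'n) measure)) <= ?q ^ m / v" .
 qed
qed

text \<open>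
  Near the lattice the difference is small by continuity; far from it the normalised kernel is small and the
  function bounded.
\<close>

lemma conv_uniform:
 fixes g :: "(real ^ 'n) \<times> real => 'b::euclidean_space"
 assumes g: "box_supported T d g" "d > 0" and e: "e > 0"
 obtains m0 where "\<And>m p. m >= m0 ==> m > 0 \<and> (fst p \<in> torus_cell \<longrightarrow> norm (conv T (moll m) g p - g p) <= e)"
proof -
 obtain G where G: "G > 0" "\<And>z. norm (g z) <= G" using box_supported_bounded[OF g] by blast
 obtain \<delta> m1 where \<delta>: "0 < \<delta>" "\<delta> < 1" and m1: "m1 > (0::nat)"
  and near: "\<And>m x y t s. m >= m1 ==> x \<in> torus_cell ==> y \<in> torus_cell ==> \<bar>t - s\<bar> <= 1 / real m ==> peak (x - y) >= 1 - \<delta>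
   ==> norm (g (y, s) - g (x, t)) <= e / 2"
  using kernel_near[OF g, of "e / 2"] e by (metis half_gt_zero)
 define Z where "Z m = (\<integral>x. peak x ^ m \<partial>(torus :: (real ^ 'n) measure))" for m
 have Z: "Z m > 0" for m unfolding Z_def by (rule peak_mass_pos)
 define V where "V = measure (torus :: (real ^ 'n) measure) torus_cell"
 have V: "V >= 0" by (simp add: V_def)
 have "(\<lambda>m. 2 * G * V * ((1 - \<delta>) ^ m / Z m)) \<longlonglongrightarrow> 0"
  using tendsto_mult_right_zero[OF peak_concentrates[OF \<delta>, where 'n = 'n]] unfolding Z_def by blast
 then have "\<forall>\<^sub>F m in sequentially. 2 * G * V * ((1 - \<delta>) ^ m / Z m) < e / 2"
  by (rule order_tendstoD(2)) (use e in simp)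
 then obtain m2 where m2: "\<And>m. m >= m2 ==> 2 * G * V * ((1 - \<delta>) ^ m / Z m) < e / 2" by (auto simp: eventually_sequentially)
 have "norm (conv T (moll m) g p - g p) <= e" if m: "m >= max m1 m2" and p: "fst p \<in> torus_cell" for m p
 proof -
  let ?U = "cyl UNIV :: ((real ^ 'n) \<times> real) measure" and ?K = "\<lambda>z. moll m (p - z)"
  have m0: "m > 0" using m m1 by simp
  note K = kernel_moll[OF m0, where 'n = 'n]
  note B = bump_scaled_integral[OF m0]
  let ?b = "\<integral>t. bump (real m * t) \<partial>lborel"
  have gc: "continuous_on UNIV g" using g(1) unfolding box_supported_def by blast
  have gm [measurable]: "g \<in> borel_measurable borel" by (rule borel_measurable_continuous_onI[OF gc])
  have idU [measurable]: "(\<lambda>z. z) \<in> ?U \<rightarrow>\<^sub>M borel" by (rule borel_measurable_cylI) simp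
  have KI: "integrable ?U ?K"
   using moll_mass_shift(2)[OF m0, of p] by (intro integrableI_nonneg) (auto simp: moll_nonneg)
  have KG: "integrable ?U (\<lambda>z. ?K z *R g z)"
  proof (rule Bochner_Integration.integrable_bound[where f = "\<lambda>z. G * ?K z"])
   show "AE z in ?U. norm (?K z *R g z) <= norm (G * ?K z)"
    using G by (intro AE_I2) (simp add: abs_mult moll_nonneg mult.commute[of G] mult_left_mono)
  qed (use KI in auto)
  have "conv T (moll m) g p = (\<integral>z. ?K z *R g z \<partial>?U)"
  proof -
   have g0: "g z = 0" if "snd z \<notin> {0<..<T}" for z
   proof (rule ccontr)
    assume "g z \<noteq> 0"
    then have "d <= snd z \<and> snd z <= T - d" using g(1) unfolding box_supported_def by (metis prod.collapse)
    then show False using that g(2) by auto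
   qed
   have ind: "indicator (torus_cell \<times> {0<..<T}) z *R (?K z *R g z) = indicator (torus_cell \<times> UNIV) z *R (?K z *R g z)" for z
    by (cases "snd z \<in> {0<..<T}") (simp_all add: g0 indicator_times)
   have "conv T (moll m) g p = (\<integral>z. indicator (torus_cell \<times> {0<..<T}) z *R (?K z *R g z) \<partial>lborel)"
    unfolding conv_def cylinder_def by (rule integral_restrict_space) simp
   also have "... = (\<integral>z. indicator (torus_cell \<times> UNIV) z *R (?K z *R g z) \<partial>lborel)" by (simp only: ind)
   also have "... = (\<integral>z. ?K z *R g z \<partial>?U)"
    unfolding cyl_def by (rule integral_restrict_space[symmetric]) simp
   finally show ?thesis .
  qed
  moreover have "g p = (\<integral>z. ?K z *R g p \<partial>?U)"
  proof -
   have "ennreal (\<integral>z. ?K z \<partial>?U) = 1"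
    using nn_integral_eq_integral[OF KI] moll_mass_shift(2)[OF m0, of p] by (simp add: moll_nonneg)
   then have "(\<integral>z. ?K z \<partial>?U) = 1" by (simp add: ennreal_eq_1)
   then show ?thesis using KI by simp
  qed
  ultimately have "conv T (moll m) g p - g p = (\<integral>z. ?K z *R g z - ?K z *R g p \<partial>?U)"
   using KI KG by simp
  then have "conv T (moll m) g p - g p = (\<integral>z. ?K z *R (g z - g p) \<partial>?U)" by (simp add: scaleR_diff_right)
  also have "ennreal (norm ...) <= (\<integral>\<^sup>+z. ennreal (norm (?K z *R (g z - g p))) \<partial>?U)"
   using KI KG by (intro integral_norm_bound_ennreal) (simp add: scaleR_diff_right)
  also have "... <= (\<integral>\<^sup>+z. ennreal (e / 2) * ennreal (?K z)
    + ennreal (2 * G * ((1 - \<delta>) ^ m / Z m)) * ennreal (bump (real m * (snd p - snd z)) / ?b) \<partial>?U)"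
  proof (rule nn_integral_mono)
   fix z assume "z \<in> space ?U"
   then have z: "fst z \<in> torus_cell" by auto
   have b0: "0 <= bump (real m * (snd p - snd z)) / ?b" using B(2) by (simp add: bump_nonneg)
   have T0: "0 <= 2 * G * ((1 - \<delta>) ^ m / Z m)" using G \<delta> Z[of m] by simp
   have "norm (?K z *R (g z - g p)) <= e / 2 * ?K z + 2 * G * ((1 - \<delta>) ^ m / Z m) * (bump (real m * (snd p - snd z)) / ?b)"
   proof (cases "peak (fst p - fst z) >= 1 - \<delta>")
    case True
    show ?thesis
    proof (cases "\<bar>snd p - snd z\<bar> <= 1 / real m")
     case t: True
     have "norm (g z - g p) <= e / 2" using near[of m "fst p" "fst z" "snd p" "snd z"] m p z t True by simp
     then have "?K z * norm (g z - g p) <= ?K z * (e / 2)" by (intro mult_left_mono moll_nonneg)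
     moreover have "0 <= 2 * G * ((1 - \<delta>) ^ m / Z m) * (bump (real m * (snd p - snd z)) / ?b)"
      using T0 b0 by (rule mult_nonneg_nonneg)
     ultimately show ?thesis by (simp add: moll_nonneg mult.commute)
    next
     case False
     then have "?K z = 0" using K unfolding kernel_def by (cases p; cases z) auto
     then show ?thesis using mult_nonneg_nonneg[OF T0 b0] by (simp only: scaleR_zero_left norm_zero mult_zero_right add_0)
    qed
   next
    case False
    have "?K z = peak (fst p - fst z) ^ m / Z m * (bump (real m * (snd p - snd z)) / ?b)"
     by (simp add: moll_def Z_def)
    also have "... <= (1 - \<delta>) ^ m / Z m * (bump (real m * (snd p - snd z)) / ?b)"
     using False Z[of m] b0 peak_bounds(1)[of "fst p - fst z"]
     by (intro mult_right_mono divide_right_mono power_mono) auto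
    finally have 1: "?K z <= (1 - \<delta>) ^ m / Z m * (bump (real m * (snd p - snd z)) / ?b)" .
    have "norm (g z - g p) <= 2 * G" using norm_triangle_ineq4[of "g z" "g p"] G(2)[of z] G(2)[of p] by linarith
    then have "?K z * norm (g z - g p) <= (1 - \<delta>) ^ m / Z m * (bump (real m * (snd p - snd z)) / ?b) * (2 * G)"
     using order_trans[OF moll_nonneg 1] by (intro mult_mono[OF 1]) auto
    moreover have "0 <= e / 2 * ?K z" using e moll_nonneg[of m "p - z"] by simp
    ultimately show ?thesis by (simp add: moll_nonneg mult_ac)
   qed
   then have "ennreal (norm (?K z *R (g z - g p))) <= ennreal (e / 2 * ?K z + 2 * G * ((1 - \<delta>) ^ m / Z m) * (bump (real m * (snd p - snd z)) / ?b))"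
    by (rule ennreal_leI)
   also have "... = ennreal (e / 2 * ?K z) + ennreal (2 * G * ((1 - \<delta>) ^ m / Z m) * (bump (real m * (snd p - snd z)) / ?b))"
    using e moll_nonneg[of m "p - z"] mult_nonneg_nonneg[OF T0 b0] by (intro ennreal_plus) auto
   finally show "ennreal (norm (?K z *R (g z - g p))) <= ennreal (e / 2) * ennreal (?K z)
    + ennreal (2 * G * ((1 - \<delta>) ^ m / Z m)) * ennreal (bump (real m * (snd p - snd z)) / ?b)"
    using e T0 b0 by (simp only: ennreal_mult[OF _ moll_nonneg] ennreal_mult[OF T0 b0] half_gt_zero less_imp_le)
  qed
  also have "... = ennreal (e / 2) * (\<integral>\<^sup>+z. ennreal (?K z) \<partial>?U)
    + ennreal (2 * G * ((1 - \<delta>) ^ m / Z m)) * (\<integral>\<^sup>+z. ennreal (bump (real m * (snd p - snd z)) / ?b) \<partial>?U)"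
  proof -
   have m1: "(\<lambda>z. ennreal (?K z)) \<in> borel_measurable ?U" by measurable
   have m2: "(\<lambda>z. ennreal (bump (real m * (snd p - snd z)) / ?b)) \<in> borel_measurable ?U"
    by (rule borel_measurable_cylI) (intro measurable_compose[OF borel_measurable_continuous_onI measurable_ennreal]
      continuous_intros continuous_on_compose2[OF C_k_continuous[OF C_k_bump]]; use B(2) in auto)
   show ?thesis using m1 m2 by (simp add: nn_integral_add nn_integral_cmult)
  qed
  also have "(\<integral>\<^sup>+z. ennreal (bump (real m * (snd p - snd z)) / ?b) \<partial>?U) = ennreal V"
  proof -
   have bm: "(\<lambda>z :: (real ^ 'n) \<times> real. ennreal (bump (real m * (snd p - snd z)) / ?b)) \<in> borel_measurable borel"
    by (intro measurable_compose[OF borel_measurable_continuous_onI measurable_ennreal]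
      continuous_intros continuous_on_compose2[OF C_k_continuous[OF C_k_bump]]; use B(2) in auto)
   have sym: "bump (real m * (snd p - t)) = bump (real m * (t + - snd p))" for t
    using bump_even[of "real m * (t - snd p)"] by (simp add: algebra_simps)
   have "(\<integral>\<^sup>+t. ennreal (bump (real m * (snd p - t)) / ?b) \<partial>lborel) = (\<integral>\<^sup>+t. ennreal (bump (real m * t) / ?b) \<partial>lborel)"
    unfolding sym by (rule lborel_nn_shift[of "\<lambda>t. ennreal (bump (real m * t) / ?b)"]) measurable
   also have "... = 1" using B by (subst nn_integral_eq_integral) (auto simp: bump_nonneg intro!: divide_nonneg_nonneg)
   finally have 1: "(\<integral>\<^sup>+t. ennreal (bump (real m * (snd p - t)) / ?b) \<partial>lborel) = 1" .
   have "(\<integral>\<^sup>+z. ennreal (bump (real m * (snd p - snd z)) / ?b) \<partial>?U)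
    = (\<integral>\<^sup>+t. (\<integral>\<^sup>+x. ennreal (bump (real m * (snd p - t)) / ?b) \<partial>(torus :: (real ^ 'n) measure)) * indicator UNIV t \<partial>lborel)"
    using bm by (subst nn_integral_cyl) auto
   also have "... = (\<integral>\<^sup>+t. ennreal (bump (real m * (snd p - t)) / ?b) * ennreal V \<partial>lborel)"
    by (simp add: V_def torus.emeasure_eq_measure)
   also have "... = 1 * ennreal V" unfolding 1[symmetric] by (rule nn_integral_multc) measurable
   finally show ?thesis by simp
  qed
  also have "(\<integral>\<^sup>+z. ennreal (?K z) \<partial>?U) = 1" by (rule moll_mass_shift(2)[OF m0])
  also have "ennreal (e / 2) * 1 + ennreal (2 * G * ((1 - \<delta>) ^ m / Z m)) * ennreal V
   = ennreal (e / 2 + 2 * G * V * ((1 - \<delta>) ^ m / Z m))"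
   using e G \<delta> Z[of m] V by (subst ennreal_plus) (auto simp: mult_ac simp flip: ennreal_mult)
  also have "... <= ennreal e" using m2[of m] m by (intro ennreal_leI) auto
  finally show ?thesis using e by (simp add: ennreal_le_iff)
 qed
 then show thesis using that[of "max m1 m2"] m1 by auto
qed

text \<open>
  By density and the bound above, it suffices to treat functions for which the convergence is uniform.
\<close>

lemma mollify_L2:
 fixes u :: "(real ^ 'n) \<times> real => 'b::euclidean_space"
 assumes u: "u \<in> borel_measurable (cylinder T)" "integrable (cylinder T) (\<lambda>z. nsq (u z))" and e: "e > 0"
 shows "\<exists>m0. \<forall>m\<ge>m0. (\<integral>\<^sup>+p. ennreal (nsq (conv T (moll m) u p - u p)) \<partial>cylinder T) <= ennreal e"
proof -
 let ?C = "cylinder T :: ((real ^ 'n) \<times> real) measure"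
 interpret C: finite_measure ?C by (rule finite_measure_cylinder)
 define V where "V = measure ?C (space ?C)"
 have V: "V >= 0" by (simp add: V_def)
 define e1 where "e1 = e / (6 + 4 * V)"
 have e1: "e1 > 0" "e1 * (6 + 4 * V) = e" unfolding e1_def using e V by (auto intro!: divide_pos_pos add_pos_nonneg)
 obtain g d where d: "d > 0" and g: "box_supported T d g" and I: "integrable ?C (\<lambda>z. nsq (u z - g z))"
  and small: "(\<integral>z. nsq (u z - g z) \<partial>?C) < e1"
  using box_supported_dense[OF u e1(1)] by blast
 obtain m0 where m0: "\<And>m p. m >= m0 ==> m > 0 \<and> (fst p \<in> torus_cell \<longrightarrow> norm (conv T (moll m) g p - g p) <= sqrt e1)"
  using conv_uniform[OF g d, of "sqrt e1"] e1(1) by (metis real_sqrt_gt_0_iff)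
 have gm: "g \<in> borel_measurable ?C"
  using borel_measurable_continuous_onI[of g] g unfolding cylinder_eq_cyl box_supported_def by (intro borel_measurable_cylI) blast
 have ug: "(\<lambda>z. u z - g z) \<in> borel_measurable ?C" using u(1) gm by simp
 have ui: "integrable ?C u" by (rule integrable_cylinder_L2[OF u])
 have gi: "integrable ?C g"
 proof -
  have "integrable ?C (\<lambda>z. u z - (u z - g z))"
   by (intro Bochner_Integration.integrable_diff ui integrable_cylinder_L2[OF ug I])
  then show ?thesis by simp
 qed
 have D: "sqdist ?C u g <= ennreal e1"
  using small by (subst nn_integral_eq_integral[OF I]) (auto intro: ennreal_leI)
 show ?thesis
 proof (intro exI allI impI)
  fix m assume "m >= m0"
  then have m: "m > 0" and near: "\<And>p. fst p \<in> torus_cell ==> norm (conv T (moll m) g p - g p) <= sqrt e1" using m0 by auto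
  note K = kernel_moll[OF m, where 'n = 'n]
  have cont: "continuous_on UNIV (conv T (moll m) f)" if "integrable ?C f" for f :: "(real ^ 'n) \<times> real => 'b"
   using C_k_conv[OF that K, of 0] by simp
  have cm: "conv T (moll m) f \<in> borel_measurable ?C" if "integrable ?C f" for f :: "(real ^ 'n) \<times> real => 'b"
   unfolding cylinder_eq_cyl by (intro borel_measurable_cylI borel_measurable_continuous_onI cont that)
  have lin: "conv T (moll m) u p - conv T (moll m) g p = conv T (moll m) (\<lambda>z. u z - g z) p" for p
   unfolding conv_def using conv_integrable[OF K ui, of p] conv_integrable[OF K gi, of p] by (simp add: scaleR_diff_right)
  let ?w = "\<lambda>z. u z - g z"
  have wi: "integrable ?C ?w" by (rule integrable_cylinder_L2[OF ug I])
  have "(\<integral>\<^sup>+p. ennreal (nsq (conv T (moll m) u p - u p)) \<partial>?C)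
   <= (\<integral>\<^sup>+p. (2 * ennreal (nsq (conv T (moll m) ?w p)) + ennreal (4 * e1)) + 4 * ennreal (nsq (?w p)) \<partial>?C)"
  proof (rule nn_integral_mono)
   fix p assume "p \<in> space ?C"
   then have "fst p \<in> torus_cell" by (auto simp: cylinder_eq_cyl)
   then have "nsq (conv T (moll m) g p - g p) <= (sqrt e1)\<^sup>2" by (intro power_mono near) auto
   then have 1: "nsq (conv T (moll m) g p - g p) <= e1" using e1(1) by simp
   have "conv T (moll m) u p - u p = conv T (moll m) ?w p + ((conv T (moll m) g p - g p) + (g p - u p))"
    using lin[of p] by (simp add: algebra_simps)
   then have "nsq (conv T (moll m) u p - u p)
    <= 2 * nsq (conv T (moll m) ?w p) + 2 * nsq ((conv T (moll m) g p - g p) + (g p - u p))"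
    using norm_add_sq_le by metis
   also have "... <= 2 * nsq (conv T (moll m) ?w p) + 2 * (2 * e1 + 2 * nsq (?w p))"
    using norm_add_sq_le[of "conv T (moll m) g p - g p" "g p - u p"] 1 by (simp add: norm_minus_commute)
   also have "... = (2 * nsq (conv T (moll m) ?w p) + 4 * e1) + 4 * nsq (?w p)" by simp
   finally have "ennreal (nsq (conv T (moll m) u p - u p))
    <= ennreal ((2 * nsq (conv T (moll m) ?w p) + 4 * e1) + 4 * nsq (?w p))" by (rule ennreal_leI)
   also have "... = (2 * ennreal (nsq (conv T (moll m) ?w p)) + ennreal (4 * e1)) + 4 * ennreal (nsq (?w p))"
    using e1(1) by (subst ennreal_plus, simp, simp, subst ennreal_plus) (auto simp: ennreal_mult)
   finally show "ennreal (nsq (conv T (moll m) u p - u p))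
    <= (2 * ennreal (nsq (conv T (moll m) ?w p)) + ennreal (4 * e1)) + 4 * ennreal (nsq (?w p))" .
  qed
  also have "... = (2 * (\<integral>\<^sup>+p. ennreal (nsq (conv T (moll m) ?w p)) \<partial>?C) + ennreal (4 * e1) * ennreal V)
    + 4 * (\<integral>\<^sup>+p. ennreal (nsq (?w p)) \<partial>?C)"
  proof -
   have a: "(\<lambda>p. ennreal (nsq (conv T (moll m) ?w p))) \<in> borel_measurable ?C" using cm[OF wi] by measurable
   have b: "(\<lambda>p. ennreal (nsq (?w p))) \<in> borel_measurable ?C" using ug by measurable
   show ?thesis using a b by (simp add: nn_integral_add nn_integral_cmult V_def C.emeasure_eq_measure)
  qed
  also have "... <= (2 * ennreal e1 + ennreal (4 * e1) * ennreal V) + 4 * ennreal e1"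
   by (intro add_mono mult_left_mono order_trans[OF conv_L2_bound[OF m ug I] D] D order_refl) auto
  also have "... = ennreal e"
  proof -
   have "2 * ennreal e1 = ennreal (2 * e1)" "4 * ennreal e1 = ennreal (4 * e1)" using e1(1) by (auto simp: ennreal_mult)
   then have "(2 * ennreal e1 + ennreal (4 * e1) * ennreal V) + 4 * ennreal e1 = ennreal ((2 * e1 + 4 * e1 * V) + 4 * e1)"
    using e1(1) V by (simp add: ennreal_plus[symmetric] ennreal_mult[symmetric] del: ennreal_plus)
   also have "(2 * e1 + 4 * e1 * V) + 4 * e1 = e" using e1(2) by (simp add: algebra_simps)
   finally show ?thesis .
  qed
  finally show "(\<integral>\<^sup>+p. ennreal (nsq (conv T (moll m) u p - u p)) \<partial>?C) <= ennreal e" .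
 qed
qed

section \<open>Completeness\<close>

definition L2_limit :: "'a measure => (nat => 'a => 'b::real_normed_vector) => ('a => 'b) => bool" where
 "L2_limit M f h \<longleftrightarrow> (\<forall>e>0. \<exists>N. \<forall>m\<ge>N. sqdist M (f m) h <= ennreal e)"

lemma AE_cyl_iff:
 assumes "I \<in> sets borel"
 shows "(AE z in (cyl I :: ((real ^ 'n) \<times> real) measure). P z) \<longleftrightarrow> (AE z in lborel. z \<in> torus_cell \<times> I \<longrightarrow> P z)"
 unfolding cyl_def using cell_times_sets[OF assms] by (subst AE_restrict_space_iff) auto

lemma L1_le_of_L2_le:
 fixes f :: "'a => 'b::euclidean_space"
 assumes M: "finite_measure M" and f: "f \<in> borel_measurable M" and e: "e > 0"
  and le: "(\<integral>\<^sup>+z. ennreal (nsq (f z)) \<partial>M) <= ennreal (e^2)"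
 shows "(\<integral>\<^sup>+z. ennreal (norm (f z)) \<partial>M) <= ennreal (e * (1 + measure M (space M)))"
proof -
 interpret finite_measure M by (rule M)
 have "(\<integral>\<^sup>+z. ennreal (norm (f z)) \<partial>M) <= (\<integral>\<^sup>+z. ennreal (1 / e) * ennreal (nsq (f z)) + ennreal e \<partial>M)"
 proof (rule nn_integral_mono)
  fix z
  have "0 <= (norm (f z) - e)\<^sup>2 + e * norm (f z)" using e by simp
  then have "norm (f z) * e <= nsq (f z) + e^2" by (simp add: power2_eq_square algebra_simps)
  then have "norm (f z) <= 1 / e * nsq (f z) + e" using e by (simp add: field_simps power2_eq_square)
  then have "ennreal (norm (f z)) <= ennreal (1 / e * nsq (f z) + e)" by (rule ennreal_leI)
  also have "... = ennreal (1 / e * nsq (f z)) + ennreal e" using e by (intro ennreal_plus) auto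
  also have "ennreal (1 / e * nsq (f z)) = ennreal (1 / e) * ennreal (nsq (f z))" using e by (intro ennreal_mult) auto
  finally show "ennreal (norm (f z)) <= ennreal (1 / e) * ennreal (nsq (f z)) + ennreal e" .
 qed
 also have "... = ennreal (1 / e) * (\<integral>\<^sup>+z. ennreal (nsq (f z)) \<partial>M) + ennreal e * ennreal (measure M (space M))"
  using f by (simp add: nn_integral_add nn_integral_cmult emeasure_eq_measure)
 also have "... <= ennreal (1 / e) * ennreal (e^2) + ennreal e * ennreal (measure M (space M))"
  by (intro add_right_mono mult_left_mono le) simp
 also have "... = ennreal (1 / e * e^2 + e * measure M (space M))"
  using e by (simp add: ennreal_plus[symmetric] ennreal_mult[symmetric] del: ennreal_plus)
 also have "1 / e * e^2 + e * measure M (space M) = e * (1 + measure M (space M))"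
  using e by (simp add: power2_eq_square field_simps)
 finally show ?thesis .
qed

lemma square_root_scale:
 assumes "e > (0::real)" "V >= (0::real)"
 obtains d where "d > 0" "d * (1 + V) <= e"
 using that[of "e / (1 + V)"] assms by simp

lemma L2_limit_imp_L1:
 fixes f :: "nat => 'a => 'b::euclidean_space"
 assumes M: "finite_measure M" and f: "\<And>m. f m \<in> borel_measurable M" "h \<in> borel_measurable M" and lim: "L2_limit M f h"
 shows "(\<lambda>m. \<integral>\<^sup>+z. ennreal (norm (f m z - h z)) \<partial>M) \<longlonglongrightarrow> 0"
proof (rule tendsto_zero_ennreal)
 fix e :: real assume e: "e > 0"
 obtain d where d: "d > 0" "d * (1 + measure M (space M)) <= e / 2"
  by (rule square_root_scale[OF half_gt_zero[OF e] measure_nonneg])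
 obtain N where N: "\<And>m. m >= N ==> sqdist M (f m) h <= ennreal (d^2)"
  using lim d(1) unfolding L2_limit_def by (metis zero_less_power)
 have "(\<integral>\<^sup>+z. ennreal (norm (f m z - h z)) \<partial>M) < ennreal e" if "m >= N" for m
 proof -
  have "(\<integral>\<^sup>+z. ennreal (norm (f m z - h z)) \<partial>M) <= ennreal (d * (1 + measure M (space M)))"
   using f by (intro L1_le_of_L2_le M d(1) N that) auto
  also have "... <= ennreal (e / 2)" by (intro ennreal_leI d)
  also have "... < ennreal e" using e by (intro ennreal_lessI) auto
  finally show ?thesis .
 qed
 then show "\<forall>\<^sub>F m in sequentially. (\<integral>\<^sup>+z. ennreal (norm (f m z - h z)) \<partial>M) < ennreal e"
  by (auto simp: eventually_sequentially)
qed

lemma L2_limit_subseq: "L2_limit M f h ==> strict_mono r ==> L2_limit M (\<lambda>m. f (r m)) h"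
 unfolding L2_limit_def by (meson order_trans seq_suble)

text \<open>
  Riesz--Fischer for convergence on compact time intervals. A subsequence converges almost
  everywhere on each of countably many intervals, hence a diagonal one on all of them, and Fatou's
  lemma turns the Cauchy property into convergence to the pointwise limit. Choosing the limit
  pointwise makes it inherit exact properties such as periodicity.
\<close>

lemma Riesz_Fischer_local:
 fixes g :: "nat => (real ^ 'n) \<times> real => 'b::euclidean_space"
 assumes T: "T > 0" and g: "\<And>m. continuous_on UNIV (g m)"
  and cauchy: "\<And>a b e. 0 < a ==> a < b ==> b < T ==> e > 0 ==>
   \<exists>N. \<forall>i\<ge>N. \<forall>j\<ge>N. sqdist (cyl {a..b}) (g i) (g j) <= ennreal e"
 shows "\<exists>r. strict_mono r \<and> (AE z in cylinder T. convergent (\<lambda>i. g (r i) z)) \<and>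
  (\<forall>a b. 0 < a \<and> a < b \<and> b < T \<longrightarrow> L2_limit (cyl {a..b}) (\<lambda>i. g (r i)) (\<lambda>z. lim (\<lambda>i. g (r i) z)))"
proof -
 define I where "I n = {T / (real n + 3) .. T - T / (real n + 3)}" for n :: nat
 define P where "P n s \<longleftrightarrow> (AE z in (cyl (I n) :: ((real ^ 'n) \<times> real) measure). Cauchy (\<lambda>i. g (s i) z))" for n and s :: "nat => nat"
 have gm: "g m \<in> borel_measurable (cyl J)" for m J
  by (intro borel_measurable_cylI borel_measurable_continuous_onI g)
 have gi: "integrable (cyl {a..b}) (g m)" for m a b
  by (intro integrable_cyl_continuous continuous_on_subset[OF g]) auto
 have ex: "\<exists>r'. strict_mono r' \<and> P n (s \<circ> r')" if s: "strict_mono s" for n and s :: "nat => nat"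
 proof -
  let ?a = "T / (real n + 3)" and ?b = "T - T / (real n + 3)"
  let ?M = "cyl (I n) :: ((real ^ 'n) \<times> real) measure"
  have ab: "0 < ?a" "?a < ?b" "?b < T"
  proof -
   have "?a <= T / 3" using T by (intro divide_left_mono) auto
   moreover show "0 < ?a" using T by (intro divide_pos_pos) auto
   ultimately show "?a < ?b" "?b < T" using T by auto
  qed
  have fin: "finite_measure ?M" unfolding I_def by (rule finite_measure_cyl) auto
  have "\<exists>N. \<forall>i\<ge>N. \<forall>j\<ge>N. (LINT x|?M. norm (g (s i) x - g (s j) x)) < e" if e: "e > 0" for e
  proof -
   obtain d where d: "d > 0" "d * (1 + measure ?M (space ?M)) <= e / 2"
    by (rule square_root_scale[OF half_gt_zero[OF e] measure_nonneg])
   obtain N where N: "\<And>i j. i >= N ==> j >= N ==> sqdist ?M (g i) (g j) <= ennreal (d^2)"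
    using cauchy[OF ab zero_less_power[OF d(1), of 2]] unfolding I_def by blast
   have "(LINT x|?M. norm (g (s i) x - g (s j) x)) < e" if ij: "i >= N" "j >= N" for i j
   proof -
    have "ennreal (LINT x|?M. norm (g (s i) x - g (s j) x)) = (\<integral>\<^sup>+z. ennreal (norm (g (s i) z - g (s j) z)) \<partial>?M)"
     using gi unfolding I_def by (intro nn_integral_eq_integral[symmetric]) auto
    also have "... <= ennreal (d * (1 + measure ?M (space ?M)))"
     using ij seq_suble[OF s, of i] seq_suble[OF s, of j] gm by (intro L1_le_of_L2_le fin d(1) N) auto
    also have "... <= ennreal (e / 2)" by (intro ennreal_leI d)
    finally have "(LINT x|?M. norm (g (s i) x - g (s j) x)) <= e / 2" using e by (simp add: ennreal_le_iff)
    then show ?thesis using e by simp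
   qed
   then show ?thesis by blast
  qed
  then obtain r' where "strict_mono r'" "AE x in ?M. Cauchy (\<lambda>i. g (s (r' i)) x)"
   using cauchy_L1_AE_cauchy_subseq[of ?M "\<lambda>m. g (s m)"] gi unfolding I_def by blast
  then show ?thesis unfolding P_def by auto
 qed
 interpret D: subseqs P by unfold_locales (rule ex)
 have stable: "P n (s \<circ> r)" if "strict_mono r" "P n s" for r s n
 proof -
  have "Cauchy (\<lambda>i. g ((s \<circ> r) i) z)" if "Cauchy (\<lambda>i. g (s i) z)" for z
   using Cauchy_subseq_Cauchy[OF that \<open>strict_mono r\<close>] by (simp add: o_def)
  then show ?thesis using \<open>P n s\<close> unfolding P_def by (auto elim: eventually_mono)
 qed
 define r where "r = D.diagseq"
 have r: "strict_mono r" unfolding r_def by (rule D.subseq_diagseq)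
 have "AE z in (cyl (I n) :: ((real ^ 'n) \<times> real) measure). convergent (\<lambda>i. g (r i) z)" for n
 proof -
  have "P n (r \<circ> ((+) (Suc n)))" unfolding r_def by (rule D.diagseq_holds) (rule stable)
  then have "AE z in (cyl (I n) :: ((real ^ 'n) \<times> real) measure). Cauchy (\<lambda>i. g (r (Suc n + i)) z)" by (simp add: P_def o_def)
  then show ?thesis
  proof (rule eventually_mono)
   fix z assume "Cauchy (\<lambda>i. g (r (Suc n + i)) z)"
   then have "convergent (\<lambda>i. g (r (i + Suc n)) z)" by (simp add: Cauchy_convergent_iff add.commute)
   then show "convergent (\<lambda>i. g (r i) z)" using convergent_ignore_initial_segment[of "\<lambda>i. g (r i) z" "Suc n"] by blast
  qed
 qed
 then have "AE z in lborel. z \<in> torus_cell \<times> I n \<longrightarrow> convergent (\<lambda>i. g (r i) z)" for n :: nat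
  by (subst (asm) AE_cyl_iff) (auto simp: I_def)
 then have "AE z in lborel. \<forall>n. z \<in> torus_cell \<times> I n \<longrightarrow> convergent (\<lambda>i. g (r i) z)" unfolding AE_all_countable by blast
 then have all: "AE z in lborel. z \<in> torus_cell \<times> {0<..<T} \<longrightarrow> convergent (\<lambda>i. g (r i) z)"
 proof (rule eventually_mono)
  fix z :: "(real ^ 'n) \<times> real" assume c: "\<forall>n. z \<in> torus_cell \<times> I n \<longrightarrow> convergent (\<lambda>i. g (r i) z)"
  show "z \<in> torus_cell \<times> {0<..<T} \<longrightarrow> convergent (\<lambda>i. g (r i) z)"
  proof
   assume z: "z \<in> torus_cell \<times> {0<..<T}"
   then have t: "0 < snd z" "snd z < T" by auto
   obtain n where n: "real n > max (T / snd z) (T / (T - snd z))" using reals_Archimedean2 by blast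
   then have "T / snd z <= real n + 3" "T / (T - snd z) <= real n + 3" by auto
   then have "T / (real n + 3) <= snd z" "T / (real n + 3) <= T - snd z" using t by (simp_all add: field_simps)
   then have "z \<in> torus_cell \<times> I n" using z by (auto simp: I_def)
   then show "convergent (\<lambda>i. g (r i) z)" using c by blast
  qed
 qed
 then have conv: "AE z in cylinder T. convergent (\<lambda>i. g (r i) z)"
  unfolding cylinder_eq_cyl by (subst AE_cyl_iff) auto
 have "L2_limit (cyl {a..b}) (\<lambda>i. g (r i)) (\<lambda>z. lim (\<lambda>i. g (r i) z))" if ab: "0 < a" "a < b" "b < T" for a b
  unfolding L2_limit_def
 proof (intro allI impI)
  fix e :: real assume "e > 0"
  obtain N where N: "\<And>i j. i >= N ==> j >= N ==> sqdist (cyl {a..b}) (g i) (g j) <= ennreal e"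
   using cauchy[OF ab \<open>e > 0\<close>] by blast
  have "(\<integral>\<^sup>+z. ennreal (nsq (g (r m) z - lim (\<lambda>i. g (r i) z))) \<partial>cyl {a..b}) <= ennreal e" if m: "m >= N" for m
  proof -
   have ae: "AE z in cyl {a..b}. convergent (\<lambda>i. g (r i) z)"
    using all ab by (subst AE_cyl_iff) (auto elim!: eventually_mono)
   have "(\<integral>\<^sup>+z. ennreal (nsq (g (r m) z - lim (\<lambda>i. g (r i) z))) \<partial>cyl {a..b})
    = (\<integral>\<^sup>+z. liminf (\<lambda>j. ennreal (nsq (g (r m) z - g (r j) z))) \<partial>cyl {a..b})"
    using ae
   proof (intro nn_integral_cong_AE, elim eventually_mono)
    fix z assume "convergent (\<lambda>i. g (r i) z)"
    then have "(\<lambda>i. g (r i) z) \<longlonglongrightarrow> lim (\<lambda>i. g (r i) z)" by (simp add: convergent_LIMSEQ_iff)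
    then have "(\<lambda>j. ennreal (nsq (g (r m) z - g (r j) z))) \<longlonglongrightarrow> ennreal (nsq (g (r m) z - lim (\<lambda>i. g (r i) z)))"
     by (intro tendsto_intros)
    then show "ennreal (nsq (g (r m) z - lim (\<lambda>i. g (r i) z))) = liminf (\<lambda>j. ennreal (nsq (g (r m) z - g (r j) z)))"
     using lim_imp_Liminf[OF sequentially_bot] by metis
   qed
   also have "... <= liminf (\<lambda>j. \<integral>\<^sup>+z. ennreal (nsq (g (r m) z - g (r j) z)) \<partial>cyl {a..b})"
    using gm by (intro nn_integral_liminf) measurable
   also have "... <= liminf (\<lambda>j. ennreal e)"
    using m seq_suble[OF r] by (intro Liminf_mono eventually_sequentiallyI[of N] N) (meson order_trans)+
   finally show ?thesis by (simp add: Liminf_const)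
  qed
  then show "\<exists>N. \<forall>m\<ge>N. (\<integral>\<^sup>+z. ennreal (nsq (g (r m) z - lim (\<lambda>i. g (r i) z))) \<partial>cyl {a..b}) <= ennreal e" by blast
 qed
 then show ?thesis using r conv by blast
qed

text \<open>Distributional identities survive the limit, because the test field is bounded.\<close>

lemma L2_limit_inner:
 fixes f :: "nat => 'a => 'b::euclidean_space" and \<psi> :: "'a => 'b"
 assumes M: "finite_measure M" and f: "\<And>m. integrable M (f m)" "integrable M h" and lim: "L2_limit M f h"
  and \<psi>: "\<psi> \<in> borel_measurable M" "\<And>z. z \<in> space M ==> norm (\<psi> z) <= B"
 shows "(\<lambda>m. \<integral>z. f m z \<bullet> \<psi> z \<partial>M) \<longlonglongrightarrow> (\<integral>z. h z \<bullet> \<psi> z \<partial>M)"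
proof (rule tendsto_L1_int)
 have i: "integrable M (\<lambda>z. u z \<bullet> \<psi> z)" if u: "integrable M u" for u
 proof (rule Bochner_Integration.integrable_bound)
  show "integrable M (\<lambda>z. B * norm (u z))" using u by auto
  show "(\<lambda>z. u z \<bullet> \<psi> z) \<in> borel_measurable M" using \<psi>(1) u by measurable
  show "AE z in M. norm (u z \<bullet> \<psi> z) <= norm (B * norm (u z))"
  proof (rule AE_I2)
   fix z assume "z \<in> space M"
   have "norm (u z \<bullet> \<psi> z) <= norm (\<psi> z) * norm (u z)" using Cauchy_Schwarz_ineq2[of "u z" "\<psi> z"] by (simp add: mult.commute)
   also have "... <= B * norm (u z)" by (intro mult_right_mono \<psi>(2)) (use \<open>z \<in> space M\<close> in auto)
   finally show "norm (u z \<bullet> \<psi> z) <= norm (B * norm (u z))" by simp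
  qed
 qed
 show "integrable M (\<lambda>z. f m z \<bullet> \<psi> z)" for m by (rule i[OF f(1)])
 show "integrable M (\<lambda>z. h z \<bullet> \<psi> z)" by (rule i[OF f(2)])
 have fm: "\<And>m. f m \<in> borel_measurable M" "h \<in> borel_measurable M" using f by auto
 have "(\<lambda>m. ennreal \<bar>B\<bar> * (\<integral>\<^sup>+z. ennreal (norm (f m z - h z)) \<partial>M)) \<longlonglongrightarrow> ennreal \<bar>B\<bar> * 0"
  by (rule tendsto_mult_ennreal) (auto intro: L2_limit_imp_L1[OF M fm lim])
 then have l: "(\<lambda>m. ennreal \<bar>B\<bar> * (\<integral>\<^sup>+z. ennreal (norm (f m z - h z)) \<partial>M)) \<longlonglongrightarrow> 0" by simp
 show "(\<lambda>m. \<integral>\<^sup>+z. ennreal (norm (f m z \<bullet> \<psi> z - h z \<bullet> \<psi> z)) \<partial>M) \<longlonglongrightarrow> 0"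
 proof (rule tendsto_sandwich[OF _ _ tendsto_const l]; rule always_eventually; rule allI)
  fix m
  show "0 <= (\<integral>\<^sup>+z. ennreal (norm (f m z \<bullet> \<psi> z - h z \<bullet> \<psi> z)) \<partial>M)" by simp
  have "(\<integral>\<^sup>+z. ennreal (norm (f m z \<bullet> \<psi> z - h z \<bullet> \<psi> z)) \<partial>M) <= (\<integral>\<^sup>+z. ennreal \<bar>B\<bar> * ennreal (norm (f m z - h z)) \<partial>M)"
  proof (rule nn_integral_mono)
   fix z assume z: "z \<in> space M"
   have "norm (f m z \<bullet> \<psi> z - h z \<bullet> \<psi> z) <= norm (\<psi> z) * norm (f m z - h z)"
    using Cauchy_Schwarz_ineq2[of "f m z - h z" "\<psi> z"] by (simp add: mult.commute inner_diff_left)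
   also have "... <= \<bar>B\<bar> * norm (f m z - h z)" using \<psi>(2)[OF z] by (intro mult_right_mono) auto
   finally show "ennreal (norm (f m z \<bullet> \<psi> z - h z \<bullet> \<psi> z)) <= ennreal \<bar>B\<bar> * ennreal (norm (f m z - h z))"
    by (simp add: ennreal_leI flip: ennreal_mult)
  qed
  also have "... = ennreal \<bar>B\<bar> * (\<integral>\<^sup>+z. ennreal (norm (f m z - h z)) \<partial>M)" using fm by (intro nn_integral_cmult) measurable
  finally show "(\<integral>\<^sup>+z. ennreal (norm (f m z \<bullet> \<psi> z - h z \<bullet> \<psi> z)) \<partial>M) <= ennreal \<bar>B\<bar> * (\<integral>\<^sup>+z. ennreal (norm (f m z - h z)) \<partial>M)" .
 qed
qed

section \<open>Distributional derivatives of limits\<close>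

lemma dir_deriv_zero_outside:
 fixes f :: "(real ^ 'n) \<times> real => 'b::real_normed_vector"
 assumes z: "\<And>z. snd z \<notin> {a..b} ==> f z = 0" and p: "snd p \<notin> {a..b}"
 shows "dir_deriv v f p = 0"
proof -
 have op: "open (UNIV \<times> (- {a..b}) :: ((real ^ 'n) \<times> real) set)" by (intro open_Times) auto
 have "(f has_derivative (\<lambda>_. 0)) (at p)"
 proof (rule has_derivative_transform_within_open[OF has_derivative_const op])
  show "p \<in> UNIV \<times> (- {a..b})" using p by (cases p) auto
  show "0 = f y" if "y \<in> UNIV \<times> (- {a..b})" for y
  proof -
   have "snd y \<notin> {a..b}" using that by (cases y) auto
   then show ?thesis by (simp add: z)
  qed
 qed
 then show ?thesis by (rule has_derivative_imp_dir_deriv)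
qed

lemma periodic_dir_deriv:
 fixes f :: "(real ^ 'n) \<times> real => 'b::real_normed_vector"
 assumes f: "C_k (Suc 0) f" "\<And>t. torus_periodic (\<lambda>x. f (x, t))"
 shows "torus_periodic (\<lambda>x. dir_deriv v f (x, t))"
 by (rule torus_periodic_partial) (use f in auto)

lemma derivatives_continuous:
 fixes u :: "(real ^ 'n) \<times> real => 'b::euclidean_space"
 assumes "C_k 2 u"
 shows "continuous_on UNIV (time_deriv u)" "continuous_on UNIV (laplacian u)"
proof -
 have C2: "C_k (Suc (Suc 0)) u" using assms by (simp only: numeral_2_eq_2)
 show "continuous_on UNIV (time_deriv u)" "continuous_on UNIV (laplacian u)"
  using C_k_continuous[OF C_k_dir_deriv[OF C2]] C_k_continuous[OF C_k_dir_deriv[OF C_k_dir_deriv[OF C2]]]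
  by (auto simp: time_deriv_def laplacian_def[abs_def] space_deriv_def intro!: continuous_on_sum)
qed

lemma derivatives_periodic:
 fixes u :: "(real ^ 'n) \<times> real => 'b::euclidean_space"
 assumes "C_k 2 u" "\<And>t. torus_periodic (\<lambda>x. u (x, t))"
 shows "torus_periodic (\<lambda>x. time_deriv u (x, t))" "torus_periodic (\<lambda>x. laplacian u (x, t))"
proof -
 have C2: "C_k (Suc (Suc 0)) u" using assms(1) by (simp only: numeral_2_eq_2)
 note p = periodic_dir_deriv[OF C_k_pred[OF C2] assms(2)]
 note pp = periodic_dir_deriv[OF C_k_dir_deriv[OF C2] p]
 show "torus_periodic (\<lambda>x. time_deriv u (x, t))" unfolding time_deriv_def by (rule p)
 show "torus_periodic (\<lambda>x. laplacian u (x, t))"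
  using pp unfolding laplacian_def space_deriv_def torus_periodic_def by simp
qed

lemma integral_parts_time:
 fixes u \<psi> :: "(real ^ 'n) \<times> real => 'b::euclidean_space"
 assumes u: "C_k 1 u" and \<psi>: "C_k 1 \<psi>" "\<And>x. \<psi> (x, a) = 0" "\<And>x. \<psi> (x, b) = 0" and ab: "a <= b"
 shows "(\<integral>z. u z \<bullet> time_deriv \<psi> z \<partial>cyl {a..b}) = - (\<integral>z. time_deriv u z \<bullet> \<psi> z \<partial>cyl {a..b})"
proof -
 have C1: "C_k (Suc 0) u" "C_k (Suc 0) \<psi>" using u \<psi>(1) by (simp_all only: One_nat_def)
 have c: "continuous_on UNIV u" "continuous_on UNIV \<psi>" "continuous_on UNIV (time_deriv u)" "continuous_on UNIV (time_deriv \<psi>)"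
  using C_k_continuous[OF u] C_k_continuous[OF \<psi>(1)] C1 by (auto simp: time_deriv_def)
 have c1: "continuous_on (UNIV \<times> {a..b}) (\<lambda>z. u z \<bullet> time_deriv \<psi> z)" "continuous_on (UNIV \<times> {a..b}) (\<lambda>z. time_deriv u z \<bullet> \<psi> z)"
  by (auto intro!: continuous_on_inner intro: continuous_on_subset[OF c(1)] continuous_on_subset[OF c(2)]
    continuous_on_subset[OF c(3)] continuous_on_subset[OF c(4)])
 have d: "u differentiable (at p)" "\<psi> differentiable (at p)" for p
  using C_k_differentiable[OF u] C_k_differentiable[OF \<psi>(1)] by auto
 have hp: "has_partial (\<lambda>z. u z \<bullet> \<psi> z) (u p \<bullet> time_deriv \<psi> p + time_deriv u p \<bullet> \<psi> p) (0, 1) p" for p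
  unfolding time_deriv_def by (intro has_partial_inner has_partial_dir_deriv d)
 have "(\<integral>z. u z \<bullet> time_deriv \<psi> z + time_deriv u z \<bullet> \<psi> z \<partial>cyl {a..b}) = (\<integral>x. u (x, b) \<bullet> \<psi> (x, b) - u (x, a) \<bullet> \<psi> (x, a) \<partial>torus)"
  by (rule integral_cyl_time_partial[OF hp ab]) (intro continuous_on_add c1)
 also have "... = 0" by (simp add: \<psi>(2,3))
 finally show ?thesis using integrable_cyl_continuous[OF c1(1)] integrable_cyl_continuous[OF c1(2)] by simp
qed

lemma integral_parts_space:
 fixes u \<psi> :: "(real ^ 'n) \<times> real => 'b::euclidean_space"
 assumes u: "C_k 1 u" "\<And>t. torus_periodic (\<lambda>x. u (x, t))" and \<psi>: "C_k 1 \<psi>" "\<And>t. torus_periodic (\<lambda>x. \<psi> (x, t))"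
 shows "(\<integral>z. u z \<bullet> space_deriv i \<psi> z \<partial>cyl {a..b}) = - (\<integral>z. space_deriv i u z \<bullet> \<psi> z \<partial>cyl {a..b})"
proof -
 have C1: "C_k (Suc 0) u" "C_k (Suc 0) \<psi>" using u(1) \<psi>(1) by (simp_all only: One_nat_def)
 have c: "continuous_on UNIV u" "continuous_on UNIV \<psi>" "continuous_on UNIV (space_deriv i u)" "continuous_on UNIV (space_deriv i \<psi>)"
  using C_k_continuous[OF u(1)] C_k_continuous[OF \<psi>(1)] C1 by (auto simp: space_deriv_def)
 have c1: "continuous_on (UNIV \<times> {a..b}) (\<lambda>z. u z \<bullet> space_deriv i \<psi> z)" "continuous_on (UNIV \<times> {a..b}) (\<lambda>z. space_deriv i u z \<bullet> \<psi> z)"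
  by (auto intro!: continuous_on_inner intro: continuous_on_subset[OF c(1)] continuous_on_subset[OF c(2)]
    continuous_on_subset[OF c(3)] continuous_on_subset[OF c(4)])
 have d: "u differentiable (at p)" "\<psi> differentiable (at p)" for p
  using C_k_differentiable[OF u(1)] C_k_differentiable[OF \<psi>(1)] by auto
 have hp: "has_partial (\<lambda>z. u z \<bullet> \<psi> z) (u p \<bullet> space_deriv i \<psi> p + space_deriv i u p \<bullet> \<psi> p) (axis i 1, 0) p" for p
  unfolding space_deriv_def by (intro has_partial_inner has_partial_dir_deriv d)
 have per: "torus_periodic (\<lambda>x. u (x, t) \<bullet> \<psi> (x, t))" for t
  using u(2)[of t] \<psi>(2)[of t] by (simp add: torus_periodic_def)
 have per': "torus_periodic (\<lambda>x. u (x, t) \<bullet> space_deriv i \<psi> (x, t) + space_deriv i u (x, t) \<bullet> \<psi> (x, t))" for t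
  using u(2)[of t] \<psi>(2)[of t] periodic_dir_deriv[OF C1(1) u(2), of "(axis i 1, 0)" t] periodic_dir_deriv[OF C1(2) \<psi>(2), of "(axis i 1, 0)" t]
  by (simp add: torus_periodic_def space_deriv_def)
 have "(\<integral>z. u z \<bullet> space_deriv i \<psi> z + space_deriv i u z \<bullet> \<psi> z \<partial>cyl {a..b}) = 0"
  by (rule integral_cyl_space_partial[OF per per' hp]) (intro continuous_on_add c1)
 then show ?thesis using integrable_cyl_continuous[OF c1(1)] integrable_cyl_continuous[OF c1(2)] by simp
qed

lemma integral_parts_laplacian:
 fixes u \<psi> :: "(real ^ 'n) \<times> real => 'b::euclidean_space"
 assumes u: "C_k 2 u" "\<And>t. torus_periodic (\<lambda>x. u (x, t))" and \<psi>: "C_k 2 \<psi>" "\<And>t. torus_periodic (\<lambda>x. \<psi> (x, t))"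
 shows "(\<integral>z. u z \<bullet> laplacian \<psi> z \<partial>cyl {a..b}) = (\<integral>z. laplacian u z \<bullet> \<psi> z \<partial>cyl {a..b})"
proof -
 have C2: "C_k (Suc (Suc 0)) u" "C_k (Suc (Suc 0)) \<psi>" using u(1) \<psi>(1) by (simp_all only: numeral_2_eq_2)
 have C1: "C_k 1 u" "C_k 1 \<psi>" "C_k 1 (space_deriv i u)" "C_k 1 (space_deriv i \<psi>)" for i
  using C2 C_k_pred[OF C2(1)] C_k_pred[OF C2(2)] by (auto simp: space_deriv_def)
 have per: "torus_periodic (\<lambda>x. space_deriv i u (x, t))" "torus_periodic (\<lambda>x. space_deriv i \<psi> (x, t))" for i t
  unfolding space_deriv_def using periodic_dir_deriv[OF C_k_pred[OF C2(1)] u(2)] periodic_dir_deriv[OF C_k_pred[OF C2(2)] \<psi>(2)] by auto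
 have c: "continuous_on (UNIV \<times> {a..b}) u" "continuous_on (UNIV \<times> {a..b}) \<psi>"
  "continuous_on (UNIV \<times> {a..b}) (space_deriv i (space_deriv i u))" "continuous_on (UNIV \<times> {a..b}) (space_deriv i (space_deriv i \<psi>))" for i
  unfolding space_deriv_def
  by (auto intro: continuous_on_subset[OF C_k_continuous[OF u(1)]] continuous_on_subset[OF C_k_continuous[OF \<psi>(1)]]
    continuous_on_subset[OF C_k_continuous[OF C_k_dir_deriv[OF C_k_dir_deriv[OF C2(1)]]]]
    continuous_on_subset[OF C_k_continuous[OF C_k_dir_deriv[OF C_k_dir_deriv[OF C2(2)]]]])
 have i: "integrable (cyl {a..b}) (\<lambda>z. u z \<bullet> space_deriv i (space_deriv i \<psi>) z)" "integrable (cyl {a..b}) (\<lambda>z. space_deriv i (space_deriv i u) z \<bullet> \<psi> z)" for i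
  by (intro integrable_cyl_continuous continuous_on_inner c)+
 have "(\<integral>z. u z \<bullet> laplacian \<psi> z \<partial>cyl {a..b}) = (\<Sum>i\<in>UNIV. \<integral>z. u z \<bullet> space_deriv i (space_deriv i \<psi>) z \<partial>cyl {a..b})"
  unfolding laplacian_def inner_sum_right using i by (intro Bochner_Integration.integral_sum) auto
 also have "... = (\<Sum>i\<in>UNIV. \<integral>z. space_deriv i (space_deriv i u) z \<bullet> \<psi> z \<partial>cyl {a..b})"
  using integral_parts_space[OF C1(1) u(2) C1(4) per(2)] integral_parts_space[OF C1(3) per(1) C1(2) \<psi>(2)] by simp
 also have "... = (\<integral>z. laplacian u z \<bullet> \<psi> z \<partial>cyl {a..b})"
  unfolding laplacian_def inner_sum_left using i by (intro Bochner_Integration.integral_sum[symmetric]) auto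
 finally show ?thesis .
qed

lemma L2_limit_cyl_mono:
 assumes "L2_limit (cyl I) f h" "K \<subseteq> I" "K \<in> sets borel" "I \<in> sets borel"
 shows "L2_limit (cyl K) f h"
 using assms(1) nn_integral_cyl_mono_set[OF assms(2-4)] unfolding L2_limit_def by (meson order_trans)

lemma L2_limit_integrable:
 fixes f :: "nat => 'a => 'b::euclidean_space"
 assumes M: "finite_measure M" and f: "\<And>m. integrable M (f m)" "h \<in> borel_measurable M" and lim: "L2_limit M f h"
 shows "integrable M h"
proof -
 obtain N where "(\<integral>\<^sup>+z. ennreal (nsq (f N z - h z)) \<partial>M) <= ennreal 1"
  using lim[unfolded L2_limit_def, rule_format, OF zero_less_one] by blast
 then have "(\<integral>\<^sup>+z. ennreal (nsq (f N z - h z)) \<partial>M) <= ennreal (1\<^sup>2)" by (simp only: power_one)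
 then have "(\<integral>\<^sup>+z. ennreal (norm (f N z - h z)) \<partial>M) <= ennreal (1 * (1 + measure M (space M)))"
  using f by (intro L1_le_of_L2_le M) auto
 also have "... < \<infinity>" by simp
 finally have "integrable M (\<lambda>z. f N z - h z)" using f by (intro integrableI_bounded) auto
 then have "integrable M (\<lambda>z. f N z - (f N z - h z))" by (rule Bochner_Integration.integrable_diff[OF f(1)])
 then show ?thesis by simp
qed

lemma integral_cylinder_support:
 fixes f :: "(real ^ 'n) \<times> real => 'b::{banach, second_countable_topology}"
 assumes "\<And>z. snd z \<notin> {a..b} ==> f z = 0" "0 < a" "b < T"
 shows "(\<integral>z. f z \<partial>cylinder T) = (\<integral>z. f z \<partial>cyl {a..b})"
proof -
 have e: "indicator (torus_cell \<times> {0<..<T}) z *R f z = indicator (torus_cell \<times> {a..b}) z *R f z" for z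
  using assms by (cases "snd z \<in> {a..b}") (auto simp: indicator_times)
 have "(\<integral>z. f z \<partial>cylinder T) = (\<integral>z. indicator (torus_cell \<times> {0<..<T}) z *R f z \<partial>lborel)"
  unfolding cylinder_def by (rule integral_restrict_space) simp
 also have "... = (\<integral>z. indicator (torus_cell \<times> {a..b}) z *R f z \<partial>lborel)" by (simp only: e)
 also have "... = (\<integral>z. f z \<partial>cyl {a..b})" unfolding cyl_def by (rule integral_restrict_space[symmetric]) simp
 finally show ?thesis .
qed

lemma integrable_cyl_mono:
 fixes f :: "(real ^ 'n) \<times> real => 'b::euclidean_space"
 assumes f: "integrable (cyl K) f" and I: "I \<subseteq> K" "I \<in> sets borel" "K \<in> sets borel"
 shows "integrable (cyl I) f"
proof -
 note [measurable] = I(2,3)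
 have "integrable lborel (\<lambda>z. indicator (torus_cell \<times> K) z *R f z)"
  using f unfolding cyl_def by (subst (asm) integrable_restrict_space) auto
 then have "integrable lborel (\<lambda>z. indicator (torus_cell \<times> I) z *R (indicator (torus_cell \<times> K) z *R f z))"
  by (rule integrable_mult_indicator[rotated]) simp
 moreover have "indicator (torus_cell \<times> I) z *R (indicator (torus_cell \<times> K) z *R f z) = indicator (torus_cell \<times> I) z *R f z" for z
  using I(1) by (auto simp: indicator_def)
 ultimately have "integrable lborel (\<lambda>z. indicator (torus_cell \<times> I) z *R f z)" by (simp only:)
 then show ?thesis unfolding cyl_def by (subst integrable_restrict_space) auto
qed

lemma L1_loc_limit:
 fixes f :: "nat => (real ^ 'n) \<times> real => real ^ 2"
 assumes T: "T > 0" and f: "\<And>m. continuous_on UNIV (f m)" and h: "h \<in> borel_measurable borel" "\<And>t. torus_periodic (\<lambda>x. h (x, t))"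
  and lim: "\<And>a b. 0 < a ==> a < b ==> b < T ==> L2_limit (cyl {a..b}) f h"
 shows "L1_loc_cylinder T h"
 unfolding L1_loc_cylinder_def
proof (intro conjI allI impI ballI)
 show "h \<in> borel_measurable (cylinder T)" unfolding cylinder_eq_cyl by (rule borel_measurable_cylI[OF h(1)])
 show "torus_periodic (\<lambda>x. h (x, t))" for t by (rule h(2))
 fix a b :: real assume ab: "0 < a \<and> b < T"
 define a' b' where "a' = min a (T / 3)" and "b' = max b (2 * T / 3)"
 have ab': "0 < a'" "a' < b'" "b' < T" "a' <= a" "b <= b'" using ab T by (auto simp: a'_def b'_def)
 have "integrable (cyl {a'..b'}) h"
  by (rule L2_limit_integrable[OF finite_measure_cyl _ borel_measurable_cylI[OF h(1)] lim[OF ab'(1-3)]])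
   (auto intro!: integrable_cyl_continuous continuous_on_subset[OF f])
 then have "integrable lborel (\<lambda>z. indicator (torus_cell \<times> {a'..b'}) z *R h z)"
  unfolding cyl_def by (subst (asm) integrable_restrict_space) auto
 then have "integrable lborel (\<lambda>z. indicator (UNIV \<times> {a..b}) z *R (indicator (torus_cell \<times> {a'..b'}) z *R h z))"
  by (rule integrable_mult_indicator[rotated]) (auto intro!: borel_closed closed_Times)
 moreover have "indicator (UNIV \<times> {a..b}) z *R (indicator (torus_cell \<times> {a'..b'}) z *R h z)
  = indicator (torus_cell \<times> {0<..<T}) z *R (indicator (UNIV \<times> {a..b}) z *R h z)" for z
  using ab ab' by (auto simp: indicator_def)
 ultimately have "integrable lborel (\<lambda>z. indicator (torus_cell \<times> {0<..<T}) z *R (indicator (UNIV \<times> {a..b}) z *R h z))" by (simp only:)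
 then show "set_integrable (cylinder T) (UNIV \<times> {a..b}) h"
  unfolding cylinder_def set_integrable_def by (subst integrable_restrict_space) auto
qed

lemma test_field_box:
 fixes \<psi> :: "(real ^ 'n) \<times> real => real ^ 2"
 assumes T: "T > 0" and \<psi>: "test_field T \<psi>"
 obtains a b where "0 < a" "a < b" "b < T" "\<And>z. snd z \<notin> {a..b} ==> \<psi> z = 0" "\<And>x. \<psi> (x, a) = 0" "\<And>x. \<psi> (x, b) = 0"
proof -
 obtain a b where ab: "0 < a" "b < T" "\<And>x t. t \<notin> {a..b} ==> \<psi> (x, t) = 0" using \<psi> unfolding test_field_def by blast
 define a' b' where "a' = min a (T / 3) / 2" and "b' = (max b (2 * T / 3) + T) / 2"
 have 1: "0 < a'" "a' < a" "a' < T / 3" using ab(1) T by (auto simp: a'_def min_def)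
 have 2: "b < b'" "2 * T / 3 < b'" "b' < T" using ab(2) T by (auto simp: b'_def max_def)
 show thesis
 proof (rule that)
  show "0 < a'" "b' < T" by (rule 1, rule 2)
  show "a' < b'" using 1 2 T by linarith
  show "\<psi> (x, a') = 0" "\<psi> (x, b') = 0" for x using 1 2 by (auto intro: ab(3))
  show "\<psi> z = 0" if "snd z \<notin> {a'..b'}" for z
  proof -
   have "snd z \<notin> {a..b}" using that 1 2 by auto
   then show ?thesis using ab(3)[of "snd z" "fst z"] by simp
  qed
 qed
qed

lemma bounded_on_cell:
 fixes f :: "(real ^ 'n) \<times> real => 'b::real_normed_vector"
 assumes "continuous_on UNIV f"
 obtains B where "\<And>z. z \<in> space (cyl {a..b}) ==> norm (f z) <= B"
proof -
 have "compact (f ` (cbox 0 (\<chi> i. 2 * pi) \<times> {a..b}))"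
  by (intro compact_continuous_image compact_Times continuous_on_subset[OF assms]) auto
 then obtain B where B: "\<forall>y\<in>f ` (cbox 0 (\<chi> i. 2 * pi) \<times> {a..b}). norm y <= B" using compact_imp_bounded bounded_iff by metis
 have "norm (f z) <= B" if "z \<in> space (cyl {a..b})" for z
 proof -
  have "z \<in> cbox 0 (\<chi> i. 2 * pi) \<times> {a..b}" using that torus_cell_subset by (cases z) auto
  then show ?thesis using B by blast
 qed
 then show thesis using that by blast
qed

text \<open>Both identities are integrations by parts for the approximations, followed by a passage to the limit.\<close>

lemma weak_derivatives_limit:
 fixes u :: "nat => (real ^ 'n) \<times> real => real ^ 2"
 assumes T: "T > 0" and u: "\<And>m. C_k 2 (u m)" "\<And>m t. torus_periodic (\<lambda>x. u m (x, t))"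
  and q: "integrable (cylinder T) q" "L2_limit (cylinder T) u q"
  and ht: "ht \<in> borel_measurable borel" "\<And>t. torus_periodic (\<lambda>x. ht (x, t))"
   "\<And>a b. 0 < a ==> a < b ==> b < T ==> L2_limit (cyl {a..b}) (\<lambda>m. time_deriv (u m)) ht"
  and hl: "hl \<in> borel_measurable borel" "\<And>t. torus_periodic (\<lambda>x. hl (x, t))"
   "\<And>a b. 0 < a ==> a < b ==> b < T ==> L2_limit (cyl {a..b}) (\<lambda>m. laplacian (u m)) hl"
 shows "weak_time_deriv T q ht" "weak_laplacian T q hl"
proof -
 note cu = C_k_continuous[OF u(1)] derivatives_continuous[OF u(1)]
 have C1: "C_k 1 (u m)" for m by (rule C_k_mono[OF u(1)]) simp
 note L1 = L1_loc_limit[OF T cu(2) ht] L1_loc_limit[OF T cu(3) hl]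
 have key: "(\<integral>p. q p \<bullet> time_deriv \<psi> p \<partial>cylinder T) = - (\<integral>p. ht p \<bullet> \<psi> p \<partial>cylinder T) \<and>
   (\<integral>p. q p \<bullet> laplacian \<psi> p \<partial>cylinder T) = (\<integral>p. hl p \<bullet> \<psi> p \<partial>cylinder T)" if \<psi>: "test_field T \<psi>" for \<psi> :: "(real ^ 'n) \<times> real => real ^ 2"
 proof -
  obtain a b where ab: "0 < a" "a < b" "b < T" and z: "\<And>z. snd z \<notin> {a..b} ==> \<psi> z = 0" "\<And>x. \<psi> (x, a) = 0" "\<And>x. \<psi> (x, b) = 0"
   using test_field_box[OF T \<psi>] by blast
  let ?M = "cyl {a..b} :: ((real ^ 'n) \<times> real) measure"
  have P: "C_infinity \<psi>" "\<And>t. torus_periodic (\<lambda>x. \<psi> (x, t))" using \<psi> by (auto simp: test_field_def)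
  have Pk: "C_k k \<psi>" for k using P(1) by (simp add: C_infinity_def)
  have zd: "dir_deriv v \<psi> p = 0" if "snd p \<notin> {a..b}" for v p
   by (rule dir_deriv_zero_outside[OF z(1) that])
  have zdd: "dir_deriv w (dir_deriv v \<psi>) p = 0" if "snd p \<notin> {a..b}" for v w p
   by (rule dir_deriv_zero_outside[OF zd that])
  have zt: "time_deriv \<psi> p = 0" "laplacian \<psi> p = 0" if "snd p \<notin> {a..b}" for p
   using zd[OF that] zdd[OF that] by (auto simp: time_deriv_def laplacian_def space_deriv_def)
  note c = C_k_continuous[OF Pk] derivatives_continuous[OF Pk]
  have fin: "finite_measure ?M" by (rule finite_measure_cyl) auto
  have lim: "(\<lambda>m. \<integral>z. f m z \<bullet> \<phi> z \<partial>?M) \<longlonglongrightarrow> (\<integral>z. g z \<bullet> \<phi> z \<partial>?M)"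
   if h: "\<And>m. continuous_on UNIV (f m)" "integrable ?M g" "L2_limit ?M f g" "continuous_on UNIV \<phi>" for f g and \<phi> :: "(real ^ 'n) \<times> real => real ^ 2"
  proof -
   obtain B where "\<And>z. z \<in> space ?M ==> norm (\<phi> z) <= B" using bounded_on_cell[OF h(4)] by blast
   then show ?thesis using h
    by (intro L2_limit_inner[OF fin _ h(2,3)])
     (auto intro!: integrable_cyl_continuous borel_measurable_cylI borel_measurable_continuous_onI intro: continuous_on_subset)
  qed
  have qi: "integrable ?M q" by (rule integrable_cyl_mono[OF q(1)[unfolded cylinder_eq_cyl]]) (use ab in auto)
  have ql: "L2_limit ?M u q" by (rule L2_limit_cyl_mono[OF q(2)[unfolded cylinder_eq_cyl]]) (use ab in auto)
  have hi: "integrable ?M ht" "integrable ?M hl"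
   by (rule L2_limit_integrable[OF fin _ borel_measurable_cylI[OF ht(1)] ht(3)[OF ab]],
     rule integrable_cyl_continuous, rule continuous_on_subset[OF cu(2)], simp,
     rule L2_limit_integrable[OF fin _ borel_measurable_cylI[OF hl(1)] hl(3)[OF ab]],
     rule integrable_cyl_continuous, rule continuous_on_subset[OF cu(3)], simp)
  have parts_t: "(\<integral>z. u m z \<bullet> time_deriv \<psi> z \<partial>?M) = - (\<integral>z. time_deriv (u m) z \<bullet> \<psi> z \<partial>?M)" for m
   using ab by (intro integral_parts_time C1 Pk z) auto
  have parts_l: "(\<integral>z. u m z \<bullet> laplacian \<psi> z \<partial>?M) = (\<integral>z. laplacian (u m) z \<bullet> \<psi> z \<partial>?M)" for m
   by (intro integral_parts_laplacian u Pk P)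
  have "(\<lambda>m. \<integral>z. u m z \<bullet> time_deriv \<psi> z \<partial>?M) \<longlonglongrightarrow> (\<integral>z. q z \<bullet> time_deriv \<psi> z \<partial>?M)" by (rule lim[OF cu(1) qi ql c(2)])
  moreover have "(\<lambda>m. \<integral>z. u m z \<bullet> time_deriv \<psi> z \<partial>?M) \<longlonglongrightarrow> - (\<integral>z. ht z \<bullet> \<psi> z \<partial>?M)"
   unfolding parts_t by (intro tendsto_minus lim[OF cu(2) hi(1) ht(3)[OF ab] c(1)])
  ultimately have 1: "(\<integral>z. q z \<bullet> time_deriv \<psi> z \<partial>?M) = - (\<integral>z. ht z \<bullet> \<psi> z \<partial>?M)" by (rule LIMSEQ_unique)
  have "(\<lambda>m. \<integral>z. u m z \<bullet> laplacian \<psi> z \<partial>?M) \<longlonglongrightarrow> (\<integral>z. q z \<bullet> laplacian \<psi> z \<partial>?M)" by (rule lim[OF cu(1) qi ql c(3)])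
  moreover have "(\<lambda>m. \<integral>z. u m z \<bullet> laplacian \<psi> z \<partial>?M) \<longlonglongrightarrow> (\<integral>z. hl z \<bullet> \<psi> z \<partial>?M)"
   unfolding parts_l by (rule lim[OF cu(3) hi(2) hl(3)[OF ab] c(1)])
  ultimately have 2: "(\<integral>z. q z \<bullet> laplacian \<psi> z \<partial>?M) = (\<integral>z. hl z \<bullet> \<psi> z \<partial>?M)" by (rule LIMSEQ_unique)
  have S: "(\<integral>p. w p \<bullet> \<zeta> p \<partial>cylinder T) = (\<integral>p. w p \<bullet> \<zeta> p \<partial>?M)" if "\<And>p. snd p \<notin> {a..b} ==> \<zeta> p = 0"
   for w \<zeta> :: "(real ^ 'n) \<times> real => real ^ 2"
   by (rule integral_cylinder_support) (use that ab in auto)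
  have "(\<integral>p. w p \<bullet> \<psi> p \<partial>cylinder T) = (\<integral>p. w p \<bullet> \<psi> p \<partial>?M)"
   "(\<integral>p. w p \<bullet> time_deriv \<psi> p \<partial>cylinder T) = (\<integral>p. w p \<bullet> time_deriv \<psi> p \<partial>?M)"
   "(\<integral>p. w p \<bullet> laplacian \<psi> p \<partial>cylinder T) = (\<integral>p. w p \<bullet> laplacian \<psi> p \<partial>?M)" for w
   by (rule S, rule z(1), assumption, rule S, rule zt(1), assumption, rule S, rule zt(2), assumption)
  then show ?thesis using 1 2 by simp
 qed
 show "weak_time_deriv T q ht" using key L1(1) unfolding weak_time_deriv_def by blast
 show "weak_laplacian T q hl" using key L1(2) unfolding weak_laplacian_def by blast
qed

section \<open>Interior regularity\<close>

lemma cube_exp_decreasing: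
 assumes y: "3 <= y" "y <= (y' :: real)"
 shows "y' ^ 3 * exp (- y') <= y ^ 3 * exp (- y)"
proof -
 have d: "((\<lambda>y. y ^ 3 * exp (- y)) has_real_derivative (3 - u) * (u^2 * exp (- u))) (at u)" for u :: real
  by (auto intro!: derivative_eq_intros simp: power2_eq_square power3_eq_cube algebra_simps)
 show ?thesis
 proof (rule DERIV_nonpos_imp_nonincreasing[OF y(2)])
  fix x assume "y <= x" "x <= y'"
  then have "(3 - x) * (x^2 * exp (- x)) <= 0" using y(1) by (intro mult_nonpos_nonneg) auto
  then show "\<exists>z. ((\<lambda>y. y ^ 3 * exp (- y)) has_real_derivative z) (at x) \<and> z <= 0" using d by blast
 qed
qed

lemma cube_exp_bounded:
 assumes "0 <= (y :: real)"
 shows "y ^ 3 * exp (- y) <= 27"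
proof (cases "y <= 3")
 case True
 have "y ^ 3 * exp (- y) <= 3 ^ 3 * 1" using assms True by (intro mult_mono power_mono) auto
 then show ?thesis by simp
next
 case False
 have "y ^ 3 * exp (- y) <= 3 ^ 3 * exp (- 3)" using False by (intro cube_exp_decreasing) auto
 also have "... <= 3 ^ 3 * 1" by (intro mult_left_mono) auto
 finally show ?thesis by simp
qed

lemma interval_weights_continuous:
 fixes \<eta> :: "real ^ 'n => real"
 assumes "C_k k \<eta>"
 shows "continuous_on (UNIV \<times> {a<..<b}) (interval_xi \<eta> l a b)" "continuous_on (UNIV \<times> {a<..<b}) (interval_phi \<eta> l a b)"
proof -
 have c: "continuous_on (UNIV \<times> {a<..<b}) (\<lambda>z. \<eta> (fst z))"
  by (rule continuous_on_compose2[OF C_k_continuous[OF assms] continuous_on_fst[OF continuous_on_id]]) simp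
 have n: "\<forall>z\<in>UNIV \<times> {a<..<b}. (snd z - a) * (b - snd z) \<noteq> 0" by auto
 show "continuous_on (UNIV \<times> {a<..<b}) (interval_xi \<eta> l a b)" "continuous_on (UNIV \<times> {a<..<b}) (interval_phi \<eta> l a b)"
  unfolding interval_xi_def[abs_def] interval_phi_def[abs_def] by (intro continuous_intros c n)+
qed

context
 fixes \<eta> :: "real ^ 'n => real"
 assumes \<eta>: "C_k 4 \<eta>" "torus_periodic \<eta>" "\<And>x. \<eta> x > 0"
begin

lemma sup_norm_weight: "\<eta> x <= sup_norm \<eta>" "sup_norm \<eta> > 0"
proof -
 show *: "\<eta> x <= sup_norm \<eta>" for x by (rule le_sup_norm[OF C_k_continuous[OF \<eta>(1)] \<eta>(2)])
 show "sup_norm \<eta> > 0" using *[of 0] \<eta>(3)[of 0] by linarith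
qed

lemma weight_gap:
 assumes "l > 0"
 shows "0 < exp (2 * l * sup_norm \<eta>) - exp (l * sup_norm \<eta>)"
  "exp (2 * l * sup_norm \<eta>) - exp (l * sup_norm \<eta>) <= exp (2 * l * sup_norm \<eta>) - exp (l * \<eta> x)"
proof -
 have "l * \<eta> x <= l * sup_norm \<eta>" using assms sup_norm_weight(1) by (intro mult_left_mono) auto
 then show "exp (2 * l * sup_norm \<eta>) - exp (l * sup_norm \<eta>) <= exp (2 * l * sup_norm \<eta>) - exp (l * \<eta> x)" by simp
 have "0 < l * sup_norm \<eta>" using assms sup_norm_weight(2) by simp
 then show "0 < exp (2 * l * sup_norm \<eta>) - exp (l * sup_norm \<eta>)" by simp
qed

lemma interval_xi_pos: "snd z \<in> {a<..<b} ==> interval_xi \<eta> l a b z > 0"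
 by (auto simp: interval_xi_def intro!: divide_pos_pos)

lemma interval_phi_nonneg:
 assumes "l > 0" "snd z \<in> {a<..<b}"
 shows "interval_phi \<eta> l a b z >= 0"
 using weight_gap(1)[OF assms(1)] weight_gap(2)[OF assms(1), of "fst z"] assms(2) unfolding interval_phi_def by (intro divide_nonneg_pos) auto

text \<open>
  The exponent of the decaying factor is at least a positive multiple of the singularity of \<open>\<xi>\<close>.
\<close>

lemma weighted_cube_bounded:
 assumes l: "l > 0" and s: "s > 0"
 obtains B where "B >= 0" "\<And>a b z. snd z \<in> {a<..<b} ==>
  decay \<eta> l s a b z * (cubic \<eta> l s a b z) <= B"
proof
 define N E where "N = exp (2 * l * sup_norm \<eta>) - exp (l * sup_norm \<eta>)" and "E = exp (l * sup_norm \<eta>)"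
 have N: "N > 0" unfolding N_def by (rule weight_gap(1)[OF l])
 let ?B = "s ^ 3 * l ^ 4 * (E / (2 * s * N)) ^ 3 * 27"
 show "?B >= 0" using s N by (simp add: E_def)
 fix a b :: real and z :: "(real ^ 'n) \<times> real" assume z: "snd z \<in> {a<..<b}"
 define \<tau> where "\<tau> = 1 / ((snd z - a) * (b - snd z))"
 have \<tau>: "\<tau> > 0" using z by (simp add: \<tau>_def)
 have "l * \<eta> (fst z) <= l * sup_norm \<eta>" using l sup_norm_weight(1) by (intro mult_left_mono) auto
 then have xi: "0 <= interval_xi \<eta> l a b z" "interval_xi \<eta> l a b z <= E * \<tau>"
  using \<tau> z interval_xi_pos[OF z, of l] by (auto simp: interval_xi_def \<tau>_def E_def intro!: divide_right_mono)
 have phi: "N * \<tau> <= interval_phi \<eta> l a b z"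
  using weight_gap(2)[OF l, of "fst z"] z by (auto simp: interval_phi_def \<tau>_def N_def intro!: divide_right_mono)
 have y: "0 <= 2 * s * N * \<tau>" using s N \<tau> by simp
 have "decay \<eta> l s a b z * (cubic \<eta> l s a b z)
  <= exp (- (2 * s * N * \<tau>)) * (s ^ 3 * l ^ 4 * (E * \<tau>) ^ 3)"
 proof (rule mult_mono)
  have "s * (N * \<tau>) <= s * interval_phi \<eta> l a b z" using phi s by (intro mult_left_mono) auto
  then show "decay \<eta> l s a b z <= exp (- (2 * s * N * \<tau>))" by (simp add: mult.assoc)
  show "cubic \<eta> l s a b z <= s ^ 3 * l ^ 4 * (E * \<tau>) ^ 3"
   using s l xi by (intro mult_left_mono power_mono) auto
  show "0 <= cubic \<eta> l s a b z" using s l xi by simp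
 qed simp
 also have "... = s ^ 3 * l ^ 4 * (E / (2 * s * N)) ^ 3 * ((2 * s * N * \<tau>) ^ 3 * exp (- (2 * s * N * \<tau>)))"
  using s N by (simp add: power_mult_distrib power_divide field_simps)
 also have "... <= ?B" using s N by (intro mult_left_mono cube_exp_bounded y) (simp add: E_def)
 finally show "decay \<eta> l s a b z * (cubic \<eta> l s a b z) <= ?B" .
qed

lemma weighted_inverse_lower:
 assumes s: "s > 0" and ab: "a' < a" "b < b'"
 obtains c where "c > 0" "\<And>z. z \<in> space (cyl {a..b}) ==> c <= decay \<eta> l s a' b' z * recip \<eta> l s a' b' z"
proof -
 let ?f = "\<lambda>z. decay \<eta> l s a' b' z * recip \<eta> l s a' b' z"
 let ?K = "cbox (0 :: real ^ 'n) (\<chi> i. 2 * pi) \<times> {a..b}"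
 have sub: "?K \<subseteq> UNIV \<times> {a'<..<b'}" using ab by auto
 have pos: "interval_xi \<eta> l a' b' z > 0" if "z \<in> ?K" for z using that ab by (intro interval_xi_pos) auto
 note c = interval_weights_continuous[OF \<eta>(1), THEN continuous_on_subset[OF _ sub]]
 have "continuous_on ?K ?f" using pos s by (intro continuous_intros c) fastforce
 moreover have "compact ?K" by (intro compact_Times) auto
 ultimately have "\<exists>c>0. \<forall>z\<in>?K. c <= ?f z"
 proof (cases "?K = {}")
  case False
  assume "continuous_on ?K ?f" "compact ?K"
  then obtain y where "y \<in> ?K" "\<forall>z\<in>?K. ?f y <= ?f z" using continuous_attains_inf[OF _ False] by blast
  then show ?thesis using pos[of y] s by (intro exI[of _ "?f y"]) auto
 qed (use zero_less_one in blast)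
 then obtain c where c: "c > 0" "\<And>z. z \<in> ?K ==> c <= ?f z" by blast
 show thesis
 proof (rule that[OF c(1)])
  fix z :: "(real ^ 'n) \<times> real" assume "z \<in> space (cyl {a..b})"
  then show "c <= ?f z" using torus_cell_subset by (intro c(2)) (cases z; auto)
 qed
qed

end

text \<open>
  On compact time intervals the Carleman weights are bounded above and below, so that the Carleman
  inequality with fixed parameters becomes a maximal regularity estimate in the interior.
\<close>

lemma local_regularity:
 fixes \<eta> :: "real ^ 'n => real" and \<omega>\<^sub>0 :: "(real ^ 'n) set" and J :: "'b::euclidean_space => 'b" and \<alpha> \<gamma> :: real
 assumes \<eta>: "C_k 4 \<eta>" "torus_periodic \<eta>" "\<And>x. \<eta> x > 0"
  and \<omega>\<^sub>0: "torus_set \<omega>\<^sub>0" "open \<omega>\<^sub>0" "\<And>x. x \<notin> \<omega>\<^sub>0 ==> norm (grad \<eta> x) > 0"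
  and \<alpha>: "\<alpha> > 0"
  and J: "linear J" "\<And>x y. J x \<bullet> y = - (x \<bullet> J y)" "\<And>x y. J x \<bullet> J y = x \<bullet> y" "\<And>x. J (J x) = - x"
  and ab: "a' < a" "a < b" "b < b'"
 shows "\<exists>c>0. \<forall>u :: (real ^ 'n) \<times> real => 'b. C_k 2 u \<and> (\<forall>t. torus_periodic (\<lambda>x. u (x, t))) \<longrightarrow>
  (\<integral>\<^sup>+z. ennreal (nsq (time_deriv u z) + nsq (laplacian u z)) \<partial>cyl {a..b})
  <= ennreal c * (\<integral>\<^sup>+z. ennreal (nsq (heat_operator \<alpha> \<gamma> J u z) + nsq (u z)) \<partial>cyl {a'<..<b'})"
proof -
 obtain l0 s0 C where *: "l0 >= 1" "s0 >= 1" "C > 0" and carleman: "\<And>(q :: (real ^ 'n) \<times> real => 'b) a b l s.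
  a < b \<and> C_k 2 q \<and> (\<forall>t. torus_periodic (\<lambda>x. q (x, t))) \<and> l >= l0 \<and>
  s >= s0 * (exp (2 * l * sup_norm \<eta>) * (b - a) + (b - a)\<^sup>2) ==> carleman_estimate \<eta> \<omega>\<^sub>0 \<alpha> \<gamma> J C l s a b q"
  using smooth_carleman[OF \<eta> \<omega>\<^sub>0 \<alpha> J] by blast
 define s where "s = s0 * (exp (2 * l0 * sup_norm \<eta>) * (b' - a') + (b' - a')\<^sup>2)"
 have s: "s > 0" unfolding s_def using *(2) ab by (intro mult_pos_pos add_pos_pos) auto
 have l: "l0 > 0" using *(1) by simp
 let ?E = "\<lambda>z. decay \<eta> l0 s a' b' z" and ?W = "\<lambda>z. cubic \<eta> l0 s a' b' z" and ?P = "\<lambda>z. recip \<eta> l0 s a' b' z"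
 obtain B where B: "B >= 0" "\<And>z. snd z \<in> {a'<..<b'} ==> ?E z * ?W z <= B"
  using weighted_cube_bounded[OF \<eta> l s] by metis
 obtain c where c: "c > 0" "\<And>z. z \<in> space (cyl {a..b}) ==> c <= ?E z * ?P z"
  using weighted_inverse_lower[OF \<eta> s ab(1,3)] by metis
 show ?thesis
 proof (intro exI conjI allI impI)
  show "1 / c * (C * (1 + B)) > 0" using c *(3) B by simp
  fix u :: "(real ^ 'n) \<times> real => 'b" assume "C_k 2 u \<and> (\<forall>t. torus_periodic (\<lambda>x. u (x, t)))"
  then have u: "C_k 2 u" "\<And>t. torus_periodic (\<lambda>x. u (x, t))" by auto
  let ?D = "\<lambda>z. nsq (time_deriv u z) + nsq (laplacian u z)"
  let ?L = "\<lambda>z. heat_operator \<alpha> \<gamma> J u z"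
  let ?I = "\<lambda>z. indicator \<omega>\<^sub>0 (fst z) * (?E z * (?W z * nsq (u z)))"
  note cu = C_k_continuous[OF u(1)] derivatives_continuous[OF u(1)]
  have cL: "continuous_on UNIV ?L"
   by (intro continuous_intros cu linear_continuous_on_compose[OF cu(3) J(1)])
  have Dm: "(\<lambda>z. ennreal (?D z)) \<in> borel_measurable borel"
   by (intro measurable_compose[OF borel_measurable_continuous_onI measurable_ennreal] continuous_intros cu)
  have Lm: "(\<lambda>z. ennreal (nsq (?L z) + nsq (u z))) \<in> borel_measurable borel"
   by (intro measurable_compose[OF borel_measurable_continuous_onI measurable_ennreal] continuous_intros cu cL)
  have "ennreal c * (\<integral>\<^sup>+z. ennreal (?D z) \<partial>cyl {a..b}) = (\<integral>\<^sup>+z. ennreal c * ennreal (?D z) \<partial>cyl {a..b})"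
   by (rule nn_integral_cmult[symmetric]) (rule borel_measurable_cylI[OF Dm])
  also have "... <= (\<integral>\<^sup>+z. ennreal (?E z * (?P z * ?D z + ?W z * nsq (u z))) \<partial>cyl {a..b})"
  proof (rule nn_integral_mono)
   fix z assume z: "z \<in> space (cyl {a..b} :: ((real ^ 'n) \<times> real) measure)"
   then have xi: "interval_xi \<eta> l0 a' b' z > 0" using ab by (intro interval_xi_pos[OF \<eta>]) auto
   have "c * ?D z <= ?E z * ?P z * ?D z" by (intro mult_right_mono c(2)[OF z]) simp
   moreover have "0 <= ?E z * (?W z * nsq (u z))" using s l xi by simp
   ultimately have "c * ?D z <= ?E z * (?P z * ?D z + ?W z * nsq (u z))"
    unfolding distrib_left mult.assoc by linarith
   then show "ennreal c * ennreal (?D z) <= ennreal (?E z * (?P z * ?D z + ?W z * nsq (u z)))"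
    using c(1) by (subst ennreal_mult[symmetric]) (auto intro!: ennreal_leI)
  qed
  also have "... <= (\<integral>\<^sup>+z. ennreal (?E z * (?P z * ?D z + ?W z * nsq (u z))) \<partial>cyl {a'<..<b'})"
   using ab by (intro nn_integral_cyl_mono_set) auto
  also have "... <= (\<integral>\<^sup>+z. ennreal (C * (?E z * nsq (?L z) + ?I z)) \<partial>cyl {a'<..<b'})"
   by (rule carleman[unfolded carleman_estimate_def]) (use u ab in \<open>auto simp: s_def\<close>)
  also have "... <= (\<integral>\<^sup>+z. ennreal (C * (1 + B)) * ennreal (nsq (?L z) + nsq (u z)) \<partial>cyl {a'<..<b'})"
  proof (rule nn_integral_mono)
   fix z assume "z \<in> space (cyl {a'<..<b'} :: ((real ^ 'n) \<times> real) measure)"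
   then have z: "snd z \<in> {a'<..<b'}" by auto
   have "0 <= s * interval_phi \<eta> l0 a' b' z" using s interval_phi_nonneg[OF \<eta> l z] by simp
   then have e: "?E z <= 1" by (simp add: mult.assoc)
   have 1: "?E z * nsq (?L z) <= 1 * nsq (?L z)" by (intro mult_right_mono e) simp
   have W: "?E z * ?W z * nsq (u z) <= B * nsq (u z)"
    by (intro mult_right_mono B(2)[OF z]) simp
   have "?I z <= B * nsq (u z)"
    using W B(1) by (cases "fst z \<in> \<omega>\<^sub>0") (simp_all add: mult.assoc)
   moreover have "0 <= B * nsq (?L z)" using B(1) by simp
   ultimately have "?E z * nsq (?L z) + ?I z
    <= (1 + B) * (nsq (?L z) + nsq (u z))"
    using 1 zero_le_power2[of "norm (u z)"] unfolding distrib_left distrib_right mult_1_left by linarith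
   then have "C * (?E z * nsq (?L z) + ?I z)
    <= C * ((1 + B) * (nsq (?L z) + nsq (u z)))" using *(3) by (intro mult_left_mono) auto
   then show "ennreal (C * (?E z * nsq (?L z) + ?I z))
    <= ennreal (C * (1 + B)) * ennreal (nsq (?L z) + nsq (u z))"
    using *(3) B(1) by (subst ennreal_mult[symmetric]) (auto intro!: ennreal_leI simp: mult.assoc)
  qed
  also have "... = ennreal (C * (1 + B)) * (\<integral>\<^sup>+z. ennreal (nsq (?L z) + nsq (u z)) \<partial>cyl {a'<..<b'})"
   by (rule nn_integral_cmult) (rule borel_measurable_cylI[OF Lm])
  finally have "ennreal (1 / c) * (ennreal c * (\<integral>\<^sup>+z. ennreal (?D z) \<partial>cyl {a..b}))
   <= ennreal (1 / c) * (ennreal (C * (1 + B)) * (\<integral>\<^sup>+z. ennreal (nsq (?L z) + nsq (u z)) \<partial>cyl {a'<..<b'}))"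
   by (rule mult_left_mono) simp
  moreover have "ennreal (1 / c) * ennreal c = 1" using c(1) by (simp flip: ennreal_mult)
  moreover have "ennreal (1 / c) * ennreal (C * (1 + B)) = ennreal (1 / c * (C * (1 + B)))"
   using c(1) *(3) B(1) by (intro ennreal_mult[symmetric]) auto
  ultimately show "(\<integral>\<^sup>+z. ennreal (?D z) \<partial>cyl {a..b})
   <= ennreal (1 / c * (C * (1 + B))) * (\<integral>\<^sup>+z. ennreal (nsq (?L z) + nsq (u z)) \<partial>cyl {a'<..<b'})"
   by (simp add: mult.assoc[symmetric])
 qed
qed

section \<open>Comparison of the weights\<close>

lemma interval_weights_measurable:
 fixes \<eta> :: "real ^ 'n => real"
 assumes "C_k k \<eta>"
 shows "interval_xi \<eta> l a b \<in> borel_measurable borel" "interval_phi \<eta> l a b \<in> borel_measurable borel"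
proof -
 have [measurable]: "\<eta> \<in> borel_measurable borel" by (rule borel_measurable_continuous_onI[OF C_k_continuous[OF assms]])
 have [measurable]: "(\<lambda>z. \<eta> (fst z)) \<in> borel_measurable borel"
  by (intro borel_measurable_continuous_onI continuous_on_compose2[OF C_k_continuous[OF assms] continuous_on_fst[OF continuous_on_id]]) simp
 have [measurable]: "(snd :: (real ^ 'n) \<times> real => real) \<in> borel_measurable borel"
  by (intro borel_measurable_continuous_onI continuous_on_snd continuous_on_id)
 show "interval_xi \<eta> l a b \<in> borel_measurable borel" unfolding interval_xi_def[abs_def] by measurable
 show "interval_phi \<eta> l a b \<in> borel_measurable borel" unfolding interval_phi_def[abs_def] by measurable
qed

lemma nn_integral_cyl_indicator:
 assumes "I \<subseteq> K" "I \<in> sets borel" "K \<in> sets borel"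
 shows "(\<integral>\<^sup>+z. indicator I (snd z) * f z \<partial>(cyl K :: ((real ^ 'n) \<times> real) measure)) = (\<integral>\<^sup>+z. f z \<partial>cyl I)"
proof -
 have e: "(indicator I (snd z) * f z) * indicator (torus_cell \<times> K) z = f z * indicator (torus_cell \<times> I) z" for z
  using assms(1) by (auto simp: indicator_def)
 have "(\<integral>\<^sup>+z. indicator I (snd z) * f z \<partial>(cyl K :: ((real ^ 'n) \<times> real) measure)) = (\<integral>\<^sup>+z. (indicator I (snd z) * f z) * indicator (torus_cell \<times> K) z \<partial>lborel)"
  unfolding cyl_def using cell_times_sets[OF assms(3)] by (intro nn_integral_restrict_space) auto
 also have "... = (\<integral>\<^sup>+z. f z * indicator (torus_cell \<times> I) z \<partial>lborel)" by (simp only: e)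
 also have "... = (\<integral>\<^sup>+z. f z \<partial>cyl I)"
  unfolding cyl_def using cell_times_sets[OF assms(2)] by (intro nn_integral_restrict_space[symmetric]) auto
 finally show ?thesis .
qed

text \<open>
  Shrinking the time interval increases the factor \<open>\<tau> = 1 / (t (T - t))\<close> of both weights. The exponential
  decay wins over the growth of the cube, since \<open>y\<^sup>3 exp (- y)\<close> decreases for \<open>y \<ge> 3\<close> and the
  exponent is beyond that point for large parameters. Hence the weights of a shorter interval are
  dominated by those of the full one.
\<close>

lemma shrunken_weights_le:
 fixes \<eta> :: "real ^ 'n => real"
 assumes \<eta>: "C_k 4 \<eta>" "torus_periodic \<eta>" "\<And>x. \<eta> x > 0"
  and l: "l > 0" "l * sup_norm \<eta> >= 1" and s: "s >= T^2" and z: "0 <= d" "snd z \<in> {d<..<T - d}"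
 shows "decay \<eta> l s d (T - d) z <= decay \<eta> l s 0 T z"
  "decay \<eta> l s d (T - d) z * (cubic \<eta> l s d (T - d) z)
   <= decay \<eta> l s 0 T z * (cubic \<eta> l s 0 T z)"
proof -
 define t N E \<tau> \<tau>' where "t = snd z" and "N = exp (2 * l * sup_norm \<eta>) - exp (l * \<eta> (fst z))"
  and "E = exp (l * \<eta> (fst z))" and "\<tau> = 1 / (t * (T - t))" and "\<tau>' = 1 / ((t - d) * (T - d - t))"
 have t: "d < t" "t < T - d" "0 < t" "t < T" using z by (auto simp: t_def)
 have T: "T > 0" using t by linarith
 have s0: "s > 0" using s T by (meson less_le_trans zero_less_power)
 have ex: "exp (l * sup_norm \<eta>) >= 2" using l(2) exp_ge_add_one_self[of "l * sup_norm \<eta>"] by linarith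
 have "exp (2 * l * sup_norm \<eta>) = exp (l * sup_norm \<eta>) * exp (l * sup_norm \<eta>)" by (simp flip: exp_add)
 then have "exp (2 * l * sup_norm \<eta>) - exp (l * sup_norm \<eta>) = exp (l * sup_norm \<eta>) * (exp (l * sup_norm \<eta>) - 1)"
  by (simp add: algebra_simps)
 also have "... >= 1 * 1"
  using ex l(2) by (intro mult_mono) auto
 finally have N: "N >= 1" using weight_gap(2)[OF \<eta> l(1), of "fst z"] unfolding N_def by linarith
 have p: "0 < (t - d) * (T - d - t)" "0 < t * (T - t)" using t by auto
 have "(t - d) * (T - d - t) <= t * (T - t)" using t z(1) by (intro mult_mono) auto
 then have \<tau>: "\<tau> <= \<tau>'" unfolding \<tau>_def \<tau>'_def using p by (intro divide_left_mono) auto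
 have "0 <= (T - 2 * t)\<^sup>2" by simp
 then have "4 * (t * (T - t)) <= T^2" by (simp add: power2_eq_square algebra_simps)
 then have "T^2 * \<tau> >= 4" unfolding \<tau>_def using p by (simp add: field_simps)
 moreover have \<tau>0: "\<tau> > 0" using p by (simp add: \<tau>_def)
 ultimately have st: "s * \<tau> >= 4" using s mult_right_mono[OF s, of \<tau>] by linarith
 have "4 * 1 <= (s * \<tau>) * N" by (rule mult_mono[OF st N]) (use st in auto)
 then have y: "3 <= 2 * s * N * \<tau>" by (simp add: mult_ac)
 have yy: "2 * s * N * \<tau> <= 2 * s * N * \<tau>'" using s0 N \<tau> by (intro mult_left_mono) auto
 have phi: "- 2 * s * interval_phi \<eta> l 0 T z = - (2 * s * N * \<tau>)" "- 2 * s * interval_phi \<eta> l d (T - d) z = - (2 * s * N * \<tau>')"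
  by (simp_all add: interval_phi_def N_def \<tau>_def \<tau>'_def t_def)
 have xi: "interval_xi \<eta> l 0 T z = E * \<tau>" "interval_xi \<eta> l d (T - d) z = E * \<tau>'"
  by (simp_all add: interval_xi_def E_def \<tau>_def \<tau>'_def t_def)
 show "decay \<eta> l s d (T - d) z <= decay \<eta> l s 0 T z"
  unfolding phi using yy by simp
 have form: "exp (- (2 * s * N * r)) * (s ^ 3 * l ^ 4 * (E * r) ^ 3)
  = s ^ 3 * l ^ 4 * (E / (2 * s * N)) ^ 3 * ((2 * s * N * r) ^ 3 * exp (- (2 * s * N * r)))" for r
  using s0 N by (simp add: power_mult_distrib power_divide field_simps)
 show "decay \<eta> l s d (T - d) z * (cubic \<eta> l s d (T - d) z)
   <= decay \<eta> l s 0 T z * (cubic \<eta> l s 0 T z)"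
  unfolding phi xi form using s0 N by (intro mult_left_mono cube_exp_decreasing y yy) (simp add: E_def)
qed

lemma dir_deriv_diff:
 assumes "f differentiable (at p)" "g differentiable (at p)"
 shows "dir_deriv v (\<lambda>z. f z - g z) p = dir_deriv v f p - dir_deriv v g p"
proof -
 have "((\<lambda>z. f z - g z) has_derivative (\<lambda>v. dir_deriv v f p - dir_deriv v g p)) (at p)"
  using assms unfolding dir_deriv_def by (intro has_derivative_diff) (simp_all add: frechet_derivative_works)
 then show ?thesis by (rule has_derivative_imp_dir_deriv)
qed

lemma derivatives_diff:
 fixes f g :: "(real ^ 'n) \<times> real => 'b::euclidean_space"
 assumes "C_k 2 f" "C_k 2 g"
 shows "time_deriv (\<lambda>z. f z - g z) p = time_deriv f p - time_deriv g p"
  "laplacian (\<lambda>z. f z - g z) p = laplacian f p - laplacian g p"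
proof -
 have C2: "C_k (Suc (Suc 0)) f" "C_k (Suc (Suc 0)) g" using assms by (simp_all only: numeral_2_eq_2)
 have d: "f differentiable (at p)" "g differentiable (at p)" for p
  using C_k_differentiable[OF assms(1)] C_k_differentiable[OF assms(2)] by auto
 have 1: "dir_deriv v (\<lambda>z. f z - g z) = (\<lambda>p. dir_deriv v f p - dir_deriv v g p)" for v
  by (intro ext dir_deriv_diff d)
 have dd: "dir_deriv v f differentiable (at p)" "dir_deriv v g differentiable (at p)" for v p
  using C_k_differentiable[OF C_k_dir_deriv[OF C2(1)]] C_k_differentiable[OF C_k_dir_deriv[OF C2(2)]] by auto
 show "time_deriv (\<lambda>z. f z - g z) p = time_deriv f p - time_deriv g p" by (simp add: time_deriv_def 1)
 show "laplacian (\<lambda>z. f z - g z) p = laplacian f p - laplacian g p"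
  by (simp add: laplacian_def space_deriv_def 1 dir_deriv_diff[OF dd] sum_subtractf)
qed

lemma L2_limit_cauchy:
 fixes f :: "nat => 'a => 'b::euclidean_space"
 assumes f: "\<And>m. f m \<in> borel_measurable M" "h \<in> borel_measurable M" and lim: "L2_limit M f h" and e: "e > 0"
 shows "\<exists>N. \<forall>i\<ge>N. \<forall>j\<ge>N. sqdist M (f i) (f j) <= ennreal e"
proof -
 have "e / 4 > 0" using e by simp
 then obtain N where N: "\<And>m. m >= N ==> sqdist M (f m) h <= ennreal (e / 4)"
  using lim unfolding L2_limit_def by blast
 have "sqdist M (f i) (f j) <= ennreal e" if ij: "i >= N" "j >= N" for i j
 proof -
  have "sqdist M (f i) (f j)
   <= (\<integral>\<^sup>+z. 2 * ennreal (nsq (f i z - h z)) + 2 * ennreal (nsq (f j z - h z)) \<partial>M)"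
  proof (rule nn_integral_mono)
   fix z
   have "nsq (f i z - f j z) <= 2 * nsq (f i z - h z) + 2 * nsq (f j z - h z)"
    using norm_add_sq_le[of "f i z - h z" "h z - f j z"] by (simp add: norm_minus_commute)
   then have "ennreal (nsq (f i z - f j z)) <= ennreal (2 * nsq (f i z - h z) + 2 * nsq (f j z - h z))"
    by (rule ennreal_leI)
   also have "... = 2 * ennreal (nsq (f i z - h z)) + 2 * ennreal (nsq (f j z - h z))"
    by (simp add: ennreal_mult)
   finally show "ennreal (nsq (f i z - f j z)) <= 2 * ennreal (nsq (f i z - h z)) + 2 * ennreal (nsq (f j z - h z))" .
  qed
  also have "... = 2 * sqdist M (f i) h + 2 * sqdist M (f j) h"
   using f by (simp add: nn_integral_add nn_integral_cmult)
  also have "... <= 2 * ennreal (e / 4) + 2 * ennreal (e / 4)" by (intro add_mono mult_left_mono N ij) auto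
  also have "... = ennreal e"
  proof -
   have "2 * ennreal (e / 4) = ennreal (e / 2)" using ennreal_mult[of 2 "e / 4"] e by simp
   then show ?thesis using e by (simp flip: ennreal_plus)
  qed
  finally show ?thesis .
 qed
 then show ?thesis by blast
qed

section \<open>Passage to the limit\<close>

text \<open>
  What the limit uses of the mollified solutions; the index is shifted, as kernels need a positive radius.
\<close>

lemma approximations:
 fixes q F :: "(real ^ 'n) \<times> real => real ^ 2"
 assumes sol: "weak_solution \<alpha> \<gamma> T F qT q" and F: "L2_cylinder T F"
 defines "u \<equiv> \<lambda>m. conv T (moll (Suc m)) q" and "f \<equiv> \<lambda>m. conv T (moll (Suc m)) F"
 shows "C_k 2 (u m)" "torus_periodic (\<lambda>x. u m (x, t))" "continuous_on UNIV (f m)"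
  "L2_limit (cylinder T) u q" "L2_limit (cylinder T) f F" "L2_cylinder T q"
  "1 / real (Suc m) < snd p ==> snd p < T - 1 / real (Suc m) ==>
   time_deriv (u m) p + (\<alpha> *R laplacian (u m) p - \<gamma> *R rot (laplacian (u m) p)) = - f m p"
proof -
 show q: "L2_cylinder T q" using sol unfolding weak_solution_def L2_H1_with_def by blast
 have K: "kernel (moll (Suc m) :: (real ^ 'n) \<times> real => real) (1 / real (Suc m))" for m by (rule kernel_moll) simp
 have lim: "L2_limit (cylinder T) (\<lambda>m. conv T (moll (Suc m)) g) g" if g: "L2_cylinder T g" for g :: "(real ^ 'n) \<times> real => real ^ 2"
  unfolding L2_limit_def
 proof (intro allI impI)
  fix e :: real assume e: "e > 0"
  have "g \<in> borel_measurable (cylinder T)" "integrable (cylinder T) (\<lambda>z. nsq (g z))" using g by (auto simp: L2_cylinder_def)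
  from mollify_L2[OF this e] obtain m0 where
   "\<forall>m\<ge>m0. (\<integral>\<^sup>+p. ennreal (nsq (conv T (moll m) g p - g p)) \<partial>cylinder T) <= ennreal e" by blast
  then show "\<exists>N. \<forall>m\<ge>N. (\<integral>\<^sup>+p. ennreal (nsq (conv T (moll (Suc m)) g p - g p)) \<partial>cylinder T) <= ennreal e"
   by (intro exI[of _ m0]) simp
 qed
 show "C_k 2 (u m)" unfolding u_def by (rule C_k_conv[OF L2_cylinder_integrable[OF q] K])
 show "torus_periodic (\<lambda>x. u m (x, t))" unfolding u_def by (rule conv_periodic[OF K])
 show "continuous_on UNIV (f m)" unfolding f_def by (rule C_k_continuous[OF C_k_conv[OF L2_cylinder_integrable[OF F] K, of 0]])
 show "L2_limit (cylinder T) u q" unfolding u_def by (rule lim[OF q])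
 show "L2_limit (cylinder T) f F" unfolding f_def by (rule lim[OF F])
 show "1 / real (Suc m) < snd p ==> snd p < T - 1 / real (Suc m) ==>
   time_deriv (u m) p + (\<alpha> *R laplacian (u m) p - \<gamma> *R rot (laplacian (u m) p)) = - f m p"
  unfolding u_def f_def by (rule mollified_equation[OF sol F K])
qed

text \<open>
  Differences of mollified solutions solve the equation for the differences of the mollified data. Interior
  regularity thus passes the Cauchy property from them to the derivatives, which yields the
  existence of \<open>\<partial>\<^sub>t q\<close> and \<open>\<Delta> q\<close> as functions.
\<close>

lemma derivatives_cauchy:
 fixes q F :: "(real ^ 'n) \<times> real => real ^ 2" and \<eta> :: "real ^ 'n => real" and \<omega>\<^sub>0 :: "(real ^ 'n) set"
 assumes \<eta>: "C_k 4 \<eta>" "torus_periodic \<eta>" "\<And>x. \<eta> x > 0"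
  and \<omega>\<^sub>0: "torus_set \<omega>\<^sub>0" "open \<omega>\<^sub>0" "\<And>x. x \<notin> \<omega>\<^sub>0 ==> norm (grad \<eta> x) > 0"
  and \<alpha>: "\<alpha> > 0" and sol: "weak_solution \<alpha> \<gamma> T F qT q" and F: "L2_cylinder T F"
  and ab: "0 < a" "a < b" "b < T" and e: "e > 0"
 shows "\<exists>N. \<forall>i\<ge>N. \<forall>j\<ge>N. (\<integral>\<^sup>+z. ennreal ((norm
   ((time_deriv (conv T (moll (Suc i)) q) z, laplacian (conv T (moll (Suc i)) q) z)
   - (time_deriv (conv T (moll (Suc j)) q) z, laplacian (conv T (moll (Suc j)) q) z)))\<^sup>2) \<partial>cyl {a..b}) <= ennreal e"
proof -
 define u f where "u m = conv T (moll (Suc m)) q" and "f m = conv T (moll (Suc m)) F" for m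
 note A = approximations[OF sol F, folded u_def f_def]
 define a' b' where "a' = a / 2" and "b' = (b + T) / 2"
 have ab': "a' < a" "b < b'" "0 < a'" "b' < T" "a' < b'" using ab by (auto simp: a'_def b'_def)
 have "\<exists>c>0. \<forall>u :: (real ^ 'n) \<times> real => real ^ 2. C_k 2 u \<and> (\<forall>t. torus_periodic (\<lambda>x. u (x, t))) \<longrightarrow>
  (\<integral>\<^sup>+z. ennreal (nsq (time_deriv u z) + nsq (laplacian u z)) \<partial>cyl {a..b})
  <= ennreal c * (\<integral>\<^sup>+z. ennreal (nsq (heat_operator \<alpha> \<gamma> rot u z) + nsq (u z)) \<partial>cyl {a'<..<b'})"
  by (rule local_regularity[OF \<eta> \<omega>\<^sub>0 \<alpha> rot_linear rot_skew rot_iso rot_rot ab'(1) ab(2) ab'(2)])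
 then obtain c where c: "c > 0" and reg: "\<And>u :: (real ^ 'n) \<times> real => real ^ 2. C_k 2 u \<and> (\<forall>t. torus_periodic (\<lambda>x. u (x, t))) ==>
  (\<integral>\<^sup>+z. ennreal (nsq (time_deriv u z) + nsq (laplacian u z)) \<partial>cyl {a..b})
  <= ennreal c * (\<integral>\<^sup>+z. ennreal (nsq (heat_operator \<alpha> \<gamma> rot u z) + nsq (u z)) \<partial>cyl {a'<..<b'})"
  by blast
 have qm: "q \<in> borel_measurable (cylinder T)" "F \<in> borel_measurable (cylinder T)" using A(6) F by (auto simp: L2_cylinder_def)
 have um: "u m \<in> borel_measurable (cyl I)" "f m \<in> borel_measurable (cyl I)" for m I
  by (intro borel_measurable_cylI borel_measurable_continuous_onI C_k_continuous[OF A(1)] A(3))+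
 note [measurable] = um
 have umC: "u m \<in> borel_measurable (cylinder T)" "f m \<in> borel_measurable (cylinder T)" for m
  unfolding cylinder_eq_cyl by (rule um)+
 define e1 where "e1 = e / (2 * c)"
 have e1: "e1 > 0" "c * (e1 + e1) = e" using e c by (auto simp: e1_def)
 obtain N1 where N1: "\<And>i j. i >= N1 ==> j >= N1 ==> sqdist (cylinder T) (u i) (u j) <= ennreal e1"
  using L2_limit_cauchy[OF umC(1) qm(1) A(4) e1(1)] by blast
 obtain N2 where N2: "\<And>i j. i >= N2 ==> j >= N2 ==> sqdist (cylinder T) (f i) (f j) <= ennreal e1"
  using L2_limit_cauchy[OF umC(2) qm(2) A(5) e1(1)] by blast
 obtain N3 where N3: "real N3 > max (1 / a') (1 / (T - b'))" using reals_Archimedean2 by blast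
 have far: "1 / real (Suc m) < a'" "b' < T - 1 / real (Suc m)" if "m >= N3" for m
 proof -
  have "1 / a' < real (Suc m)" "1 / (T - b') < real (Suc m)" using that N3 by auto
  then have "1 / real (Suc m) < a'" "1 / real (Suc m) < T - b'" using ab'(3,4) by (simp_all add: field_simps)
  then show "1 / real (Suc m) < a'" "b' < T - 1 / real (Suc m)" by auto
 qed
 have "(\<integral>\<^sup>+z. ennreal (nsq ((time_deriv (u i) z, laplacian (u i) z) - (time_deriv (u j) z, laplacian (u j) z))) \<partial>cyl {a..b}) <= ennreal e"
  if ij: "i >= max N1 (max N2 N3)" "j >= max N1 (max N2 N3)" for i j
 proof -
  let ?w = "\<lambda>z. u i z - u j z"
  have w: "C_k 2 ?w"
   using C_k_add[OF A(1)[of i] C_k_linear[OF bounded_linear_minus[OF bounded_linear_ident] A(1)[of j]]] by simp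
  have wp: "torus_periodic (\<lambda>x. ?w (x, t))" for t using A(2)[of i t] A(2)[of j t] by (simp add: torus_periodic_def)
  note D = derivatives_diff[OF A(1)[of i] A(1)[of j]]
  have "(\<integral>\<^sup>+z. ennreal (nsq ((time_deriv (u i) z, laplacian (u i) z) - (time_deriv (u j) z, laplacian (u j) z))) \<partial>cyl {a..b})
   = (\<integral>\<^sup>+z. ennreal (nsq (time_deriv ?w z) + nsq (laplacian ?w z)) \<partial>cyl {a..b})"
   by (simp add: D norm_Pair)
  also have "... <= ennreal c * (\<integral>\<^sup>+z. ennreal (nsq (heat_operator \<alpha> \<gamma> rot ?w z) + nsq (?w z)) \<partial>cyl {a'<..<b'})"
   by (rule reg) (use w wp in blast)
  also have "(\<integral>\<^sup>+z. ennreal (nsq (heat_operator \<alpha> \<gamma> rot ?w z) + nsq (?w z)) \<partial>cyl {a'<..<b'})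
   = (\<integral>\<^sup>+z. ennreal (nsq (f i z - f j z)) + ennreal (nsq (u i z - u j z)) \<partial>cyl {a'<..<b'})"
  proof (rule nn_integral_cong)
   fix z assume "z \<in> space (cyl {a'<..<b'} :: ((real ^ 'n) \<times> real) measure)"
   then have z: "a' < snd z" "snd z < b'" by auto
   have eq: "time_deriv (u m) z + (\<alpha> *R laplacian (u m) z - \<gamma> *R rot (laplacian (u m) z)) = - f m z" if "m >= N3" for m
    using far[OF that] z by (intro A(7)) linarith+
   have "heat_operator \<alpha> \<gamma> rot ?w z = - f i z - (- f j z)"
    using eq[of i, symmetric] eq[of j, symmetric] ij by (simp add: D linear_diff[OF rot_linear] algebra_simps)
   then have "norm (heat_operator \<alpha> \<gamma> rot ?w z) = norm (f i z - f j z)"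
    by (simp add: norm_minus_commute)
   then show "ennreal (nsq (heat_operator \<alpha> \<gamma> rot ?w z) + nsq (?w z))
    = ennreal (nsq (f i z - f j z)) + ennreal (nsq (u i z - u j z))" by simp
  qed
  also have "... = sqdist (cyl {a'<..<b'}) (f i) (f j) + sqdist (cyl {a'<..<b'}) (u i) (u j)"
   by (intro nn_integral_add) measurable
  also have "... <= sqdist (cylinder T) (f i) (f j) + sqdist (cylinder T) (u i) (u j)"
   unfolding cylinder_eq_cyl using ab' by (intro add_mono nn_integral_cyl_mono_set) auto
  also have "... <= ennreal e1 + ennreal e1" using ij by (intro add_mono N1 N2) auto
  finally have "(\<integral>\<^sup>+z. ennreal (nsq ((time_deriv (u i) z, laplacian (u i) z) - (time_deriv (u j) z, laplacian (u j) z))) \<partial>cyl {a..b})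
   <= ennreal c * (ennreal e1 + ennreal e1)" by (simp add: mult_left_mono)
  also have "... = ennreal (c * (e1 + e1))"
   using c e1(1) by (simp only: ennreal_plus[symmetric] ennreal_mult[symmetric] less_imp_le add_nonneg_nonneg)
  finally show ?thesis by (simp only: e1(2))
 qed
 then show ?thesis unfolding u_def by blast
qed

text \<open>
  Passing from the mollified solutions to \<open>q\<close> in the Carleman inequality. On the left, Fatou's lemma
  applies along an almost everywhere convergent sequence, although the weights vary with the
  interval. On the right, the weights are dominated by those of the full interval, and
  \<open>\<bar>f\<bar>\<^sup>2 \<le> 2 \<bar>F\<bar>\<^sup>2 + 2 \<bar>f - F\<bar>\<^sup>2\<close> isolates an error that vanishes in the limit.
\<close>

lemma carleman_limit:
 fixes q F ht hl :: "(real ^ 'n) \<times> real => real ^ 2" and u f :: "nat => (real ^ 'n) \<times> real => real ^ 2"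
  and \<eta> :: "real ^ 'n => real" and \<omega> \<omega>\<^sub>0 :: "(real ^ 'n) set" and \<delta> :: "nat => real"
 assumes \<eta>: "C_k 4 \<eta>" "torus_periodic \<eta>" "\<And>x. \<eta> x > 0"
  and \<omega>: "open \<omega>" "\<omega>\<^sub>0 \<subseteq> \<omega>" and T: "T > 0"
  and u: "\<And>i. C_k 2 (u i)" and f: "\<And>i. continuous_on UNIV (f i)"
  and m: "q \<in> borel_measurable (cylinder T)" "F \<in> borel_measurable (cylinder T)"
  and L2: "L2_limit (cylinder T) u q" "L2_limit (cylinder T) f F"
  and ae: "AE z in cylinder T. (\<lambda>i. u i z) \<longlonglongrightarrow> q z" "AE z in cylinder T. (\<lambda>i. time_deriv (u i) z) \<longlonglongrightarrow> ht z"
   "AE z in cylinder T. (\<lambda>i. laplacian (u i) z) \<longlonglongrightarrow> hl z"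
  and \<delta>: "\<And>i. 0 <= \<delta> i" "\<delta> \<longlonglongrightarrow> 0"
  and l: "l > 0" "l * sup_norm \<eta> >= 1" and s: "s >= T^2" and C: "C > 0"
  and carleman: "\<And>i. \<delta> i < T - \<delta> i ==> (\<integral>\<^sup>+z. ennreal (carleman_left \<eta> l s (\<delta> i) (T - \<delta> i) (u i) z) \<partial>cyl {\<delta> i<..<T - \<delta> i})
   <= (\<integral>\<^sup>+z. ennreal (C * carleman_right \<eta> \<omega>\<^sub>0 l s (\<delta> i) (T - \<delta> i) (f i z) (u i) z) \<partial>cyl {\<delta> i<..<T - \<delta> i})"
 shows "(\<integral>\<^sup>+z. ennreal (decay \<eta> l s 0 T z * (recip \<eta> l s 0 T z * (nsq (ht z) + nsq (hl z)) + cubic \<eta> l s 0 T z * nsq (q z))) \<partial>cylinder T)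
   <= ennreal (2 * C) * ((\<integral>\<^sup>+z. ennreal (decay \<eta> l s 0 T z * nsq (F z)) \<partial>cylinder T)
    + (\<integral>\<^sup>+z\<in>\<omega> \<times> {0<..<T}. ennreal (decay \<eta> l s 0 T z * (cubic \<eta> l s 0 T z * nsq (q z))) \<partial>cylinder T))"
  (is "?LHS <= ennreal (2 * C) * (?RF + ?Rq)")
proof -
 let ?H = "\<lambda>z. ennreal (decay \<eta> l s 0 T z * (recip \<eta> l s 0 T z * (nsq (ht z) + nsq (hl z)) + cubic \<eta> l s 0 T z * nsq (q z)))"
 define E W where "E d z = decay \<eta> l s d (T - d) z"
  and "W d z = cubic \<eta> l s d (T - d) z" for d z
 define P where "P d z = recip \<eta> l s d (T - d) z" for d z
 let ?M = "\<lambda>i z. ennreal (E (\<delta> i) z * (P (\<delta> i) z * (nsq (time_deriv (u i) z) + nsq (laplacian (u i) z)) + W (\<delta> i) z * nsq (u i z)))"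
 have s0: "s > 0" using s T by (meson less_le_trans zero_less_power)
 have meas [measurable]: "E d \<in> borel_measurable borel" "W d \<in> borel_measurable borel" "P d \<in> borel_measurable borel" for d
  unfolding E_def[abs_def] W_def[abs_def] P_def[abs_def] using interval_weights_measurable[OF \<eta>(1)] by measurable
 have cm: "g \<in> borel_measurable (cylinder T)" if "g \<in> borel_measurable borel" for g :: "(real ^ 'n) \<times> real => 'c::topological_space"
  unfolding cylinder_eq_cyl by (rule borel_measurable_cylI[OF that])
 note cont = C_k_continuous[OF u] derivatives_continuous[OF u]
 have um: "u i \<in> borel_measurable borel" "time_deriv (u i) \<in> borel_measurable borel" "laplacian (u i) \<in> borel_measurable borel"
  "f i \<in> borel_measurable borel" for i
  by (rule borel_measurable_continuous_onI, rule cont f)+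
 define L where "L i z = indicator {\<delta> i<..<T - \<delta> i} (snd z) *
  ?M i z" for i z
 have Lm: "L i \<in> borel_measurable (cylinder T)" for i
 proof (rule cm)
  have [measurable]: "(snd :: (real ^ 'n) \<times> real => real) \<in> borel_measurable borel"
   by (intro borel_measurable_continuous_onI continuous_on_snd continuous_on_id)
  show "L i \<in> borel_measurable borel" unfolding L_def[abs_def] using um by measurable
 qed
 have "?LHS = (\<integral>\<^sup>+z. liminf (\<lambda>i. L i z) \<partial>cylinder T)"
 proof (rule nn_integral_cong_AE)
  have sp: "AE z in cylinder T. z \<in> torus_cell \<times> {0<..<T}" by (rule AE_I2) (simp add: cylinder_eq_cyl)
  show "AE z in cylinder T. ?H z = liminf (\<lambda>i. L i z)"
   using ae sp
  proof eventually_elim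
   case (elim z)
   define t where "t = snd z"
   have t: "0 < t" "t < T" using elim(4) by (auto simp: t_def)
   have d0: "(\<lambda>i. (t - \<delta> i) * (T - \<delta> i - t)) \<longlonglongrightarrow> (t - 0) * (T - 0 - t)" by (intro tendsto_intros \<delta>(2))
   have nz: "(t - 0) * (T - 0 - t) \<noteq> 0" using t by simp
   have xi: "(\<lambda>i. interval_xi \<eta> l (\<delta> i) (T - \<delta> i) z) \<longlonglongrightarrow> interval_xi \<eta> l 0 T z"
    unfolding interval_xi_def t_def[symmetric] using tendsto_divide[OF tendsto_const d0 nz] by simp
   have phi: "(\<lambda>i. interval_phi \<eta> l (\<delta> i) (T - \<delta> i) z) \<longlonglongrightarrow> interval_phi \<eta> l 0 T z"
    unfolding interval_phi_def t_def[symmetric] using tendsto_divide[OF tendsto_const d0 nz] by simp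
   have "interval_xi \<eta> l 0 T z > 0" using t by (intro interval_xi_pos[OF \<eta>]) (simp add: t_def)
   then have nz2: "s * interval_xi \<eta> l 0 T z \<noteq> 0" using s0 by simp
   have "(\<lambda>i. ?M i z)
    \<longlonglongrightarrow> ?H z"
    unfolding E_def P_def W_def by (intro tendsto_intros xi phi nz2 elim(1) elim(2) elim(3))
   moreover have "\<forall>\<^sub>F i in sequentially. ?M i z = L i z"
   proof -
    have "\<forall>\<^sub>F i in sequentially. \<delta> i < min t (T - t)" by (rule order_tendstoD(2)[OF \<delta>(2)]) (use t in simp)
    then show ?thesis
    proof eventually_elim
     case (elim i)
     then have "snd z \<in> {\<delta> i<..<T - \<delta> i}" by (auto simp: t_def)
     then show ?case by (simp add: L_def)
    qed
   qed
   ultimately have "(\<lambda>i. L i z) \<longlonglongrightarrow> ?H z"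
    by (rule Lim_transform_eventually)
   then show ?case by (rule lim_imp_Liminf[OF sequentially_bot, symmetric])
  qed
 qed
 also have "... <= liminf (\<lambda>i. \<integral>\<^sup>+z. L i z \<partial>cylinder T)" by (rule nn_integral_liminf[OF Lm])
 finally have fatou: "?LHS <= liminf (\<lambda>i. \<integral>\<^sup>+z. L i z \<partial>cylinder T)" .
 obtain B where B: "B >= 0" and WB: "\<And>z. snd z \<in> {0<..<T} ==> E 0 z * W 0 z <= B"
  using weighted_cube_bounded[OF \<eta> l(1) s0] unfolding E_def W_def by (metis diff_zero)
 define R where "R i = sqdist (cylinder T) (f i) F + sqdist (cylinder T) (u i) q" for i
 have bound: "(\<integral>\<^sup>+z. L i z \<partial>cylinder T) <= ennreal (2 * C) * (?RF + ?Rq) + ennreal (2 * C * (1 + B)) * R i" if i: "\<delta> i < T - \<delta> i" for i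
 proof -
  let ?I = "{\<delta> i<..<T - \<delta> i}"
  let ?G = "\<lambda>z. ennreal (2 * C) * (ennreal (E 0 z * nsq (F z)) + ennreal (E 0 z * (W 0 z * nsq (q z))) * indicator (\<omega> \<times> {0<..<T}) z)
   + ennreal (2 * C * (1 + B)) * (ennreal (nsq (f i z - F z)) + ennreal (nsq (u i z - q z)))"
  have "(\<integral>\<^sup>+z. L i z \<partial>cylinder T) = (\<integral>\<^sup>+z. ?M i z \<partial>cyl ?I)"
   unfolding L_def cylinder_eq_cyl using \<delta>(1)[of i] by (intro nn_integral_cyl_indicator) auto
  also have "... <= (\<integral>\<^sup>+z. ennreal (C * (E (\<delta> i) z * nsq (f i z) + indicator \<omega>\<^sub>0 (fst z) * (E (\<delta> i) z * (W (\<delta> i) z * nsq (u i z))))) \<partial>cyl ?I)"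
   unfolding E_def P_def W_def by (rule carleman[OF i])
  also have "... <= (\<integral>\<^sup>+z. ?G z \<partial>cyl ?I)"
  proof (rule nn_integral_mono)
   fix z assume "z \<in> space (cyl ?I :: ((real ^ 'n) \<times> real) measure)"
   then have z: "snd z \<in> ?I" by auto
   let ?l = "E (\<delta> i) z * nsq (f i z) + indicator \<omega>\<^sub>0 (fst z) * (E (\<delta> i) z * (W (\<delta> i) z * nsq (u i z)))" and ?e = "nsq (f i z - F z) + nsq (u i z - q z)"
    and ?a = "E 0 z * nsq (F z)" and ?b = "E 0 z * (W 0 z * nsq (q z))" and ?i = "indicator (\<omega> \<times> {0<..<T}) z :: real"
   have z0: "snd z \<in> {0<..<T}" using z \<delta>(1)[of i] by auto
   have Ele: "E (\<delta> i) z <= E 0 z" and Wle: "E (\<delta> i) z * W (\<delta> i) z <= E 0 z * W 0 z"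
    using shrunken_weights_le[OF \<eta> l s \<delta>(1) z] by (simp_all add: E_def W_def)
   have E0: "0 <= E d z" "0 <= s * interval_phi \<eta> l 0 T z" for d
    using s0 interval_phi_nonneg[OF \<eta> l(1) z0] by (simp_all add: E_def)
   have E1: "E 0 z <= 1" using E0(2) by (simp add: E_def mult.assoc)
   have W0: "0 <= W 0 z" using interval_xi_pos[OF \<eta> z0, of l] s0 by (simp add: W_def)
   have EW: "0 <= E 0 z * W 0 z" using E0(1) W0 by simp
   have nf: "nsq (f i z) <= 2 * nsq (F z) + 2 * nsq (f i z - F z)" using norm_add_sq_le[of "F z" "f i z - F z"] by simp
   have nu: "nsq (u i z) <= 2 * nsq (q z) + 2 * nsq (u i z - q z)" using norm_add_sq_le[of "q z" "u i z - q z"] by simp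
   have "E (\<delta> i) z * nsq (f i z) <= E 0 z * (2 * nsq (F z) + 2 * nsq (f i z - F z))"
    by (rule mult_mono[OF Ele nf E0(1)]) simp
   also have "... = 2 * ?a + 2 * (E 0 z * nsq (f i z - F z))" by (simp add: algebra_simps)
   also have "E 0 z * nsq (f i z - F z) <= 1 * nsq (f i z - F z)" by (intro mult_right_mono E1) simp
   finally have 1: "E (\<delta> i) z * nsq (f i z) <= 2 * ?a + 2 * nsq (f i z - F z)" by simp
   have 2: "indicator \<omega>\<^sub>0 (fst z) * (E (\<delta> i) z * (W (\<delta> i) z * nsq (u i z)))
    <= 2 * (?b * ?i) + 2 * (B * nsq (u i z - q z))"
   proof (cases "fst z \<in> \<omega>\<^sub>0")
    case True
    then have ind: "z \<in> \<omega> \<times> {0<..<T}" using \<omega>(2) z0 by (cases z) auto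
    have "(E (\<delta> i) z * W (\<delta> i) z) * nsq (u i z) <= (E 0 z * W 0 z) * (2 * nsq (q z) + 2 * nsq (u i z - q z))"
     by (rule mult_mono[OF Wle nu EW]) simp
    also have "... = 2 * ?b + 2 * ((E 0 z * W 0 z) * nsq (u i z - q z))" by (simp add: algebra_simps)
    also have "(E 0 z * W 0 z) * nsq (u i z - q z) <= B * nsq (u i z - q z)" by (intro mult_right_mono WB z0) simp
    finally show ?thesis using True ind by (simp add: mult.assoc)
   next
    case False
    have "0 <= ?b * ?i" using E0(1) W0 by simp
    then show ?thesis using False B by simp
   qed
   have 3: "0 <= B * nsq (f i z - F z)" "0 <= nsq (u i z - q z)" using B by auto
   have "?l <= 2 * (?a + ?b * ?i) + 2 * ((1 + B) * ?e)"
    using 1 2 3 unfolding distrib_left distrib_right mult_1_left by linarith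
   then have "C * ?l <= C * (2 * (?a + ?b * ?i) + 2 * ((1 + B) * ?e))" using C by (intro mult_left_mono) auto
   also have "... = 2 * C * (?a + ?b * ?i) + 2 * C * (1 + B) * ?e" by (simp add: algebra_simps)
   finally have "ennreal (C * ?l) <= ennreal (2 * C * (?a + ?b * ?i) + 2 * C * (1 + B) * ?e)" by (rule ennreal_leI)
   also have "... = ?G z"
   proof -
    have a: "0 <= ?a" "0 <= ?b"
     "0 <= ?b * ?i" using E0(1) W0 by auto
    have i: "ennreal (?b * ?i) = ennreal ?b * indicator (\<omega> \<times> {0<..<T}) z"
     by (cases "z \<in> \<omega> \<times> {0<..<T}") simp_all
    have "0 <= 2 * C * (?a + ?b * ?i)"
     "0 <= 2 * C * (1 + B) * ?e" using C B add_nonneg_nonneg[OF a(1,3)] by auto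
    then have "ennreal (2 * C * (?a + ?b * ?i) + 2 * C * (1 + B) * ?e)
     = ennreal (2 * C * (?a + ?b * ?i))
     + ennreal (2 * C * (1 + B) * ?e)" by (rule ennreal_plus)
    also have "ennreal (2 * C * (?a + ?b * ?i))
     = ennreal (2 * C) * (ennreal ?a + ennreal (?b * ?i))"
     using C a by (subst ennreal_mult) (auto simp: ennreal_plus)
    also have "ennreal (2 * C * (1 + B) * ?e)
     = ennreal (2 * C * (1 + B)) * (ennreal (nsq (f i z - F z)) + ennreal (nsq (u i z - q z)))"
     using C B by (subst ennreal_mult) (auto simp: ennreal_plus)
    finally show ?thesis unfolding i .
   qed
   finally show "ennreal (C * ?l) <= ?G z" .
  qed
  also have "... <= (\<integral>\<^sup>+z. ?G z \<partial>cylinder T)"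
   unfolding cylinder_eq_cyl using \<delta>(1)[of i] by (intro nn_integral_cyl_mono_set) auto
  also have "... = ennreal (2 * C) * (?RF + ?Rq) + ennreal (2 * C * (1 + B)) * R i"
  proof -
   note [measurable] = m cm[OF um(1)] cm[OF um(4)] cm[OF meas(1)] cm[OF meas(2)]
   have [measurable]: "\<omega> \<times> {0<..<T} \<in> sets borel" using \<omega>(1) by (intro borel_open open_Times) auto
   have [measurable]: "(indicator (\<omega> \<times> {0<..<T}) :: _ => ennreal) \<in> borel_measurable (cylinder T)" by (rule cm) measurable
   have "(\<integral>\<^sup>+z. ?G z \<partial>cylinder T)
    = ennreal (2 * C) * ((\<integral>\<^sup>+z. ennreal (E 0 z * nsq (F z)) \<partial>cylinder T) + (\<integral>\<^sup>+z. ennreal (E 0 z * (W 0 z * nsq (q z))) * indicator (\<omega> \<times> {0<..<T}) z \<partial>cylinder T))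
    + ennreal (2 * C * (1 + B)) * R i"
    unfolding R_def by (simp add: nn_integral_add nn_integral_cmult)
   then show ?thesis by (simp add: E_def W_def)
  qed
  finally show ?thesis .
 qed
 show ?thesis
 proof (rule ennreal_le_epsilon)
  fix e :: real assume e: "e > 0"
  define e1 where "e1 = e / (4 * C * (1 + B))"
  have e1: "e1 > 0" "2 * C * (1 + B) * (e1 + e1) = e" using e C B by (auto simp: e1_def)
  obtain N1 where N1: "\<And>i. i >= N1 ==> sqdist (cylinder T) (u i) q <= ennreal e1"
   using L2(1) e1(1) unfolding L2_limit_def by blast
  obtain N2 where N2: "\<And>i. i >= N2 ==> sqdist (cylinder T) (f i) F <= ennreal e1"
   using L2(2) e1(1) unfolding L2_limit_def by blast
  have "\<forall>\<^sub>F i in sequentially. \<delta> i < T / 2" by (rule order_tendstoD(2)[OF \<delta>(2)]) (use T in simp)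
  then obtain N3 where N3: "\<And>i. i >= N3 ==> \<delta> i < T / 2" by (auto simp: eventually_sequentially)
  have "(\<integral>\<^sup>+z. L i z \<partial>cylinder T) <= ennreal (2 * C) * (?RF + ?Rq) + ennreal e" if i: "i >= max N1 (max N2 N3)" for i
  proof -
   have "\<delta> i < T - \<delta> i" using N3[of i] i by simp
   note bound[OF this]
   also have "ennreal (2 * C * (1 + B)) * R i <= ennreal (2 * C * (1 + B)) * (ennreal e1 + ennreal e1)"
    unfolding R_def using i by (intro mult_left_mono add_mono N1 N2) auto
   also have "... = ennreal (2 * C * (1 + B) * (e1 + e1))"
    using e1(1) C B by (simp only: ennreal_plus[symmetric] ennreal_mult[symmetric] less_imp_le add_nonneg_nonneg mult_nonneg_nonneg zero_le_one zero_le_numeral)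
   finally show ?thesis unfolding e1(2) by (simp add: add_left_mono)
  qed
  then have "liminf (\<lambda>i. \<integral>\<^sup>+z. L i z \<partial>cylinder T) <= liminf (\<lambda>i. ennreal (2 * C) * (?RF + ?Rq) + ennreal e)"
   by (intro Liminf_mono eventually_sequentiallyI) blast
  also have "... = ennreal (2 * C) * (?RF + ?Rq) + ennreal e" by (simp add: Liminf_const)
  finally show "?LHS <= ennreal (2 * C) * (?RF + ?Rq) + ennreal e" using fatou by (rule order_trans[rotated])
 qed
qed

lemma carleman_weights_interval: "carleman_xi \<eta> l T = interval_xi \<eta> l 0 T" "carleman_phi \<eta> l T = interval_phi \<eta> l 0 T"
 by (auto simp: carleman_xi_def carleman_phi_def interval_xi_def interval_phi_def)

text \<open>
  A sequence that converges almost everywhere together with its derivatives: first a subsequence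
  along which \<open>q\<close> itself converges, then a further one for the derivatives, which are Cauchy on
  compact time intervals.
\<close>

lemma approximating_sequence:
 fixes q F :: "(real ^ 'n) \<times> real => real ^ 2" and \<eta> :: "real ^ 'n => real" and \<omega>\<^sub>0 :: "(real ^ 'n) set"
 assumes \<eta>: "C_k 4 \<eta>" "torus_periodic \<eta>" "\<And>x. \<eta> x > 0"
  and \<omega>\<^sub>0: "torus_set \<omega>\<^sub>0" "open \<omega>\<^sub>0" "\<And>x. x \<notin> \<omega>\<^sub>0 ==> norm (grad \<eta> x) > 0"
  and \<alpha>: "\<alpha> > 0" and T: "T > 0" and sol: "weak_solution \<alpha> \<gamma> T F qT q" and F: "L2_cylinder T F"
 defines "u \<equiv> \<lambda>m. conv T (moll (Suc m)) q"
 obtains r qt lq where "strict_mono r" "weak_time_deriv T q qt" "weak_laplacian T q lq"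
  "AE z in cylinder T. (\<lambda>i. u (r i) z) \<longlonglongrightarrow> q z" "AE z in cylinder T. (\<lambda>i. time_deriv (u (r i)) z) \<longlonglongrightarrow> qt z"
  "AE z in cylinder T. (\<lambda>i. laplacian (u (r i)) z) \<longlonglongrightarrow> lq z"
proof -
 have u: "conv T (moll (Suc m)) q = u m" for m by (simp add: u_def)
 note A = approximations[OF sol F, unfolded u]
 have qi: "integrable (cylinder T) q" by (rule L2_cylinder_integrable[OF A(6)])
 have fin: "finite_measure (cylinder T :: ((real ^ 'n) \<times> real) measure)" by (rule finite_measure_cylinder)
 have uint: "integrable (cylinder T) (u m)" for m
 proof -
  have "integrable (cyl {0..T}) (u m)" by (intro integrable_cyl_continuous continuous_on_subset[OF C_k_continuous[OF A(1)]]) simp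
  then show ?thesis unfolding cylinder_eq_cyl by (rule integrable_cyl_mono) auto
 qed
 have um: "u m \<in> borel_measurable (cylinder T)" "q \<in> borel_measurable (cylinder T)" for m using uint qi by auto
 have "(\<lambda>m. \<integral>\<^sup>+z. ennreal (norm (u m z - q z)) \<partial>cylinder T) \<longlonglongrightarrow> 0"
  by (rule L2_limit_imp_L1[OF fin um A(4)])
 moreover have "(\<integral>\<^sup>+z. ennreal (norm (u m z - q z)) \<partial>cylinder T) = ennreal (\<integral>z. norm (u m z - q z) \<partial>cylinder T)" for m
  by (intro nn_integral_eq_integral integrable_norm Bochner_Integration.integrable_diff uint qi) simp
 ultimately have "(\<lambda>m. ennreal (\<integral>z. norm (u m z - q z) \<partial>cylinder T)) \<longlonglongrightarrow> ennreal 0" by simp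
 then have "(\<lambda>m. \<integral>z. norm (u m z - q z) \<partial>cylinder T) \<longlonglongrightarrow> 0" by (subst (asm) tendsto_ennreal_iff) auto
 moreover have "integrable (cylinder T) (\<lambda>z. u m z - q z)" for m by (intro Bochner_Integration.integrable_diff uint qi)
 ultimately obtain r1 :: "nat => nat" where r1: "strict_mono r1" and ae1: "AE z in cylinder T. (\<lambda>i. u (r1 i) z - q z) \<longlonglongrightarrow> 0"
  using tendsto_L1_AE_subseq[of "cylinder T" "\<lambda>m z. u m z - q z"] by blast
 define g where "g m z = (time_deriv (u (r1 m)) z, laplacian (u (r1 m)) z)" for m z
 have gc: "continuous_on UNIV (g m)" for m
  unfolding g_def by (intro continuous_on_Pair derivatives_continuous A(1))
 have cauchy: "\<exists>N. \<forall>i\<ge>N. \<forall>j\<ge>N. sqdist (cyl {a..b}) (g i) (g j) <= ennreal e"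
  if ab: "0 < a" "a < b" "b < T" "e > 0" for a b e
 proof -
  obtain N where N: "\<And>i j. i >= N ==> j >= N ==> (\<integral>\<^sup>+z. ennreal (nsq ((time_deriv (u i) z, laplacian (u i) z)
   - (time_deriv (u j) z, laplacian (u j) z))) \<partial>cyl {a..b}) <= ennreal e"
   using derivatives_cauchy[OF \<eta> \<omega>\<^sub>0 \<alpha> sol F ab] unfolding u by blast
  have "sqdist (cyl {a..b}) (g i) (g j) <= ennreal e" if "i >= N" "j >= N" for i j
   unfolding g_def by (rule N) (use that seq_suble[OF r1] in \<open>auto intro: order_trans\<close>)
  then show ?thesis by blast
 qed
 obtain r2 where r2: "strict_mono r2" and ae2: "AE z in cylinder T. convergent (\<lambda>i. g (r2 i) z)"
  and lim: "\<And>a b. 0 < a ==> a < b ==> b < T ==> L2_limit (cyl {a..b}) (\<lambda>i. g (r2 i)) (\<lambda>z. lim (\<lambda>i. g (r2 i) z))"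
  using Riesz_Fischer_local[OF T gc cauchy] by blast
 define r where "r i = r1 (r2 i)" for i
 define h where "h z = lim (\<lambda>i. g (r2 i) z)" for z
 define qt lq where "qt z = fst (h z)" and "lq z = snd (h z)" for z
 have r: "strict_mono r" using strict_mono_o[OF r1 r2] by (simp add: r_def[abs_def] o_def)
 have gper: "torus_periodic (\<lambda>x. g m (x, t))" for m t
  using derivatives_periodic[OF A(1,2), of "r1 m" t] by (simp add: g_def torus_periodic_def)
 have hper: "torus_periodic (\<lambda>x. h (x, t))" for t
  using gper unfolding h_def torus_periodic_def by simp
 have per: "torus_periodic (\<lambda>x. qt (x, t))" "torus_periodic (\<lambda>x. lq (x, t))" for t
  using hper[of t] by (simp_all add: qt_def lq_def torus_periodic_def)
 have hm: "h \<in> borel_measurable borel"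
  unfolding h_def[abs_def] by (rule borel_measurable_lim_metric) (rule borel_measurable_continuous_onI[OF gc])
 have hm': "qt \<in> borel_measurable borel" "lq \<in> borel_measurable borel"
  unfolding qt_def[abs_def] lq_def[abs_def]
  by (rule measurable_compose[OF hm], rule borel_measurable_continuous_onI, intro continuous_on_fst continuous_on_snd continuous_on_id)+
 have part: "L2_limit (cyl {a..b}) (\<lambda>i. time_deriv (u (r i))) qt" "L2_limit (cyl {a..b}) (\<lambda>i. laplacian (u (r i))) lq"
  if ab: "0 < a" "a < b" "b < T" for a b
 proof -
  have proj: "norm (fst w) <= norm w" "norm (snd w) <= norm w" for w :: "(real ^ 2) \<times> (real ^ 2)"
   by (cases w; simp add: norm_fst_le norm_snd_le)+
  have le: "nsq (time_deriv (u (r i)) z - qt z) <= nsq (g (r2 i) z - h z)"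
   "nsq (laplacian (u (r i)) z - lq z) <= nsq (g (r2 i) z - h z)" for i z
   using proj[of "g (r2 i) z - h z"]
   by (auto simp: g_def qt_def lq_def r_def intro!: power_mono)
  have "L2_limit (cyl {a..b}) (\<lambda>i. g (r2 i)) h" using lim[OF ab] by (simp add: h_def[abs_def])
  then show "L2_limit (cyl {a..b}) (\<lambda>i. time_deriv (u (r i))) qt" "L2_limit (cyl {a..b}) (\<lambda>i. laplacian (u (r i))) lq"
   unfolding L2_limit_def
   by (meson order_trans nn_integral_mono ennreal_leI le)+
 qed
 have weak: "weak_time_deriv T q qt" "weak_laplacian T q lq"
  by (rule weak_derivatives_limit[where u = "\<lambda>i. u (r i)", OF T A(1) A(2) qi L2_limit_subseq[OF A(4) r] hm'(1) per(1) part(1) hm'(2) per(2) part(2)]; assumption)+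
 have c1: "AE z in cylinder T. (\<lambda>i. u (r i) z) \<longlonglongrightarrow> q z" using ae1
 proof (rule eventually_mono)
  fix z assume "(\<lambda>i. u (r1 i) z - q z) \<longlonglongrightarrow> 0"
  then have "(\<lambda>i. u (r1 i) z) \<longlonglongrightarrow> q z" by (simp add: LIM_zero_iff)
  from LIMSEQ_subseq_LIMSEQ[OF this r2] show "(\<lambda>i. u (r i) z) \<longlonglongrightarrow> q z" by (simp add: o_def r_def)
 qed
 have c2: "AE z in cylinder T. (\<lambda>i. g (r2 i) z) \<longlonglongrightarrow> h z"
  using ae2 by (rule eventually_mono) (simp add: convergent_LIMSEQ_iff h_def)
 have c3: "AE z in cylinder T. (\<lambda>i. time_deriv (u (r i)) z) \<longlonglongrightarrow> qt z"
  using c2 by (rule eventually_mono) (auto simp: g_def r_def qt_def dest: tendsto_fst)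
 have c4: "AE z in cylinder T. (\<lambda>i. laplacian (u (r i)) z) \<longlonglongrightarrow> lq z"
  using c2 by (rule eventually_mono) (auto simp: g_def r_def lq_def dest: tendsto_snd)
 show thesis by (rule that[OF r weak c1 c3 c4])
qed

theorem lemma3p1:
  fixes \<alpha> \<gamma> :: real
    and \<omega> \<omega>\<^sub>0 :: "(real ^ 'n) set"
    and \<eta>\<^sub>0 :: "real ^ 'n \<Rightarrow> real"
  assumes "\<alpha> > 0" and "\<gamma> \<noteq> 0"
    and "torus_set \<omega>" and "open \<omega>" and "\<omega> \<noteq> {}"
    and "torus_set \<omega>\<^sub>0" and "open \<omega>\<^sub>0" and "closure \<omega>\<^sub>0 \<subseteq> \<omega>"
    and "torus_periodic \<eta>\<^sub>0" and "C_k 4 \<eta>\<^sub>0" and "\<And>x. \<eta>\<^sub>0 x > 0"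
    and "\<And>x. x \<notin> \<omega>\<^sub>0 \<Longrightarrow> norm (grad \<eta>\<^sub>0 x) > 0"
  shows "\<exists>lstar \<sigma>star C\<^sub>1 :: real. lstar \<ge> 1 \<and> \<sigma>star \<ge> 1 \<and> C\<^sub>1 > 0 \<and>
    (\<forall>T F qT q. T > 0 \<and> L2_cylinder T F \<and> L2_torus qT \<and> weak_solution \<alpha> \<gamma> T F qT q \<longrightarrow>
      (\<exists>qt lq. weak_time_deriv T q qt \<and> weak_laplacian T q lq \<and>
        (\<forall>l s. l \<ge> lstar \<and> s \<ge> \<sigma>star * (exp (2 * l * sup_norm \<eta>\<^sub>0) * T + T\<^sup>2) \<longrightarrow>
          (let \<xi> = carleman_xi \<eta>\<^sub>0 l T; \<phi> = carleman_phi \<eta>\<^sub>0 l T in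
            (\<integral>\<^sup>+p. ennreal (exp (- 2 * s * \<phi> p) *
                (inverse (s * \<xi> p) * ((norm (qt p))\<^sup>2 + (norm (lq p))\<^sup>2) +
                 s ^ 3 * l ^ 4 * \<xi> p ^ 3 * (norm (q p))\<^sup>2)) \<partial>cylinder T)
            \<le> ennreal C\<^sub>1 *
               ((\<integral>\<^sup>+p. ennreal (exp (- 2 * s * \<phi> p) * (norm (F p))\<^sup>2) \<partial>cylinder T) +
                (\<integral>\<^sup>+p\<in>\<omega> \<times> {0<..<T}. ennreal (exp (- 2 * s * \<phi> p) *
                   (s ^ 3 * l ^ 4 * \<xi> p ^ 3 * (norm (q p))\<^sup>2)) \<partial>cylinder T))))))"
proof -
 note \<eta> = assms(10,9,11) and \<omega>\<^sub>0 = assms(6,7,12)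
 have sub: "\<omega>\<^sub>0 \<subseteq> \<omega>" using assms(8) closure_subset[of \<omega>\<^sub>0] by blast
 have K: "sup_norm \<eta>\<^sub>0 > 0" by (rule sup_norm_weight(2)[OF \<eta>])
 obtain l0 s0 C where *: "l0 >= 1" "s0 >= 1" "C > 0" and carleman: "\<And>(q :: (real ^ 'n) \<times> real => real ^ 2) a b l s.
  a < b \<and> C_k 2 q \<and> (\<forall>t. torus_periodic (\<lambda>x. q (x, t))) \<and> l >= l0 \<and>
  s >= s0 * (exp (2 * l * sup_norm \<eta>\<^sub>0) * (b - a) + (b - a)\<^sup>2) ==> carleman_estimate \<eta>\<^sub>0 \<omega>\<^sub>0 \<alpha> \<gamma> rot C l s a b q"
  using smooth_carleman[OF \<eta> \<omega>\<^sub>0 assms(1) rot_linear rot_skew rot_iso rot_rot, of \<gamma>] by blast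
 let "\<exists>ls ss C. _ \<and> _ \<and> _ \<and> (\<forall>T F qT q. ?hyp T F qT q \<longrightarrow> ?concl ls ss C T F q)" = ?thesis
 show ?thesis
 proof (rule exI[of _ "max l0 (1 / sup_norm \<eta>\<^sub>0)"], rule exI[of _ s0], rule exI[of _ "2 * C"], intro conjI allI impI)
  show "max l0 (1 / sup_norm \<eta>\<^sub>0) >= 1" "s0 >= 1" "2 * C > 0" using * by auto
  fix T :: real and F qT and q :: "(real ^ 'n) \<times> real => real ^ 2"
  assume "T > 0 \<and> L2_cylinder T F \<and> L2_torus qT \<and> weak_solution \<alpha> \<gamma> T F qT q"
  then have T: "T > 0" and F: "L2_cylinder T F" and sol: "weak_solution \<alpha> \<gamma> T F qT q" by auto
  define u f where "u m = conv T (moll (Suc m)) q" and "f m = conv T (moll (Suc m)) F" for m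
  note A = approximations[OF sol F, folded u_def f_def]
  obtain r qt lq where r: "strict_mono r" and weak: "weak_time_deriv T q qt" "weak_laplacian T q lq"
   and ae: "AE z in cylinder T. (\<lambda>i. u (r i) z) \<longlonglongrightarrow> q z" "AE z in cylinder T. (\<lambda>i. time_deriv (u (r i)) z) \<longlonglongrightarrow> qt z"
    "AE z in cylinder T. (\<lambda>i. laplacian (u (r i)) z) \<longlonglongrightarrow> lq z"
   using approximating_sequence[OF \<eta> \<omega>\<^sub>0 assms(1) T sol F] unfolding u_def by blast
  have key: "(\<integral>\<^sup>+z. ennreal (decay \<eta>\<^sub>0 l s 0 T z * (recip \<eta>\<^sub>0 l s 0 T z * (nsq (qt z) + nsq (lq z)) + cubic \<eta>\<^sub>0 l s 0 T z * nsq (q z))) \<partial>cylinder T)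
    <= ennreal (2 * C) * ((\<integral>\<^sup>+z. ennreal (decay \<eta>\<^sub>0 l s 0 T z * nsq (F z)) \<partial>cylinder T)
     + (\<integral>\<^sup>+z\<in>\<omega> \<times> {0<..<T}. ennreal (decay \<eta>\<^sub>0 l s 0 T z * (cubic \<eta>\<^sub>0 l s 0 T z * nsq (q z))) \<partial>cylinder T))"
   if ls: "l >= max l0 (1 / sup_norm \<eta>\<^sub>0) \<and> s >= s0 * (exp (2 * l * sup_norm \<eta>\<^sub>0) * T + T\<^sup>2)" for l s
  proof -
   have l: "l > 0" "l * sup_norm \<eta>\<^sub>0 >= 1" "l >= l0" using ls *(1) K by (auto simp: field_simps)
   have "1 * (0 + T^2) <= s0 * (exp (2 * l * sup_norm \<eta>\<^sub>0) * T + T^2)" using *(2) T by (intro mult_mono add_mono) auto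
   then have s: "s >= T^2" using ls by simp
   \<comment> \<open>Twice the radius of the kernel in time: the mollified equation holds on the shrunken interval.\<close>
   define \<delta> where "\<delta> i = 2 / real (Suc (r i))" for i
   have \<delta>: "0 <= \<delta> i" for i by (simp add: \<delta>_def)
   have "(\<lambda>m. 2 * inverse (real (Suc m))) \<longlonglongrightarrow> 2 * 0" by (intro tendsto_intros LIMSEQ_inverse_real_of_nat)
   from LIMSEQ_subseq_LIMSEQ[OF this r] have \<delta>0: "\<delta> \<longlonglongrightarrow> 0" by (simp add: \<delta>_def[abs_def] o_def divide_inverse)
   have m: "q \<in> borel_measurable (cylinder T)" "F \<in> borel_measurable (cylinder T)" using A(6) F by (auto simp: L2_cylinder_def)
   show ?thesis
   proof (rule carleman_limit[OF \<eta> assms(4) sub T A(1) A(3) m L2_limit_subseq[OF A(4) r] L2_limit_subseq[OF A(5) r] ae \<delta> \<delta>0 l(1,2) s *(3)])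
    fix i assume i: "\<delta> i < T - \<delta> i"
    let ?a = "\<delta> i" and ?b = "T - \<delta> i"
    have small: "s0 * (exp (2 * l * sup_norm \<eta>\<^sub>0) * (?b - ?a) + (?b - ?a)\<^sup>2) <= s0 * (exp (2 * l * sup_norm \<eta>\<^sub>0) * T + T^2)"
     using *(2) i \<delta>[of i] by (intro mult_left_mono add_mono power_mono) auto
    have eq: "norm (heat_operator \<alpha> \<gamma> rot (u (r i)) z) = norm (f (r i) z)"
     if "z \<in> space (cyl {?a<..<?b})" for z :: "(real ^ 'n) \<times> real"
    proof -
     have "?a < snd z" "snd z < ?b" using that by auto
     moreover have "1 / real (Suc (r i)) <= \<delta> i" by (simp add: \<delta>_def divide_right_mono)
     ultimately have "1 / real (Suc (r i)) < snd z" "snd z < T - 1 / real (Suc (r i))" by linarith+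
     from A(7)[OF this] show ?thesis by simp
    qed
    have "(\<integral>\<^sup>+z. ennreal (carleman_left \<eta>\<^sub>0 l s ?a ?b (u (r i)) z) \<partial>cyl {?a<..<?b})
     <= (\<integral>\<^sup>+z. ennreal (C * carleman_right \<eta>\<^sub>0 \<omega>\<^sub>0 l s ?a ?b (heat_operator \<alpha> \<gamma> rot (u (r i)) z) (u (r i)) z) \<partial>cyl {?a<..<?b})"
     using i A(1,2) l(3) order_trans[OF small] ls by (intro carleman[unfolded carleman_estimate_def]) blast
    also have "(\<integral>\<^sup>+z. ennreal (C * carleman_right \<eta>\<^sub>0 \<omega>\<^sub>0 l s ?a ?b (heat_operator \<alpha> \<gamma> rot (u (r i)) z) (u (r i)) z) \<partial>cyl {?a<..<?b})
     = (\<integral>\<^sup>+z. ennreal (C * carleman_right \<eta>\<^sub>0 \<omega>\<^sub>0 l s ?a ?b (f (r i) z) (u (r i)) z) \<partial>cyl {?a<..<?b})"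
     by (rule nn_integral_cong) (simp only: eq)
    finally show "(\<integral>\<^sup>+z. ennreal (carleman_left \<eta>\<^sub>0 l s ?a ?b (u (r i)) z) \<partial>cyl {?a<..<?b})
     <= (\<integral>\<^sup>+z. ennreal (C * carleman_right \<eta>\<^sub>0 \<omega>\<^sub>0 l s ?a ?b (f (r i) z) (u (r i)) z) \<partial>cyl {?a<..<?b})" .
   qed
  qed
  \<comment> \<open>The second bound on \<open>l\<close> serves the comparison of the weights.\<close>
  show "?concl (max l0 (1 / sup_norm \<eta>\<^sub>0)) s0 (2 * C) T F q"
   unfolding Let_def carleman_weights_interval using weak key by blast
 qed
qed

end
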